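(* Let $M\ge 2$ and let $g_1,\dots,g_M\in \mathrm{SO}(3)$ be rotations whose matrix entries are algebraic numbers and which freely generate a free subgroup $\Gamma$ of $\mathrm{SO}(3)$. Assume that for every $x\in\mathbb S^2$ the stabilizer of $x$ in $\Gamma$ is either trivial or cyclic. Let $q=2M-1$ and let $T_q$ be the operator on $L^2(\mathbb S^2)$ $$T_qf(x)=\frac1{\sqrt q}\sum_{j=1}^M\left(f(g_jx)+f(g_j^{-1}x)\right).$$ Then for every $6<p\le\infty$ there is a constant $C>0$, depending only on $p$ and on $g_1,\dots,g_M$, such that for every integer $s\ge 2$ and every function $\psi_s$ on $\mathbb S^2$ with $\|\psi_s\|_{2}=1$ which satisfies $\Delta\psi_s=s(s+1)\psi_s$ and is also an eigenfunction of $T_q$, one has $$\|\psi_s\|_{p}\le C\,\frac{s^{\frac12-\frac2p}}{\sqrt{\log s}}$$ (with $\frac2p=0$ if $p=\infty$).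
   Context: $\mathbb S^2$ is the round unit $2$-sphere, $\Delta$ is its positive Laplace–Beltrami operator (eigenvalues $s(s+1)$, $s=0,1,2,\dots$), and $L^p$ norms are with respect to the rotation-invariant surface measure. *)

theory Defs
  imports
    "HOL-Analysis.Analysis"
    "HOL-Probability.Essential_Supremum"
    "HOL-Computational_Algebra.Polynomial"
    "HOL-Algebra.Elementary_Groups"
    "HOL-Algebra.Group_Action"
begin

section \<open>Rotations and free generation\<close>

definition SO3 :: "(real^3^3) monoid" where
  "SO3 = \<lparr>carrier = {A. rotation_matrix A}, mult = (**), one = mat 1\<rparr>"

lemma rotation_matrix_transpose:
  fixes A :: "real^3^3"
  assumes "rotation_matrix A"
  shows "rotation_matrix (transpose A)" "transpose A ** A = mat 1" "A ** transpose A = mat 1"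
  using assms by (auto simp: rotation_matrix_def orthogonal_matrix_def det_transpose)

lemma group_SO3: "group SO3"
proof (rule groupI)
  fix x y z assume "x \<in> carrier SO3" "y \<in> carrier SO3" "z \<in> carrier SO3"
  then show "x \<otimes>\<^bsub>SO3\<^esub> y \<in> carrier SO3" "x \<otimes>\<^bsub>SO3\<^esub> y \<otimes>\<^bsub>SO3\<^esub> z = x \<otimes>\<^bsub>SO3\<^esub> (y \<otimes>\<^bsub>SO3\<^esub> z)"
    by (auto simp: SO3_def rotation_matrix_def orthogonal_matrix_mul det_mul matrix_mul_assoc)
next
  fix x assume "x \<in> carrier SO3"
  then show "\<exists>y\<in>carrier SO3. y \<otimes>\<^bsub>SO3\<^esub> x = \<one>\<^bsub>SO3\<^esub>"
    using rotation_matrix_transpose[of x] by (auto simp: SO3_def)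
qed (auto simp: SO3_def rotation_matrix_def orthogonal_matrix_id)

text \<open>
  A letter is a pair \<open>(j, b)\<close>, standing for \<open>g j\<close> if \<open>b\<close> holds and for the inverse of \<open>g j\<close>
  otherwise.
\<close>

definition letter_value :: "('a, 'b) monoid_scheme \<Rightarrow> ('i \<Rightarrow> 'a) \<Rightarrow> 'i \<times> bool \<Rightarrow> 'a" where
  "letter_value G g l = (if snd l then g (fst l) else inv\<^bsub>G\<^esub> (g (fst l)))"

definition word_value :: "('a, 'b) monoid_scheme \<Rightarrow> ('i \<Rightarrow> 'a) \<Rightarrow> ('i \<times> bool) list \<Rightarrow> 'a" where
  "word_value G g w = foldr (\<lambda>l a. letter_value G g l \<otimes>\<^bsub>G\<^esub> a) w \<one>\<^bsub>G\<^esub>"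

definition reduced_word :: "('i \<times> bool) list \<Rightarrow> bool" where
  "reduced_word w \<longleftrightarrow> successively (\<lambda>k l. \<not> (fst k = fst l \<and> snd k \<noteq> snd l)) w"

text \<open>
  The family \<open>g\<close>, indexed by \<open>J\<close>, is a basis of the subgroup it generates, which is then free:
  no nonempty reduced word evaluates to the identity. In particular \<open>g\<close> is injective on \<open>J\<close>.
\<close>

definition freely_generates_on :: "('a, 'b) monoid_scheme \<Rightarrow> ('i \<Rightarrow> 'a) \<Rightarrow> 'i set \<Rightarrow> bool" where
  "freely_generates_on G g J \<longleftrightarrow> g ` J \<subseteq> carrier G \<and>
     (\<forall>w. w \<noteq> [] \<and> fst ` set w \<subseteq> J \<and> reduced_word w \<longrightarrow> word_value G g w \<noteq> \<one>\<^bsub>G\<^esub>)"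

definition stabilizer_group :: "(real^3^3) monoid \<Rightarrow> real^3 \<Rightarrow> (real^3^3) monoid" where
  "stabilizer_group \<Gamma> x = \<Gamma>\<lparr>carrier := stabilizer \<Gamma> (*v) x\<rparr>"


section \<open>The surface measure of the unit sphere and \<open>L\<^sup>p\<close> norms\<close>

text \<open>
  The surface measure as in polar coordinates: the area of \<open>A\<close> is three times the volume of the
  cone over \<open>A\<close> in the unit ball. The total mass is \<open>4\<pi>\<close>.
\<close>

definition sphere_measure :: "(real^3) measure" where
  "sphere_measure = scale_measure 3
     (distr (restrict_space lborel (ball 0 1 - {0})) (restrict_space borel (sphere 0 1))
            (\<lambda>y. y /\<^sub>R norm y))"

lemma space_sphere_measure [simp]: "space sphere_measure = sphere 0 1"
  by (simp add: sphere_measure_def space_restrict_space space_scale_measure)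

lemma sets_sphere_measure [simp, measurable_cong]:
  "sets sphere_measure = sets (restrict_space borel (sphere 0 1))"
  by (simp add: sphere_measure_def)

lemma measurable_radial_projection:
  "(\<lambda>y::real^3. y /\<^sub>R norm y)
     \<in> restrict_space lborel (ball 0 1 - {0}) \<rightarrow>\<^sub>M restrict_space borel (sphere 0 1)"
  by (intro measurable_restrict_space2 measurable_restrict_space1)
     (auto simp: space_restrict_space)

lemma emeasure_sphere_measure:
  assumes "A \<in> sets (restrict_space borel (sphere 0 1))"
  shows "emeasure sphere_measure A =
           3 * emeasure lborel {y. y \<noteq> 0 \<and> norm y < 1 \<and> y /\<^sub>R norm y \<in> A}"
proof -
  have "emeasure sphere_measure A = 3 * emeasure (restrict_space lborel (ball 0 1 - {0}))
          ((\<lambda>y. y /\<^sub>R norm y) -` A \<inter> space (restrict_space lborel (ball 0 1 - {0})))"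
    using assms
    by (simp add: sphere_measure_def emeasure_distr[OF measurable_radial_projection])
  also have "(\<lambda>y. y /\<^sub>R norm y) -` A \<inter> space (restrict_space lborel (ball 0 1 - {0 :: real^3}))
      = {y. y \<noteq> 0 \<and> norm y < 1 \<and> y /\<^sub>R norm y \<in> A}" (is "_ = ?S")
    by (auto simp: space_restrict_space)
  also have "emeasure (restrict_space lborel (ball 0 1 - {0})) ?S = emeasure lborel ?S"
    by (subst emeasure_restrict_space) auto
  finally show ?thesis .
qed

lemma emeasure_sphere_measure_space:
  "emeasure sphere_measure (sphere 0 1) = ennreal (4 * pi)"
proof -
  have "emeasure sphere_measure (sphere 0 1) =
      3 * emeasure lborel {y::real^3. y \<noteq> 0 \<and> norm y < 1 \<and> y /\<^sub>R norm y \<in> sphere 0 1}"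
    by (rule emeasure_sphere_measure) (auto simp: sets_restrict_space)
  also have "{y::real^3. y \<noteq> 0 \<and> norm y < 1 \<and> y /\<^sub>R norm y \<in> sphere 0 1} = ball 0 1 - {0}"
    by auto
  also have "emeasure lborel (ball 0 1 - {0::real^3}) = emeasure lborel (ball (0::real^3) 1)"
    by (subst emeasure_Diff) auto
  also have "\<dots> = ennreal (4 / 3 * pi)"
    by (simp add: emeasure_ball unit_ball_vol_3)
  also have "3 * \<dots> = ennreal (4 * pi)"
    by (simp flip: ennreal_numeral ennreal_mult)
  finally show ?thesis .
qed

definition Lp_norm :: "'a measure \<Rightarrow> ennreal \<Rightarrow> ('a \<Rightarrow> complex) \<Rightarrow> ennreal" where
  "Lp_norm M p f =
     (if p = \<infinity> then esssup M (\<lambda>x. ennreal (norm (f x)))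
      else let I = (\<integral>\<^sup>+x. ennreal (norm (f x) powr enn2real p) \<partial>M)
           in if I = \<infinity> then \<infinity> else ennreal (enn2real I powr (1 / enn2real p)))"


section \<open>The Laplace--Beltrami operator\<close>

text \<open>
  Functions on the sphere are represented by functions on the whole space, of which only the
  values on the unit sphere matter. They are differentiated through their extension that is
  constant on the rays from the origin.
\<close>

definition radial_extension :: "(real^3 \<Rightarrow> complex) \<Rightarrow> real^3 \<Rightarrow> complex" where
  "radial_extension f y = f (y /\<^sub>R norm y)"

definition partial_derivative :: "3 \<Rightarrow> (real^3 \<Rightarrow> complex) \<Rightarrow> real^3 \<Rightarrow> complex" where
  "partial_derivative i F x = vector_derivative (\<lambda>t. F (x + t *\<^sub>R axis i 1)) (at 0)"

definition C1_on :: "(real^3) set \<Rightarrow> (real^3 \<Rightarrow> complex) \<Rightarrow> bool" where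
  "C1_on U F \<longleftrightarrow> F differentiable_on U \<and> (\<forall>i. continuous_on U (partial_derivative i F))"

definition C2_on :: "(real^3) set \<Rightarrow> (real^3 \<Rightarrow> complex) \<Rightarrow> bool" where
  "C2_on U F \<longleftrightarrow> C1_on U F \<and> (\<forall>i. C1_on U (partial_derivative i F))"

definition C2_sphere :: "(real^3 \<Rightarrow> complex) \<Rightarrow> bool" where
  "C2_sphere f \<longleftrightarrow> C2_on (- {0}) (radial_extension f)"

text \<open>
  In polar coordinates the Euclidean Laplacian is
  \<open>\<partial>\<^sub>r\<^sup>2 + (2/r) \<partial>\<^sub>r + r\<^sup>-\<^sup>2 \<Delta>\<^sub>S\<close>, so on an extension that is constant in \<open>r\<close> it restricts to
  the (negative) Laplace--Beltrami operator of the sphere; the sign makes the operator positive.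
\<close>

definition sphere_laplacian :: "(real^3 \<Rightarrow> complex) \<Rightarrow> real^3 \<Rightarrow> complex" where
  "sphere_laplacian f x =
     - (\<Sum>i\<in>UNIV. partial_derivative i (partial_derivative i (radial_extension f)) x)"


section \<open>The averaging operator\<close>

definition T_op :: "nat \<Rightarrow> (nat \<Rightarrow> real^3^3) \<Rightarrow> (real^3 \<Rightarrow> complex) \<Rightarrow> real^3 \<Rightarrow> complex" where
  "T_op M g f x = (let q = 2 * real M - 1 in
     complex_of_real (1 / sqrt q) * (\<Sum>j\<in>{1..M}. f (g j *v x) + f (matrix_inv (g j) *v x)))"

definition T_eigenfunction :: "nat \<Rightarrow> (nat \<Rightarrow> real^3^3) \<Rightarrow> (real^3 \<Rightarrow> complex) \<Rightarrow> bool" where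
  "T_eigenfunction M g f \<longleftrightarrow> (\<exists>\<mu>. AE x in sphere_measure. T_op M g f x = \<mu> * f x)"

end

(*
  Let E be the set where a real joint eigenfunction u exceeds a, f its indicator function and
  F = Pi f with Pi the orthogonal projection onto the spherical harmonics of degree s. Then
  a |E| <= <u, F>. A combination of the Chebyshev polynomials of T, of length N ~ log s, that is of
  size N at the eigenvalue of u gives
  N <u, F>^2 <= C sum_(n < 2N) |q^(-n/2) sum_(w reduced, |w| = n) <F o w, F>|.
  In each inner product the part of the reproducing kernel near the points +-x is controlled by the
  bound int_B phi^2 <= C rho for spherical harmonics phi on balls B of radius rho, and the far part
  by the decay of the Legendre polynomials. Only O(n) words of length n move a given point y to
  within exp(-c n) of x: quotients of two such words almost fix x, hence almost commute, hence
  commute, because nonzero entries of a word minus the identity are at least exp(-c n), the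
  generators being algebraic; and commuting words are powers of one element. This gives
  |E| <= C s / ((log s)^3 a^6) and E empty for a >= C sqrt(s / log s), the distributional form of
  the claim.
*)
theory Submission
  imports Defs
begin


section \<open>Legendre polynomials\<close>

text \<open>An indicator has L1 norm and squared L2 norm both equal to m = |E|, so the near part of
  the kernel costs a multiple of m and the far part a multiple of m^2; the latter is meant to be
  absorbed by N a^2 m^2. The obstacle is that the near part is estimated word by word, which loses
  the number ~ q^n of words against the normalisation q^(-n/2), whereas the far part on the O(n)
  exceptional words keeps that normalisation as decay. The radius of the near region therefore
  shrinks with n, rho = R^2 q^(-3n/4) / s, and both sums over n converge. The choice R ~ s / (N a^2)
  absorbs the far part and leaves N a^2 m <= C R^2 / s, whence the shape s / (N^3 a^6). If R < 1,
  every near region is empty and m = 0: this is the sup bound. All other words stay at distance at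
  least s^(-1/2), where their crude count q^n is affordable, but only for a >= C s^(13/32). Below
  that level only the empty word is used; the loss of (log s)^3 is paid for by a small power of A /
  a, A being the sup bound, which is where p > 6 enters.\<close>

fun legendre :: "nat \<Rightarrow> real poly" where
  "legendre 0 = 1"
| "legendre (Suc 0) = [:0, 1:]"
| "legendre (Suc (Suc n)) =
     smult (1 / (real n + 2)) (smult (2 * real n + 3) ([:0, 1:] * legendre (Suc n)) - smult (real n + 1) (legendre n))"

lemma legendre_Suc_Suc:
  "(real n + 2) * poly (legendre (Suc (Suc n))) x =
     (2 * real n + 3) * x * poly (legendre (Suc n)) x - (real n + 1) * poly (legendre n) x"
  by (simp add: field_simps)

lemma pderiv_legendre_Suc_Suc:
  "(real n + 2) * poly (pderiv (legendre (Suc (Suc n)))) x =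
     (2 * real n + 3) * (poly (legendre (Suc n)) x + x * poly (pderiv (legendre (Suc n))) x)
       - (real n + 1) * poly (pderiv (legendre n)) x"
proof -
  have "pderiv (legendre (Suc (Suc n))) = smult (1 / (real n + 2))
     (smult (2 * real n + 3) ([:0, 1:] * pderiv (legendre (Suc n)) + legendre (Suc n)) - smult (real n + 1) (pderiv (legendre n)))"
    by (simp add: pderiv_smult pderiv_diff pderiv_mult pderiv_pCons del: mult_pCons_left)
  then have "poly (pderiv (legendre (Suc (Suc n)))) x = (1 / (real n + 2)) *
     ((2 * real n + 3) * (x * poly (pderiv (legendre (Suc n))) x + poly (legendre (Suc n)) x) - (real n + 1) * poly (pderiv (legendre n)) x)"
    by simp
  then show ?thesis by (simp add: field_simps)
qed

text \<open>Differentiating the recursion turns the second ladder relation into the first one for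
  the next index; the second one for the next index then needs both. Hence the joint
  induction.\<close>

lemma pderiv_legendre_pair:
  "poly (pderiv (legendre (Suc n))) x
     = x * poly (pderiv (legendre n)) x + (real n + 1) * poly (legendre n) x \<and>
   x * poly (pderiv (legendre (Suc n))) x - poly (pderiv (legendre n)) x
     = (real n + 1) * poly (legendre (Suc n)) x"
proof (induction n)
  case 0
  then show ?case by (simp add: pderiv_pCons)
next
  case (Suc n)
  define P Q R where "P = poly (legendre n) x" and "Q = poly (legendre (Suc n)) x"
    and "R = poly (legendre (Suc (Suc n))) x"
  define P' Q' R' where "P' = poly (pderiv (legendre n)) x" and "Q' = poly (pderiv (legendre (Suc n))) x"
    and "R' = poly (pderiv (legendre (Suc (Suc n)))) x"
  have IH: "Q' = x * P' + (real n + 1) * P" "x * Q' - P' = (real n + 1) * Q"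
    unfolding P_def Q_def P'_def Q'_def using Suc by blast+
  have r: "(real n + 2) * R = (2 * real n + 3) * x * Q - (real n + 1) * P"
    unfolding P_def Q_def R_def by (rule legendre_Suc_Suc)
  have r': "(real n + 2) * R' = (2 * real n + 3) * (Q + x * Q') - (real n + 1) * P'"
    unfolding P'_def Q'_def R'_def Q_def by (rule pderiv_legendre_Suc_Suc)
  have "(real n + 2) * R' = (real n + 2) * (x * Q' + (real n + 2) * Q)"
    unfolding r' using IH by algebra
  then have 1: "R' = x * Q' + (real n + 2) * Q" by simp
  have "x * R' - Q' = (real n + 2) * R"
    unfolding 1 r using IH by algebra
  with 1 show ?case
    unfolding P'_def Q'_def R'_def Q_def R_def by (simp add: algebra_simps)
qed

lemma pderiv_legendre_Suc:
  "poly (pderiv (legendre (Suc n))) x = x * poly (pderiv (legendre n)) x + (real n + 1) * poly (legendre n) x"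
  using pderiv_legendre_pair by blast

text \<open>The ladder relations combine to (x^2 - 1) P_n' = n (x P_n - P_(n-1)). Differentiating
  once more and eliminating P_(n-1)' by a ladder relation gives the equation.\<close>

lemma legendre_ode:
  "(1 - x\<^sup>2) * poly (pderiv (pderiv (legendre n))) x - 2 * x * poly (pderiv (legendre n)) x
     + real (n * (n + 1)) * poly (legendre n) x = 0"
proof (cases n)
  case 0
  then show ?thesis by (simp add: pderiv_1)
next
  case (Suc m)
  have "[:-1, 0, 1:] * pderiv (legendre n) = smult (real n) ([:0, 1:] * legendre n - legendre m)"
  proof (rule poly_eq_poly_eq_iff[THEN iffD1], rule ext)
    fix y
    show "poly ([:-1, 0, 1:] * pderiv (legendre n)) y = poly (smult (real n) ([:0, 1:] * legendre n - legendre m)) y"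
      using pderiv_legendre_pair[of m y] unfolding Suc by (simp del: legendre.simps) algebra
  qed
  then have "pderiv ([:-1, 0, 1:] * pderiv (legendre n)) = pderiv (smult (real n) ([:0, 1:] * legendre n - legendre m))"
    by simp
  then have "poly (pderiv ([:-1, 0, 1:] * pderiv (legendre n))) x = poly (pderiv (smult (real n) ([:0, 1:] * legendre n - legendre m))) x"
    by simp
  then have "(x\<^sup>2 - 1) * poly (pderiv (pderiv (legendre n))) x + 2 * x * poly (pderiv (legendre n)) x
     = real n * (poly (legendre n) x + x * poly (pderiv (legendre n)) x - poly (pderiv (legendre m)) x)"
    by (simp add: pderiv_mult pderiv_smult pderiv_diff pderiv_pCons power2_eq_square algebra_simps
          del: legendre.simps mult_pCons_left)
  then show ?thesis
    using pderiv_legendre_pair[of m x] unfolding Suc by (simp add: power2_eq_square del: legendre.simps) algebra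
qed

lemma legendre_1 [simp]: "poly (legendre n) 1 = 1"
proof (induction n rule: legendre.induct)
  case (3 n)
  then show ?case using legendre_Suc_Suc[of n 1] by (simp add: field_simps)
qed auto

lemma legendre_minus: "poly (legendre n) (- x) = (-1) ^ n * poly (legendre n) x"
proof (induction n rule: legendre.induct)
  case (3 n)
  then show ?case by (simp add: algebra_simps)
qed auto

lemma degree_legendre [simp]: "degree (legendre n) = n"
  and lead_coeff_legendre_nonzero: "coeff (legendre n) n \<noteq> 0"
proof -
  have "degree (legendre n) \<le> n \<and> coeff (legendre n) n \<noteq> 0"
  proof (induction n rule: legendre.induct)
    case (3 n)
    have "degree (legendre (Suc (Suc n))) \<le> Suc (Suc n)"
      using 3 by (auto intro!: degree_diff_le order_trans[OF degree_smult_le] order_trans[OF degree_pCons_le])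
    moreover have "coeff (legendre n) (Suc (Suc n)) = 0"
      using 3 by (intro coeff_eq_0) auto
    ultimately show ?case using 3 by (simp add: add_pos_nonneg)
  qed auto
  then show "degree (legendre n) = n" "coeff (legendre n) n \<noteq> 0"
    by (auto intro: antisym le_degree)
qed

text \<open>At 0 the recursion multiplies by -(n+1)/(n+2) in steps of two, and (n+1)(n+3) <= (n+2)^2
  preserves the bound. It controls the starting value in \<open>legendre_bernstein\<close>.\<close>

lemma legendre_0_power2: "(poly (legendre n) 0)\<^sup>2 \<le> 1 / (real n + 1)"
proof (induction n rule: legendre.induct)
  case (3 n)
  have "(poly (legendre (Suc (Suc n))) 0)\<^sup>2 = ((real n + 1) / (real n + 2))\<^sup>2 * (poly (legendre n) 0)\<^sup>2"
    by (simp add: field_simps power2_eq_square)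
  also have "\<dots> \<le> ((real n + 1) / (real n + 2))\<^sup>2 * (1 / (real n + 1))"
    using 3 by (intro mult_left_mono) auto
  also have "\<dots> = (real n + 1) / (real n + 2)\<^sup>2"
    by (simp add: power2_eq_square power_divide)
  also have "\<dots> \<le> 1 / (real n + 3)"
  proof -
    have "(real n + 1) * (real n + 3) \<le> (real n + 2)\<^sup>2" by (simp add: power2_eq_square algebra_simps)
    then have "(real n + 1) * (real n + 3) / (real n + 2)\<^sup>2 \<le> 1"
      by (simp add: divide_le_eq_1)
    then show ?thesis
      by (intro mult_imp_le_div_pos) auto
  qed
  finally show ?case by (simp add: add.commute del: legendre.simps)
qed auto

lemma pderiv_legendre_0_power2: "n \<ge> 1 \<Longrightarrow> (poly (pderiv (legendre n)) 0)\<^sup>2 \<le> real n"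
proof -
  assume "n \<ge> 1"
  then obtain m where m: "n = Suc m" by (cases n) auto
  have "(poly (pderiv (legendre n)) 0)\<^sup>2 = (real m + 1)\<^sup>2 * (poly (legendre m) 0)\<^sup>2"
    unfolding m pderiv_legendre_Suc by (simp add: power_mult_distrib)
  also have "\<dots> \<le> (real m + 1)\<^sup>2 * (1 / (real m + 1))"
    by (intro mult_left_mono legendre_0_power2) auto
  also have "\<dots> = real n" by (simp add: m power2_eq_square)
  finally show ?thesis .
qed

text \<open>By the differential equation P^2 + (1 - t^2) P'^2 / (n(n+1)) has derivative 2 t P'^2 /
  (n(n+1)), so it increases on [0, 1] up to its value 1 at t = 1. Parity covers negative
  arguments.\<close>

lemma abs_legendre_le_1:
  assumes "\<bar>x\<bar> \<le> 1"
  shows "\<bar>poly (legendre n) x\<bar> \<le> 1"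
proof (cases "n = 0")
  case False
  define k where "k = real (n * (n + 1))"
  have k: "k > 0" using False by (simp add: k_def add_pos_nonneg)
  have main: "(poly (legendre n) x)\<^sup>2 \<le> 1" if "0 \<le> x" "x \<le> 1" for x
  proof -
    define P P' P'' where "P = poly (legendre n)" and "P' = poly (pderiv (legendre n))"
      and "P'' = poly (pderiv (pderiv (legendre n)))"
    have dP: "(P has_real_derivative P' t) (at t)" "(P' has_real_derivative P'' t) (at t)" for t
      unfolding P_def P'_def P''_def by (rule poly_DERIV)+
    define N where "N = (\<lambda>t. (P t)\<^sup>2 + (1 - t\<^sup>2) * (P' t)\<^sup>2 / k)"
    have "(N has_real_derivative (2 * t * (P' t)\<^sup>2 / k)) (at t)" for t
    proof -
      have ode: "(1 - t\<^sup>2) * P'' t = 2 * t * P' t - k * P t"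
        using legendre_ode[of t n] by (simp add: P_def P'_def P''_def k_def)
      have "(N has_real_derivative
          (2 * P t * P' t + ((1 - t\<^sup>2) * (2 * P' t * P'' t) - 2 * t * (P' t)\<^sup>2) / k)) (at t)"
        unfolding N_def using k
        by (auto intro!: derivative_eq_intros dP simp: field_simps power2_eq_square)
      also have "(1 - t\<^sup>2) * (2 * P' t * P'' t) = 2 * P' t * (2 * t * P' t - k * P t)"
        using ode by algebra
      also have "2 * P t * P' t + (2 * P' t * (2 * t * P' t - k * P t) - 2 * t * (P' t)\<^sup>2) / k = 2 * t * (P' t)\<^sup>2 / k"
        using k by (simp add: field_simps power2_eq_square)
      finally show ?thesis .
    qed
    then have "N x \<le> N 1"
      using that k by (intro DERIV_nonneg_imp_nondecreasing[of x 1 N]) (auto intro!: exI)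
    moreover have "N 1 = 1" by (simp add: N_def P_def)
    moreover have "(P x)\<^sup>2 \<le> N x"
      using that k by (auto simp: N_def power_le_one)
    ultimately show ?thesis by (simp add: P_def)
  qed
  have "(poly (legendre n) x)\<^sup>2 = (poly (legendre n) \<bar>x\<bar>)\<^sup>2"
    using legendre_minus[of n x] by (auto simp: abs_if power_mult_distrib simp flip: power_mult)
  also have "\<dots> \<le> 1" using assms by (intro main) auto
  finally show ?thesis by (simp add: abs_square_le_1)
qed simp

text \<open>
  Sonin's monotonicity argument for \<open>u = (sin \<theta>)\<^sup>1\<^sup>/\<^sup>2 P\<^sub>n(cos \<theta>)\<close>, which satisfies
  \<open>u'' + q u = 0\<close> with \<open>q = (n + 1/2)\<^sup>2 + 1/(4 sin\<^sup>2 \<theta>)\<close>: the quantity \<open>u\<^sup>2 + u'\<^sup>2 / q\<close>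
  is maximal at \<open>\<theta> = \<pi>/2\<close>.
\<close>

lemma legendre_bernstein:
  assumes n: "n \<ge> 1" and x: "\<bar>x\<bar> \<le> 1"
  shows "sqrt (1 - x\<^sup>2) * (poly (legendre n) x)\<^sup>2 \<le> 2 / real n"
proof (cases "\<bar>x\<bar> = 1")
  case True
  then have "x\<^sup>2 = 1" by (metis one_power2 power2_abs)
  then show ?thesis by simp
next
  case False
  have main: "sqrt (1 - x\<^sup>2) * (poly (legendre n) x)\<^sup>2 \<le> 2 / real n" if x: "0 \<le> x" "x < 1" for x
  proof -
    define P P' P'' where "P = poly (legendre n)" and "P' = poly (pderiv (legendre n))"
      and "P'' = poly (pderiv (pderiv (legendre n)))"
    have dP: "(P has_real_derivative P' t) (at t)" "(P' has_real_derivative P'' t) (at t)" for t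
      unfolding P_def P'_def P''_def by (rule poly_DERIV)+
    define c where "c = (real n + 1/2)\<^sup>2"
    have c: "c \<ge> (real n)\<^sup>2" "c > 0" by (auto simp: c_def power2_eq_square algebra_simps intro!: add_nonneg_pos)
    \<comment> \<open>With \<open>t = cos \<theta>\<close>, \<open>Z t\<close> is u' times the
      square root of sin \<theta>, and \<open>D t\<close> is the coefficient of the equation for u
      times sin^2 \<theta>. Thus \<open>N\<close> is Sonin's quantity written in the variable
      t.\<close>
    define Z where "Z = (\<lambda>t. t * P t / 2 - (1 - t\<^sup>2) * P' t)"
    define D where "D = (\<lambda>t. c * (1 - t\<^sup>2) + 1/4)"
    define N where "N = (\<lambda>t. sqrt (1 - t\<^sup>2) * ((P t)\<^sup>2 + (Z t)\<^sup>2 / D t))"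
    have der: "(N has_real_derivative (- t * (Z t)\<^sup>2 / (2 * (D t)\<^sup>2) / sqrt (1 - t\<^sup>2))) (at t)"
      if t: "0 \<le> t" "t < 1" for t
    proof -
      have t2: "t\<^sup>2 < 1" using t by (simp add: abs_square_less_1)
      have D0: "D t > 0" using t2 c by (auto simp: D_def intro!: add_nonneg_pos)
      define r where "r = sqrt (1 - t\<^sup>2)"
      have r: "r > 0" "r * r = 1 - t\<^sup>2" using t2 by (auto simp: r_def)
      have ode: "(1 - t\<^sup>2) * P'' t = 2 * t * P' t - (c - 1/4) * P t"
        using legendre_ode[of t n] by (simp add: P_def P'_def P''_def c_def power2_eq_square algebra_simps)
      have dZ: "(Z has_real_derivative ((c + 1/4) * P t + t * P' t / 2)) (at t)"
      proof -
        have "(Z has_real_derivative (P t / 2 + t * P' t / 2 + 2 * t * P' t - (1 - t\<^sup>2) * P'' t)) (at t)"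
          unfolding Z_def by (auto intro!: derivative_eq_intros dP simp: field_simps)
        then show ?thesis unfolding ode by (simp add: algebra_simps)
      qed
      have dD: "(D has_real_derivative (- 2 * c * t)) (at t)"
        unfolding D_def by (auto intro!: derivative_eq_intros)
      have dr: "((\<lambda>t. sqrt (1 - t\<^sup>2)) has_real_derivative (- t / r)) (at t)"
        using t2 by (auto intro!: derivative_eq_intros simp: r_def field_simps)
      have "(N has_real_derivative ((- t / r) * ((P t)\<^sup>2 + (Z t)\<^sup>2 / D t) +
          r * (2 * P t * P' t + ((2 * Z t * ((c + 1/4) * P t + t * P' t / 2)) * D t - (Z t)\<^sup>2 * (- 2 * c * t)) / (D t * D t)))) (at t)"
        unfolding N_def r_def
      proof (rule DERIV_mult'[OF dr[unfolded r_def], THEN DERIV_cong])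
        show "((\<lambda>t. (P t)\<^sup>2 + (Z t)\<^sup>2 / D t) has_real_derivative
          (2 * P t * P' t + ((2 * Z t * ((c + 1/4) * P t + t * P' t / 2)) * D t - (Z t)\<^sup>2 * (- 2 * c * t)) / (D t * D t))) (at t)"
          using D0 by (auto intro!: derivative_eq_intros dP dZ dD)
      qed simp
      also have "(- t / r) * ((P t)\<^sup>2 + (Z t)\<^sup>2 / D t) +
          r * (2 * P t * P' t + ((2 * Z t * ((c + 1/4) * P t + t * P' t / 2)) * D t - (Z t)\<^sup>2 * (- 2 * c * t)) / (D t * D t))
        = (- t * (Z t)\<^sup>2 / (2 * (D t)\<^sup>2) / r)" (is "?L = ?R")
      proof -
        define a b d e where "a = P t" and "b = P' t" and "d = D t" and "e = Z t"
        have e: "e = t * a / 2 - (1 - t\<^sup>2) * b" by (simp add: e_def Z_def a_def b_def)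
        have d: "d = c * (1 - t\<^sup>2) + 1/4" by (simp add: d_def D_def)
        have d0: "d > 0" using D0 by (simp add: d_def)
        \<comment> \<open>Multiplication by \<open>r d^2\<close> together with
          \<open>r r = 1 - t^2\<close> removes all roots and denominators; what remains is a
          polynomial identity.\<close>
        have "- t * (a\<^sup>2 * d\<^sup>2 + e\<^sup>2 * d) +
            (1 - t\<^sup>2) * (2 * a * b * d\<^sup>2 + ((2 * e * ((c + 1/4) * a + t * b / 2)) * d - e\<^sup>2 * (- 2 * c * t))) = - t * e\<^sup>2 / 2"
          unfolding e d by (simp add: field_simps power2_eq_square)
        moreover have "?L * r * d\<^sup>2 = - t * (a\<^sup>2 * d\<^sup>2 + e\<^sup>2 * d) +
            (r * r) * (2 * a * b * d\<^sup>2 + ((2 * e * ((c + 1/4) * a + t * b / 2)) * d - e\<^sup>2 * (- 2 * c * t)))"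
          using d0 r(1) unfolding a_def[symmetric] b_def[symmetric] d_def[symmetric] e_def[symmetric]
          by (simp add: field_simps power2_eq_square)
        ultimately have "?L * r * d\<^sup>2 = - t * e\<^sup>2 / 2" using r(2) by simp
        then show ?thesis using d0 r(1) unfolding d_def[symmetric] e_def[symmetric]
          by (simp add: field_simps power2_eq_square)
      qed
      finally show ?thesis by (simp add: r_def)
    qed
    have "N x \<le> N 0"
    proof (rule DERIV_nonpos_imp_nonincreasing[of 0 x N])
      fix t assume "0 \<le> t" "t \<le> x"
      then show "\<exists>y. (N has_real_derivative y) (at t) \<and> y \<le> 0"
        using x by (intro exI[of _ "- t * (Z t)\<^sup>2 / (2 * (D t)\<^sup>2) / sqrt (1 - t\<^sup>2)"] conjI der)
          (auto simp: divide_le_0_iff power_le_one abs_square_le_1)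
    qed (use x in auto)
    also have "N 0 = (P 0)\<^sup>2 + (P' 0)\<^sup>2 / (c + 1/4)" by (simp add: N_def Z_def D_def)
    also have "(P' 0)\<^sup>2 / (c + 1/4) \<le> real n / (real n)\<^sup>2"
      using n c pderiv_legendre_0_power2[OF n] unfolding P'_def by (intro frac_le) auto
    also have "(P 0)\<^sup>2 \<le> 1 / real n"
      unfolding P_def by (rule order_trans[OF legendre_0_power2]) (use n in \<open>auto intro!: divide_left_mono\<close>)
    also have "1 / real n + real n / (real n)\<^sup>2 = 2 / real n"
      using n by (simp add: power2_eq_square field_simps)
    finally have "N x \<le> 2 / real n" by simp
    moreover have "sqrt (1 - x\<^sup>2) * (P x)\<^sup>2 \<le> N x"
    proof -
      have "x\<^sup>2 < 1" using x by (simp add: abs_square_less_1)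
      then have "D x \<ge> 0" "sqrt (1 - x\<^sup>2) \<ge> 0" using c by (auto simp: D_def)
      then show ?thesis unfolding N_def by (intro mult_left_mono) auto
    qed
    ultimately show ?thesis by (simp add: P_def)
  qed
  have "(poly (legendre n) x)\<^sup>2 = (poly (legendre n) \<bar>x\<bar>)\<^sup>2"
    using legendre_minus[of n x] by (auto simp: abs_if power_mult_distrib simp flip: power_mult)
  then show ?thesis using main[of "\<bar>x\<bar>"] False x by simp
qed

text \<open>The leading coefficient of each Legendre polynomial is nonzero, so subtracting a
  multiple lowers the degree: linear statements need to be checked on Legendre polynomials
  only.\<close>

lemma legendre_span_induct:
  fixes p :: "real poly"
  assumes zero: "Q 0" and add: "\<And>p q. Q p \<Longrightarrow> Q q \<Longrightarrow> Q (p + q)" and smult: "\<And>c p. Q p \<Longrightarrow> Q (smult c p)"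
    and leg: "\<And>n. Q (legendre n)"
  shows "Q p"
proof (induction "degree p" arbitrary: p rule: less_induct)
  case less
  define n where "n = degree p"
  define c where "c = coeff p n / coeff (legendre n) n"
  define r where "r = p - smult c (legendre n)"
  have "Q r"
  proof (cases "r = 0")
    case True
    then show ?thesis using zero by simp
  next
    case False
    have "degree r \<le> n" unfolding r_def n_def by (auto intro!: degree_diff_le order_trans[OF degree_smult_le])
    moreover have "coeff r n = 0"
      using lead_coeff_legendre_nonzero[of n] by (simp add: r_def c_def)
    ultimately have "degree r < n"
      using False by (metis leading_coeff_0_iff le_neq_implies_less)
    then show ?thesis using less unfolding n_def by blast
  qed
  then have "Q (r + smult c (legendre n))" by (intro add smult leg)
  then show ?case by (simp add: r_def)
qed

section \<open>Calculus on the sphere\<close>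

unbundle cross3_syntax

abbreviation S2 :: "(real^3) set" where "S2 \<equiv> sphere 0 1"
abbreviation \<sigma> :: "(real^3) measure" where "\<sigma> \<equiv> sphere_measure"

lemma finite_measure_sphere_measure: "finite_measure \<sigma>"
  by (rule finite_measureI) (simp add: emeasure_sphere_measure_space)

interpretation sph: finite_measure "sphere_measure" by (rule finite_measure_sphere_measure)

lemma measure_sphere_measure_space: "measure \<sigma> S2 = 4 * pi"
  by (simp add: measure_def emeasure_sphere_measure_space)

lemma borel_measurable_sphere_measure:
  "f \<in> borel \<rightarrow>\<^sub>M N \<Longrightarrow> f \<in> \<sigma> \<rightarrow>\<^sub>M N"
  unfolding measurable_cong_sets[OF sets_sphere_measure refl] by (rule measurable_restrict_space1)

lemma continuous_on_imp_borel_measurable_sphere_measure: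
  fixes f :: "real^3 \<Rightarrow> 'b::topological_space"
  assumes "continuous_on S2 f"
  shows "f \<in> borel_measurable \<sigma>"
  using borel_measurable_continuous_on_restrict[OF assms]
  unfolding measurable_cong_sets[OF sets_sphere_measure refl] .

lemma sphere_bounded_integrable:
  fixes f :: "real^3 \<Rightarrow> real"
  assumes "f \<in> borel_measurable \<sigma>" "\<And>x. x \<in> S2 \<Longrightarrow> \<bar>f x\<bar> \<le> B"
  shows "integrable \<sigma> f"
  using assms by (intro sph.integrable_const_bound[where B = B]) auto

lemma sphere_continuous_integrable:
  fixes f :: "real^3 \<Rightarrow> real"
  assumes "continuous_on S2 f"
  shows "integrable \<sigma> f"
proof -
  have "compact (f ` S2)" using assms by (intro compact_continuous_image) auto
  then obtain B where "\<forall>y\<in>f ` S2. norm y \<le> B" using compact_imp_bounded bounded_iff by metis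
  then show ?thesis
    by (intro sphere_bounded_integrable[where B = B] continuous_on_imp_borel_measurable_sphere_measure assms) auto
qed

section \<open>Invariance of the surface measure under orthogonal maps\<close>

lemma emeasure_lborel_orthogonal_vimage:
  fixes f :: "real^3 \<Rightarrow> real^3"
  assumes f: "orthogonal_transformation f" and S: "S \<in> sets borel" "bounded S"
  shows "emeasure lborel (f -` S) = emeasure lborel S"
proof -
  have bij: "bij f" by (rule orthogonal_transformation_bij[OF f])
  have g: "orthogonal_transformation (inv_into UNIV f)" by (rule orthogonal_transformation_inv[OF f])
  have eq: "f -` S = inv_into UNIV f ` S" by (simp add: bij bij_vimage_eq_inv_image)
  have S': "S \<in> lmeasurable" using S by (simp add: bounded_set_imp_lmeasurable)
  have fS: "f -` S \<in> sets borel"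
    using measurable_sets_borel[of f borel S] S(1) orthogonal_transformation_linear[OF f]
    by (simp add: borel_measurable_continuous_onI linear_continuous_on linear_linear)
  have S'': "inv_into UNIV f ` S \<in> lmeasurable"
    using measurable_linear_image[OF orthogonal_transformation_linear[OF g] S'] by simp
  have "emeasure lebesgue (inv_into UNIV f ` S) = emeasure lebesgue S"
    using measure_orthogonal_image[OF g S'] S' S'' by (simp add: emeasure_eq_measure2 fmeasurableD2)
  then show ?thesis using eq fS S(1) by (simp add: emeasure_completion main_part_sets)
qed

text \<open>A linear isometry commutes with the radial projection, so it carries the cone over a set
  to the cone over its image, and invariance of volume in space applies.\<close>

lemma distr_sphere_measure_orthogonal:
  assumes f: "orthogonal_transformation f"
  shows "distr \<sigma> \<sigma> f = \<sigma>"
proof (rule measure_eqI)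
  fix A assume "A \<in> sets (distr \<sigma> \<sigma> f)"
  then have A: "A \<in> sets (restrict_space borel S2)" by simp
  have lin: "linear f" by (rule orthogonal_transformation_linear[OF f])
  have nrm: "norm (f x) = norm x" for x by (rule orthogonal_transformation_norm[OF f])
  have fb: "f \<in> borel \<rightarrow>\<^sub>M borel"
    using lin by (simp add: borel_measurable_continuous_onI linear_continuous_on linear_linear)
  have fm: "f \<in> \<sigma> \<rightarrow>\<^sub>M \<sigma>"
    using borel_measurable_sphere_measure[OF fb]
    by (subst measurable_cong_sets[OF refl sets_sphere_measure])
       (rule measurable_restrict_space2, auto simp: nrm)
  have A': "f -` A \<inter> S2 \<in> sets (restrict_space borel S2)"
    using measurable_sets[OF fm, of A] A by simp
  obtain A0 where A0: "A0 \<in> sets borel" "A = A0 \<inter> S2"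
    using A by (auto simp: sets_restrict_space)
  define S where "S = {y::real^3. y \<noteq> 0 \<and> norm y < 1 \<and> y /\<^sub>R norm y \<in> A}"
  have "S = ((\<lambda>y. y /\<^sub>R norm y) -` A0 \<inter> space borel) \<inter> (ball 0 1 - {0})"
    unfolding S_def A0(2) by (auto simp: norm_divide)
  also have "\<dots> \<in> sets borel"
    by (intro sets.Int measurable_sets[OF _ A0(1)]) auto
  finally have S: "S \<in> sets borel" .
  have Sb: "bounded S" unfolding S_def by (auto simp: bounded_iff intro!: exI[of _ 1])
  have "emeasure (distr \<sigma> \<sigma> f) A = emeasure \<sigma> (f -` A \<inter> S2)"
    using A fm by (simp add: emeasure_distr)
  also have "\<dots> = 3 * emeasure lborel {y. y \<noteq> 0 \<and> norm y < 1 \<and> y /\<^sub>R norm y \<in> f -` A \<inter> S2}"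
    by (rule emeasure_sphere_measure[OF A'])
  also have "{y. y \<noteq> 0 \<and> norm y < 1 \<and> y /\<^sub>R norm y \<in> f -` A \<inter> S2} = f -` S"
  proof -
    have "f y = 0 \<longleftrightarrow> y = 0" for y using nrm[of y] by (metis norm_eq_zero)
    moreover have "f (y /\<^sub>R norm y) = f y /\<^sub>R norm (f y)" for y
      by (simp only: nrm linear_scale[OF lin])
    moreover have "norm (y /\<^sub>R norm y) = 1" if "y \<noteq> 0" for y :: "real^3" using that by simp
    ultimately show ?thesis unfolding S_def by (auto simp only: vimage_def mem_Collect_eq Int_iff mem_sphere_0 nrm)
  qed
  also have "emeasure lborel (f -` S) = emeasure lborel S"
    by (rule emeasure_lborel_orthogonal_vimage[OF f S Sb])
  also have "3 * \<dots> = emeasure \<sigma> A" unfolding S_def by (rule emeasure_sphere_measure[OF A, symmetric])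
  finally show "emeasure (distr \<sigma> \<sigma> f) A = emeasure \<sigma> A" .
qed simp

lemma orthogonal_measurable_sphere:
  assumes f: "orthogonal_transformation f"
  shows "f \<in> \<sigma> \<rightarrow>\<^sub>M \<sigma>"
proof -
  have "f \<in> borel \<rightarrow>\<^sub>M borel"
    using orthogonal_transformation_linear[OF f]
    by (simp add: borel_measurable_continuous_onI linear_continuous_on linear_linear)
  from borel_measurable_sphere_measure[OF this] show ?thesis
    by (subst measurable_cong_sets[OF refl sets_sphere_measure])
       (rule measurable_restrict_space2, auto simp: orthogonal_transformation_norm[OF f])
qed

lemma integral_sphere_orthogonal:
  fixes h :: "real^3 \<Rightarrow> real"
  assumes f: "orthogonal_transformation f" and h: "h \<in> borel_measurable \<sigma>"
  shows "(\<integral>x. h (f x) \<partial>\<sigma>) = (\<integral>x. h x \<partial>\<sigma>)"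
  using integral_distr[OF orthogonal_measurable_sphere[OF f] h] distr_sphere_measure_orthogonal[OF f] by simp

section \<open>Rotation flows and integration by parts on the sphere\<close>

text \<open>Rodrigues' formula for the rotation by the angle \<open>t\<close> about the unit vector
  \<open>a\<close>.\<close>

definition rot :: "real^3 \<Rightarrow> real \<Rightarrow> real^3 \<Rightarrow> real^3" where
  "rot a t x = cos t *\<^sub>R x + sin t *\<^sub>R (a \<times> x) + ((1 - cos t) * (a \<bullet> x)) *\<^sub>R a"

lemma rot_0 [simp]: "rot a 0 x = x"
  by (simp add: rot_def)

lemma orthogonal_transformation_rot:
  assumes "norm a = 1"
  shows "orthogonal_transformation (rot a t)"
  unfolding orthogonal_transformation
proof (intro conjI allI)
  show "linear (rot a t)"
    by (rule linearI) (simp_all add: rot_def cross_add_right cross_mult_right inner_add_right scaleR_add_right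
        scaleR_add_left algebra_simps)
  fix x
  have aa: "a \<bullet> a = 1" using assms by (simp add: dot_square_norm)
  have c: "(a \<times> x) \<bullet> (a \<times> x) = x \<bullet> x - (a \<bullet> x)\<^sup>2"
    using norm_cross_dot[of a x] assms by (simp add: power_mult_distrib flip: dot_square_norm)
  have "rot a t x \<bullet> rot a t x = (cos t)\<^sup>2 * (x \<bullet> x) + (sin t)\<^sup>2 * ((a \<times> x) \<bullet> (a \<times> x))
      + ((1 - cos t)\<^sup>2 + 2 * cos t * (1 - cos t)) * (a \<bullet> x)\<^sup>2"
    by (simp add: rot_def inner_add_left inner_add_right dot_cross_self inner_commute[of x a] aa power2_eq_square
        algebra_simps)
  also have "\<dots> = x \<bullet> x" unfolding c sin_squared_eq by (simp add: power2_eq_square algebra_simps)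
  finally show "norm (rot a t x) = norm x" by (simp add: norm_eq)
qed

lemma rot_has_vector_derivative:
  assumes "norm a = 1"
  shows "((\<lambda>t. rot a t x) has_vector_derivative (a \<times> rot a t x)) (at t)"
proof -
  have "a \<times> (a \<times> x) = (a \<bullet> x) *\<^sub>R a - (a \<bullet> a) *\<^sub>R x"
    by (simp add: cross3_simps forall_3)
  moreover have "a \<bullet> a = 1" using assms by (simp add: dot_square_norm)
  moreover have "a \<times> rot a t x = cos t *\<^sub>R (a \<times> x) + sin t *\<^sub>R (a \<times> (a \<times> x))"
    by (simp add: rot_def cross_add_right cross_mult_right)
  ultimately have e: "a \<times> rot a t x = - sin t *\<^sub>R x + cos t *\<^sub>R (a \<times> x) + (sin t * (a \<bullet> x)) *\<^sub>R a"
    by (simp add: scaleR_diff_right)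
  show ?thesis unfolding e unfolding rot_def
    by (auto intro!: derivative_eq_intros simp: has_real_derivative_iff_has_vector_derivative[symmetric])
qed

text \<open>The integral of \<open>G\<close> along the rotation flow is constant in time; its
  derivative at time 0 may be taken under the integral by dominated convergence.\<close>

lemma integral_rotation_derivative_eq_0:
  fixes G :: "real^3 \<Rightarrow> real"
  assumes a: "norm a = 1"
    and der: "\<And>x. x \<in> S2 \<Longrightarrow> (G has_derivative D x) (at x)"
    and cont: "continuous_on S2 (\<lambda>x. D x (a \<times> x))"
  shows "(\<integral>x. D x (a \<times> x) \<partial>\<sigma>) = 0"
proof -
  have rS: "rot a t x \<in> S2" if "x \<in> S2" for t x
    using that orthogonal_transformation_norm[OF orthogonal_transformation_rot[OF a]] by simp
  have Gc: "continuous_on S2 G"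
    by (meson continuous_at_imp_continuous_on der has_derivative_continuous)
  have path: "((\<lambda>t. G (rot a t x)) has_real_derivative D (rot a t x) (a \<times> rot a t x)) (at t)" if "x \<in> S2" for x t
    unfolding has_real_derivative_iff_has_vector_derivative
    using vector_derivative_diff_chain_within[of "\<lambda>t. rot a t x" _ t UNIV G "D (rot a t x)",
        OF rot_has_vector_derivative[OF a] has_derivative_at_withinI[OF der[OF rS[OF that]]]]
    by (simp add: o_def)
  obtain B where B: "\<And>x. x \<in> S2 \<Longrightarrow> \<bar>D x (a \<times> x)\<bar> \<le> B"
  proof -
    have "compact ((\<lambda>x. D x (a \<times> x)) ` S2)" using cont by (intro compact_continuous_image) auto
    then obtain B where "\<forall>y\<in>(\<lambda>x. D x (a \<times> x)) ` S2. norm y \<le> B" using compact_imp_bounded bounded_iff by metis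
    then show ?thesis by (intro that[of B]) auto
  qed
  define h where "h = (\<lambda>n::nat. 1 / real (Suc n))"
  define s where "s = (\<lambda>n x. (G (rot a (h n) x) - G x) / h n)"
  have h0: "h n > 0" for n by (simp add: h_def)
  have hlim: "h \<longlonglongrightarrow> 0" unfolding h_def by (rule LIMSEQ_Suc[OF lim_1_over_n])
  have Gm: "G \<in> borel_measurable \<sigma>" by (rule continuous_on_imp_borel_measurable_sphere_measure[OF Gc])
  have Grm: "(\<lambda>x. G (rot a t x)) \<in> borel_measurable \<sigma>" for t
    by (rule measurable_compose[OF orthogonal_measurable_sphere[OF orthogonal_transformation_rot[OF a]] Gm])
  have sm: "s n \<in> borel_measurable \<sigma>" for n
    unfolding s_def using Gm Grm by measurable
  have "(\<lambda>n. \<integral>x. s n x \<partial>\<sigma>) \<longlonglongrightarrow> (\<integral>x. D x (a \<times> x) \<partial>\<sigma>)"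
  proof (rule integral_dominated_convergence[where w = "\<lambda>_. B"])
    show "AE x in \<sigma>. (\<lambda>n. s n x) \<longlonglongrightarrow> D x (a \<times> x)"
    proof (rule AE_I2)
      fix x assume "x \<in> space \<sigma>"
      then have x: "x \<in> S2" by simp
      have "((\<lambda>t. (G (rot a t x) - G (rot a 0 x)) / (t - 0)) \<longlongrightarrow> D x (a \<times> x)) (at 0)"
        using path[OF x, of 0] unfolding has_field_derivative_iff by simp
      then have "((\<lambda>t. (G (rot a t x) - G x) / t) \<longlongrightarrow> D x (a \<times> x)) (at 0)" by simp
      moreover have "filterlim h (at 0) sequentially"
        using hlim h0 by (auto simp: filterlim_at less_imp_neq[OF h0, symmetric] intro!: always_eventually)
      ultimately show "(\<lambda>n. s n x) \<longlonglongrightarrow> D x (a \<times> x)"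
        unfolding s_def by (rule filterlim_compose)
    qed
    fix n
    show "AE x in \<sigma>. norm (s n x) \<le> B"
    proof (rule AE_I2)
      fix x assume "x \<in> space \<sigma>"
      then have x: "x \<in> S2" by simp
      \<comment> \<open>The mean value theorem identifies the difference quotient with the
        derivative at another point of the orbit, which stays on the sphere; this supplies the
        dominating constant \<open>B\<close>.\<close>
      have "\<exists>z>0. z < h n \<and> G (rot a (h n) x) - G (rot a 0 x) = (h n - 0) * (D (rot a z x) (a \<times> rot a z x))"
        using path[OF x] h0 by (intro MVT2) auto
      then obtain z where "G (rot a (h n) x) - G x = h n * (D (rot a z x) (a \<times> rot a z x))" by auto
      then have "s n x = D (rot a z x) (a \<times> rot a z x)" using h0[of n] by (simp add: s_def)
      then show "norm (s n x) \<le> B" using B[OF rS[OF x]] by simp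
    qed
  qed (use sm cont in \<open>auto intro: continuous_on_imp_borel_measurable_sphere_measure\<close>)
  moreover have "(\<integral>x. s n x \<partial>\<sigma>) = 0" for n
  proof -
    have i: "integrable \<sigma> G" by (rule sphere_continuous_integrable[OF Gc])
    have "continuous_on S2 (\<lambda>x. G (rot a (h n) x))"
      using rS by (intro continuous_on_compose2[OF Gc])
        (auto intro!: linear_continuous_on simp: linear_linear orthogonal_transformation_linear[OF orthogonal_transformation_rot[OF a]])
    then have "integrable \<sigma> (\<lambda>x. G (rot a (h n) x))" by (rule sphere_continuous_integrable)
    then show ?thesis
      using i integral_sphere_orthogonal[OF orthogonal_transformation_rot[OF a] Gm, of "h n"] by (simp add: s_def)
  qed
  ultimately show ?thesis by (simp add: LIMSEQ_const_iff)
qed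

lemma cross_axis:
  fixes x :: "real^3"
  shows "axis 1 1 \<times> x = vector [0, - x$3, x$2]" "axis 2 1 \<times> x = vector [x$3, 0, - x$1]"
    "axis 3 1 \<times> x = vector [- x$2, x$1, 0]"
  by (simp_all add: cross3_def axis_def)

text \<open>The spherical Laplacian at a unit vector \<open>x\<close>, computed from the Euclidean
  gradient \<open>g\<close> and Hessian \<open>H\<close> of an arbitrary extension: the Euclidean
  Laplacian minus the second radial derivative minus twice the first.\<close>

definition lap :: "real^3 \<Rightarrow> real^3 \<Rightarrow> real^3^3 \<Rightarrow> real" where
  "lap x g H = trace H - x \<bullet> (H *v x) - 2 * (x \<bullet> g)"

text \<open>
  The spherical Laplacian is the sum of the squares of the infinitesimal rotations
  \<open>L\<^sub>a F(x) = DF(x)(a \<times> x)\<close>, and the integral of \<open>L\<^sub>a(F L\<^sub>a K)\<close> vanishes by rotation invariance.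
\<close>

lemma integration_by_parts_sphere:
  fixes F K :: "real^3 \<Rightarrow> real"
  assumes F: "\<And>x. x \<in> S2 \<Longrightarrow> (F has_derivative (\<lambda>v. gF x \<bullet> v)) (at x)" "continuous_on S2 gF"
    and gK: "\<And>x. x \<in> S2 \<Longrightarrow> (gK has_derivative (\<lambda>v. HK x *v v)) (at x)" "continuous_on S2 HK"
  shows "(\<integral>x. F x * lap x (gK x) (HK x) + (x \<times> gF x) \<bullet> (x \<times> gK x) \<partial>\<sigma>) = 0"
proof -
  define e :: "3 \<Rightarrow> real^3" where "e = (\<lambda>i. axis i 1)"
  \<comment> \<open>\<open>D i x\<close> is the derivative at \<open>x\<close> of F times the
    derivative of K along the rotation field of the i-th axis; evaluated on that same field it is
    the integrand whose integral vanishes.\<close>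
  define D where "D = (\<lambda>i x v. F x * ((HK x *v v) \<bullet> (e i \<times> x) + gK x \<bullet> (e i \<times> v)) + (gF x \<bullet> v) * (gK x \<bullet> (e i \<times> x)))"
  have Fc: "continuous_on S2 F" by (meson continuous_at_imp_continuous_on F(1) has_derivative_continuous)
  have gKc: "continuous_on S2 gK" by (meson continuous_at_imp_continuous_on gK(1) has_derivative_continuous)
  have cr: "bounded_linear (\<lambda>x. a \<times> x)" for a :: "real^3"
    using bilinear_cross by (simp add: bilinear_def linear_linear)
  have c1: "continuous_on S2 (\<lambda>x. e i \<times> x)" for i by (intro linear_continuous_on cr)
  have c2: "continuous_on S2 (\<lambda>x. HK x *v (e i \<times> x))" for i
    unfolding matrix_vector_mult_def
    by (intro continuous_intros c1 gK(2))
  have cD: "continuous_on S2 (\<lambda>x. D i x (e i \<times> x))" for i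
    unfolding D_def
    by (intro continuous_intros Fc gKc c1 c2 F(2) continuous_on_cross)
  have z: "(\<integral>x. D i x (e i \<times> x) \<partial>\<sigma>) = 0" for i
  proof (rule integral_rotation_derivative_eq_0[where G = "\<lambda>x. F x * (gK x \<bullet> (e i \<times> x))"])
    fix x :: "real^3" assume x: "x \<in> S2"
    have "((\<lambda>x. e i \<times> x) has_derivative (\<lambda>v. e i \<times> v)) (at x)"
      by (rule bounded_linear_imp_has_derivative[OF cr])
    from has_derivative_mult[OF F(1)[OF x] has_derivative_inner[OF gK(1)[OF x] this]]
    show "((\<lambda>x. F x * (gK x \<bullet> (e i \<times> x))) has_derivative D i x) (at x)"
      unfolding D_def by (simp add: algebra_simps)
  qed (use cD in \<open>auto simp: e_def\<close>)
  have "(\<integral>x. (\<Sum>i\<in>UNIV. D i x (e i \<times> x)) \<partial>\<sigma>) = 0"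
    using z by (subst Bochner_Integration.integral_sum) (auto intro: sphere_continuous_integrable cD)
  also have "(\<integral>x. (\<Sum>i\<in>UNIV. D i x (e i \<times> x)) \<partial>\<sigma>)
      = (\<integral>x. F x * lap x (gK x) (HK x) + (x \<times> gF x) \<bullet> (x \<times> gK x) \<partial>\<sigma>)"
  proof (rule Bochner_Integration.integral_cong[OF refl])
    fix x assume "x \<in> space \<sigma>"
    then have "x \<bullet> x = 1" by (simp add: dot_square_norm)
    then have x3: "x$1 * x$1 + x$2 * x$2 + x$3 * x$3 = 1" by (simp add: inner_vec_def sum_3)
    \<comment> \<open>Summed over the three axes, the squared rotation fields produce the trace
      minus the radial second derivative, and the vectors
      \<open>e i \<times> (e i \<times> x)\<close> add up to -2x, the first-order term of
      \<open>lap\<close>.\<close>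
    have q: "(\<Sum>i\<in>UNIV. (HK x *v (e i \<times> x)) \<bullet> (e i \<times> x)) = trace (HK x) * (x \<bullet> x) - x \<bullet> (HK x *v x)"
      unfolding e_def sum_3 cross_axis inner_vec_def trace_def by (simp add: matrix_vector_mult_def sum_3 vector_3) algebra
    have q2: "(\<Sum>i\<in>UNIV. gK x \<bullet> (e i \<times> (e i \<times> x))) = - 2 * (x \<bullet> gK x)"
      unfolding e_def sum_3 cross_axis inner_vec_def by (simp add: vector_3 cross3_def)
    have q3: "(\<Sum>i\<in>UNIV. (gF x \<bullet> (e i \<times> x)) * (gK x \<bullet> (e i \<times> x))) = (x \<times> gF x) \<bullet> (x \<times> gK x)"
      unfolding e_def sum_3 cross_axis inner_vec_def by (simp add: vector_3 cross3_def) algebra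
    have "(\<Sum>i\<in>UNIV. D i x (e i \<times> x)) = F x * ((\<Sum>i\<in>UNIV. (HK x *v (e i \<times> x)) \<bullet> (e i \<times> x))
        + (\<Sum>i\<in>UNIV. gK x \<bullet> (e i \<times> (e i \<times> x)))) + (\<Sum>i\<in>UNIV. (gF x \<bullet> (e i \<times> x)) * (gK x \<bullet> (e i \<times> x)))"
      unfolding D_def by (simp add: sum.distrib sum_distrib_left distrib_left)
    also have "\<dots> = F x * lap x (gK x) (HK x) + (x \<times> gF x) \<bullet> (x \<times> gK x)"
      unfolding q q2 q3 \<open>x \<bullet> x = 1\<close> lap_def by simp
    finally show "(\<Sum>i\<in>UNIV. D i x (e i \<times> x)) = F x * lap x (gK x) (HK x) + (x \<times> gF x) \<bullet> (x \<times> gK x)" .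
  qed
  finally show ?thesis .
qed

section \<open>Eigenfunctions of the Laplacian\<close>

lemma sphere_inner_self: "x \<in> S2 \<Longrightarrow> x \<bullet> x = 1"
  by (simp add: dot_square_norm)

lemma sphere_inner_bound: "x \<in> S2 \<Longrightarrow> y \<in> S2 \<Longrightarrow> \<bar>x \<bullet> y\<bar> \<le> 1"
  using Cauchy_Schwarz_ineq2[of x y] by simp

lemma continuous_poly_inner [continuous_intros]:
  fixes f g :: "'a::topological_space \<Rightarrow> real^3"
  shows "continuous_on S f \<Longrightarrow> continuous_on S g \<Longrightarrow> continuous_on S (\<lambda>x. poly p (f x \<bullet> g x))"
  by (intro continuous_intros)

section \<open>Zonal functions, eigenfunctions and Green's identity\<close>

definition outer :: "real^3 \<Rightarrow> real^3^3" where "outer e = (\<chi> i j. e$i * e$j)"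

lemma outer_mult: "(c *\<^sub>R outer e) *v v = (c * (e \<bullet> v)) *\<^sub>R e"
  by (simp add: outer_def vec_eq_iff matrix_vector_mult_def inner_vec_def sum_distrib_left sum_distrib_right algebra_simps)

lemma zonal_gradient:
  assumes "(k has_real_derivative k' (x \<bullet> e)) (at (x \<bullet> e))"
  shows "((\<lambda>x. k (x \<bullet> e)) has_derivative (\<lambda>v. (k' (x \<bullet> e) *\<^sub>R e) \<bullet> v)) (at x)"
proof -
  have "((\<lambda>x. x \<bullet> e) has_derivative (\<lambda>v. v \<bullet> e)) (at x)"
    by (auto intro!: derivative_eq_intros)
  from has_derivative_compose[OF this assms[unfolded has_field_derivative_def]]
  show ?thesis by (simp add: inner_commute algebra_simps)
qed

lemma zonal_hessian:
  fixes e :: "real^3"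
  assumes "(k' has_real_derivative k'' (x \<bullet> e)) (at (x \<bullet> e))"
  shows "((\<lambda>x. k' (x \<bullet> e) *\<^sub>R e) has_derivative (\<lambda>v. (k'' (x \<bullet> e) *\<^sub>R outer e) *v v)) (at x)"
proof -
  have "((\<lambda>x. x \<bullet> e) has_derivative (\<lambda>v. v \<bullet> e)) (at x)"
    by (auto intro!: derivative_eq_intros)
  from has_derivative_compose[OF this assms[unfolded has_field_derivative_def]]
  have "((\<lambda>x. k' (x \<bullet> e)) has_derivative (\<lambda>v. k'' (x \<bullet> e) * (v \<bullet> e))) (at x)" by simp
  from has_derivative_scaleR_left[OF this, of e] show ?thesis unfolding outer_mult by (simp add: inner_commute)
qed

lemma lap_zonal:
  assumes "x \<in> S2" "e \<in> S2"
  shows "lap x (c *\<^sub>R e) (d *\<^sub>R outer e) = (1 - (x \<bullet> e)\<^sup>2) * d - 2 * (x \<bullet> e) * c"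
proof -
  have "trace (d *\<^sub>R outer e) = d"
    using sphere_inner_self[OF assms(2)]
    by (simp add: trace_def outer_def inner_vec_def sum_distrib_left[symmetric])
  then show ?thesis unfolding lap_def outer_mult by (simp add: inner_commute power2_eq_square algebra_simps)
qed

text \<open>Gradient and Hessian are carried as explicit data of a function defined in space and
  differentiable at the points of the sphere. Polynomials in \<open>x \<bullet> e\<close>, zonal
  convolutions and radial extensions all fit this form.\<close>

definition C2_fun :: "(real^3 \<Rightarrow> real) \<Rightarrow> (real^3 \<Rightarrow> real^3) \<Rightarrow> (real^3 \<Rightarrow> real^3^3) \<Rightarrow> bool" where
  "C2_fun u g H \<longleftrightarrow> (\<forall>x\<in>S2. (u has_derivative (\<lambda>v. g x \<bullet> v)) (at x)) \<and>
     (\<forall>x\<in>S2. (g has_derivative (\<lambda>v. H x *v v)) (at x)) \<and> continuous_on S2 H"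

lemma C2_funD:
  assumes "C2_fun u g H"
  shows "\<And>x. x \<in> S2 \<Longrightarrow> (u has_derivative (\<lambda>v. g x \<bullet> v)) (at x)"
    "\<And>x. x \<in> S2 \<Longrightarrow> (g has_derivative (\<lambda>v. H x *v v)) (at x)"
    "continuous_on S2 H" "continuous_on S2 g" "continuous_on S2 u"
  using assms unfolding C2_fun_def
  by (auto intro!: continuous_at_imp_continuous_on dest: has_derivative_continuous)

definition sph_eigen :: "nat \<Rightarrow> (real^3 \<Rightarrow> real) \<Rightarrow> bool" where
  "sph_eigen s u \<longleftrightarrow> (\<exists>g H. C2_fun u g H \<and> (\<forall>x\<in>S2. lap x (g x) (H x) = - real (s * (s + 1)) * u x))"

lemma sph_eigen_continuous: "sph_eigen s u \<Longrightarrow> continuous_on S2 u"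
  unfolding sph_eigen_def using C2_funD(5) by blast

lemma C2_fun_zonal:
  fixes e :: "real^3"
  assumes e: "e \<in> S2"
    and k: "\<And>z. \<bar>z\<bar> \<le> 1 \<Longrightarrow> (k has_real_derivative k' z) (at z)"
    and k': "\<And>z. \<bar>z\<bar> \<le> 1 \<Longrightarrow> (k' has_real_derivative k'' z) (at z)"
    and k'': "continuous_on {-1..1} k''"
  shows "C2_fun (\<lambda>x. k (x \<bullet> e)) (\<lambda>x. k' (x \<bullet> e) *\<^sub>R e) (\<lambda>x. k'' (x \<bullet> e) *\<^sub>R outer e)"
  unfolding C2_fun_def
proof (intro conjI ballI)
  have "(\<lambda>x. x \<bullet> e) ` S2 \<subseteq> {-1..1}" using sphere_inner_bound[OF _ e] by (auto simp: abs_le_iff minus_le_iff)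
  then have "continuous_on S2 (\<lambda>x. k'' (x \<bullet> e))"
    by (intro continuous_on_compose2[OF k'']) (auto intro!: continuous_intros)
  then show "continuous_on S2 (\<lambda>x. k'' (x \<bullet> e) *\<^sub>R outer e)" by (intro continuous_intros)
qed (auto intro!: zonal_gradient zonal_hessian k k' sphere_inner_bound e simp del: mem_sphere_0)

text \<open>The Legendre operator: the Laplacian acting on functions
  \<open>p (x \<bullet> e)\<close>, expressed in the variable z =
  \<open>x \<bullet> e\<close>.\<close>

definition zlap :: "real poly \<Rightarrow> real poly" where
  "zlap p = [:1, 0, -1:] * pderiv (pderiv p) - [:0, 2:] * pderiv p"

lemma poly_zlap: "poly (zlap p) z = (1 - z\<^sup>2) * poly (pderiv (pderiv p)) z - 2 * z * poly (pderiv p) z"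
  by (simp add: zlap_def power2_eq_square algebra_simps)

lemma C2_fun_poly:
  assumes e: "e \<in> S2"
  shows "C2_fun (\<lambda>x. poly p (x \<bullet> e)) (\<lambda>x. poly (pderiv p) (x \<bullet> e) *\<^sub>R e) (\<lambda>x. poly (pderiv (pderiv p)) (x \<bullet> e) *\<^sub>R outer e)"
  by (intro C2_fun_zonal e poly_DERIV continuous_intros)

lemma integration_by_parts_C2:
  assumes "\<forall>x\<in>S2. (F has_derivative (\<lambda>v. gF x \<bullet> v)) (at x)" "continuous_on S2 gF" "C2_fun K gK HK"
  shows "(\<integral>x. F x * lap x (gK x) (HK x) + (x \<times> gF x) \<bullet> (x \<times> gK x) \<partial>\<sigma>) = 0"
  by (rule integration_by_parts_sphere) (use assms C2_funD[OF assms(3)] in auto)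

text \<open>Self-adjointness of the Laplacian against a zonal polynomial: integrating by parts in
  both orders produces the same gradient term \<open>Ga\<close>, which cancels.\<close>

lemma green_zonal:
  assumes u: "sph_eigen s u" and e: "e \<in> S2"
  shows "(\<integral>x. u x * poly (zlap p) (x \<bullet> e) \<partial>\<sigma>) = - real (s * (s + 1)) * (\<integral>x. u x * poly p (x \<bullet> e) \<partial>\<sigma>)"
proof -
  obtain g H where C: "C2_fun u g H" and eig: "\<And>x. x \<in> S2 \<Longrightarrow> lap x (g x) (H x) = - real (s * (s + 1)) * u x"
    using u unfolding sph_eigen_def by auto
  note P = C2_fun_poly[OF e, of p]
  define gP HP where "gP = (\<lambda>x. poly (pderiv p) (x \<bullet> e) *\<^sub>R e)" and "HP = (\<lambda>x. poly (pderiv (pderiv p)) (x \<bullet> e) *\<^sub>R outer e)"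
  define Ga where "Ga = (\<lambda>x. (x \<times> g x) \<bullet> (x \<times> gP x))"
  have c: "continuous_on S2 Ga" unfolding Ga_def gP_def
    by (intro continuous_intros continuous_on_cross C2_funD(4)[OF C])
  have uc: "continuous_on S2 u" by (rule C2_funD(5)[OF C])
  have "(\<integral>x. u x * poly (zlap p) (x \<bullet> e) + Ga x \<partial>\<sigma>) = (\<integral>x. u x * lap x (gP x) (HP x) + (x \<times> g x) \<bullet> (x \<times> gP x) \<partial>\<sigma>)"
    by (rule Bochner_Integration.integral_cong)
      (auto simp: lap_zonal[OF _ e] poly_zlap Ga_def gP_def HP_def simp del: mem_sphere_0)
  also have "\<dots> = 0" unfolding gP_def HP_def
    by (rule integration_by_parts_C2[OF _ C2_funD(4)[OF C] P]) (use C2_funD(1)[OF C] in auto)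
  finally have 1: "(\<integral>x. u x * poly (zlap p) (x \<bullet> e) + Ga x \<partial>\<sigma>) = 0" .
  have "(\<integral>x. - real (s * (s + 1)) * (u x * poly p (x \<bullet> e)) + Ga x \<partial>\<sigma>)
      = (\<integral>x. poly p (x \<bullet> e) * lap x (g x) (H x) + (x \<times> gP x) \<bullet> (x \<times> g x) \<partial>\<sigma>)"
    by (rule Bochner_Integration.integral_cong)
      (auto simp: eig Ga_def inner_commute[of "_ \<times> g _"] simp del: mem_sphere_0)
  also have "\<dots> = 0" unfolding gP_def
    by (rule integration_by_parts_C2[OF _ C2_funD(4)[OF P] C]) (use C2_funD(1)[OF P] in auto)
  finally have 2: "(\<integral>x. - real (s * (s + 1)) * (u x * poly p (x \<bullet> e)) + Ga x \<partial>\<sigma>) = 0" .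
  have i: "integrable \<sigma> Ga" "integrable \<sigma> (\<lambda>x. u x * poly (zlap p) (x \<bullet> e))" "integrable \<sigma> (\<lambda>x. u x * poly p (x \<bullet> e))"
    by (intro sphere_continuous_integrable c continuous_intros uc)+
  show ?thesis using 1 2 i by simp
qed

lemma zlap_legendre: "zlap (legendre l) = smult (- real (l * (l + 1))) (legendre l)"
proof (rule poly_eq_poly_eq_iff[THEN iffD1], rule ext)
  fix z show "poly (zlap (legendre l)) z = poly (smult (- real (l * (l + 1))) (legendre l)) z"
    using legendre_ode[of z l] by (simp only: poly_zlap poly_smult mult_minus_left eq_neg_iff_add_eq_0)
qed

text \<open>Both sides of Green's identity are multiples of the same integral, with factors l(l+1)
  and s(s+1), which differ because n(n+1) is strictly increasing.\<close>

lemma eigen_orthogonal_legendre: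
  assumes u: "sph_eigen s u" and e: "e \<in> S2" and l: "l \<noteq> s"
  shows "(\<integral>x. u x * poly (legendre l) (x \<bullet> e) \<partial>\<sigma>) = 0"
proof -
  define J where "J = (\<integral>x. u x * poly (legendre l) (x \<bullet> e) \<partial>\<sigma>)"
  have "(\<integral>x. u x * poly (zlap (legendre l)) (x \<bullet> e) \<partial>\<sigma>) = (\<integral>x. - real (l * (l + 1)) * (u x * poly (legendre l) (x \<bullet> e)) \<partial>\<sigma>)"
    by (rule Bochner_Integration.integral_cong) (auto simp: zlap_legendre)
  also have "\<dots> = - real (l * (l + 1)) * J" by (simp add: J_def)
  finally have "real (l * (l + 1)) * J = real (s * (s + 1)) * J"
    using green_zonal[OF u e, of "legendre l"]
    by (simp only: J_def[symmetric] mult_minus_left neg_equal_iff_equal)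
  moreover have "l * (l + 1) \<noteq> s * (s + 1)"
    using l mult_strict_mono[of l s "l + 1" "s + 1"] mult_strict_mono[of s l "s + 1" "l + 1"]
    by (cases l s rule: linorder_cases) auto
  ultimately have "J = 0" by (metis mult_cancel_right of_nat_eq_iff)
  then show ?thesis by (simp add: J_def)
qed

lemma sph_eigen_legendre:
  assumes e: "e \<in> S2"
  shows "sph_eigen l (\<lambda>x. poly (legendre l) (x \<bullet> e))"
  unfolding sph_eigen_def
proof (intro exI conjI ballI)
  show "C2_fun (\<lambda>x. poly (legendre l) (x \<bullet> e)) (\<lambda>x. poly (pderiv (legendre l)) (x \<bullet> e) *\<^sub>R e)
    (\<lambda>x. poly (pderiv (pderiv (legendre l))) (x \<bullet> e) *\<^sub>R outer e)"
    by (rule C2_fun_poly[OF e])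
  fix x assume x: "x \<in> S2"
  show "lap x (poly (pderiv (legendre l)) (x \<bullet> e) *\<^sub>R e) (poly (pderiv (pderiv (legendre l))) (x \<bullet> e) *\<^sub>R outer e)
    = - real (l * (l + 1)) * poly (legendre l) (x \<bullet> e)"
    using legendre_ode[of "x \<bullet> e" l] by (simp only: lap_zonal[OF x e] mult_minus_left eq_neg_iff_add_eq_0)
qed

lemma sph_eigen_const: "sph_eigen 0 (\<lambda>x. c)"
  unfolding sph_eigen_def C2_fun_def
  by (intro exI[of _ "\<lambda>_. 0"]) (auto simp: lap_def trace_def intro!: derivative_eq_intros)

section \<open>Zonal integrals and an approximate identity\<close>

definition zint :: "real^3 \<Rightarrow> real poly \<Rightarrow> real" where
  "zint e p = (\<integral>x. poly p (x \<bullet> e) \<partial>\<sigma>)"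

lemma integrable_poly_inner: "integrable \<sigma> (\<lambda>x. poly p (x \<bullet> e))"
  by (intro sphere_continuous_integrable continuous_intros)

lemma zint_add: "zint e (p + q) = zint e p + zint e q"
  and zint_diff: "zint e (p - q) = zint e p - zint e q"
  and zint_smult: "zint e (smult c p) = c * zint e p"
  unfolding zint_def poly_add poly_diff poly_smult by (simp_all add: integrable_poly_inner)

lemma zint_zlap: "e \<in> S2 \<Longrightarrow> zint e (zlap p) = 0"
  using green_zonal[OF sph_eigen_const[of 1], of e p] by (simp add: zint_def)

text \<open>Nonnegative on the sphere when evaluated at \<open>x \<bullet> e\<close>, equal to 1 at
  \<open>e\<close>, and concentrating there as \<open>D\<close> grows: a polynomial approximate
  identity, so that Legendre expansions stay finite.\<close>

definition bump :: "nat \<Rightarrow> real poly" where "bump D = [:1/2, 1/2:] ^ D"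

lemma poly_bump: "poly (bump D) z = ((1 + z) / 2) ^ D"
  by (simp add: bump_def field_simps)

text \<open>The Laplacian of a bump integrates to zero and is a combination of two consecutive
  bumps; this is a recursion for their masses.\<close>

lemma zint_bump: "e \<in> S2 \<Longrightarrow> zint e (bump D) = 4 * pi / (real D + 1)"
proof (induction D)
  case 0
  then show ?case by (simp add: zint_def bump_def measure_sphere_measure_space)
next
  case (Suc D)
  have d1: "pderiv (bump (Suc D)) = smult (real (Suc D) / 2) (bump D)"
    by (simp only: bump_def pderiv_power_Suc) (simp add: pderiv_pCons bump_def)
  have key: "zlap (bump (Suc D)) = smult ((real D + 1)\<^sup>2) (bump D) - smult ((real D + 1) * (real D + 2)) (bump (Suc D))"
  proof (cases D)
    case 0
    then show ?thesis unfolding zlap_def d1 by (simp add: bump_def)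
  next
    case (Suc E)
    have d2: "pderiv (bump D) = smult (real D / 2) (bump E)"
      unfolding Suc by (simp only: bump_def pderiv_power_Suc) (simp add: pderiv_pCons bump_def)
    show ?thesis
    proof (rule poly_eq_poly_eq_iff[THEN iffD1], rule ext)
      fix z :: real
      define w where "w = (1 + z) / 2"
      have z: "z = 2 * w - 1" by (simp add: w_def field_simps)
      have "poly (zlap (bump (Suc D))) z = (1 - z\<^sup>2) * (real (Suc D) / 2 * (real D / 2 * w ^ E)) - 2 * z * (real (Suc D) / 2 * w ^ D)"
        unfolding poly_zlap d1 pderiv_smult d2 poly_smult poly_bump w_def by simp
      also have "\<dots> = (real D + 1)\<^sup>2 * w ^ D - (real D + 1) * (real D + 2) * w ^ Suc D"
        unfolding z Suc by (simp add: power2_eq_square field_simps)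
      finally show "poly (zlap (bump (Suc D))) z = poly (smult ((real D + 1)\<^sup>2) (bump D) - smult ((real D + 1) * (real D + 2)) (bump (Suc D))) z"
        unfolding poly_diff poly_smult poly_bump w_def .
    qed
  qed
  have "(real D + 1)\<^sup>2 * zint e (bump D) = (real D + 1) * (real D + 2) * zint e (bump (Suc D))"
    using zint_zlap[OF Suc.prems, of "bump (Suc D)"] unfolding key zint_diff zint_smult by simp
  then have "(real D + 1) * ((real D + 1) * zint e (bump D)) = (real D + 1) * ((real D + 2) * zint e (bump (Suc D)))"
    by (simp add: power2_eq_square algebra_simps)
  then have "(real D + 1) * zint e (bump D) = (real D + 2) * zint e (bump (Suc D))"
    by (subst (asm) mult_cancel_left) auto
  then show ?case using Suc by (simp add: field_simps)
qed

text \<open>Close to \<open>e\<close> continuity of \<open>f\<close> suffices; elsewhere the bump is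
  at most t^D with t < 1, which beats the normalising factor D + 1.\<close>

lemma bump_approximate_identity:
  fixes f :: "real^3 \<Rightarrow> real"
  assumes f: "continuous_on S2 f" and e: "e \<in> S2"
  shows "(\<lambda>D. (real D + 1) / (4 * pi) * (\<integral>x. f x * poly (bump D) (x \<bullet> e) \<partial>\<sigma>)) \<longlonglongrightarrow> f e"
proof (rule LIMSEQ_I)
  fix r :: real assume r: "r > 0"
  obtain B where B: "\<And>x. x \<in> S2 \<Longrightarrow> \<bar>f x\<bar> \<le> B"
  proof -
    have "compact (f ` S2)" using f by (intro compact_continuous_image) auto
    then obtain B where "\<forall>y\<in>f ` S2. norm y \<le> B" using compact_imp_bounded bounded_iff by metis
    then show ?thesis by (intro that[of B]) auto
  qed
  have B0: "B \<ge> 0" using B[OF e] by linarith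
  obtain d where d: "d > 0" "\<And>x. x \<in> S2 \<Longrightarrow> dist x e < d \<Longrightarrow> dist (f x) (f e) < r / 2"
    using f e r unfolding continuous_on_iff by (metis half_gt_zero)
  define d' where "d' = min d 1"
  have d': "d' > 0" "d' \<le> 1" "d' \<le> d" using d by (auto simp: d'_def)
  \<comment> \<open>At distance at least d' from \<open>e\<close> one has
    \<open>x \<bullet> e\<close> <= 1 - d'^2/2, so the base of the bump is at most \<open>t\<close>.
    Capping d' at 1 keeps \<open>t\<close> nonnegative.\<close>
  define t where "t = 1 - d'\<^sup>2 / 4"
  have t: "0 \<le> t" "t < 1" using d' by (auto simp: t_def power_le_one intro: order_trans[of _ 1])
  have "(\<lambda>D. 2 * B * (real D * t ^ D + t ^ D)) \<longlonglongrightarrow> 2 * B * (0 + 0)"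
    using t by (intro tendsto_intros powser_times_n_limit_0 LIMSEQ_power_zero) auto
  then have "(\<lambda>D. 2 * B * (real D + 1) * t ^ D) \<longlonglongrightarrow> 0" by (simp add: algebra_simps)
  from LIMSEQ_D[OF this, of "r / 2"] r obtain N where N: "\<And>D. D \<ge> N \<Longrightarrow> 2 * B * (real D + 1) * t ^ D < r / 2"
    using t B0 by (auto simp: abs_mult)
  show "\<exists>no. \<forall>D\<ge>no. norm ((real D + 1) / (4 * pi) * (\<integral>x. f x * poly (bump D) (x \<bullet> e) \<partial>\<sigma>) - f e) < r"
  proof (intro exI allI impI)
    fix D assume D: "D \<ge> N"
    define c where "c = (real D + 1) / (4 * pi)"
    have c: "c > 0" by (simp add: c_def)
    have cz: "c * zint e (bump D) = 1" by (simp add: zint_bump[OF e] c_def)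
    have i1: "integrable \<sigma> (\<lambda>x. f x * poly (bump D) (x \<bullet> e))"
      by (intro sphere_continuous_integrable continuous_intros f)
    have i2: "integrable \<sigma> (\<lambda>x. r / 2 * poly (bump D) (x \<bullet> e) + 2 * B * t ^ D)"
      by (intro sphere_continuous_integrable continuous_intros f)
    have pw: "\<bar>(f x - f e) * poly (bump D) (x \<bullet> e)\<bar> \<le> r / 2 * poly (bump D) (x \<bullet> e) + 2 * B * t ^ D" if x: "x \<in> S2" for x
    proof -
      have z: "\<bar>x \<bullet> e\<bar> \<le> 1" by (rule sphere_inner_bound[OF x e])
      then have b0: "poly (bump D) (x \<bullet> e) \<ge> 0" by (auto simp: poly_bump)
      show ?thesis
      proof (cases "dist x e < d")
        case True
        then have "\<bar>f x - f e\<bar> \<le> r / 2" using d(2)[OF x True] by (simp add: dist_real_def)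
        then have "\<bar>(f x - f e) * poly (bump D) (x \<bullet> e)\<bar> \<le> r / 2 * poly (bump D) (x \<bullet> e)"
          unfolding abs_mult abs_of_nonneg[OF b0] using b0 by (rule mult_right_mono)
        moreover have "0 \<le> 2 * B * t ^ D" using B0 t by simp
        ultimately show ?thesis by linarith
      next
        case False
        then have "norm (x - e) \<ge> d'" using d' by (simp add: dist_norm)
        then have "d'\<^sup>2 \<le> (norm (x - e))\<^sup>2" using d' by (intro power_mono) auto
        also have "(norm (x - e))\<^sup>2 = 2 - 2 * (x \<bullet> e)"
          using sphere_inner_self[OF x] sphere_inner_self[OF e]
          by (simp add: power2_norm_eq_inner inner_diff_left inner_diff_right inner_commute)
        finally have "(1 + x \<bullet> e) / 2 \<le> t" by (simp add: t_def)
        then have "poly (bump D) (x \<bullet> e) \<le> t ^ D" using z unfolding poly_bump by (intro power_mono) auto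
        moreover have "\<bar>f x - f e\<bar> \<le> 2 * B" using B[OF x] B[OF e] by linarith
        ultimately have "\<bar>(f x - f e) * poly (bump D) (x \<bullet> e)\<bar> \<le> 2 * B * t ^ D"
          using b0 B0 by (auto simp: abs_mult intro!: mult_mono)
        moreover have "0 \<le> r / 2 * poly (bump D) (x \<bullet> e)" using b0 r by simp
        ultimately show ?thesis by linarith
      qed
    qed
    have "c * (\<integral>x. f x * poly (bump D) (x \<bullet> e) \<partial>\<sigma>) - f e = c * ((\<integral>x. f x * poly (bump D) (x \<bullet> e) \<partial>\<sigma>) - f e * zint e (bump D))"
      using cz by (simp add: right_diff_distrib algebra_simps)
    also have "(\<integral>x. f x * poly (bump D) (x \<bullet> e) \<partial>\<sigma>) - f e * zint e (bump D) = (\<integral>x. (f x - f e) * poly (bump D) (x \<bullet> e) \<partial>\<sigma>)"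
      using i1 integrable_poly_inner[of "bump D" e] by (simp add: zint_def algebra_simps)
    finally have "norm (c * (\<integral>x. f x * poly (bump D) (x \<bullet> e) \<partial>\<sigma>) - f e) = c * \<bar>\<integral>x. (f x - f e) * poly (bump D) (x \<bullet> e) \<partial>\<sigma>\<bar>"
      using c by (simp add: abs_mult)
    also have "\<bar>\<integral>x. (f x - f e) * poly (bump D) (x \<bullet> e) \<partial>\<sigma>\<bar> \<le> (\<integral>x. \<bar>(f x - f e) * poly (bump D) (x \<bullet> e)\<bar> \<partial>\<sigma>)"
      by (rule integral_abs_bound)
    also have "\<dots> \<le> (\<integral>x. r / 2 * poly (bump D) (x \<bullet> e) + 2 * B * t ^ D \<partial>\<sigma>)"
      by (intro integral_mono i2 sphere_continuous_integrable continuous_intros f) (use pw in auto)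
    also have "\<dots> = r / 2 * zint e (bump D) + 4 * pi * (2 * B * t ^ D)"
      using integrable_poly_inner[of "bump D" e] by (simp add: zint_def measure_sphere_measure_space)
    finally have "norm (c * (\<integral>x. f x * poly (bump D) (x \<bullet> e) \<partial>\<sigma>) - f e) \<le> r / 2 * (c * zint e (bump D)) + c * (4 * pi * (2 * B * t ^ D))"
      using c by (simp add: distrib_left mult_ac)
    also have "\<dots> = r / 2 + 2 * B * (real D + 1) * t ^ D" unfolding cz by (simp add: c_def)
    also have "\<dots> < r" using N[OF D] by simp
    finally show "norm ((real D + 1) / (4 * pi) * (\<integral>x. f x * poly (bump D) (x \<bullet> e) \<partial>\<sigma>) - f e) < r" unfolding c_def .
  qed
qed

section \<open>Norms of Legendre polynomials and the reproducing formula\<close>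

lemma zint_legendre_orthogonal:
  assumes e: "e \<in> S2" and "l \<noteq> m"
  shows "zint e (legendre l * legendre m) = 0"
  using eigen_orthogonal_legendre[OF sph_eigen_legendre[OF e, of l] e, of m] assms(2) by (simp add: zint_def)

text \<open>The integral of z P_n P_(n+1) is computed twice, expanding z P_n or z P_(n+1) by the
  recursion; orthogonality leaves one term each time, which links the norms of consecutive
  polynomials.\<close>

lemma zint_legendre_sq:
  assumes e: "e \<in> S2"
  shows "zint e (legendre l * legendre l) = 4 * pi / (2 * real l + 1)"
proof -
  have base: "zint e (legendre 0 * legendre 0) = 4 * pi"
    by (simp add: zint_def measure_sphere_measure_space)
  have rec: "[:0, 1:] * legendre (Suc n) = smult ((real n + 2) / (2 * real n + 3)) (legendre (Suc (Suc n))) + smult ((real n + 1) / (2 * real n + 3)) (legendre n)" for n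
  proof (rule poly_eq_poly_eq_iff[THEN iffD1], rule ext)
    fix z
    have "(2 * real n + 3) * (z * poly (legendre (Suc n)) z) = (real n + 2) * poly (legendre (Suc (Suc n))) z + (real n + 1) * poly (legendre n) z"
      using legendre_Suc_Suc[of n z] by (simp del: legendre.simps)
    then have "z * poly (legendre (Suc n)) z = ((real n + 2) * poly (legendre (Suc (Suc n))) z + (real n + 1) * poly (legendre n) z) / (2 * real n + 3)"
      by (metis add_nonneg_pos less_irrefl mult_nonneg_nonneg nonzero_mult_div_cancel_left of_nat_0_le_iff zero_le_numeral zero_less_numeral)
    then show "poly ([:0, 1:] * legendre (Suc n)) z = poly (smult ((real n + 2) / (2 * real n + 3)) (legendre (Suc (Suc n))) + smult ((real n + 1) / (2 * real n + 3)) (legendre n)) z"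
      by (simp add: add_divide_distrib distrib_right del: legendre.simps)
  qed
  have rec0: "[:0, 1:] * legendre 0 = legendre 1" by simp
  have step: "(2 * real n + 3) * zint e (legendre (Suc n) * legendre (Suc n)) = (2 * real n + 1) * zint e (legendre n * legendre n)" for n
  proof (cases n)
    case 0
    have "zint e (([:0, 1:] * legendre 1) * legendre 0) = zint e (legendre 1 * ([:0, 1:] * legendre 0))"
      by (simp add: mult_ac)
    then have "zint e (([:0, 1:] * legendre 1) * legendre 0) = zint e (legendre 1 * legendre 1)" unfolding rec0 .
    moreover have "zint e (([:0, 1:] * legendre 1) * legendre 0) = 1 / 3 * zint e (legendre 0 * legendre 0)"
      using rec[of 0] zint_legendre_orthogonal[OF e, of 2 0]
      unfolding One_nat_def by (simp add: distrib_right zint_add zint_smult numeral_2_eq_2 del: legendre.simps mult_pCons_left)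
    ultimately show ?thesis using 0 by simp
  next
    case (Suc m)
    have a: "zint e (([:0, 1:] * legendre (Suc n)) * legendre n) = (real n + 1) / (2 * real n + 3) * zint e (legendre n * legendre n)"
      unfolding rec distrib_right zint_add mult_smult_left zint_smult using zint_legendre_orthogonal[OF e, of "Suc (Suc n)" n] by simp
    have "zint e (([:0, 1:] * legendre n) * legendre (Suc n)) = (real m + 2) / (2 * real m + 3) * zint e (legendre (Suc n) * legendre (Suc n))"
      unfolding Suc rec distrib_right zint_add mult_smult_left zint_smult using zint_legendre_orthogonal[OF e, of m "Suc (Suc m)"] by simp
    also have "([:0, 1:] * legendre n) * legendre (Suc n) = ([:0, 1:] * legendre (Suc n)) * legendre n"
      by (simp only: mult_ac)
    finally have "(real n + 1) / (2 * real n + 3) * zint e (legendre n * legendre n) = (real n + 1) / (2 * real n + 1) * zint e (legendre (Suc n) * legendre (Suc n))"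
      unfolding a by (simp add: Suc algebra_simps)
    then have "(real n + 1) * (zint e (legendre n * legendre n) / (2 * real n + 3)) = (real n + 1) * (zint e (legendre (Suc n) * legendre (Suc n)) / (2 * real n + 1))"
      by simp
    then have "zint e (legendre n * legendre n) / (2 * real n + 3) = zint e (legendre (Suc n) * legendre (Suc n)) / (2 * real n + 1)"
      by (subst (asm) mult_cancel_left) auto
    then show ?thesis by (simp add: field_simps)
  qed
  show ?thesis
  proof (induction l)
    case 0
    then show ?case using base by simp
  next
    case (Suc l)
    then show ?case using step[of l] by (simp add: field_simps del: legendre.simps)
  qed
qed

text \<open>The functionals p -> integral of u p and p -> integral of P_s p, both zonal about
  \<open>e\<close>, vanish on every P_l with l different from s, hence are proportional on all
  polynomials. The approximate identity turns this into values at \<open>e\<close>, where P_s is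
  1.\<close>

lemma eigen_reproducing:
  assumes u: "sph_eigen s u" and e: "e \<in> S2"
  shows "u e = (2 * real s + 1) / (4 * pi) * (\<integral>x. u x * poly (legendre s) (x \<bullet> e) \<partial>\<sigma>)"
proof -
  define J where "J = (\<lambda>p. \<integral>x. u x * poly p (x \<bullet> e) \<partial>\<sigma>)"
  define Z where "Z = (\<lambda>p. \<integral>x. poly (legendre s) (x \<bullet> e) * poly p (x \<bullet> e) \<partial>\<sigma>)"
  have uc: "continuous_on S2 u" by (rule sph_eigen_continuous[OF u])
  have iu: "integrable \<sigma> (\<lambda>x. u x * poly p (x \<bullet> e))" for p
    by (intro sphere_continuous_integrable continuous_intros uc)
  have iz: "integrable \<sigma> (\<lambda>x. poly (legendre s) (x \<bullet> e) * poly p (x \<bullet> e))" for p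
    by (intro sphere_continuous_integrable continuous_intros)
  define n where "n = 4 * pi / (2 * real s + 1)"
  have ident: "n * J p = Z p * J (legendre s)" for p
  proof (induction p rule: legendre_span_induct)
    case 1
    then show ?case by (simp add: J_def Z_def)
  next
    case (2 p q)
    have "J (p + q) = J p + J q" "Z (p + q) = Z p + Z q"
      unfolding J_def Z_def poly_add distrib_left using iu iz by simp_all
    then show ?case using 2 by (simp add: algebra_simps)
  next
    case (3 c p)
    have "J (smult c p) = c * J p" "Z (smult c p) = c * Z p"
      unfolding J_def Z_def poly_smult by (simp_all add: mult.left_commute)
    then show ?case using 3 by simp
  next
    case (4 l)
    show ?case
    proof (cases "l = s")
      case True
      then have "Z (legendre l) = n" using zint_legendre_sq[OF e, of s] by (simp add: Z_def n_def zint_def)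
      then show ?thesis using True by simp
    next
      case False
      have "J (legendre l) = 0" unfolding J_def by (rule eigen_orthogonal_legendre[OF u e False])
      moreover have "Z (legendre l) = 0" unfolding Z_def
        by (rule eigen_orthogonal_legendre[OF sph_eigen_legendre[OF e] e False])
      ultimately show ?thesis by simp
    qed
  qed
  have l1: "(\<lambda>D. (real D + 1) / (4 * pi) * J (bump D)) \<longlonglongrightarrow> u e"
    unfolding J_def by (rule bump_approximate_identity[OF uc e])
  have "(\<lambda>D. (real D + 1) / (4 * pi) * Z (bump D)) \<longlonglongrightarrow> poly (legendre s) (e \<bullet> e)"
    unfolding Z_def by (rule bump_approximate_identity[OF _ e]) (intro continuous_intros)
  then have l2: "(\<lambda>D. (real D + 1) / (4 * pi) * Z (bump D)) \<longlonglongrightarrow> 1"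
    using sphere_inner_self[OF e] by simp
  have "(\<lambda>D. n * ((real D + 1) / (4 * pi) * J (bump D))) \<longlonglongrightarrow> n * u e"
    by (intro tendsto_intros l1)
  moreover have "(\<lambda>D. n * ((real D + 1) / (4 * pi) * J (bump D))) = (\<lambda>D. ((real D + 1) / (4 * pi) * Z (bump D)) * J (legendre s))"
    using ident[of "bump _"] by (auto simp: fun_eq_iff)
  moreover have "(\<lambda>D. ((real D + 1) / (4 * pi) * Z (bump D)) * J (legendre s)) \<longlonglongrightarrow> 1 * J (legendre s)"
    by (intro tendsto_intros l2)
  ultimately have "n * u e = 1 * J (legendre s)" using LIMSEQ_unique by metis
  then show ?thesis unfolding n_def J_def by (simp add: field_simps)
qed

section \<open>The spectral projection\<close>

text \<open>This class contains the continuous functions and the indicators of Borel sets, is closed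
  under products and rotations, and consists of integrable functions because the sphere has finite
  measure; integrability thus becomes a structural check.\<close>

definition bfun :: "(real^3 \<Rightarrow> real) \<Rightarrow> bool" where
  "bfun f \<longleftrightarrow> f \<in> borel_measurable \<sigma> \<and> (\<exists>B. \<forall>x\<in>S2. \<bar>f x\<bar> \<le> B)"

lemma bfun_measurable: "bfun f \<Longrightarrow> f \<in> borel_measurable \<sigma>"
  by (simp add: bfun_def)

lemma bfun_integrable: "bfun f \<Longrightarrow> integrable \<sigma> f"
  unfolding bfun_def using sphere_bounded_integrable by blast

lemma bfun_mult: "bfun f \<Longrightarrow> bfun g \<Longrightarrow> bfun (\<lambda>x. f x * g x)"
  unfolding bfun_def
proof (elim conjE exE, intro conjI)
  fix A B assume "\<forall>x\<in>S2. \<bar>f x\<bar> \<le> A" "\<forall>x\<in>S2. \<bar>g x\<bar> \<le> B"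
  then have "\<forall>x\<in>S2. \<bar>f x * g x\<bar> \<le> \<bar>A\<bar> * \<bar>B\<bar>"
    by (force simp: abs_mult intro!: mult_mono)
  then show "\<exists>B. \<forall>x\<in>S2. \<bar>f x * g x\<bar> \<le> B" by blast
qed auto

lemma bfun_add: "bfun f \<Longrightarrow> bfun g \<Longrightarrow> bfun (\<lambda>x. f x + g x)"
  unfolding bfun_def
proof (elim conjE exE, intro conjI)
  fix A B assume "\<forall>x\<in>S2. \<bar>f x\<bar> \<le> A" "\<forall>x\<in>S2. \<bar>g x\<bar> \<le> B"
  then have "\<forall>x\<in>S2. \<bar>f x + g x\<bar> \<le> A + B" by force
  then show "\<exists>B. \<forall>x\<in>S2. \<bar>f x + g x\<bar> \<le> B" by blast
qed auto

lemma bfun_continuous: "continuous_on S2 f \<Longrightarrow> bfun f"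
proof -
  assume f: "continuous_on S2 f"
  then have "compact (f ` S2)" by (intro compact_continuous_image) auto
  then obtain B where "\<forall>y\<in>f ` S2. norm y \<le> B" using compact_imp_bounded bounded_iff by metis
  then show ?thesis unfolding bfun_def
    using continuous_on_imp_borel_measurable_sphere_measure[OF f] by (auto intro!: exI[of _ B])
qed

lemma bfun_const: "bfun (\<lambda>x. c)"
  by (intro bfun_continuous continuous_intros)

lemma bfun_cmult: "bfun f \<Longrightarrow> bfun (\<lambda>x. c * f x)"
  by (intro bfun_mult bfun_const)

lemma bfun_diff: "bfun f \<Longrightarrow> bfun g \<Longrightarrow> bfun (\<lambda>x. f x - g x)"
  using bfun_add[of f "\<lambda>x. -1 * g x"] bfun_cmult[of g "-1"] by simp

lemma bfun_nth: "bfun f \<Longrightarrow> bfun (\<lambda>y. y$i * f y)"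
  by (rule bfun_mult[OF bfun_continuous]) (auto intro!: continuous_intros)

lemma bfun_poly: "bfun (\<lambda>y. poly p (x \<bullet> y))"
  by (intro bfun_continuous continuous_intros)

lemma bfun_orthogonal:
  assumes "orthogonal_transformation A" "bfun f"
  shows "bfun (\<lambda>x. f (A x))"
proof -
  obtain B where "\<forall>x\<in>S2. \<bar>f x\<bar> \<le> B" using assms(2) unfolding bfun_def by blast
  moreover have "A x \<in> S2" if "x \<in> S2" for x using that orthogonal_transformation_norm[OF assms(1)] by simp
  ultimately show ?thesis
    using assms measurable_compose[OF orthogonal_measurable_sphere[OF assms(1)], of f borel]
    unfolding bfun_def by blast
qed

section \<open>Convolution with zonal polynomials\<close>

definition zonal_conv :: "real poly \<Rightarrow> (real^3 \<Rightarrow> real) \<Rightarrow> real^3 \<Rightarrow> real" where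
  "zonal_conv p f x = (\<integral>y. poly p (x \<bullet> y) * f y \<partial>\<sigma>)"

lemma integrable_zonal_conv: "bfun f \<Longrightarrow> integrable \<sigma> (\<lambda>y. poly p (x \<bullet> y) * f y)"
  by (intro bfun_integrable bfun_mult bfun_poly)

text \<open>Horner's rule under the integral: one factor \<open>x \<bullet> y\<close> is expanded in
  coordinates, and each coordinate of y is moved into the function.\<close>

lemma zonal_conv_pCons:
  assumes f: "bfun f"
  shows "zonal_conv (pCons a q) f x = a * (\<integral>y. f y \<partial>\<sigma>) + (\<Sum>i\<in>UNIV. x$i * zonal_conv q (\<lambda>y. y$i * f y) x)"
proof -
  have "zonal_conv (pCons a q) f x = (\<integral>y. a * f y + (\<Sum>i\<in>UNIV. x$i * (poly q (x \<bullet> y) * (y$i * f y))) \<partial>\<sigma>)"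
    unfolding zonal_conv_def
  proof (rule Bochner_Integration.integral_cong[OF refl])
    fix y
    have "(x \<bullet> y) * (c * f y) = (\<Sum>i\<in>UNIV. x$i * (c * (y$i * f y)))" for c
      by (simp add: inner_vec_def sum_distrib_right sum_distrib_left mult_ac)
    from this[of "poly q (x \<bullet> y)"]
    show "poly (pCons a q) (x \<bullet> y) * f y = a * f y + (\<Sum>i\<in>UNIV. x$i * (poly q (x \<bullet> y) * (y$i * f y)))"
      by (simp add: distrib_right mult.assoc)
  qed
  also have "\<dots> = a * (\<integral>y. f y \<partial>\<sigma>) + (\<Sum>i\<in>UNIV. x$i * zonal_conv q (\<lambda>y. y$i * f y) x)"
    using bfun_integrable[OF f] integrable_zonal_conv[OF bfun_nth[OF f]]
    by (simp add: zonal_conv_def)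
  finally show ?thesis .
qed

lemma zonal_conv_add: "bfun f \<Longrightarrow> zonal_conv (p + q) f x = zonal_conv p f x + zonal_conv q f x"
  unfolding zonal_conv_def poly_add distrib_right by (simp add: integrable_zonal_conv)

lemma zonal_conv_diff: "bfun f \<Longrightarrow> zonal_conv (p - q) f x = zonal_conv p f x - zonal_conv q f x"
  unfolding zonal_conv_def poly_diff left_diff_distrib by (simp add: integrable_zonal_conv)

lemma zonal_conv_smult: "zonal_conv (smult c p) f x = c * zonal_conv p f x"
  unfolding zonal_conv_def poly_smult by (simp add: mult.assoc)

text \<open>The convolution is a polynomial in x whose coefficients are moments of \<open>f\<close>.
  Induction along Horner's rule therefore replaces differentiation under the integral;
  \<open>f\<close> varies because it picks up coordinate factors.\<close>

lemma zonal_conv_has_derivative: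
  assumes "bfun f"
  shows "(zonal_conv p f has_derivative (\<lambda>v. \<Sum>i\<in>UNIV. v$i * zonal_conv (pderiv p) (\<lambda>y. y$i * f y) x)) (at x)"
  using assms
proof (induction p arbitrary: f)
  case 0
  then show ?case by (simp add: zonal_conv_def[abs_def])
next
  case (pCons a q)
  have d: "((\<lambda>x. x$i) has_derivative (\<lambda>v. v$i)) (at x)" for i
    by (rule bounded_linear_imp_has_derivative[OF bounded_linear_vec_nth])
  have "((\<lambda>x. a * (\<integral>y. f y \<partial>\<sigma>) + (\<Sum>i\<in>UNIV. x$i * zonal_conv q (\<lambda>y. y$i * f y) x)) has_derivative
      (\<lambda>v. 0 + (\<Sum>i\<in>UNIV. x$i * (\<Sum>j\<in>UNIV. v$j * zonal_conv (pderiv q) (\<lambda>y. y$j * (y$i * f y)) x)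
          + v$i * zonal_conv q (\<lambda>y. y$i * f y) x))) (at x)"
    by (intro has_derivative_add has_derivative_const has_derivative_sum has_derivative_mult d pCons.IH bfun_nth pCons.prems)
  also have "(\<lambda>x. a * (\<integral>y. f y \<partial>\<sigma>) + (\<Sum>i\<in>UNIV. x$i * zonal_conv q (\<lambda>y. y$i * f y) x)) = zonal_conv (pCons a q) f"
    using zonal_conv_pCons[OF pCons.prems] by (simp add: fun_eq_iff)
  also have "(\<lambda>v. 0 + (\<Sum>i\<in>UNIV. x$i * (\<Sum>j\<in>UNIV. v$j * zonal_conv (pderiv q) (\<lambda>y. y$j * (y$i * f y)) x)
          + v$i * zonal_conv q (\<lambda>y. y$i * f y) x)) = (\<lambda>v. \<Sum>i\<in>UNIV. v$i * zonal_conv (pderiv (pCons a q)) (\<lambda>y. y$i * f y) x)"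
  proof
    fix v :: "real^3"
    have z: "zonal_conv (pderiv (pCons a q)) (\<lambda>y. y$j * f y) x = zonal_conv q (\<lambda>y. y$j * f y) x
        + (\<Sum>i\<in>UNIV. x$i * zonal_conv (pderiv q) (\<lambda>y. y$i * (y$j * f y)) x)" for j
      unfolding pderiv_pCons by (simp add: zonal_conv_add bfun_nth pCons.prems zonal_conv_pCons)
    have "(\<Sum>i\<in>UNIV. x$i * (\<Sum>j\<in>UNIV. v$j * zonal_conv (pderiv q) (\<lambda>y. y$j * (y$i * f y)) x))
       = (\<Sum>j\<in>UNIV. v$j * (\<Sum>i\<in>UNIV. x$i * zonal_conv (pderiv q) (\<lambda>y. y$i * (y$j * f y)) x))"
      by (simp only: sum_distrib_left mult.left_commute, subst sum.swap, simp add: mult_ac)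
    then show "0 + (\<Sum>i\<in>UNIV. x$i * (\<Sum>j\<in>UNIV. v$j * zonal_conv (pderiv q) (\<lambda>y. y$j * (y$i * f y)) x)
          + v$i * zonal_conv q (\<lambda>y. y$i * f y) x) = (\<Sum>i\<in>UNIV. v$i * zonal_conv (pderiv (pCons a q)) (\<lambda>y. y$i * f y) x)"
      unfolding z by (simp add: sum.distrib distrib_left)
  qed
  finally show ?case .
qed

lemma zonal_conv_continuous: "bfun f \<Longrightarrow> continuous_on S (zonal_conv p f)"
  by (meson continuous_at_imp_continuous_on zonal_conv_has_derivative has_derivative_continuous)

definition Pi_proj :: "nat \<Rightarrow> (real^3 \<Rightarrow> real) \<Rightarrow> real^3 \<Rightarrow> real" where
  "Pi_proj s f x = (2 * real s + 1) / (4 * pi) * zonal_conv (legendre s) f x"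

lemma Pi_proj_continuous: "bfun f \<Longrightarrow> continuous_on S (Pi_proj s f)"
  unfolding Pi_proj_def[abs_def] by (intro continuous_intros zonal_conv_continuous)

lemma bfun_Pi_proj: "bfun f \<Longrightarrow> bfun (Pi_proj s f)"
  by (rule bfun_continuous[OF Pi_proj_continuous])

text \<open>Horner's rule read backwards turns the radial terms of \<open>lap\<close> into
  convolutions, the trace simplifies since y is a unit vector, and together they form the
  convolution with \<open>zlap\<close> of the Legendre polynomial. Symmetry of the Hessian is
  recorded for Rellich's identity.\<close>

lemma Pi_proj_C2_eigen:
  assumes f: "bfun f"
  obtains g H where "C2_fun (Pi_proj s f) g H" "\<And>x. transpose (H x) = H x"
    "\<And>x. x \<in> S2 \<Longrightarrow> lap x (g x) (H x) = - real (s * (s + 1)) * Pi_proj s f x"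
proof -
  define c where "c = (2 * real s + 1) / (4 * pi)"
  define P where "P = legendre s"
  define g :: "real^3 \<Rightarrow> real^3" where "g = (\<lambda>x. \<chi> i. c * zonal_conv (pderiv P) (\<lambda>y. y$i * f y) x)"
  define H :: "real^3 \<Rightarrow> real^3^3" where "H = (\<lambda>x. \<chi> i j. c * zonal_conv (pderiv (pderiv P)) (\<lambda>y. y$j * (y$i * f y)) x)"
  have u: "Pi_proj s f = (\<lambda>x. c * zonal_conv P f x)"
    by (simp add: Pi_proj_def fun_eq_iff c_def P_def)
  have C: "C2_fun (Pi_proj s f) g H"
    unfolding C2_fun_def
  proof (intro conjI ballI)
    fix x :: "real^3"
    have "((\<lambda>x. c * zonal_conv P f x) has_derivative (\<lambda>v. c * (\<Sum>i\<in>UNIV. v$i * zonal_conv (pderiv P) (\<lambda>y. y$i * f y) x))) (at x)"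
      by (intro has_derivative_mult_right zonal_conv_has_derivative f)
    then show "(Pi_proj s f has_derivative (\<lambda>v. g x \<bullet> v)) (at x)"
      unfolding u by (simp add: g_def inner_vec_def sum_distrib_left mult_ac)
    show "(g has_derivative (\<lambda>v. H x *v v)) (at x)"
    proof (subst has_derivative_componentwise_within, intro ballI)
      fix b :: "real^3" assume "b \<in> Basis"
      then obtain i where b: "b = axis i 1" by (auto simp: Basis_vec_def)
      have "((\<lambda>x. c * zonal_conv (pderiv P) (\<lambda>y. y$i * f y) x) has_derivative
          (\<lambda>v. c * (\<Sum>j\<in>UNIV. v$j * zonal_conv (pderiv (pderiv P)) (\<lambda>y. y$j * (y$i * f y)) x))) (at x)"
        by (intro has_derivative_mult_right zonal_conv_has_derivative bfun_nth f)
      then show "((\<lambda>x. g x \<bullet> b) has_derivative (\<lambda>v. (H x *v v) \<bullet> b)) (at x)"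
        unfolding b by (simp add: inner_axis g_def H_def matrix_vector_mult_def sum_distrib_left mult_ac)
    qed
    show "continuous_on S2 H"
      unfolding H_def by (intro continuous_intros zonal_conv_continuous bfun_nth f)
  qed
  have sym: "transpose (H x) = H x" for x
    by (simp add: transpose_def H_def vec_eq_iff mult.left_commute)
  have L: "lap x (g x) (H x) = - real (s * (s + 1)) * Pi_proj s f x" if x: "x \<in> S2" for x
  proof -
    have "trace (H x) = c * (\<Sum>i\<in>UNIV. zonal_conv (pderiv (pderiv P)) (\<lambda>y. y$i * (y$i * f y)) x)"
      by (simp add: trace_def H_def sum_distrib_left)
    also have "(\<Sum>i\<in>UNIV. zonal_conv (pderiv (pderiv P)) (\<lambda>y. y$i * (y$i * f y)) x)
       = (\<integral>y. (\<Sum>i\<in>UNIV. poly (pderiv (pderiv P)) (x \<bullet> y) * (y$i * (y$i * f y))) \<partial>\<sigma>)"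
      unfolding zonal_conv_def by (subst Bochner_Integration.integral_sum) (auto intro!: integrable_zonal_conv[OF bfun_nth[OF bfun_nth[OF f]]])
    also have "\<dots> = zonal_conv (pderiv (pderiv P)) f x"
      unfolding zonal_conv_def
    proof (rule Bochner_Integration.integral_cong[OF refl])
      fix y assume "y \<in> space \<sigma>"
      then have "(\<Sum>i\<in>UNIV. y$i * y$i) = 1" using sphere_inner_self[of y] by (simp add: inner_vec_def)
      then have "(\<Sum>i\<in>UNIV. y$i * (y$i * f y)) = f y" by (simp flip: mult.assoc sum_distrib_right)
      then show "(\<Sum>i\<in>UNIV. poly (pderiv (pderiv P)) (x \<bullet> y) * (y$i * (y$i * f y))) = poly (pderiv (pderiv P)) (x \<bullet> y) * f y"
        by (simp flip: sum_distrib_left)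
    qed
    finally have 1: "trace (H x) = c * zonal_conv (pderiv (pderiv P)) f x" .
    have mulx: "(\<Sum>i\<in>UNIV. x$i * zonal_conv q (\<lambda>y. y$i * h y) x) = zonal_conv (pCons 0 q) h x" if "bfun h" for q h
      using zonal_conv_pCons[OF that, of 0 q x] by simp
    have 2: "x \<bullet> g x = c * zonal_conv (pCons 0 (pderiv P)) f x"
      unfolding mulx[OF f, symmetric] by (simp add: g_def inner_vec_def sum_distrib_left mult_ac)
    have "x \<bullet> (H x *v x) = (\<Sum>i\<in>UNIV. x$i * (c * (\<Sum>j\<in>UNIV. x$j * zonal_conv (pderiv (pderiv P)) (\<lambda>y. y$j * (y$i * f y)) x)))"
      by (simp add: H_def inner_vec_def matrix_vector_mult_def sum_distrib_left mult_ac)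
    also have "\<dots> = (\<Sum>i\<in>UNIV. x$i * (c * zonal_conv (pCons 0 (pderiv (pderiv P))) (\<lambda>y. y$i * f y) x))"
      using mulx[OF bfun_nth[OF f]] by simp
    also have "\<dots> = c * zonal_conv (pCons 0 (pCons 0 (pderiv (pderiv P)))) f x"
      unfolding mulx[OF f, symmetric] by (simp add: sum_distrib_left mult_ac)
    finally have 3: "x \<bullet> (H x *v x) = c * zonal_conv (pCons 0 (pCons 0 (pderiv (pderiv P)))) f x" .
    have "zlap P = pderiv (pderiv P) - pCons 0 (pCons 0 (pderiv (pderiv P))) - smult 2 (pCons 0 (pderiv P))"
      by (rule poly_eq_poly_eq_iff[THEN iffD1], rule ext) (simp add: poly_zlap power2_eq_square algebra_simps)
    then have "zonal_conv (zlap P) f x = zonal_conv (pderiv (pderiv P)) f x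
        - zonal_conv (pCons 0 (pCons 0 (pderiv (pderiv P)))) f x - 2 * zonal_conv (pCons 0 (pderiv P)) f x"
      by (simp only: zonal_conv_diff[OF f] zonal_conv_smult)
    then have "lap x (g x) (H x) = c * zonal_conv (zlap P) f x"
      unfolding lap_def 1 2 3 by (simp only: right_diff_distrib mult.left_commute)
    then show ?thesis unfolding P_def zlap_legendre zonal_conv_smult by (simp add: u P_def)
  qed
  show thesis using that C sym L by blast
qed

lemma sph_eigen_Pi_proj: "bfun f \<Longrightarrow> sph_eigen s (Pi_proj s f)"
  unfolding sph_eigen_def using Pi_proj_C2_eigen by metis

lemma Pi_proj_eigen: "sph_eigen s u \<Longrightarrow> x \<in> S2 \<Longrightarrow> Pi_proj s u x = u x"
  using eigen_reproducing[of s u x] by (simp add: Pi_proj_def zonal_conv_def inner_commute mult.commute)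

lemma Pi_proj_idem: "bfun f \<Longrightarrow> x \<in> S2 \<Longrightarrow> Pi_proj s (Pi_proj s f) x = Pi_proj s f x"
  by (intro Pi_proj_eigen sph_eigen_Pi_proj)

section \<open>The projection as an orthogonal projection commuting with rotations\<close>

lemma measurable_ident_sphere: "(\<lambda>x. x) \<in> \<sigma> \<rightarrow>\<^sub>M borel"
  by (rule borel_measurable_sphere_measure) simp

lemma measurable_poly_inner_pair [measurable]:
  "(\<lambda>(x, y). poly p (x \<bullet> y)) \<in> borel_measurable (\<sigma> \<Otimes>\<^sub>M \<sigma>)"
proof -
  have [measurable]: "poly p \<in> borel_measurable borel"
    by (intro borel_measurable_continuous_onI continuous_intros)
  have [measurable]: "(\<lambda>x. fst x) \<in> \<sigma> \<Otimes>\<^sub>M \<sigma> \<rightarrow>\<^sub>M borel"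
    by (rule measurable_compose[OF measurable_fst measurable_ident_sphere])
  have [measurable]: "(\<lambda>x. snd x) \<in> \<sigma> \<Otimes>\<^sub>M \<sigma> \<rightarrow>\<^sub>M borel"
    by (rule measurable_compose[OF measurable_snd measurable_ident_sphere])
  show ?thesis unfolding split_beta by measurable
qed

interpretation sph2: pair_sigma_finite "sphere_measure" "sphere_measure"
  by unfold_locales

lemma finite_measure_sphere_pair: "finite_measure (\<sigma> \<Otimes>\<^sub>M \<sigma>)"
proof (rule finite_measureI)
  show "emeasure (\<sigma> \<Otimes>\<^sub>M \<sigma>) (space (\<sigma> \<Otimes>\<^sub>M \<sigma>)) \<noteq> \<infinity>"
    unfolding space_pair_measure sph.emeasure_pair_measure_Times[OF sets.top sets.top]
    by (simp add: emeasure_sphere_measure_space ennreal_mult_eq_top_iff)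
qed

lemma pair_bounded_integrable:
  fixes h :: "real^3 \<Rightarrow> real^3 \<Rightarrow> real"
  assumes "case_prod h \<in> borel_measurable (\<sigma> \<Otimes>\<^sub>M \<sigma>)" "\<And>x y. x \<in> S2 \<Longrightarrow> y \<in> S2 \<Longrightarrow> \<bar>h x y\<bar> \<le> B"
  shows "integrable (\<sigma> \<Otimes>\<^sub>M \<sigma>) (case_prod h)"
  using assms
  by (intro finite_measure.integrable_const_bound[OF finite_measure_sphere_pair, where B = B])
    (auto simp: space_pair_measure)

lemma Pi_proj_self_adjoint:
  assumes f: "bfun f" and g: "bfun g"
  shows "(\<integral>x. Pi_proj s f x * g x \<partial>\<sigma>) = (\<integral>x. f x * Pi_proj s g x \<partial>\<sigma>)"
proof -
  define P where "P = poly (legendre s)"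
  define c where "c = (2 * real s + 1) / (4 * pi)"
  obtain A B where A: "\<And>x. x \<in> S2 \<Longrightarrow> \<bar>f x\<bar> \<le> A" and B: "\<And>x. x \<in> S2 \<Longrightarrow> \<bar>g x\<bar> \<le> B"
    using f g unfolding bfun_def by blast
  have [measurable]: "f \<in> borel_measurable \<sigma>" "g \<in> borel_measurable \<sigma>" using f g by (auto simp: bfun_def)
  have [measurable]: "(\<lambda>(x, y). P (x \<bullet> y)) \<in> borel_measurable (\<sigma> \<Otimes>\<^sub>M \<sigma>)" unfolding P_def by measurable
  have i: "integrable (\<sigma> \<Otimes>\<^sub>M \<sigma>) (case_prod (\<lambda>x y. P (x \<bullet> y) * f y * g x))"
  proof (rule pair_bounded_integrable[where B = "1 * \<bar>A\<bar> * \<bar>B\<bar>"])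
    fix x y :: "real^3" assume "x \<in> S2" "y \<in> S2"
    then show "\<bar>P (x \<bullet> y) * f y * g x\<bar> \<le> 1 * \<bar>A\<bar> * \<bar>B\<bar>"
      unfolding abs_mult using A[of y] B[of x] abs_legendre_le_1[OF sphere_inner_bound[of x y], of s]
      by (intro mult_mono) (auto simp: P_def)
  qed measurable
  have "(\<integral>x. Pi_proj s f x * g x \<partial>\<sigma>) = c * (\<integral>x. (\<integral>y. P (x \<bullet> y) * f y * g x \<partial>\<sigma>) \<partial>\<sigma>)"
    unfolding Pi_proj_def zonal_conv_def c_def[symmetric] P_def[symmetric] integral_mult_left_zero
    by (simp add: mult.assoc)
  also have "(\<integral>x. (\<integral>y. P (x \<bullet> y) * f y * g x \<partial>\<sigma>) \<partial>\<sigma>) = (\<integral>y. (\<integral>x. P (x \<bullet> y) * f y * g x \<partial>\<sigma>) \<partial>\<sigma>)"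
    by (rule sph2.Fubini_integral[OF i, symmetric])
  also have "c * \<dots> = (\<integral>y. f y * Pi_proj s g y \<partial>\<sigma>)"
  proof -
    have "(\<integral>x. P (x \<bullet> y) * f y * g x \<partial>\<sigma>) = f y * zonal_conv (legendre s) g y" for y
      by (simp add: zonal_conv_def P_def inner_commute mult_ac flip: integral_mult_right_zero)
    then show ?thesis
      unfolding Pi_proj_def c_def[symmetric] by (simp only: mult.left_commute[of "f _" c] integral_mult_right_zero)
  qed
  finally show ?thesis .
qed

lemma Pi_proj_inner:
  assumes f: "bfun f" and g: "bfun g"
  shows "(\<integral>x. Pi_proj s f x * Pi_proj s g x \<partial>\<sigma>) = (\<integral>x. Pi_proj s f x * g x \<partial>\<sigma>)"
proof -
  have "(\<integral>x. Pi_proj s f x * g x \<partial>\<sigma>) = (\<integral>x. Pi_proj s (Pi_proj s f) x * g x \<partial>\<sigma>)"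
    by (rule Bochner_Integration.integral_cong) (auto simp: Pi_proj_idem f)
  also have "\<dots> = (\<integral>x. Pi_proj s f x * Pi_proj s g x \<partial>\<sigma>)"
    by (intro Pi_proj_self_adjoint bfun_Pi_proj f g)
  finally show ?thesis by simp
qed

lemma Pi_proj_contraction:
  assumes f: "bfun f"
  shows "(\<integral>x. (Pi_proj s f x)\<^sup>2 \<partial>\<sigma>) \<le> (\<integral>x. (f x)\<^sup>2 \<partial>\<sigma>)"
proof -
  have P: "bfun (Pi_proj s f)" by (rule bfun_Pi_proj[OF f])
  have "0 \<le> (\<integral>x. (f x - Pi_proj s f x)\<^sup>2 \<partial>\<sigma>)" by simp
  also have "\<dots> = (\<integral>x. f x * f x - 2 * (Pi_proj s f x * f x) + Pi_proj s f x * Pi_proj s f x \<partial>\<sigma>)"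
    by (rule Bochner_Integration.integral_cong) (auto simp: power2_eq_square algebra_simps)
  also have "\<dots> = (\<integral>x. f x * f x \<partial>\<sigma>) - 2 * (\<integral>x. Pi_proj s f x * f x \<partial>\<sigma>) + (\<integral>x. Pi_proj s f x * Pi_proj s f x \<partial>\<sigma>)"
    using f P by (simp add: bfun_integrable bfun_mult)
  finally show ?thesis unfolding Pi_proj_inner[OF f f, symmetric] by (simp add: power2_eq_square)
qed

lemma zonal_conv_orthogonal:
  assumes A: "orthogonal_transformation A" and f: "bfun f"
  shows "zonal_conv p (\<lambda>y. f (A y)) x = zonal_conv p f (A x)"
proof -
  have "(\<lambda>y. poly p (A x \<bullet> y) * f y) \<in> borel_measurable \<sigma>"
    by (intro bfun_measurable bfun_mult bfun_poly f)
  from integral_sphere_orthogonal[OF A this]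
  show ?thesis using A by (simp add: zonal_conv_def orthogonal_transformation_def)
qed

lemma Pi_proj_orthogonal:
  assumes A: "orthogonal_transformation A" and f: "bfun f"
  shows "Pi_proj s (\<lambda>y. f (A y)) x = Pi_proj s f (A x)"
  by (simp add: Pi_proj_def zonal_conv_orthogonal[OF A f])

section \<open>Bernstein-type mass bounds\<close>

lemma inner_cross_cross: "(x \<times> a) \<bullet> (x \<times> b) = (x \<bullet> x) * (a \<bullet> b) - (x \<bullet> a) * (x \<bullet> b)"
  for x :: "real^3"
  by (simp add: cross3_simps) 

lemma bfun_indicator:
  assumes "S \<in> sets borel"
  shows "bfun (indicator S)"
  unfolding bfun_def
proof
  show "indicator S \<in> borel_measurable \<sigma>"
    by (intro borel_measurable_sphere_measure borel_measurable_indicator assms)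
qed (auto intro!: exI[of _ 1] simp: indicator_def)

text \<open>The integrand of the integration by parts as one function, so that several integrations
  by parts can be combined pointwise before integrating.\<close>

definition ibp_term where
  "ibp_term F gF gK HK = (\<lambda>x. F x * lap x (gK x) (HK x) + (x \<times> gF x) \<bullet> (x \<times> gK x))"

lemma ibp_term:
  assumes F: "\<And>x. x \<in> S2 \<Longrightarrow> (F has_derivative (\<lambda>v. gF x \<bullet> v)) (at x)" "continuous_on S2 gF" and K: "C2_fun K gK HK"
  shows "integrable \<sigma> (ibp_term F gF gK HK)" "(\<integral>x. ibp_term F gF gK HK x \<partial>\<sigma>) = 0"
proof -
  have Fc: "continuous_on S2 F" by (meson continuous_at_imp_continuous_on F(1) has_derivative_continuous)
  have "continuous_on S2 (\<lambda>x. lap x (gK x) (HK x))"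
    unfolding lap_def trace_def matrix_vector_mult_def
    by (intro continuous_intros C2_funD(3,4)[OF K])
  then show "integrable \<sigma> (ibp_term F gF gK HK)"
    unfolding ibp_term_def
    by (intro sphere_continuous_integrable continuous_intros continuous_on_cross Fc F(2) C2_funD(4)[OF K])
  show "(\<integral>x. ibp_term F gF gK HK x \<partial>\<sigma>) = 0"
    unfolding ibp_term_def using F K by (intro integration_by_parts_C2) auto
qed

text \<open>
  Rellich's identity for the conformal vector field \<open>- a(z) \<nabla>z\<close>, \<open>z = x \<bullet> e\<close>. Pointwise, the integrand
  is bounded by a combination of five terms, each of which integrates to zero by parts;
  it uses \<open>\<Gamma>(\<Gamma>(z, \<phi>), \<phi>) = \<Gamma>(z, \<Gamma>(\<phi>, \<phi>)) / 2 - z \<Gamma>(\<phi>, \<phi>)\<close> with \<open>\<Gamma>(F, K) = \<nabla>F \<bullet> \<nabla>K\<close>.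
\<close>

lemma rellich_inequality:
  fixes \<phi> :: "real^3 \<Rightarrow> real"
  assumes C: "C2_fun \<phi> g H" and sym: "\<And>x. transpose (H x) = H x"
    and eig: "\<And>x. x \<in> S2 \<Longrightarrow> lap x (g x) (H x) = - k * \<phi> x" and e: "e \<in> S2" and k: "k \<ge> 0"
    and A: "\<And>z. \<bar>z\<bar> \<le> 1 \<Longrightarrow> (A has_real_derivative a z) (at z)"
    and a: "\<And>z. \<bar>z\<bar> \<le> 1 \<Longrightarrow> (a has_real_derivative a1 z) (at z)"
    and b: "\<And>z. b z = (1 - z\<^sup>2) * a1 z"
    and b1: "\<And>z. \<bar>z\<bar> \<le> 1 \<Longrightarrow> (b has_real_derivative b1 z) (at z)"
    and b2: "\<And>z. \<bar>z\<bar> \<le> 1 \<Longrightarrow> (b1 has_real_derivative b2 z) (at z)"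
    and cont: "continuous_on {-1..1} a1" "continuous_on {-1..1} b2"
    and a1: "\<And>z. \<bar>z\<bar> \<le> 1 \<Longrightarrow> a1 z \<ge> 0"
  shows "(\<integral>x. (\<phi> x)\<^sup>2 * (2 * k * ((x \<bullet> e) * a (x \<bullet> e) - b (x \<bullet> e))
            - ((1 - (x \<bullet> e)\<^sup>2) * b2 (x \<bullet> e) - 2 * (x \<bullet> e) * b1 (x \<bullet> e)) / 2) \<partial>\<sigma>) \<le> 0"
proof -
  \<comment> \<open>\<open>G\<close> and \<open>E\<close> are the products of gradients \<Gamma>(z,
    \<phi>) and \<Gamma>(\<phi>, \<phi>), written as inner products of cross products with
    \<open>x\<close> and hence defined in space; \<open>dG\<close> and \<open>dE\<close> are their
    Euclidean gradients.\<close>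
  define G where "G = (\<lambda>x. (x \<bullet> x) * (e \<bullet> g x) - (x \<bullet> g x) * (x \<bullet> e))"
  define E where "E = (\<lambda>x. (x \<bullet> x) * (g x \<bullet> g x) - (x \<bullet> g x) * (x \<bullet> g x))"
  define dG where "dG = (\<lambda>x. (2 * (e \<bullet> g x)) *\<^sub>R x + (x \<bullet> x) *\<^sub>R (H x *v e) - (x \<bullet> e) *\<^sub>R (g x + H x *v x) - (x \<bullet> g x) *\<^sub>R e)"
  define dE where "dE = (\<lambda>x. (2 * (g x \<bullet> g x)) *\<^sub>R x + (2 * (x \<bullet> x)) *\<^sub>R (H x *v g x) - (2 * (x \<bullet> g x)) *\<^sub>R (g x + H x *v x))"
  have symH: "u \<bullet> (H x *v v) = (H x *v u) \<bullet> v" for x u v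
    using dot_lmul_matrix[of u "H x" v] transpose_matrix_vector[of "H x" u] sym[of x] by simp
  note dg = C2_funD(2)[OF C]
  have der_G: "(G has_derivative (\<lambda>v. dG x \<bullet> v)) (at x)" if x: "x \<in> S2" for x
  proof -
    have "(G has_derivative (\<lambda>v. ((x \<bullet> x) * (e \<bullet> (H x *v v)) + (x \<bullet> v + v \<bullet> x) * (e \<bullet> g x))
        - ((x \<bullet> g x) * (v \<bullet> e) + (x \<bullet> (H x *v v) + v \<bullet> g x) * (x \<bullet> e)))) (at x)"
      unfolding G_def
      by (rule derivative_eq_intros dg[OF x] refl | simp)+
    moreover have "(\<lambda>v. ((x \<bullet> x) * (e \<bullet> (H x *v v)) + (x \<bullet> v + v \<bullet> x) * (e \<bullet> g x))
        - ((x \<bullet> g x) * (v \<bullet> e) + (x \<bullet> (H x *v v) + v \<bullet> g x) * (x \<bullet> e))) = (\<lambda>v. dG x \<bullet> v)"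
      unfolding dG_def symH by (simp add: fun_eq_iff inner_add_left inner_diff_left inner_commute algebra_simps)
    ultimately show ?thesis by simp
  qed
  have der_E: "(E has_derivative (\<lambda>v. dE x \<bullet> v)) (at x)" if x: "x \<in> S2" for x
  proof -
    have "(E has_derivative (\<lambda>v. ((x \<bullet> x) * (g x \<bullet> (H x *v v) + (H x *v v) \<bullet> g x) + (x \<bullet> v + v \<bullet> x) * (g x \<bullet> g x))
        - ((x \<bullet> g x) * (x \<bullet> (H x *v v) + v \<bullet> g x) + (x \<bullet> (H x *v v) + v \<bullet> g x) * (x \<bullet> g x)))) (at x)"
      unfolding E_def
      by (rule derivative_eq_intros dg[OF x] refl | simp)+
    moreover have "(\<lambda>v. ((x \<bullet> x) * (g x \<bullet> (H x *v v) + (H x *v v) \<bullet> g x) + (x \<bullet> v + v \<bullet> x) * (g x \<bullet> g x))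
        - ((x \<bullet> g x) * (x \<bullet> (H x *v v) + v \<bullet> g x) + (x \<bullet> (H x *v v) + v \<bullet> g x) * (x \<bullet> g x))) = (\<lambda>v. dE x \<bullet> v)"
      unfolding dE_def inner_commute[of "H x *v _" "g x"] symH
      by (simp add: fun_eq_iff inner_add_left inner_diff_left inner_commute algebra_simps)
    ultimately show ?thesis by simp
  qed
  have C\<phi>: "\<And>x. x \<in> S2 \<Longrightarrow> (\<phi> has_derivative (\<lambda>v. g x \<bullet> v)) (at x)" "continuous_on S2 g" "continuous_on S2 H" "continuous_on S2 \<phi>"
    using C2_funD[OF C] by auto
  have zab: "\<bar>x \<bullet> e\<bar> \<le> 1" if "x \<in> S2" for x by (rule sphere_inner_bound[OF that e])
  have dz: "((\<lambda>x. f (x \<bullet> e)) has_derivative (\<lambda>v. f' (x \<bullet> e) * (e \<bullet> v))) (at x)"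
    if "x \<in> S2" "\<And>z. \<bar>z\<bar> \<le> 1 \<Longrightarrow> (f has_real_derivative f' z) (at z)" for f f' x
    using zonal_gradient[where k = f and k' = f', OF that(2)[OF zab[OF that(1)]]] by (simp add: inner_commute)
  have cz: "continuous_on S2 (\<lambda>x. f (x \<bullet> e))" if "continuous_on {-1..1} f" for f :: "real \<Rightarrow> real"
  proof -
    have "(\<lambda>x. x \<bullet> e) ` S2 \<subseteq> {-1..1}" using zab by (auto simp: abs_le_iff minus_le_iff)
    then show ?thesis
      by (intro continuous_on_compose2[OF that]) (auto intro!: continuous_intros)
  qed
  have cd: "continuous_on {-1..1} f" if h: "\<And>z. \<bar>z\<bar> \<le> 1 \<Longrightarrow> (f has_real_derivative f' z) (at z)" for f f' :: "real \<Rightarrow> real"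
  proof (intro continuous_at_imp_continuous_on ballI)
    fix z :: real assume "z \<in> {-1..1}"
    then have "\<bar>z\<bar> \<le> 1" by (auto simp: abs_le_iff)
    from DERIV_isCont[OF h[OF this]] show "isCont f z" .
  qed
  have cc: "continuous_on S2 (\<lambda>x. a (x \<bullet> e))" "continuous_on S2 (\<lambda>x. a1 (x \<bullet> e))" "continuous_on S2 (\<lambda>x. b (x \<bullet> e))"
    "continuous_on S2 (\<lambda>x. b1 (x \<bullet> e))" "continuous_on S2 (\<lambda>x. b2 (x \<bullet> e))"
    using cz[OF cd[where f = a and f' = a1, OF a]] cz[OF cd[where f = b and f' = b1, OF b1]]
      cz[OF cd[where f = b1 and f' = b2, OF b2]] cz[OF cont(1)] cz[OF cont(2)] by auto
  have KA: "C2_fun (\<lambda>x. A (x \<bullet> e)) (\<lambda>x. a (x \<bullet> e) *\<^sub>R e) (\<lambda>x. a1 (x \<bullet> e) *\<^sub>R outer e)"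
    by (intro C2_fun_zonal e A a cont)
  have Kb: "C2_fun (\<lambda>x. b (x \<bullet> e)) (\<lambda>x. b1 (x \<bullet> e) *\<^sub>R e) (\<lambda>x. b2 (x \<bullet> e) *\<^sub>R outer e)"
    by (intro C2_fun_zonal e b1 b2 cont)
  have cdG: "continuous_on S2 dG" and cdE: "continuous_on S2 dE" and cG: "continuous_on S2 G" and cE: "continuous_on S2 E"
    unfolding dG_def dE_def G_def E_def matrix_vector_mult_def by (intro continuous_intros C\<phi>)+
  \<comment> \<open>The coefficients -2, 1, -k, 1, -1/2 used below cancel all second derivatives of
    \<phi> and all products of \<phi> with its gradient. The combination then equals
    \<open>T\<close> plus twice b \<Gamma>(\<phi>, \<phi>) - a1 \<Gamma>(z, \<phi>)^2.\<close>
  define Z1 where "Z1 = ibp_term (\<lambda>x. a (x \<bullet> e) * G x) (\<lambda>x. (a1 (x \<bullet> e) * G x) *\<^sub>R e + a (x \<bullet> e) *\<^sub>R dG x) g H"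
  define Z2 where "Z2 = ibp_term E dE (\<lambda>x. a (x \<bullet> e) *\<^sub>R e) (\<lambda>x. a1 (x \<bullet> e) *\<^sub>R outer e)"
  define Z3 where "Z3 = ibp_term (\<lambda>x. \<phi> x * \<phi> x) (\<lambda>x. (2 * \<phi> x) *\<^sub>R g x) (\<lambda>x. a (x \<bullet> e) *\<^sub>R e) (\<lambda>x. a1 (x \<bullet> e) *\<^sub>R outer e)"
  define Z4 where "Z4 = ibp_term (\<lambda>x. b (x \<bullet> e) * \<phi> x) (\<lambda>x. (b1 (x \<bullet> e) * \<phi> x) *\<^sub>R e + b (x \<bullet> e) *\<^sub>R g x) g H"
  define Z5 where "Z5 = ibp_term (\<lambda>x. \<phi> x * \<phi> x) (\<lambda>x. (2 * \<phi> x) *\<^sub>R g x) (\<lambda>x. b1 (x \<bullet> e) *\<^sub>R e) (\<lambda>x. b2 (x \<bullet> e) *\<^sub>R outer e)"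
  have der1: "((\<lambda>x. a (x \<bullet> e) * G x) has_derivative (\<lambda>v. ((a1 (x \<bullet> e) * G x) *\<^sub>R e + a (x \<bullet> e) *\<^sub>R dG x) \<bullet> v)) (at x)"
    if x: "x \<in> S2" for x
    using has_derivative_mult[OF dz[where f = a and f' = a1, OF x a] der_G[OF x]] by (simp add: inner_add_left algebra_simps)
  have c1: "continuous_on S2 (\<lambda>x. (a1 (x \<bullet> e) * G x) *\<^sub>R e + a (x \<bullet> e) *\<^sub>R dG x)" by (intro continuous_intros cc cG cdG)
  have Z1: "integrable \<sigma> Z1" "(\<integral>x. Z1 x \<partial>\<sigma>) = 0"
    unfolding Z1_def by (rule ibp_term[OF der1 c1 C], assumption)+
  have Z2: "integrable \<sigma> Z2" "(\<integral>x. Z2 x \<partial>\<sigma>) = 0"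
    unfolding Z2_def by (rule ibp_term[OF der_E cdE KA], assumption)+
  have der_sq: "((\<lambda>x. \<phi> x * \<phi> x) has_derivative (\<lambda>v. ((2 * \<phi> x) *\<^sub>R g x) \<bullet> v)) (at x)" if x: "x \<in> S2" for x
    using has_derivative_mult[OF C\<phi>(1)[OF x] C\<phi>(1)[OF x]] by (simp add: algebra_simps)
  have c3: "continuous_on S2 (\<lambda>x. (2 * \<phi> x) *\<^sub>R g x)" by (intro continuous_intros C\<phi>)
  have Z3: "integrable \<sigma> Z3" "(\<integral>x. Z3 x \<partial>\<sigma>) = 0"
    unfolding Z3_def by (rule ibp_term[OF der_sq c3 KA], assumption)+
  have Z5: "integrable \<sigma> Z5" "(\<integral>x. Z5 x \<partial>\<sigma>) = 0"
    unfolding Z5_def by (rule ibp_term[OF der_sq c3 Kb], assumption)+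
  have der4: "((\<lambda>x. b (x \<bullet> e) * \<phi> x) has_derivative (\<lambda>v. ((b1 (x \<bullet> e) * \<phi> x) *\<^sub>R e + b (x \<bullet> e) *\<^sub>R g x) \<bullet> v)) (at x)"
    if x: "x \<in> S2" for x
    using has_derivative_mult[OF dz[where f = b and f' = b1, OF x b1] C\<phi>(1)[OF x]] by (simp add: inner_add_left algebra_simps)
  have c4: "continuous_on S2 (\<lambda>x. (b1 (x \<bullet> e) * \<phi> x) *\<^sub>R e + b (x \<bullet> e) *\<^sub>R g x)" by (intro continuous_intros cc C\<phi>)
  have Z4: "integrable \<sigma> Z4" "(\<integral>x. Z4 x \<partial>\<sigma>) = 0"
    unfolding Z4_def by (rule ibp_term[OF der4 c4 C], assumption)+
  define T where "T = (\<lambda>x. (\<phi> x)\<^sup>2 * (2 * k * ((x \<bullet> e) * a (x \<bullet> e) - b (x \<bullet> e))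
            - ((1 - (x \<bullet> e)\<^sup>2) * b2 (x \<bullet> e) - 2 * (x \<bullet> e) * b1 (x \<bullet> e)) / 2))"
  have "(\<integral>x. T x \<partial>\<sigma>) \<le> (\<integral>x. -2 * Z1 x + Z2 x - k * Z3 x + Z4 x - Z5 x / 2 \<partial>\<sigma>)"
  proof (rule integral_mono)
    show "integrable \<sigma> T" unfolding T_def
      by (intro sphere_continuous_integrable continuous_intros cc C\<phi>) auto
    show "integrable \<sigma> (\<lambda>x. -2 * Z1 x + Z2 x - k * Z3 x + Z4 x - Z5 x / 2)"
      using Z1 Z2 Z3 Z4 Z5 by auto
    fix x assume "x \<in> space \<sigma>"
    then have x: "x \<in> S2" by simp
    have xx: "x \<bullet> x = 1" and ee: "e \<bullet> e = 1" using sphere_inner_self x e by auto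
    \<comment> \<open>Naming all scalar products that occur reduces the pointwise inequality to
      polynomial algebra; symmetry of the Hessian identifies the mixed products.\<close>
    define t p z w h1 h2 h3 N where "t = x \<bullet> g x" and "p = e \<bullet> g x" and "z = x \<bullet> e" and "w = e \<bullet> (H x *v g x)"
      and "h1 = g x \<bullet> (H x *v x)" and "h2 = x \<bullet> (H x *v x)" and "h3 = e \<bullet> (H x *v x)" and "N = g x \<bullet> g x"
    have comm: "g x \<bullet> x = t" "g x \<bullet> e = p" "e \<bullet> x = z" "g x \<bullet> (H x *v e) = w" "x \<bullet> (H x *v g x) = h1" "x \<bullet> (H x *v e) = h3"
      unfolding t_def p_def z_def w_def h1_def h3_def symH[of e x "g x"] symH[of "g x" x x] symH[of e x x]
      by (rule inner_commute)+
    have comm2: "(H x *v g x) \<bullet> e = w" "(H x *v e) \<bullet> g x = w" "(H x *v x) \<bullet> g x = h1" "(H x *v x) \<bullet> e = h3"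
      "(H x *v e) \<bullet> x = h3" "(H x *v g x) \<bullet> x = h1" "(H x *v x) \<bullet> x = h2"
      unfolding inner_commute[of "H x *v _"] comm by (simp_all only: w_def h1_def h2_def h3_def)
    note sc = t_def[symmetric] p_def[symmetric] z_def[symmetric] w_def[symmetric] h1_def[symmetric] h2_def[symmetric]
      h3_def[symmetric] N_def[symmetric] comm comm2 xx ee
    have Gx: "G x = p - t * z" and Ex: "E x = N - t * t" by (simp_all add: G_def E_def sc)
    have lz: "lap x (c *\<^sub>R e) (d *\<^sub>R outer e) = (1 - z\<^sup>2) * d - 2 * z * c" for c d
      unfolding z_def by (rule lap_zonal[OF x e])
    have GG: "(x \<times> g x) \<bullet> (x \<times> g x) = N - t * t" "(x \<times> e) \<bullet> (x \<times> g x) = p - t * z" "(x \<times> g x) \<bullet> (x \<times> e) = p - t * z"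
      unfolding inner_cross_cross by (simp_all add: sc)
    have dGg: "(x \<times> dG x) \<bullet> (x \<times> g x) = w - p * t - z * N - z * h1 - t * h3 + 2 * z * t * t + z * t * h2"
      unfolding inner_cross_cross dG_def by (simp add: inner_add_left inner_diff_left inner_add_right inner_diff_right sc algebra_simps)
    have dEe: "(x \<times> dE x) \<bullet> (x \<times> e) = 2 * (w - t * p - t * h3 - z * h1 + z * t * t + z * t * h2)"
      unfolding inner_cross_cross dE_def by (simp add: inner_add_left inner_diff_left inner_add_right inner_diff_right sc algebra_simps)
    define av a1v bv b1v b2v f where "av = a z" and "a1v = a1 z" and "bv = b z" and "b1v = b1 z" and "b2v = b2 z" and "f = \<phi> x"
    have bv: "bv = (1 - z\<^sup>2) * a1v" by (simp add: bv_def b a1v_def)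
    note sv = av_def[symmetric] a1v_def[symmetric] bv_def[symmetric] b1v_def[symmetric] b2v_def[symmetric] f_def[symmetric]
    have z1: "Z1 x = av * (p - t * z) * (- k * f) + (a1v * (p - t * z) * (p - t * z)
        + av * (w - p * t - z * N - z * h1 - t * h3 + 2 * z * t * t + z * t * h2))"
      unfolding Z1_def ibp_term_def eig[OF x] cross_add_right cross_mult_right inner_add_left inner_scaleR_left dGg GG Gx
      by (simp add: sc sv)
    have z2: "Z2 x = (N - t * t) * ((1 - z\<^sup>2) * a1v - 2 * z * av) + av * (2 * (w - t * p - t * h3 - z * h1 + z * t * t + z * t * h2))"
      unfolding Z2_def ibp_term_def z_def[symmetric] lz cross_mult_right inner_scaleR_right dEe Ex by (simp add: sv)
    have z3: "Z3 x = f * f * ((1 - z\<^sup>2) * a1v - 2 * z * av) + av * (2 * f * (p - t * z))"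
      unfolding Z3_def ibp_term_def z_def[symmetric] lz cross_mult_right inner_scaleR_right inner_scaleR_left GG by (simp add: sv)
    have z4: "Z4 x = bv * f * (- k * f) + (b1v * f * (p - t * z) + bv * (N - t * t))"
      unfolding Z4_def ibp_term_def eig[OF x] cross_add_right cross_mult_right inner_add_left inner_scaleR_left GG
      by (simp add: sc sv)
    have z5: "Z5 x = f * f * ((1 - z\<^sup>2) * b2v - 2 * z * b1v) + b1v * (2 * f * (p - t * z))"
      unfolding Z5_def ibp_term_def z_def[symmetric] lz cross_mult_right inner_scaleR_right inner_scaleR_left GG by (simp add: sv)
    have Tx: "T x = f\<^sup>2 * (2 * k * (z * av - bv) - ((1 - z\<^sup>2) * b2v - 2 * z * b1v) / 2)"
      by (simp add: T_def sc sv)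
    \<comment> \<open>Cauchy-Schwarz for the tangential parts of \<open>e\<close> and of the
      gradient. The choice b = (1 - z^2) a1 is made so that it shows the remainder to be
      nonnegative.\<close>
    have "(p - t * z)\<^sup>2 \<le> (1 - z\<^sup>2) * (N - t * t)"
    proof -
      have "((x \<times> e) \<bullet> (x \<times> g x))\<^sup>2 \<le> ((x \<times> e) \<bullet> (x \<times> e)) * ((x \<times> g x) \<bullet> (x \<times> g x))"
        by (rule Cauchy_Schwarz_ineq)
      moreover have "(x \<times> e) \<bullet> (x \<times> e) = 1 - z\<^sup>2"
        unfolding inner_cross_cross by (simp add: sc power2_eq_square)
      ultimately show ?thesis unfolding GG by simp
    qed
    moreover have "a1v \<ge> 0" using a1[OF zab[OF x]] by (simp add: a1v_def z_def)
    ultimately have "a1v * (p - t * z)\<^sup>2 \<le> a1v * ((1 - z\<^sup>2) * (N - t * t))" by (intro mult_left_mono)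
    then have "a1v * (p - t * z)\<^sup>2 \<le> bv * (N - t * t)" unfolding bv by (simp add: mult_ac)
    moreover have "-2 * Z1 x + Z2 x - k * Z3 x + Z4 x - Z5 x / 2 - T x = 2 * (bv * (N - t * t) - a1v * (p - t * z)\<^sup>2)"
      unfolding z1 z2 z3 z4 z5 Tx bv by (simp add: field_simps power2_eq_square)
    ultimately have "0 \<le> -2 * Z1 x + Z2 x - k * Z3 x + Z4 x - Z5 x / 2 - T x" by (simp only: diff_ge_0_iff_ge zero_le_mult_iff) simp
    then show "T x \<le> -2 * Z1 x + Z2 x - k * Z3 x + Z4 x - Z5 x / 2" by (simp only: diff_ge_0_iff_ge)
  qed
  also have "\<dots> = 0" using Z1 Z2 Z3 Z4 Z5 by simp
  finally show ?thesis unfolding T_def .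
qed

text \<open>Rellich's inequality for a = (1 + \<epsilon> - z)^(-1/2). The resulting weight is at
  least k (\<epsilon> a^3 - sqrt 3), and \<epsilon> a^3 is of size \<epsilon>^(-1/2) on a ball of
  radius 2 sqrt \<epsilon>: too much mass there would make the integral positive.\<close>

lemma ball_mass_aux:
  fixes \<phi> :: "real^3 \<Rightarrow> real"
  assumes C: "C2_fun \<phi> g H" and sym: "\<And>x. transpose (H x) = H x"
    and eig: "\<And>x. x \<in> S2 \<Longrightarrow> lap x (g x) (H x) = - k * \<phi> x" and e: "e \<in> S2"
    and \<epsilon>: "0 < \<epsilon>" "\<epsilon> \<le> 1" "k * \<epsilon> \<ge> 10"
  shows "(\<integral>x. (\<phi> x)\<^sup>2 * indicator (cball e (2 * sqrt \<epsilon>)) x \<partial>\<sigma>) \<le> 9 * sqrt \<epsilon> * (\<integral>x. (\<phi> x)\<^sup>2 \<partial>\<sigma>)"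
proof -
  have k: "k > 0" using \<epsilon> by (metis less_le_trans zero_less_mult_pos2 zero_less_numeral)
  \<comment> \<open>\<open>q\<close> is a square-root singularity at the centre, smoothed at scale
    \<epsilon>; \<open>A\<close> is its primitive, \<open>a1\<close> its derivative, and
    \<open>b1\<close>, \<open>b2\<close> are the first two derivatives of \<open>b\<close>.\<close>
  define q where "q = (\<lambda>z. inverse (sqrt (1 + \<epsilon> - z)))"
  define A where "A = (\<lambda>z. - 2 * sqrt (1 + \<epsilon> - z))"
  define a1 where "a1 = (\<lambda>z. (q z) ^ 3 / 2)"
  define b where "b = (\<lambda>z. (1 - z\<^sup>2) * a1 z)"
  define b1 where "b1 = (\<lambda>z. - z * (q z) ^ 3 + 3 / 4 * (1 - z\<^sup>2) * (q z) ^ 5)"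
  define b2 where "b2 = (\<lambda>z. - ((q z) ^ 3) - 3 * z * (q z) ^ 5 + 15 / 8 * (1 - z\<^sup>2) * (q z) ^ 7)"
  have v: "1 + \<epsilon> - z > 0" if "\<bar>z\<bar> \<le> 1" for z using that \<epsilon> by linarith
  have qpos: "q z > 0" if "\<bar>z\<bar> \<le> 1" for z using v[OF that] by (simp add: q_def)
  have qsq: "(q z)\<^sup>2 * (1 + \<epsilon> - z) = 1" if "\<bar>z\<bar> \<le> 1" for z
    using v[OF that] by (simp add: q_def power_inverse)
  have dq: "(q has_real_derivative (q z) ^ 3 / 2) (at z)" if "\<bar>z\<bar> \<le> 1" for z
  proof -
    have "(q has_real_derivative (- (inverse (sqrt (1 + \<epsilon> - z)) * (inverse (sqrt (1 + \<epsilon> - z)) * (-1 / 2)) * inverse (sqrt (1 + \<epsilon> - z))))) (at z)"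
      unfolding q_def using v[OF that]
      by (auto intro!: derivative_eq_intros simp: field_simps)
    then show ?thesis by (simp add: q_def power3_eq_cube)
  qed
  have dA: "(A has_real_derivative q z) (at z)" if "\<bar>z\<bar> \<le> 1" for z
    unfolding A_def q_def using v[OF that] by (auto intro!: derivative_eq_intros simp: field_simps)
  have db: "(b has_real_derivative b1 z) (at z)" if "\<bar>z\<bar> \<le> 1" for z
    unfolding b_def a1_def b1_def
    by (rule derivative_eq_intros dq[OF that] refl | simp add: field_simps power2_eq_square eval_nat_numeral)+
  have db1: "(b1 has_real_derivative b2 z) (at z)" if "\<bar>z\<bar> \<le> 1" for z
    unfolding b1_def b2_def
    by (rule derivative_eq_intros dq[OF that] refl | simp add: field_simps power2_eq_square eval_nat_numeral)+
  have cq: "continuous_on {-1..1} q"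
    by (intro continuous_at_imp_continuous_on ballI) (metis DERIV_isCont[OF dq] abs_le_iff atLeastAtMost_iff minus_le_iff)
  have c: "continuous_on {-1..1} a1" "continuous_on {-1..1} b2"
    unfolding a1_def b2_def by (auto intro!: continuous_intros cq)
  define W where "W = (\<lambda>z. 2 * k * (z * q z - b z) - ((1 - z\<^sup>2) * b2 z - 2 * z * b1 z) / 2)"
  have main: "(\<integral>x. (\<phi> x)\<^sup>2 * W (x \<bullet> e) \<partial>\<sigma>) \<le> 0"
    unfolding W_def
  proof (rule rellich_inequality[where A = A and a = q and ?a1.0 = a1 and b = b and ?b1.0 = b1 and ?b2.0 = b2 and g = g and H = H])
    show "(q has_real_derivative a1 z) (at z)" if "\<bar>z\<bar> \<le> 1" for z using dq[OF that] by (simp add: a1_def)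
    show "0 \<le> a1 z" if "\<bar>z\<bar> \<le> 1" for z using qpos[OF that] by (simp add: a1_def)
  qed (use C sym eig e k dA db db1 c in \<open>auto simp: b_def\<close>)
  have Wlow: "W z \<ge> k * (\<epsilon> * (q z) ^ 3 - sqrt 3)" if z: "\<bar>z\<bar> \<le> 1" for z
  proof -
    define r where "r = q z"
    have r0: "r > 0" using qpos[OF z] by (simp add: r_def)
    have r2: "r\<^sup>2 * (1 + \<epsilon> - z) = 1" using qsq[OF z] by (simp add: r_def)
    have one: "z * r - (1 - z\<^sup>2) * r ^ 3 / 2 \<ge> \<epsilon> * r ^ 3 - 1 / (2 * r)"
    proof -
      have "z * r - (1 - z\<^sup>2) * r ^ 3 / 2 - (\<epsilon> * r ^ 3 - (1 + \<epsilon> - z) * r / 2) = r ^ 3 * (\<epsilon>\<^sup>2 / 2)"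
      proof -
        have "z * r - (1 - z\<^sup>2) * r ^ 3 / 2 - (\<epsilon> * r ^ 3 - (1 + \<epsilon> - z) * r / 2)
          = (r\<^sup>2 * (1 + \<epsilon> - z)) * (z * r) - (1 - z\<^sup>2) * r ^ 3 / 2 - (\<epsilon> * r ^ 3 - (1 + \<epsilon> - z) * r * (r\<^sup>2 * (1 + \<epsilon> - z)) / 2)"
          unfolding r2 by simp
        also have "\<dots> = r ^ 3 * (\<epsilon>\<^sup>2 / 2)" by (simp add: field_simps power2_eq_square eval_nat_numeral)
        finally show ?thesis .
      qed
      moreover have "(1 + \<epsilon> - z) * r = 1 / r" using r2 r0 by (simp add: field_simps power2_eq_square)
      moreover have "r ^ 3 * (\<epsilon>\<^sup>2 / 2) \<ge> 0" using r0 by simp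
      ultimately show ?thesis by simp
    qed
    have inv: "1 / r \<le> sqrt 3"
    proof -
      have "1 / r = sqrt (1 + \<epsilon> - z)" unfolding r_def q_def by (simp add: field_simps)
      also have "\<dots> \<le> sqrt 3" using z \<epsilon> by (intro real_sqrt_le_mono) linarith
      finally show ?thesis .
    qed
    \<comment> \<open>All lower-order terms are r^3 times polynomials in z and \<open>y\<close>.
      Since (1 - z) r^2 <= 1, \<open>y\<close> is at most 2, and they stay below 20 r^3; the
      hypothesis that k \<epsilon> is at least 10 then absorbs half of that.\<close>
    define y where "y = (1 - z\<^sup>2) * r\<^sup>2"
    have z2: "z\<^sup>2 \<le> 1" using z by (simp add: abs_square_le_1)
    have y0: "y \<ge> 0" using z2 by (simp add: y_def)
    have y2: "y \<le> 2"
    proof -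
      have "y = (1 + z) * ((1 - z) * r\<^sup>2)" by (simp add: y_def power2_eq_square algebra_simps)
      also have "\<dots> \<le> 2 * 1"
      proof (rule mult_mono)
        have "(1 - z) * r\<^sup>2 = r\<^sup>2 * (1 + \<epsilon> - z) - \<epsilon> * r\<^sup>2" by (simp add: algebra_simps)
        moreover have "\<epsilon> * r\<^sup>2 \<ge> 0" using \<epsilon> by simp
        ultimately show "(1 - z) * r\<^sup>2 \<le> 1" unfolding r2 by linarith
      qed (use z in auto)
      finally show ?thesis by simp
    qed
    have y22: "y * y \<le> 4" using mult_mono[OF y2 y2] y0 by simp
    have zy: "\<bar>z * y\<bar> \<le> 2" using z y0 y2 mult_mono[OF z, of y 2] by (simp add: abs_mult)
    have Lb: "(1 - z\<^sup>2) * b2 z - 2 * z * b1 z = r ^ 3 * (- (1 - z\<^sup>2) - 3 * (z * y) + 15 / 8 * (y * y) + 2 * z\<^sup>2 - 3 / 2 * (z * y))"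
      unfolding b2_def b1_def y_def r_def[symmetric] by (simp add: field_simps power2_eq_square eval_nat_numeral)
    also have "\<dots> \<le> r ^ 3 * 20"
    proof (rule mult_left_mono)
      have "- (z * y) \<le> 2" using zy by linarith
      then show "- (1 - z\<^sup>2) - 3 * (z * y) + 15 / 8 * (y * y) + 2 * z\<^sup>2 - 3 / 2 * (z * y) \<le> 20"
        using z2 y22 by linarith
    qed (use r0 in simp)
    finally have Lb': "(1 - z\<^sup>2) * b2 z - 2 * z * b1 z \<le> 20 * r ^ 3" by simp
    have "W z \<ge> 2 * k * (\<epsilon> * r ^ 3 - 1 / (2 * r)) - 10 * r ^ 3"
    proof -
      have "2 * k * (z * q z - b z) \<ge> 2 * k * (\<epsilon> * r ^ 3 - 1 / (2 * r))"
        using one k unfolding b_def a1_def r_def[symmetric] by (intro mult_left_mono) auto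
      moreover have "X - 10 * R \<le> Y - L / 2" if "X \<le> Y" "L \<le> 20 * R" for X Y L R :: real using that by linarith
      ultimately show ?thesis unfolding W_def using Lb' by blast
    qed
    moreover have "10 * r ^ 3 \<le> (k * \<epsilon>) * r ^ 3" using \<epsilon> r0 by (intro mult_right_mono) auto
    moreover have "k * (1 / r) \<le> k * sqrt 3" using k inv by (intro mult_left_mono) auto
    ultimately show ?thesis unfolding r_def[symmetric] by (simp add: algebra_simps)
  qed
  \<comment> \<open>The lower bound for \<epsilon> q^3 on the ball, where 1 + \<epsilon> - z <= 3
    \<epsilon>. Its reciprocal times sqrt 3 is the constant 9 sqrt \<epsilon>.\<close>
  define c3 where "c3 = 1 / (3 * sqrt 3 * sqrt \<epsilon>)"
  have pw: "k * (c3 * ((\<phi> x)\<^sup>2 * indicator (cball e (2 * sqrt \<epsilon>)) x) - sqrt 3 * (\<phi> x)\<^sup>2) \<le> (\<phi> x)\<^sup>2 * W (x \<bullet> e)" if x: "x \<in> S2" for x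
  proof -
    define z where "z = x \<bullet> e"
    have z: "\<bar>z\<bar> \<le> 1" unfolding z_def by (rule sphere_inner_bound[OF x e])
    have "c3 * indicator (cball e (2 * sqrt \<epsilon>)) x \<le> \<epsilon> * (q z) ^ 3"
    proof (cases "x \<in> cball e (2 * sqrt \<epsilon>)")
      case True
      then have "norm (x - e) \<le> 2 * sqrt \<epsilon>" by (simp add: dist_norm norm_minus_commute)
      then have "(norm (x - e))\<^sup>2 \<le> (2 * sqrt \<epsilon>)\<^sup>2" by (intro power_mono) auto
      also have "(norm (x - e))\<^sup>2 = 2 - 2 * z"
        using sphere_inner_self[OF x] sphere_inner_self[OF e]
        by (simp add: power2_norm_eq_inner inner_diff_left inner_diff_right inner_commute z_def)
      finally have "1 + \<epsilon> - z \<le> 3 * \<epsilon>" using \<epsilon> by (simp add: power_mult_distrib)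
      then have "sqrt (1 + \<epsilon> - z) \<le> sqrt 3 * sqrt \<epsilon>" by (simp flip: real_sqrt_mult)
      then have "q z \<ge> inverse (sqrt 3 * sqrt \<epsilon>)" unfolding q_def using v[OF z] by (intro le_imp_inverse_le) auto
      then have "(q z) ^ 3 \<ge> (inverse (sqrt 3 * sqrt \<epsilon>)) ^ 3" using \<epsilon> by (intro power_mono) auto
      then have "\<epsilon> * (q z) ^ 3 \<ge> \<epsilon> * (inverse (sqrt 3 * sqrt \<epsilon>)) ^ 3" using \<epsilon> by (intro mult_left_mono) auto
      also have "\<epsilon> * (inverse (sqrt 3 * sqrt \<epsilon>)) ^ 3 = c3"
      proof -
        have "\<epsilon> = sqrt \<epsilon> * sqrt \<epsilon>" using \<epsilon> by simp
        moreover have "sqrt \<epsilon> > 0" "sqrt 3 * sqrt 3 = (3::real)" using \<epsilon> by auto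
        ultimately show ?thesis unfolding c3_def power3_eq_cube by (simp add: field_simps)
      qed
      finally show ?thesis using True by simp
    next
      case False
      then show ?thesis using qpos[OF z] \<epsilon> by simp
    qed
    then have "(\<phi> x)\<^sup>2 * (k * (c3 * indicator (cball e (2 * sqrt \<epsilon>)) x - sqrt 3)) \<le> (\<phi> x)\<^sup>2 * (k * (\<epsilon> * (q z) ^ 3 - sqrt 3))"
      using k by (intro mult_left_mono) auto
    also have "\<dots> \<le> (\<phi> x)\<^sup>2 * W z" using Wlow[OF z] by (intro mult_left_mono) auto
    finally show ?thesis unfolding z_def by (simp add: algebra_simps)
  qed
  have C\<phi>: "continuous_on S2 \<phi>" by (rule C2_funD(5)[OF C])
  have i1: "integrable \<sigma> (\<lambda>x. (\<phi> x)\<^sup>2)" by (intro sphere_continuous_integrable continuous_intros C\<phi>)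
  have bi: "bfun (indicator (cball e (2 * sqrt \<epsilon>)))"
    by (rule bfun_indicator) simp
  have i2: "integrable \<sigma> (\<lambda>x. (\<phi> x)\<^sup>2 * indicator (cball e (2 * sqrt \<epsilon>)) x)"
    by (intro bfun_integrable bfun_mult[OF bfun_continuous bi] continuous_intros C\<phi>)
  have cz: "continuous_on S2 (\<lambda>x. q (x \<bullet> e))"
    using sphere_inner_bound[OF _ e]
    by (intro continuous_on_compose2[OF cq]) (auto intro!: continuous_intros simp: abs_le_iff minus_le_iff)
  have i3: "integrable \<sigma> (\<lambda>x. (\<phi> x)\<^sup>2 * W (x \<bullet> e))"
    unfolding W_def b_def a1_def b1_def b2_def
    by (intro sphere_continuous_integrable continuous_intros C\<phi> cz) auto
  define J where "J = (\<integral>x. (\<phi> x)\<^sup>2 * indicator (cball e (2 * sqrt \<epsilon>)) x \<partial>\<sigma>)"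
  have "k * (c3 * J - sqrt 3 * (\<integral>x. (\<phi> x)\<^sup>2 \<partial>\<sigma>))
     = (\<integral>x. k * (c3 * ((\<phi> x)\<^sup>2 * indicator (cball e (2 * sqrt \<epsilon>)) x) - sqrt 3 * (\<phi> x)\<^sup>2) \<partial>\<sigma>)"
    using i1 i2 by (simp add: J_def)
  also have "\<dots> \<le> (\<integral>x. (\<phi> x)\<^sup>2 * W (x \<bullet> e) \<partial>\<sigma>)"
    using i1 i2 i3 pw by (intro integral_mono) auto
  also have "\<dots> \<le> 0" by (rule main)
  finally have "c3 * J \<le> sqrt 3 * (\<integral>x. (\<phi> x)\<^sup>2 \<partial>\<sigma>)" using k by (simp add: mult_le_0_iff)
  then have "(3 * sqrt 3 * sqrt \<epsilon>) * (c3 * J) \<le> (3 * sqrt 3 * sqrt \<epsilon>) * (sqrt 3 * (\<integral>x. (\<phi> x)\<^sup>2 \<partial>\<sigma>))"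
    using \<epsilon> by (intro mult_left_mono) auto
  also have "(3 * sqrt 3 * sqrt \<epsilon>) * (c3 * J) = J" using \<epsilon> by (simp add: c3_def)
  also have "(3 * sqrt 3 * sqrt \<epsilon>) * (sqrt 3 * (\<integral>x. (\<phi> x)\<^sup>2 \<partial>\<sigma>)) = 9 * sqrt \<epsilon> * (\<integral>x. (\<phi> x)\<^sup>2 \<partial>\<sigma>)"
    by (simp add: algebra_simps)
  finally show ?thesis unfolding J_def .
qed

text \<open>For \<epsilon> = (4 \<rho>)^2 the condition s \<rho> >= 1 makes s(s+1) \<epsilon> at
  least 16. If 4 \<rho> > 1, the factor 36 \<rho> already exceeds 1.\<close>

lemma ball_mass:
  assumes f: "bfun f" and e: "e \<in> S2" and s: "real s * \<rho> \<ge> 1" and \<rho>: "\<rho> > 0"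
  shows "(\<integral>x. (Pi_proj s f x)\<^sup>2 * indicator (cball e (8 * \<rho>)) x \<partial>\<sigma>) \<le> 36 * \<rho> * (\<integral>x. (Pi_proj s f x)\<^sup>2 \<partial>\<sigma>)"
proof (cases "4 * \<rho> \<le> 1")
  case True
  obtain g H where C: "C2_fun (Pi_proj s f) g H" "\<And>x. transpose (H x) = H x"
    "\<And>x. x \<in> S2 \<Longrightarrow> lap x (g x) (H x) = - real (s * (s + 1)) * Pi_proj s f x"
    using Pi_proj_C2_eigen[OF f, of s] by blast
  have "1 * 1 \<le> (real s * \<rho>) * (real s * \<rho>)" using s by (intro mult_mono) auto
  moreover have "real (s * (s + 1)) * (4 * \<rho>)\<^sup>2 = 16 * ((real s * \<rho>) * (real s * \<rho>)) + 16 * (real s * \<rho>\<^sup>2)"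
    by (simp add: power2_eq_square algebra_simps)
  moreover have "0 \<le> real s * \<rho>\<^sup>2" by simp
  ultimately have "real (s * (s + 1)) * (4 * \<rho>)\<^sup>2 \<ge> 10" by linarith
  moreover have "0 < (4 * \<rho>)\<^sup>2" "(4 * \<rho>)\<^sup>2 \<le> 1" using True \<rho> power_le_one[of "4 * \<rho>" 2] by auto
  ultimately have "(\<integral>x. (Pi_proj s f x)\<^sup>2 * indicator (cball e (2 * sqrt ((4 * \<rho>)\<^sup>2))) x \<partial>\<sigma>)
      \<le> 9 * sqrt ((4 * \<rho>)\<^sup>2) * (\<integral>x. (Pi_proj s f x)\<^sup>2 \<partial>\<sigma>)"
    by (intro ball_mass_aux[OF C e])
  moreover have "sqrt ((4 * \<rho>)\<^sup>2) = 4 * \<rho>" using \<rho> by (intro real_sqrt_unique) auto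
  ultimately show ?thesis by (simp only: mult.assoc[symmetric]) simp
next
  case False
  have i: "integrable \<sigma> (\<lambda>x. (Pi_proj s f x)\<^sup>2)"
    by (intro sphere_continuous_integrable continuous_intros Pi_proj_continuous f)
  have bi: "bfun (indicator (cball e (8 * \<rho>)))"
    by (rule bfun_indicator) simp
  have "(\<integral>x. (Pi_proj s f x)\<^sup>2 * indicator (cball e (8 * \<rho>)) x \<partial>\<sigma>) \<le> (\<integral>x. (Pi_proj s f x)\<^sup>2 \<partial>\<sigma>)"
    by (intro integral_mono i bfun_integrable bfun_mult[OF bfun_continuous bi] continuous_intros Pi_proj_continuous f)
      (auto simp: indicator_def)
  also have "\<dots> \<le> 36 * \<rho> * (\<integral>x. (Pi_proj s f x)\<^sup>2 \<partial>\<sigma>)"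
    using False mult_right_mono[of 1 "36 * \<rho>" "\<integral>x. (Pi_proj s f x)\<^sup>2 \<partial>\<sigma>"] by simp
  finally show ?thesis .
qed

section \<open>The reproducing kernel\<close>

lemma bfun_divide: "bfun f \<Longrightarrow> bfun (\<lambda>x. f x / c)"
  using bfun_cmult[of f "1 / c"] by simp

section \<open>Bounded functions of two points and their iterated integrals\<close>

definition bfun2 :: "(real^3 \<Rightarrow> real^3 \<Rightarrow> real) \<Rightarrow> bool" where
  "bfun2 h \<longleftrightarrow> case_prod h \<in> borel_measurable (\<sigma> \<Otimes>\<^sub>M \<sigma>) \<and> (\<exists>B. \<forall>x\<in>S2. \<forall>y\<in>S2. \<bar>h x y\<bar> \<le> B)"

lemma bfun2_mult: "bfun2 f \<Longrightarrow> bfun2 g \<Longrightarrow> bfun2 (\<lambda>x y. f x y * g x y)"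
  unfolding bfun2_def
proof (elim conjE exE, intro conjI)
  fix A B assume "\<forall>x\<in>S2. \<forall>y\<in>S2. \<bar>f x y\<bar> \<le> A" "\<forall>x\<in>S2. \<forall>y\<in>S2. \<bar>g x y\<bar> \<le> B"
  then have "\<forall>x\<in>S2. \<forall>y\<in>S2. \<bar>f x y * g x y\<bar> \<le> A * B"
    unfolding abs_mult by (meson abs_ge_zero order_trans mult_mono)
  then show "\<exists>B. \<forall>x\<in>S2. \<forall>y\<in>S2. \<bar>f x y * g x y\<bar> \<le> B" by blast
qed (simp add: split_beta')

lemma bfun2_add: "bfun2 f \<Longrightarrow> bfun2 g \<Longrightarrow> bfun2 (\<lambda>x y. f x y + g x y)"
  unfolding bfun2_def
proof (elim conjE exE, intro conjI)
  fix A B assume "\<forall>x\<in>S2. \<forall>y\<in>S2. \<bar>f x y\<bar> \<le> A" "\<forall>x\<in>S2. \<forall>y\<in>S2. \<bar>g x y\<bar> \<le> B"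
  then have "\<forall>x\<in>S2. \<forall>y\<in>S2. \<bar>f x y + g x y\<bar> \<le> A + B" by (meson abs_triangle_ineq add_mono order_trans)
  then show "\<exists>B. \<forall>x\<in>S2. \<forall>y\<in>S2. \<bar>f x y + g x y\<bar> \<le> B" by blast
qed (simp add: split_beta')

lemma bfun2_const: "bfun2 (\<lambda>x y. c)"
  by (auto simp: bfun2_def split_beta')

lemma bfun2_sum: "(\<And>i. i \<in> I \<Longrightarrow> bfun2 (f i)) \<Longrightarrow> bfun2 (\<lambda>x y. \<Sum>i\<in>I. f i x y)"
  by (induction I rule: infinite_finite_induct) (auto intro: bfun2_add bfun2_const)

lemma bfun2_diff: "bfun2 f \<Longrightarrow> bfun2 g \<Longrightarrow> bfun2 (\<lambda>x y. f x y - g x y)"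
  using bfun2_add[of f "\<lambda>x y. -1 * g x y"] bfun2_mult[OF bfun2_const, of g "-1"] by simp

lemma bfun2_abs: "bfun2 f \<Longrightarrow> bfun2 (\<lambda>x y. \<bar>f x y\<bar>)"
  by (auto simp: bfun2_def split_beta')

lemma bfun2_fst: "bfun f \<Longrightarrow> bfun2 (\<lambda>x y. f x)"
  and bfun2_snd: "bfun f \<Longrightarrow> bfun2 (\<lambda>x y. f y)"
  unfolding bfun_def bfun2_def by (auto simp: split_beta')

lemma bfun2_borel:
  assumes "(\<lambda>z. h (fst z) (snd z)) \<in> borel_measurable borel" "\<And>x y. x \<in> S2 \<Longrightarrow> y \<in> S2 \<Longrightarrow> \<bar>h x y\<bar> \<le> B"
  shows "bfun2 h"
proof -
  have [measurable]: "fst \<in> \<sigma> \<Otimes>\<^sub>M \<sigma> \<rightarrow>\<^sub>M borel" "snd \<in> \<sigma> \<Otimes>\<^sub>M \<sigma> \<rightarrow>\<^sub>M borel"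
    by (rule measurable_compose[OF measurable_fst measurable_ident_sphere],
        rule measurable_compose[OF measurable_snd measurable_ident_sphere])
  have "(\<lambda>z. (fst z, snd z)) \<in> \<sigma> \<Otimes>\<^sub>M \<sigma> \<rightarrow>\<^sub>M borel" by measurable
  from measurable_compose[OF this assms(1)] have "case_prod h \<in> borel_measurable (\<sigma> \<Otimes>\<^sub>M \<sigma>)"
    by (simp add: split_beta')
  then show ?thesis using assms(2) unfolding bfun2_def by blast
qed

lemma bfun2_section: "bfun2 h \<Longrightarrow> x \<in> S2 \<Longrightarrow> bfun (h x)"
  unfolding bfun2_def bfun_def
proof (elim conjE exE, intro conjI)
  assume "case_prod h \<in> borel_measurable (\<sigma> \<Otimes>\<^sub>M \<sigma>)" "x \<in> S2"
  then show "h x \<in> borel_measurable \<sigma>" using measurable_Pair2[of "case_prod h" \<sigma> \<sigma> borel x] by simp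
qed blast

lemma bfun2_integral:
  assumes "bfun2 h"
  shows "bfun (\<lambda>x. \<integral>y. h x y \<partial>\<sigma>)"
proof -
  obtain B where B: "\<And>x y. x \<in> S2 \<Longrightarrow> y \<in> S2 \<Longrightarrow> \<bar>h x y\<bar> \<le> B" using assms unfolding bfun2_def by blast
  have "\<bar>\<integral>y. h x y \<partial>\<sigma>\<bar> \<le> B * (4 * pi)" if x: "x \<in> S2" for x
  proof -
    have i: "integrable \<sigma> (h x)" by (intro bfun_integrable bfun2_section assms x)
    have "\<bar>\<integral>y. h x y \<partial>\<sigma>\<bar> \<le> (\<integral>y. \<bar>h x y\<bar> \<partial>\<sigma>)" by (rule integral_abs_bound)
    also have "\<dots> \<le> (\<integral>y. B \<partial>\<sigma>)" using i B[OF x] by (intro integral_mono) auto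
    finally show ?thesis by (simp add: measure_sphere_measure_space mult_ac)
  qed
  moreover have "(\<lambda>x. \<integral>y. h x y \<partial>\<sigma>) \<in> borel_measurable \<sigma>"
    using assms unfolding bfun2_def by (intro sph.borel_measurable_lebesgue_integral) (auto simp: split_beta')
  ultimately show ?thesis unfolding bfun_def by blast
qed

abbreviation dint :: "(real^3 \<Rightarrow> real^3 \<Rightarrow> real) \<Rightarrow> real" where
  "dint h \<equiv> (\<integral>x. (\<integral>y. h x y \<partial>\<sigma>) \<partial>\<sigma>)"

lemma dint_add: "bfun2 f \<Longrightarrow> bfun2 g \<Longrightarrow> dint (\<lambda>x y. f x y + g x y) = dint f + dint g"
proof -
  assume f: "bfun2 f" and g: "bfun2 g"
  have "dint (\<lambda>x y. f x y + g x y) = (\<integral>x. (\<integral>y. f x y \<partial>\<sigma>) + (\<integral>y. g x y \<partial>\<sigma>) \<partial>\<sigma>)"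
    by (rule Bochner_Integration.integral_cong[OF refl])
      (auto intro!: Bochner_Integration.integral_add bfun_integrable bfun2_section f g)
  then show ?thesis by (simp add: bfun_integrable bfun2_integral f g)
qed

lemma dint_sum: "(\<And>i. i \<in> I \<Longrightarrow> bfun2 (f i)) \<Longrightarrow> dint (\<lambda>x y. \<Sum>i\<in>I. f i x y) = (\<Sum>i\<in>I. dint (f i))"
proof (induction I rule: infinite_finite_induct)
  case (insert i I)
  have "dint (\<lambda>x y. f i x y + (\<Sum>i\<in>I. f i x y)) = dint (f i) + dint (\<lambda>x y. \<Sum>i\<in>I. f i x y)"
    by (intro dint_add bfun2_sum insert.prems) auto
  then show ?case using insert by simp
qed auto

lemma dint_mono:
  assumes "bfun2 f" "bfun2 g" "\<And>x y. x \<in> S2 \<Longrightarrow> y \<in> S2 \<Longrightarrow> f x y \<le> g x y"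
  shows "dint f \<le> dint g"
  by (intro integral_mono bfun_integrable bfun2_integral bfun2_section assms) (auto intro: assms)

lemma abs_dint_le:
  assumes "bfun2 f"
  shows "\<bar>dint f\<bar> \<le> dint (\<lambda>x y. \<bar>f x y\<bar>)"
proof -
  have "\<bar>dint f\<bar> \<le> (\<integral>x. \<bar>\<integral>y. f x y \<partial>\<sigma>\<bar> \<partial>\<sigma>)" by (rule integral_abs_bound)
  also have "\<dots> \<le> dint (\<lambda>x y. \<bar>f x y\<bar>)"
    by (intro integral_mono integrable_abs bfun_integrable bfun2_integral bfun2_abs assms integral_abs_bound)
  finally show ?thesis .
qed

section \<open>Size and localisation of the kernel\<close>

definition kern :: "nat \<Rightarrow> real^3 \<Rightarrow> real^3 \<Rightarrow> real" where
  "kern s x y = (2 * real s + 1) / (4 * pi) * poly (legendre s) (x \<bullet> y)"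

lemma bfun2_kern: "bfun2 (kern s)"
proof (rule bfun2_borel[where B = "(2 * real s + 1) / (4 * pi) * 1"])
  show "(\<lambda>z. kern s (fst z) (snd z)) \<in> borel_measurable borel"
    unfolding kern_def by (intro borel_measurable_continuous_onI continuous_intros)
  fix x y :: "real^3" assume "x \<in> S2" "y \<in> S2"
  then show "\<bar>kern s x y\<bar> \<le> (2 * real s + 1) / (4 * pi) * 1"
    unfolding kern_def abs_mult using abs_legendre_le_1[OF sphere_inner_bound[of x y]]
    by (intro mult_mono) auto
qed

lemma Pi_proj_kern: "Pi_proj s f x = (\<integral>y. kern s x y * f y \<partial>\<sigma>)"
  by (simp add: Pi_proj_def zonal_conv_def kern_def mult.assoc)

lemma Pi_proj_dint: "(\<integral>x. Pi_proj s f x * g x \<partial>\<sigma>) = dint (\<lambda>x y. kern s x y * f y * g x)"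
  unfolding Pi_proj_kern by simp

lemma kern_const_le:
  assumes "s \<ge> 1"
  shows "(2 * real s + 1) / (4 * pi) \<le> real s"
proof -
  have "2 * real s + 1 \<le> 3 * real s" using assms by simp
  also have "\<dots> \<le> real s * (4 * pi)" using mult_left_mono[of 3 "4 * pi" "real s"] pi_gt3 by (simp add: mult.commute)
  finally show ?thesis by (simp add: pos_divide_le_eq)
qed

lemma kern_bound: "s \<ge> 1 \<Longrightarrow> x \<in> S2 \<Longrightarrow> y \<in> S2 \<Longrightarrow> \<bar>kern s x y\<bar> \<le> real s"
proof -
  assume s: "s \<ge> 1" and xy: "x \<in> S2" "y \<in> S2"
  have "\<bar>kern s x y\<bar> \<le> (2 * real s + 1) / (4 * pi) * 1"
    unfolding kern_def abs_mult using abs_legendre_le_1[OF sphere_inner_bound[OF xy]]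
    by (intro mult_mono) auto
  also have "\<dots> \<le> real s"
    using kern_const_le[OF s] by simp
  finally show ?thesis .
qed

text \<open>Antipodes are excluded as well: Legendre polynomials are even or odd, so the kernel is
  as large at -x as at x.\<close>

definition far :: "real \<Rightarrow> real^3 \<Rightarrow> real^3 \<Rightarrow> bool" where
  "far \<rho> x y \<longleftrightarrow> \<rho> \<le> norm (x - y) \<and> \<rho> \<le> norm (x + y)"

text \<open>Distance at least \<rho> from both poles gives 1 - z^2 >= \<rho>^2/2, so the sine of the
  angle is at least \<rho> / sqrt 2 and \<open>legendre_bernstein\<close> applies.\<close>

lemma far_kern_bound:
  assumes s: "s \<ge> 1" and xy: "x \<in> S2" "y \<in> S2" and \<rho>: "\<rho> > 0" and f: "far \<rho> x y"
  shows "\<bar>kern s x y\<bar> \<le> 2 * sqrt (real s / \<rho>)"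
proof -
  define z where "z = x \<bullet> y"
  have z: "\<bar>z\<bar> \<le> 1" unfolding z_def by (rule sphere_inner_bound[OF xy])
  have n1: "(norm (x - y))\<^sup>2 = 2 - 2 * z" and n2: "(norm (x + y))\<^sup>2 = 2 + 2 * z"
    using sphere_inner_self[OF xy(1)] sphere_inner_self[OF xy(2)]
    by (simp_all add: power2_norm_eq_inner inner_diff_left inner_diff_right inner_add_left inner_add_right inner_commute z_def)
  have r1: "\<rho>\<^sup>2 \<le> 2 - 2 * z" unfolding n1[symmetric] using f \<rho> by (intro power_mono) (auto simp: far_def)
  have r2: "\<rho>\<^sup>2 \<le> 2 + 2 * z" unfolding n2[symmetric] using f \<rho> by (intro power_mono) (auto simp: far_def)
  have "\<rho>\<^sup>2 / 2 \<le> 1 - z\<^sup>2"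
  proof -
    have "\<rho>\<^sup>2 / 2 \<le> 1 - \<bar>z\<bar>" using r1 r2 by (auto simp: abs_if)
    also have "\<dots> \<le> (1 - \<bar>z\<bar>) * (1 + \<bar>z\<bar>)" using z mult_left_mono[of 1 "1 + \<bar>z\<bar>" "1 - \<bar>z\<bar>"] by simp
    also have "\<dots> = 1 - z\<^sup>2" by (simp add: power2_eq_square algebra_simps)
    finally show ?thesis .
  qed
  then have q: "sqrt (\<rho>\<^sup>2 / 2) \<le> sqrt (1 - z\<^sup>2)" by simp
  have sq: "sqrt (\<rho>\<^sup>2 / 2) = \<rho> / sqrt 2" using \<rho> by (simp add: real_sqrt_divide)
  define P where "P = poly (legendre s) z"
  have "\<rho> / sqrt 2 * P\<^sup>2 \<le> sqrt (1 - z\<^sup>2) * P\<^sup>2" using q sq by (intro mult_right_mono) auto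
  also have "\<dots> \<le> 2 / real s" unfolding P_def by (rule legendre_bernstein[OF s z])
  finally have P1: "P\<^sup>2 \<le> 2 * sqrt 2 / (real s * \<rho>)" using s \<rho> by (simp add: field_simps)
  define c where "c = (2 * real s + 1) / (4 * pi)"
  have c0: "c \<ge> 0" by (simp add: c_def)
  have c: "c \<le> real s" unfolding c_def by (rule kern_const_le[OF s])
  have "(kern s x y)\<^sup>2 = c\<^sup>2 * P\<^sup>2" by (simp add: kern_def c_def P_def z_def power_mult_distrib power_divide)
  also have "\<dots> \<le> (real s)\<^sup>2 * (2 * sqrt 2 / (real s * \<rho>))" using c c0 P1 by (intro mult_mono power_mono) auto
  also have "\<dots> = 2 * sqrt 2 * (real s / \<rho>)" using s \<rho> by (simp add: power2_eq_square field_simps)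
  also have "\<dots> \<le> 4 * (real s / \<rho>)" using \<rho> sqrt2_less_2 by (intro mult_right_mono) auto
  finally have "(kern s x y)\<^sup>2 \<le> 4 * (real s / \<rho>)" .
  then have "sqrt ((kern s x y)\<^sup>2) \<le> sqrt (4 * (real s / \<rho>))" by (rule real_sqrt_le_mono)
  then show ?thesis by (simp only: real_sqrt_mult real_sqrt_four real_sqrt_abs)
qed

text \<open>
  The \<open>T T\<^sup>*\<close> form of the ball estimate: restricting to balls of radius \<open>\<rho>\<close> on both sides
  gives an operator of norm \<open>O(\<rho>)\<close>.
\<close>

lemma local_projection_bound:
  assumes f: "bfun f" and S: "S \<in> sets borel" "e \<in> S2" "S \<inter> S2 \<subseteq> cball e (8 * \<rho>)"
    and s: "real s * \<rho> \<ge> 1" and \<rho>: "\<rho> > 0"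
  shows "(\<integral>x. (Pi_proj s (\<lambda>x. indicator S x * f x) x)\<^sup>2 \<partial>\<sigma>) \<le> 36 * \<rho> * (\<integral>x. indicator S x * (f x)\<^sup>2 \<partial>\<sigma>)"
proof -
  define h where "h = (\<lambda>x. indicator S x * f x)"
  have h: "bfun h" unfolding h_def by (intro bfun_mult bfun_indicator S f)
  define \<phi> where "\<phi> = Pi_proj s h"
  have p: "bfun \<phi>" unfolding \<phi>_def by (rule bfun_Pi_proj[OF h])
  define B where "B = (\<lambda>x. indicator (cball e (8 * \<rho>)) x :: real)"
  have B: "bfun B" unfolding B_def by (rule bfun_indicator) simp
  have sq: "bfun (\<lambda>x. (h x)\<^sup>2)" "bfun (\<lambda>x. (\<phi> x)\<^sup>2 * B x)"
    unfolding power2_eq_square by (intro bfun_mult h p B)+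
  have "(\<integral>x. (\<phi> x)\<^sup>2 \<partial>\<sigma>) = (\<integral>x. \<phi> x * h x \<partial>\<sigma>)"
    using Pi_proj_inner[OF h h, of s] by (simp add: \<phi>_def power2_eq_square)
  \<comment> \<open>The arithmetic-geometric mean inequality with weight 36 \<rho>. As
    \<open>h\<close> lives on \<open>S\<close>, the \<phi>^2 term may be restricted to the ball,
    where \<open>ball_mass\<close> makes it half of the left-hand side, ready to be
    absorbed.\<close>
  also have "\<dots> \<le> (\<integral>x. (36 * \<rho>) / 2 * (h x)\<^sup>2 + (1 / (72 * \<rho>)) * ((\<phi> x)\<^sup>2 * B x) \<partial>\<sigma>)"
  proof (rule integral_mono)
    show "integrable \<sigma> (\<lambda>x. \<phi> x * h x)" by (intro bfun_integrable bfun_mult p h)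
    show "integrable \<sigma> (\<lambda>x. (36 * \<rho>) / 2 * (h x)\<^sup>2 + (1 / (72 * \<rho>)) * ((\<phi> x)\<^sup>2 * B x))"
      by (intro bfun_integrable bfun_add bfun_cmult sq)
    fix x assume "x \<in> space \<sigma>"
    then have x: "x \<in> S2" by simp
    show "\<phi> x * h x \<le> (36 * \<rho>) / 2 * (h x)\<^sup>2 + (1 / (72 * \<rho>)) * ((\<phi> x)\<^sup>2 * B x)"
    proof (cases "x \<in> S")
      case True
      then have Bx: "B x = 1" using S x by (auto simp: B_def)
      define t where "t = 36 * \<rho>"
      have t: "t > 0" using \<rho> by (simp add: t_def)
      have "0 \<le> (t * h x - \<phi> x)\<^sup>2 / (2 * t)" using t by simp
      also have "\<dots> = t / 2 * (h x)\<^sup>2 + (1 / (2 * t)) * (\<phi> x)\<^sup>2 - \<phi> x * h x"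
        using t by (simp add: power2_diff power2_eq_square field_simps)
      finally show ?thesis unfolding Bx t_def by simp
    next
      case False
      then have "h x = 0" by (simp add: h_def)
      then show ?thesis using \<rho> by (simp add: B_def)
    qed
  qed
  also have "\<dots> = 18 * \<rho> * (\<integral>x. (h x)\<^sup>2 \<partial>\<sigma>) + (1 / (72 * \<rho>)) * (\<integral>x. (\<phi> x)\<^sup>2 * B x \<partial>\<sigma>)"
    using sq by (simp add: bfun_integrable)
  also have "(1 / (72 * \<rho>)) * (\<integral>x. (\<phi> x)\<^sup>2 * B x \<partial>\<sigma>) \<le> (1 / (72 * \<rho>)) * (36 * \<rho> * (\<integral>x. (\<phi> x)\<^sup>2 \<partial>\<sigma>))"
    using ball_mass[OF h S(2) s \<rho>] \<rho> unfolding \<phi>_def B_def by (intro mult_left_mono) auto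
  also have "\<dots> = (\<integral>x. (\<phi> x)\<^sup>2 \<partial>\<sigma>) / 2" using \<rho> by simp
  finally have "(\<integral>x. (\<phi> x)\<^sup>2 \<partial>\<sigma>) \<le> 36 * \<rho> * (\<integral>x. (h x)\<^sup>2 \<partial>\<sigma>)" by simp
  also have "(\<integral>x. (h x)\<^sup>2 \<partial>\<sigma>) = (\<integral>x. indicator S x * (f x)\<^sup>2 \<partial>\<sigma>)"
    by (rule Bochner_Integration.integral_cong) (auto simp: h_def indicator_def)
  finally show ?thesis unfolding \<phi>_def h_def .
qed

text \<open>Idempotence puts the projection on both factors. A sum of two energies, rather than a
  product of norms, is what adds up well over the cells of a partition.\<close>

lemma local_bilinear_bound:
  assumes f: "bfun f" and g: "bfun g"
    and S: "S \<in> sets borel" "e \<in> S2" "S \<inter> S2 \<subseteq> cball e (8 * \<rho>)"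
    and S': "S' \<in> sets borel" "e' \<in> S2" "S' \<inter> S2 \<subseteq> cball e' (8 * \<rho>)"
    and s: "real s * \<rho> \<ge> 1" and \<rho>: "\<rho> > 0"
  shows "\<bar>\<integral>x. Pi_proj s (\<lambda>x. indicator S x * f x) x * (indicator S' x * g x) \<partial>\<sigma>\<bar>
      \<le> 18 * \<rho> * ((\<integral>x. indicator S x * (f x)\<^sup>2 \<partial>\<sigma>) + (\<integral>x. indicator S' x * (g x)\<^sup>2 \<partial>\<sigma>))"
proof -
  define h h' where "h = (\<lambda>x. indicator S x * f x)" and "h' = (\<lambda>x. indicator S' x * g x)"
  have h: "bfun h" "bfun h'" unfolding h_def h'_def by (intro bfun_mult bfun_indicator S S' f g)+
  note p = bfun_Pi_proj[OF h(1), of s] bfun_Pi_proj[OF h(2), of s]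
  have sq: "bfun (\<lambda>x. (Pi_proj s h x)\<^sup>2)" "bfun (\<lambda>x. (Pi_proj s h' x)\<^sup>2)"
    unfolding power2_eq_square by (intro bfun_mult p)+
  have "(\<integral>x. Pi_proj s h x * h' x \<partial>\<sigma>) = (\<integral>x. Pi_proj s h x * Pi_proj s h' x \<partial>\<sigma>)"
    by (rule Pi_proj_inner[OF h, symmetric])
  also have "\<bar>\<dots>\<bar> \<le> (\<integral>x. \<bar>Pi_proj s h x * Pi_proj s h' x\<bar> \<partial>\<sigma>)" by (rule integral_abs_bound)
  also have "\<dots> \<le> (\<integral>x. (Pi_proj s h x)\<^sup>2 / 2 + (Pi_proj s h' x)\<^sup>2 / 2 \<partial>\<sigma>)"
  proof (rule integral_mono)
    show "integrable \<sigma> (\<lambda>x. \<bar>Pi_proj s h x * Pi_proj s h' x\<bar>)" by (intro integrable_abs bfun_integrable bfun_mult p)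
    show "integrable \<sigma> (\<lambda>x. (Pi_proj s h x)\<^sup>2 / 2 + (Pi_proj s h' x)\<^sup>2 / 2)" by (intro bfun_integrable bfun_add bfun_divide sq)
    fix x
    have "0 \<le> (\<bar>Pi_proj s h x\<bar> - \<bar>Pi_proj s h' x\<bar>)\<^sup>2" by simp
    then show "\<bar>Pi_proj s h x * Pi_proj s h' x\<bar> \<le> (Pi_proj s h x)\<^sup>2 / 2 + (Pi_proj s h' x)\<^sup>2 / 2"
      by (simp add: power2_diff abs_mult)
  qed
  also have "\<dots> = (\<integral>x. (Pi_proj s h x)\<^sup>2 \<partial>\<sigma>) / 2 + (\<integral>x. (Pi_proj s h' x)\<^sup>2 \<partial>\<sigma>) / 2"
    using sq by (simp add: bfun_integrable)
  also have "\<dots> \<le> 36 * \<rho> * (\<integral>x. indicator S x * (f x)\<^sup>2 \<partial>\<sigma>) / 2 + 36 * \<rho> * (\<integral>x. indicator S' x * (g x)\<^sup>2 \<partial>\<sigma>) / 2"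
    unfolding h_def h'_def
    by (intro add_mono divide_right_mono local_projection_bound[OF f S s \<rho>] local_projection_bound[OF g S' s \<rho>]) auto
  finally show ?thesis unfolding h_def h'_def by (simp add: algebra_simps)
qed

section \<open>Decomposition of pairs of points along a cubic grid\<close>

definition cell :: "real \<Rightarrow> real^3 \<Rightarrow> int^3" where
  "cell \<rho> x = (\<chi> i. \<lfloor>x$i / \<rho>\<rfloor>)"

text \<open>The offsets from a cube to itself and to the cubes touching it.\<close>

definition adj :: "(int^3) set" where "adj = {\<delta>. \<forall>i. \<delta>$i \<in> {-1, 0, 1}}"

lemma finite_vec_set:
  assumes "finite S"
  shows "finite {v::'a^'n. \<forall>i. v$i \<in> S}"
proof -
  have "{v::'a^'n. \<forall>i. v$i \<in> S} \<subseteq> vec_lambda ` (UNIV \<rightarrow>\<^sub>E S)"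
  proof
    fix v :: "'a^'n" assume "v \<in> {v. \<forall>i. v$i \<in> S}"
    then show "v \<in> vec_lambda ` (UNIV \<rightarrow>\<^sub>E S)" by (intro image_eqI[of _ _ "vec_nth v"]) auto
  qed
  moreover have "finite (vec_lambda ` (UNIV \<rightarrow>\<^sub>E S) :: ('a^'n) set)" by (intro finite_imageI finite_PiE assms) auto
  ultimately show ?thesis by (rule finite_subset)
qed

lemma finite_adj: "finite adj"
  unfolding adj_def by (rule finite_vec_set) simp

lemma finite_cells:
  assumes "\<rho> > 0"
  shows "finite (cell \<rho> ` S2)"
proof (rule finite_subset)
  show "cell \<rho> ` S2 \<subseteq> {v. \<forall>i. v$i \<in> {\<lfloor>-1 / \<rho>\<rfloor>..\<lfloor>1 / \<rho>\<rfloor>}}"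
  proof (clarsimp simp: cell_def)
    fix x :: "real^3" and i assume "norm x = 1"
    then have "\<bar>x$i\<bar> \<le> 1" using component_le_norm_cart[of x i] by simp
    then have "-1 \<le> x$i" "x$i \<le> 1" by auto
    then show "\<lfloor>- (1 / \<rho>)\<rfloor> \<le> \<lfloor>x$i / \<rho>\<rfloor> \<and> \<lfloor>x$i / \<rho>\<rfloor> \<le> \<lfloor>1 / \<rho>\<rfloor>"
      using assms by (intro conjI floor_mono) (auto simp: field_simps)
  qed
qed (rule finite_vec_set, simp)

lemma cell_measurable: "{x. cell \<rho> x = c} \<in> sets borel"
proof -
  have "{x. cell \<rho> x = c} = (\<Inter>i\<in>UNIV. {x. \<lfloor>x$i / \<rho>\<rfloor> = c$i})"
    by (auto simp: cell_def vec_eq_iff)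
  also have "\<dots> \<in> sets borel"
  proof (rule sets.finite_INT)
    fix i
    have "{x::real^3. \<lfloor>x$i / \<rho>\<rfloor> = c$i} = {x. real_of_int (c$i) \<le> x$i / \<rho>} \<inter> {x. x$i / \<rho> < real_of_int (c$i) + 1}"
      by (auto simp: floor_eq_iff)
    also have "\<dots> \<in> sets borel"
    proof (rule sets.Int)
      have c: "continuous_on UNIV (\<lambda>x::real^3. x$i / \<rho>)" unfolding divide_inverse by (intro continuous_intros)
      show "{x::real^3. real_of_int (c$i) \<le> x$i / \<rho>} \<in> sets borel"
        by (intro borel_closed closed_Collect_le continuous_intros c)
      show "{x::real^3. x$i / \<rho> < real_of_int (c$i) + 1} \<in> sets borel"
        by (intro borel_open open_Collect_less continuous_intros c)
    qed
    finally show "{x::real^3. \<lfloor>x$i / \<rho>\<rfloor> = c$i} \<in> sets borel" .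
  qed auto
  finally show ?thesis .
qed

lemma norm_le_3:
  fixes v :: "real^3"
  assumes "\<And>i. \<bar>v$i\<bar> \<le> t"
  shows "norm v \<le> 3 * t"
  using norm_le_l1_cart[of v] assms[of 1] assms[of 2] assms[of 3] by (simp add: sum_3)

lemma cell_near:
  assumes "\<rho> > 0" "cell \<rho> y - cell \<rho> x \<in> adj"
  shows "norm (x - y) \<le> 6 * \<rho>"
proof -
  have "\<bar>(x - y)$i\<bar> \<le> 2 * \<rho>" for i
  proof -
    have "\<lfloor>y$i / \<rho>\<rfloor> - \<lfloor>x$i / \<rho>\<rfloor> \<in> {-1, 0, 1}" using assms(2) by (auto simp: adj_def cell_def)
    then have "\<bar>x$i / \<rho> - y$i / \<rho>\<bar> \<le> 2" by auto linarith+
    then show ?thesis using assms(1) by (simp add: abs_le_iff field_simps)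
  qed
  then show ?thesis using norm_le_3[of "x - y" "2 * \<rho>"] by simp
qed

lemma cell_far:
  assumes "\<rho> > 0" "cell \<rho> y - cell \<rho> x \<notin> adj"
  shows "\<rho> \<le> norm (x - y)"
proof -
  obtain i where "\<lfloor>y$i / \<rho>\<rfloor> - \<lfloor>x$i / \<rho>\<rfloor> \<notin> {-1, 0, 1}" using assms(2) by (auto simp: adj_def cell_def)
  then have "\<bar>x$i / \<rho> - y$i / \<rho>\<bar> \<ge> 1" by auto linarith
  then have "\<bar>(x - y)$i\<bar> \<ge> \<rho>" using assms(1) by (simp add: abs_if field_simps split: if_splits)
  then show ?thesis using component_le_norm_cart[of "x - y" i] by linarith
qed

lemma cell_same: "\<rho> > 0 \<Longrightarrow> cell \<rho> x = cell \<rho> y \<Longrightarrow> norm (x - y) \<le> 8 * \<rho>"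
  using cell_near[of \<rho> y x] by (force simp: adj_def)

text \<open>Each offset costs 18, once for the cells around x and once for those around -x; the
  summand 3 serves the trivial case \<rho> >= 1/6.\<close>

definition near_const :: real where "near_const = 36 * real (card adj) + 3"

text \<open>Pairs of points whose grid cells are adjacent, directly or after passing to -x, are
  handled cell by cell with \<open>local_bilinear_bound\<close>; all other pairs are far, and there
  absolute values are taken.\<close>

lemma near_far:
  assumes f: "bfun f" and g: "bfun g" and s: "real s * \<rho> \<ge> 1" and \<rho>: "\<rho> > 0"
  shows "\<bar>\<integral>x. Pi_proj s f x * g x \<partial>\<sigma>\<bar>
     \<le> near_const * \<rho> * ((\<integral>x. (f x)\<^sup>2 \<partial>\<sigma>) + (\<integral>x. (g x)\<^sup>2 \<partial>\<sigma>))
       + dint (\<lambda>x y. of_bool (far \<rho> x y) * \<bar>kern s x y\<bar> * \<bar>f y\<bar> * \<bar>g x\<bar>)"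
proof -
  define F2 G2 where "F2 = (\<integral>x. (f x)\<^sup>2 \<partial>\<sigma>)" and "G2 = (\<integral>x. (g x)\<^sup>2 \<partial>\<sigma>)"
  have FG0: "F2 \<ge> 0" "G2 \<ge> 0" by (simp_all add: F2_def G2_def)
  have sq: "bfun (\<lambda>x. (f x)\<^sup>2)" "bfun (\<lambda>x. (g x)\<^sup>2)" unfolding power2_eq_square by (intro bfun_mult f g)+
  have farb: "bfun2 (\<lambda>x y. of_bool (far \<rho> x y))"
  proof (rule bfun2_borel[where B = 1])
    show "(\<lambda>z. of_bool (far \<rho> (fst z) (snd z)) :: real) \<in> borel_measurable borel"
    proof -
      have e: "(\<lambda>z. of_bool (far \<rho> (fst z) (snd z)) :: real)
        = indicator ({z. \<rho> \<le> norm (fst z - snd z)} \<inter> {z. \<rho> \<le> norm (fst z + snd z)})"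
        by (auto simp: fun_eq_iff far_def indicator_def)
      show ?thesis unfolding e
        by (intro borel_measurable_indicator sets.Int borel_closed closed_Collect_le continuous_intros)
    qed
  qed auto
  have kfg: "bfun2 (\<lambda>x y. kern s x y * f y * g x)" by (intro bfun2_mult bfun2_kern bfun2_fst bfun2_snd f g)
  have farint: "bfun2 (\<lambda>x y. of_bool (far \<rho> x y) * \<bar>kern s x y\<bar> * \<bar>f y\<bar> * \<bar>g x\<bar>)"
    by (intro bfun2_mult farb bfun2_abs[OF bfun2_kern] bfun2_abs[OF bfun2_fst] bfun2_abs[OF bfun2_snd] f g)
  show ?thesis
  \<comment> \<open>For large \<rho> the contraction property of the projection is enough; small
    \<rho> is needed to separate x from -x.\<close>
  proof (cases "\<rho> < 1 / 6")
    case False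
    have p: "bfun (Pi_proj s f)" by (rule bfun_Pi_proj[OF f])
    have psq: "bfun (\<lambda>x. (Pi_proj s f x)\<^sup>2)" unfolding power2_eq_square by (intro bfun_mult p)
    have "\<bar>\<integral>x. Pi_proj s f x * g x \<partial>\<sigma>\<bar> \<le> (\<integral>x. \<bar>Pi_proj s f x * g x\<bar> \<partial>\<sigma>)" by (rule integral_abs_bound)
    also have "\<dots> \<le> (\<integral>x. (Pi_proj s f x)\<^sup>2 / 2 + (g x)\<^sup>2 / 2 \<partial>\<sigma>)"
    proof (rule integral_mono)
      show "integrable \<sigma> (\<lambda>x. \<bar>Pi_proj s f x * g x\<bar>)" by (intro integrable_abs bfun_integrable bfun_mult p g)
      show "integrable \<sigma> (\<lambda>x. (Pi_proj s f x)\<^sup>2 / 2 + (g x)\<^sup>2 / 2)" by (intro bfun_integrable bfun_add bfun_divide sq psq)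
      fix x
      have "0 \<le> (\<bar>Pi_proj s f x\<bar> - \<bar>g x\<bar>)\<^sup>2" by simp
      then show "\<bar>Pi_proj s f x * g x\<bar> \<le> (Pi_proj s f x)\<^sup>2 / 2 + (g x)\<^sup>2 / 2"
        by (simp add: power2_diff abs_mult)
    qed
    also have "\<dots> = (\<integral>x. (Pi_proj s f x)\<^sup>2 \<partial>\<sigma>) / 2 + G2 / 2"
      using psq sq by (simp add: bfun_integrable G2_def)
    also have "\<dots> \<le> F2 / 2 + G2 / 2" unfolding F2_def using Pi_proj_contraction[OF f] by simp
    also have "\<dots> \<le> near_const * \<rho> * (F2 + G2)"
    proof -
      have "1 / 2 \<le> 3 * \<rho>" using False by simp
      also have "\<dots> \<le> near_const * \<rho>" using \<rho> by (intro mult_right_mono) (auto simp: near_const_def)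
      finally have "1 / 2 * (F2 + G2) \<le> near_const * \<rho> * (F2 + G2)" using FG0 by (intro mult_right_mono) auto
      then show ?thesis by simp
    qed
    also have "\<dots> \<le> near_const * \<rho> * (F2 + G2) + dint (\<lambda>x y. of_bool (far \<rho> x y) * \<bar>kern s x y\<bar> * \<bar>f y\<bar> * \<bar>g x\<bar>)"
      by simp
    finally show ?thesis unfolding F2_def G2_def .
  next
    case True
    define I where "I = cell \<rho> ` S2"
    have I: "finite I" unfolding I_def by (rule finite_cells[OF \<rho>])
    define A A' where "A = (\<lambda>c. {x. cell \<rho> x = c})" and "A' = (\<lambda>c. {x. cell \<rho> (- x) = c})"
    have A: "A c \<in> sets borel" for c unfolding A_def by (rule cell_measurable)
    have A': "A' c \<in> sets borel" for c
    proof -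
      have "A' c = uminus -` A c \<inter> space borel" by (auto simp: A_def A'_def)
      also have "\<dots> \<in> sets borel" by (rule measurable_sets[OF _ A]) simp
      finally show ?thesis .
    qed
    have Ab: "\<exists>e\<in>S2. A c \<inter> S2 \<subseteq> cball e (8 * \<rho>)" for c
    proof (cases "A c \<inter> S2 = {}")
      case True
      then show ?thesis by (intro bexI[of _ "axis 1 1"]) auto
    next
      case False
      then obtain e where e: "e \<in> A c" "e \<in> S2" by auto
      then have "A c \<inter> S2 \<subseteq> cball e (8 * \<rho>)" using cell_same[OF \<rho>, of e] by (auto simp: A_def dist_norm)
      then show ?thesis using e by blast
    qed
    have A'b: "\<exists>e\<in>S2. A' c \<inter> S2 \<subseteq> cball e (8 * \<rho>)" for c
    proof (cases "A' c \<inter> S2 = {}")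
      case True
      then show ?thesis by (intro bexI[of _ "axis 1 1"]) auto
    next
      case False
      then obtain e where e: "e \<in> A' c" "e \<in> S2" by auto
      then have "A' c \<inter> S2 \<subseteq> cball e (8 * \<rho>)" using cell_same[OF \<rho>, of "- _" "- _"]
        by (fastforce simp: A'_def dist_norm norm_minus_commute)
      then show ?thesis using e by blast
    qed
    define t :: "(int^3 \<Rightarrow> (real^3) set) \<Rightarrow> int^3 \<Rightarrow> int^3 \<Rightarrow> real^3 \<Rightarrow> real^3 \<Rightarrow> real"
      where "t = (\<lambda>X \<delta> c x y. indicator (X c) x * indicator (A (c + \<delta>)) y :: real)"
    \<comment> \<open>A cutoff equal to 1 on adjacent pairs, written as a sum over offset and cell
      so that every summand is a product of a function of x and a function of y.\<close>
    define h where "h = (\<lambda>x y. (\<Sum>\<delta>\<in>adj. \<Sum>c\<in>I. t A \<delta> c x y) + (\<Sum>\<delta>\<in>adj. \<Sum>c\<in>I. t A' \<delta> c x y))"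
    have tsum: "(\<Sum>\<delta>\<in>adj. \<Sum>c\<in>I. of_bool (d = c) * indicator (A (c + \<delta>)) y) = (of_bool (cell \<rho> y - d \<in> adj) :: real)" if "d \<in> I" for d y
    proof -
      have "(\<Sum>c\<in>I. of_bool (d = c) * indicator (A (c + \<delta>)) y) = (of_bool (cell \<rho> y - d = \<delta>) :: real)" for \<delta>
      proof -
        have "(\<Sum>c\<in>I. of_bool (d = c) * indicator (A (c + \<delta>)) y) = (\<Sum>c\<in>I. if d = c then indicator (A (d + \<delta>)) y else (0::real))"
          by (intro sum.cong) auto
        also have "\<dots> = indicator (A (d + \<delta>)) y" using I that by simp
        also have "\<dots> = of_bool (cell \<rho> y - d = \<delta>)" by (auto simp: A_def indicator_def algebra_simps)
        finally show ?thesis .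
      qed
      then have "(\<Sum>\<delta>\<in>adj. \<Sum>c\<in>I. of_bool (d = c) * indicator (A (c + \<delta>)) y) = (\<Sum>\<delta>\<in>adj. if cell \<rho> y - d = \<delta> then (1::real) else 0)"
        by (intro sum.cong) auto
      then show ?thesis using finite_adj by simp
    qed
    have hval: "h x y = of_bool (cell \<rho> y - cell \<rho> x \<in> adj) + of_bool (cell \<rho> y - cell \<rho> (- x) \<in> adj)" if x: "x \<in> S2" for x y
    proof -
      have "cell \<rho> x \<in> I" "cell \<rho> (- x) \<in> I" using x by (auto simp: I_def)
      moreover have "t A \<delta> c x y = of_bool (cell \<rho> x = c) * indicator (A (c + \<delta>)) y"
        "t A' \<delta> c x y = of_bool (cell \<rho> (- x) = c) * indicator (A (c + \<delta>)) y" for \<delta> c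
        by (auto simp: t_def A_def A'_def indicator_def)
      ultimately show ?thesis unfolding h_def using tsum by simp
    qed
    have h1: "\<bar>1 - h x y\<bar> \<le> of_bool (far \<rho> x y)" if x: "x \<in> S2" and y: "y \<in> S2" for x y
    proof -
      \<comment> \<open>A point adjacent to both x and -x would give 2 <= 12 \<rho>. Hence the two
        families do not overlap and \<open>1 - h\<close> is 0 or 1.\<close>
      have nb: "\<not> (cell \<rho> y - cell \<rho> x \<in> adj \<and> cell \<rho> y - cell \<rho> (- x) \<in> adj)"
      proof
        assume a: "cell \<rho> y - cell \<rho> x \<in> adj \<and> cell \<rho> y - cell \<rho> (- x) \<in> adj"
        then have "norm (x - y) \<le> 6 * \<rho>" "norm (- x - y) \<le> 6 * \<rho>" using cell_near[OF \<rho>] by auto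
        moreover have "norm (2 *\<^sub>R x) \<le> norm (x - y) + norm (- x - y)"
          using norm_triangle_ineq4[of "x - y" "- x - y"] by (simp add: scaleR_2)
        ultimately show False using True x by simp
      qed
      show ?thesis
      proof (cases "far \<rho> x y")
        case True
        then show ?thesis unfolding hval[OF x] using nb by auto
      next
        case False
        then have "cell \<rho> y - cell \<rho> x \<in> adj \<or> cell \<rho> y - cell \<rho> (- x) \<in> adj"
          using cell_far[OF \<rho>, of y x] cell_far[OF \<rho>, of y "- x"]
          by (auto simp: far_def norm_minus_commute[of "- x" y] add.commute)
        then show ?thesis unfolding hval[OF x] using nb by auto
      qed
    qed
    have tb: "bfun2 (t X \<delta> c)" if "\<And>c. X c \<in> sets borel" for X \<delta> c
      unfolding t_def by (intro bfun2_mult bfun2_fst bfun2_snd bfun_indicator A that)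
    have hb: "bfun2 h" unfolding h_def by (intro bfun2_add bfun2_sum tb A A')
    define K where "K = (\<lambda>x y. kern s x y * f y * g x)"
    have Kb: "bfun2 K" unfolding K_def by (rule kfg)
    \<comment> \<open>For a fixed offset the cells are disjoint in x as well as in y, so the local
      energies add up to at most the total energy; only the number of offsets is lost.\<close>
    have piece: "\<bar>\<Sum>\<delta>\<in>adj. \<Sum>c\<in>I. dint (\<lambda>x y. t X \<delta> c x y * K x y)\<bar> \<le> real (card adj) * (18 * \<rho> * (F2 + G2))"
      if X: "\<And>c. X c \<in> sets borel" "\<And>c. \<exists>e\<in>S2. X c \<inter> S2 \<subseteq> cball e (8 * \<rho>)"
        and dis: "\<And>x. (\<Sum>c\<in>I. indicator (X c) x) \<le> (1::real)" for X
    proof -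
      have "\<bar>\<Sum>\<delta>\<in>adj. \<Sum>c\<in>I. dint (\<lambda>x y. t X \<delta> c x y * K x y)\<bar> \<le> (\<Sum>\<delta>\<in>adj. \<Sum>c\<in>I. \<bar>dint (\<lambda>x y. t X \<delta> c x y * K x y)\<bar>)"
        by (intro order_trans[OF sum_abs] sum_mono sum_abs)
      also have "\<dots> \<le> (\<Sum>\<delta>\<in>adj. \<Sum>c\<in>I. 18 * \<rho> * ((\<integral>x. indicator (A (c + \<delta>)) x * (f x)\<^sup>2 \<partial>\<sigma>) + (\<integral>x. indicator (X c) x * (g x)\<^sup>2 \<partial>\<sigma>)))"
      proof (intro sum_mono)
        fix \<delta> c
        obtain e where e: "e \<in> S2" "A (c + \<delta>) \<inter> S2 \<subseteq> cball e (8 * \<rho>)" using Ab by blast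
        obtain e' where e': "e' \<in> S2" "X c \<inter> S2 \<subseteq> cball e' (8 * \<rho>)" using X(2) by blast
        have "dint (\<lambda>x y. t X \<delta> c x y * K x y) = (\<integral>x. Pi_proj s (\<lambda>y. indicator (A (c + \<delta>)) y * f y) x * (indicator (X c) x * g x) \<partial>\<sigma>)"
          unfolding Pi_proj_dint t_def K_def by (simp add: mult_ac)
        then show "\<bar>dint (\<lambda>x y. t X \<delta> c x y * K x y)\<bar> \<le> 18 * \<rho> * ((\<integral>x. indicator (A (c + \<delta>)) x * (f x)\<^sup>2 \<partial>\<sigma>) + (\<integral>x. indicator (X c) x * (g x)\<^sup>2 \<partial>\<sigma>))"
          using local_bilinear_bound[OF f g A e X(1) e' s \<rho>] by simp
      qed
      also have "\<dots> = (\<Sum>\<delta>\<in>adj. 18 * \<rho> * ((\<integral>x. (\<Sum>c\<in>I. indicator (A (c + \<delta>)) x * (f x)\<^sup>2) \<partial>\<sigma>) + (\<integral>x. (\<Sum>c\<in>I. indicator (X c) x * (g x)\<^sup>2) \<partial>\<sigma>)))"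
        by (subst (1 2) Bochner_Integration.integral_sum)
          (auto simp: sum.distrib sum_distrib_left distrib_left intro!: bfun_integrable bfun_mult[OF bfun_indicator] sq A X)
      also have "\<dots> \<le> (\<Sum>\<delta>\<in>adj. 18 * \<rho> * (F2 + G2))"
      proof (intro sum_mono mult_left_mono add_mono)
        fix \<delta>
        have "(\<Sum>c\<in>I. indicator (A (c + \<delta>)) x) \<le> (1::real)" for x
        proof -
          have "(\<Sum>c\<in>I. indicator (A (c + \<delta>)) x) = (\<Sum>c\<in>I. if c = cell \<rho> x - \<delta> then (1::real) else 0)"
            by (intro sum.cong) (auto simp: A_def indicator_def algebra_simps)
          then show ?thesis using I by simp
        qed
        then have d2: "(\<Sum>c\<in>I. indicator (A (c + \<delta>)) x * (f x)\<^sup>2) \<le> (f x)\<^sup>2" for x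
          unfolding sum_distrib_right[symmetric] by (intro mult_left_le_one_le[of _ "sum _ _", simplified]) (auto intro!: sum_nonneg)
        show "(\<integral>x. (\<Sum>c\<in>I. indicator (A (c + \<delta>)) x * (f x)\<^sup>2) \<partial>\<sigma>) \<le> F2"
          unfolding F2_def using d2
          by (intro integral_mono Bochner_Integration.integrable_sum bfun_integrable bfun_mult[OF bfun_indicator] sq A) auto
        have d3: "(\<Sum>c\<in>I. indicator (X c) x * (g x)\<^sup>2) \<le> (g x)\<^sup>2" for x
          unfolding sum_distrib_right[symmetric] using dis[of x]
          by (intro mult_left_le_one_le[of _ "sum _ _", simplified]) (auto intro!: sum_nonneg)
        show "(\<integral>x. (\<Sum>c\<in>I. indicator (X c) x * (g x)\<^sup>2) \<partial>\<sigma>) \<le> G2"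
          unfolding G2_def using d3
          by (intro integral_mono Bochner_Integration.integrable_sum bfun_integrable bfun_mult[OF bfun_indicator] sq X) auto
      qed (use \<rho> in auto)
      also have "\<dots> = real (card adj) * (18 * \<rho> * (F2 + G2))" by simp
      finally show ?thesis .
    qed
    have d1: "(\<Sum>c\<in>I. indicator (A c) x) \<le> (1::real)" for x
    proof -
      have "(\<Sum>c\<in>I. indicator (A c) x) = (\<Sum>c\<in>I. if c = cell \<rho> x then (1::real) else 0)"
        by (intro sum.cong) (auto simp: A_def indicator_def)
      then show ?thesis using I by simp
    qed
    have d1': "(\<Sum>c\<in>I. indicator (A' c) x) \<le> (1::real)" for x
    proof -
      have "(\<Sum>c\<in>I. indicator (A' c) x) = (\<Sum>c\<in>I. if c = cell \<rho> (- x) then (1::real) else 0)"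
        by (intro sum.cong) (auto simp: A'_def indicator_def)
      then show ?thesis using I by simp
    qed
    have tK: "bfun2 (\<lambda>x y. t X \<delta> c x y * K x y)" if "\<And>c. X c \<in> sets borel" for X \<delta> c
      by (intro bfun2_mult tb Kb that)
    have split: "dint (\<lambda>x y. h x y * K x y) = (\<Sum>\<delta>\<in>adj. \<Sum>c\<in>I. dint (\<lambda>x y. t A \<delta> c x y * K x y)) + (\<Sum>\<delta>\<in>adj. \<Sum>c\<in>I. dint (\<lambda>x y. t A' \<delta> c x y * K x y))"
    proof -
      have "dint (\<lambda>x y. h x y * K x y) = dint (\<lambda>x y. (\<Sum>\<delta>\<in>adj. \<Sum>c\<in>I. t A \<delta> c x y * K x y) + (\<Sum>\<delta>\<in>adj. \<Sum>c\<in>I. t A' \<delta> c x y * K x y))"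
        unfolding h_def by (simp only: distrib_right sum_distrib_right)
      also have "\<dots> = dint (\<lambda>x y. \<Sum>\<delta>\<in>adj. \<Sum>c\<in>I. t A \<delta> c x y * K x y) + dint (\<lambda>x y. \<Sum>\<delta>\<in>adj. \<Sum>c\<in>I. t A' \<delta> c x y * K x y)"
        by (intro dint_add bfun2_sum tK A A')
      also have "dint (\<lambda>x y. \<Sum>\<delta>\<in>adj. \<Sum>c\<in>I. t A \<delta> c x y * K x y) = (\<Sum>\<delta>\<in>adj. \<Sum>c\<in>I. dint (\<lambda>x y. t A \<delta> c x y * K x y))"
        by (subst dint_sum, intro bfun2_sum tK A, intro sum.cong refl dint_sum tK A)
      also have "dint (\<lambda>x y. \<Sum>\<delta>\<in>adj. \<Sum>c\<in>I. t A' \<delta> c x y * K x y) = (\<Sum>\<delta>\<in>adj. \<Sum>c\<in>I. dint (\<lambda>x y. t A' \<delta> c x y * K x y))"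
        by (subst dint_sum, intro bfun2_sum tK A', intro sum.cong refl dint_sum tK A')
      finally show ?thesis .
    qed
    have rest: "\<bar>dint (\<lambda>x y. (1 - h x y) * K x y)\<bar> \<le> dint (\<lambda>x y. of_bool (far \<rho> x y) * \<bar>kern s x y\<bar> * \<bar>f y\<bar> * \<bar>g x\<bar>)"
    proof -
      have b: "bfun2 (\<lambda>x y. (1 - h x y) * K x y)" by (intro bfun2_mult bfun2_diff bfun2_const hb Kb)
      have "\<bar>dint (\<lambda>x y. (1 - h x y) * K x y)\<bar> \<le> dint (\<lambda>x y. \<bar>(1 - h x y) * K x y\<bar>)" by (rule abs_dint_le[OF b])
      also have "\<dots> \<le> dint (\<lambda>x y. of_bool (far \<rho> x y) * \<bar>kern s x y\<bar> * \<bar>f y\<bar> * \<bar>g x\<bar>)"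
      proof (intro dint_mono bfun2_abs[OF b] farint)
        fix x y assume "x \<in> S2" "y \<in> S2"
        from mult_right_mono[OF h1[OF this], of "\<bar>K x y\<bar>"]
        show "\<bar>(1 - h x y) * K x y\<bar> \<le> of_bool (far \<rho> x y) * \<bar>kern s x y\<bar> * \<bar>f y\<bar> * \<bar>g x\<bar>"
          by (simp add: K_def abs_mult mult_ac)
      qed
      finally show ?thesis .
    qed
    have "(\<integral>x. Pi_proj s f x * g x \<partial>\<sigma>) = dint (\<lambda>x y. h x y * K x y + (1 - h x y) * K x y)"
      unfolding Pi_proj_dint K_def by (simp add: algebra_simps)
    also have "\<dots> = dint (\<lambda>x y. h x y * K x y) + dint (\<lambda>x y. (1 - h x y) * K x y)"
      by (intro dint_add bfun2_mult bfun2_diff bfun2_const hb Kb)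
    finally have "\<bar>\<integral>x. Pi_proj s f x * g x \<partial>\<sigma>\<bar> \<le> real (card adj) * (18 * \<rho> * (F2 + G2)) + real (card adj) * (18 * \<rho> * (F2 + G2))
        + dint (\<lambda>x y. of_bool (far \<rho> x y) * \<bar>kern s x y\<bar> * \<bar>f y\<bar> * \<bar>g x\<bar>)"
      unfolding split using piece[OF A Ab d1] piece[OF A' A'b d1'] rest by linarith
    also have "real (card adj) * (18 * \<rho> * (F2 + G2)) + real (card adj) * (18 * \<rho> * (F2 + G2)) \<le> near_const * \<rho> * (F2 + G2)"
    proof -
      have "near_const * \<rho> * (F2 + G2) = real (card adj) * (18 * \<rho> * (F2 + G2)) + real (card adj) * (18 * \<rho> * (F2 + G2)) + 3 * \<rho> * (F2 + G2)"
        by (simp add: near_const_def algebra_simps)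
      moreover have "3 * \<rho> * (F2 + G2) \<ge> 0" using \<rho> FG0 by simp
      ultimately show ?thesis by linarith
    qed
    finally show ?thesis unfolding F2_def G2_def by simp
  qed
qed

section \<open>Reduced words in the rotations\<close>

lemma carrier_SO3: "A \<in> carrier SO3 \<longleftrightarrow> rotation_matrix A"
  by (simp add: SO3_def)

lemma mult_SO3 [simp]: "A \<otimes>\<^bsub>SO3\<^esub> B = A ** B" and one_SO3 [simp]: "\<one>\<^bsub>SO3\<^esub> = mat 1"
  by (simp_all add: SO3_def)

lemma inv_SO3:
  assumes "rotation_matrix A"
  shows "inv\<^bsub>SO3\<^esub> A = transpose A"
  using assms rotation_matrix_transpose[OF assms]
  by (intro group.inv_equality[OF group_SO3]) (auto simp: carrier_SO3)

lemma rotation_matrix_mult: "rotation_matrix A \<Longrightarrow> rotation_matrix B \<Longrightarrow> rotation_matrix (A ** B)" for A B :: "real^3^3"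
  by (simp add: rotation_matrix_def orthogonal_matrix_mul det_mul)

lemma rotation_matrix_id: "rotation_matrix (mat 1 :: real^3^3)"
  by (simp add: rotation_matrix_def orthogonal_matrix_id)

section \<open>Combinatorics of reduced words\<close>

definition linv :: "nat * bool \<Rightarrow> nat * bool" where "linv l = (fst l, \<not> snd l)"

definition winv :: "(nat * bool) list \<Rightarrow> (nat * bool) list" where "winv w = rev (map linv w)"

lemma linv_linv [simp]: "linv (linv l) = l"
  by (simp add: linv_def)

lemma fst_linv [simp]: "fst (linv l) = fst l"
  by (simp add: linv_def)

lemma reduced_word_alt: "reduced_word w \<longleftrightarrow> successively (\<lambda>k l. l \<noteq> linv k) w"
proof -
  have "(\<not> (fst k = fst l \<and> snd k \<noteq> snd l)) = (l \<noteq> linv k)" for k l :: "nat * bool"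
    by (cases k; cases l) (auto simp: linv_def)
  then show ?thesis by (simp add: reduced_word_def)
qed

lemma reduced_Nil [simp]: "reduced_word ([] :: (nat * bool) list)"
  by (simp add: reduced_word_alt)

lemma reduced_Cons: "reduced_word (a # w) \<longleftrightarrow> w = [] \<or> hd w \<noteq> linv a \<and> reduced_word w"
  by (simp add: reduced_word_alt successively_Cons)

lemma reduced_append:
  "reduced_word (u @ w) \<longleftrightarrow> reduced_word u \<and> reduced_word w \<and> (u = [] \<or> w = [] \<or> hd w \<noteq> linv (last u))"
  by (simp add: reduced_word_alt successively_append_iff)

lemma reduced_winv [simp]: "reduced_word (winv w) \<longleftrightarrow> reduced_word w"
proof -
  have e: "(\<lambda>x y. linv x \<noteq> linv (linv y)) = (\<lambda>k l. l \<noteq> linv k)" by (auto simp: fun_eq_iff)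
  show ?thesis unfolding reduced_word_alt winv_def successively_rev successively_map e ..
qed

lemma length_winv [simp]: "length (winv w) = length w"
  by (simp add: winv_def)

lemma winv_eq_Nil [simp]: "winv w = [] \<longleftrightarrow> w = []"
  by (simp add: winv_def)

lemma winv_winv [simp]: "winv (winv w) = w"
  by (simp add: winv_def rev_map o_def)

lemma hd_winv: "w \<noteq> [] \<Longrightarrow> hd (winv w) = linv (last w)"
  by (simp add: winv_def hd_rev last_map)

lemma last_winv: "w \<noteq> [] \<Longrightarrow> last (winv w) = linv (hd w)"
  by (simp add: winv_def last_rev hd_map)

lemma winv_append: "winv (u @ w) = winv w @ winv u"
  by (simp add: winv_def)

definition wpow :: "(nat * bool) list \<Rightarrow> nat \<Rightarrow> (nat * bool) list" where
  "wpow w k = concat (replicate k w)"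

lemma wpow_0 [simp]: "wpow w 0 = []" and wpow_Suc: "wpow w (Suc k) = w @ wpow w k"
  by (simp_all add: wpow_def)

lemma wpow_Nil [simp]: "wpow [] k = []"
  by (induction k) (simp_all add: wpow_Suc)

lemma length_wpow: "length (wpow w k) = k * length w"
  by (induction k) (simp_all add: wpow_Suc)

text \<open>Every nonempty reduced word is a conjugate \<open>u v u\<^sup>-\<^sup>1\<close> of a cyclically reduced word \<open>v\<close>.\<close>

lemma cyclic_reduction:
  assumes "reduced_word w" "w \<noteq> []"
  obtains u v where "w = u @ v @ winv u" "v \<noteq> []" "hd v \<noteq> linv (last v)"
  using assms
proof (induction "length w" arbitrary: w thesis rule: less_induct)
  case less
  show ?case
  proof (cases "hd w = linv (last w)")
    case False
    then show ?thesis using less.prems(1)[of "[]" w] less.prems(3) by (auto simp: winv_def)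
  next
    case True
    obtain a r where w: "w = a # r" using less.prems(3) by (cases w) auto
    have r: "r \<noteq> []" using True unfolding w by (cases a) (auto simp: linv_def)
    then obtain w0 b where w0: "r = w0 @ [b]" by (metis append_butlast_last_id)
    have b: "b = linv a" using True by (simp add: w w0)
    have w0n: "w0 \<noteq> []" using less.prems(2) unfolding w w0 b by (auto simp: reduced_Cons)
    have "reduced_word w0" using less.prems(2) unfolding w w0 by (auto simp: reduced_Cons reduced_append)
    then obtain u v where uv: "w0 = u @ v @ winv u" "v \<noteq> []" "hd v \<noteq> linv (last v)"
      using less.hyps[of w0] w0n by (auto simp: w w0)
    have "w = (a # u) @ v @ winv (a # u)" by (simp add: w w0 b uv(1) winv_def)
    then show ?thesis using less.prems(1) uv by blast
  qed
qed

lemma reduced_wpow: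
  assumes v: "reduced_word v" "v \<noteq> []" "hd v \<noteq> linv (last v)" and k: "k \<ge> 1"
  shows "reduced_word (wpow v k) \<and> wpow v k \<noteq> [] \<and> hd (wpow v k) = hd v \<and> last (wpow v k) = last v"
  using k
proof (induction k rule: dec_induct)
  case base
  then show ?case using v by (simp add: wpow_Suc)
next
  case (step k)
  then show ?case using v by (simp add: wpow_Suc reduced_append)
qed

section \<open>Values of words in the free group of rotations\<close>

locale rotation_words =
  fixes M :: nat and g :: "nat \<Rightarrow> real^3^3"
  assumes M2: "M \<ge> 2" and g_carrier: "j \<in> {1..M} \<Longrightarrow> g j \<in> carrier SO3"
    and free: "freely_generates_on SO3 g {1..M}"
begin

definition letters :: "(nat * bool) set" where "letters = Sigma {1..M} (\<lambda>_. UNIV)"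

definition val :: "(nat * bool) list \<Rightarrow> real^3^3" where "val w = word_value SO3 g w"

definition lv :: "nat * bool \<Rightarrow> real^3^3" where "lv l = (if snd l then g (fst l) else transpose (g (fst l)))"

lemma g_rot: "j \<in> {1..M} \<Longrightarrow> rotation_matrix (g j)"
  using g_carrier by (simp add: carrier_SO3)

lemma linv_letters [simp]: "linv l \<in> letters \<longleftrightarrow> l \<in> letters"
  by (cases l) (simp add: letters_def linv_def)

lemma set_winv [simp]: "set (winv w) \<subseteq> letters \<longleftrightarrow> set w \<subseteq> letters"
  by (auto simp: winv_def)

lemma letter_value: "l \<in> letters \<Longrightarrow> letter_value SO3 g l = lv l"
  by (auto simp: letter_value_def lv_def letters_def inv_SO3 g_rot)

lemma lv_rot: "l \<in> letters \<Longrightarrow> rotation_matrix (lv l)"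
  by (auto simp: lv_def letters_def g_rot rotation_matrix_transpose(1))

lemma lv_linv: "lv (linv l) = transpose (lv l)"
  by (simp add: lv_def linv_def transpose_transpose)

lemma val_Nil [simp]: "val [] = mat 1"
  by (simp add: val_def word_value_def)

lemma val_Cons: "l \<in> letters \<Longrightarrow> val (l # w) = lv l ** val w"
  by (simp add: val_def word_value_def letter_value)

lemma val_append: "set u \<subseteq> letters \<Longrightarrow> val (u @ w) = val u ** val w"
  by (induction u) (auto simp: val_Cons matrix_mul_assoc)

lemma val_rot: "set w \<subseteq> letters \<Longrightarrow> rotation_matrix (val w)"
  by (induction w) (auto simp: val_Cons rotation_matrix_id intro!: rotation_matrix_mult lv_rot)

lemma val_transpose_mult: "set w \<subseteq> letters \<Longrightarrow> transpose (val w) ** val w = mat 1"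
  and val_mult_transpose: "set w \<subseteq> letters \<Longrightarrow> val w ** transpose (val w) = mat 1"
  using rotation_matrix_transpose[OF val_rot] by auto

lemma val_winv: "set w \<subseteq> letters \<Longrightarrow> val (winv w) = transpose (val w)"
proof (induction w)
  case (Cons l w)
  then have "val (winv (l # w)) = val (winv w) ** val [linv l]"
    using val_append[of "winv w" "[linv l]"] by (simp add: winv_append[of "[l]" w, simplified] winv_def[of "[l]"])
  also have "val [linv l] = transpose (lv l)" using Cons by (simp add: val_Cons lv_linv)
  also have "val (winv w) ** transpose (lv l) = transpose (lv l ** val w)" using Cons by (simp add: matrix_transpose_mul)
  finally show ?case using Cons by (simp add: val_Cons)
qed (simp add: winv_def transpose_mat)

lemma val_reduced_nontrivial:
  "set w \<subseteq> letters \<Longrightarrow> reduced_word w \<Longrightarrow> w \<noteq> [] \<Longrightarrow> val w \<noteq> mat 1"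
  using free unfolding freely_generates_on_def val_def letters_def by force

text \<open>A common first letter can be cancelled. If the first letters differ, the inverse of one
  word followed by the other is reduced, nonempty and evaluates to the identity, against
  freeness.\<close>

lemma val_inj:
  assumes "set u \<subseteq> letters" "set w \<subseteq> letters" "reduced_word u" "reduced_word w" "val u = val w"
  shows "u = w"
  using assms
proof (induction u arbitrary: w)
  case Nil
  then show ?case using val_reduced_nontrivial[of w] by fastforce
next
  case (Cons a u)
  show ?case
  proof (cases w)
    case Nil
    then show ?thesis using Cons.prems val_reduced_nontrivial[of "a # u"] by fastforce
  next
    case w: (Cons b r)
    have al: "a \<in> letters" "set u \<subseteq> letters" "b \<in> letters" "set r \<subseteq> letters" using Cons.prems w by auto
    show ?thesis
    proof (cases "a = b")
      case True
      have "lv a ** val u = lv a ** val r" using Cons.prems al True by (simp add: w val_Cons)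
      then have "transpose (lv a) ** (lv a ** val u) = transpose (lv a) ** (lv a ** val r)" by simp
      then have "val u = val r"
        using rotation_matrix_transpose(2)[OF lv_rot[OF al(1)]] by (simp add: matrix_mul_assoc)
      moreover have "reduced_word u" "reduced_word r" using Cons.prems w by (auto simp: reduced_Cons)
      ultimately have "u = r" using Cons.IH al by blast
      then show ?thesis using True w by simp
    next
      case False
      have "reduced_word (winv (a # u) @ w)"
        unfolding reduced_append using Cons.prems False by (auto simp: last_winv w)
      moreover have "val (winv (a # u) @ w) = mat 1"
        using Cons.prems(1,2,5) val_transpose_mult[OF Cons.prems(2)] by (simp add: val_append val_winv)
      moreover have "set (winv (a # u) @ w) \<subseteq> letters" using Cons.prems(1,2) set_winv[of "a # u"] by auto
      ultimately show ?thesis using val_reduced_nontrivial[of "winv (a # u) @ w"] w by auto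
    qed
  qed
qed

lemma ex_reduced:
  assumes "set w \<subseteq> letters"
  shows "\<exists>r. set r \<subseteq> letters \<and> reduced_word r \<and> length r \<le> length w \<and> val r = val w"
  using assms
proof (induction w)
  case (Cons a w)
  then obtain r where r: "set r \<subseteq> letters" "reduced_word r" "length r \<le> length w" "val r = val w" by auto
  have a: "a \<in> letters" using Cons.prems by simp
  show ?case
  proof (cases "r \<noteq> [] \<and> hd r = linv a")
    case True
    then obtain t where t: "r = linv a # t" by (metis list.collapse)
    have "val (a # w) = lv a ** (lv (linv a) ** val t)" using a r t by (simp add: val_Cons)
    also have "\<dots> = val t" using rotation_matrix_transpose(3)[OF lv_rot[OF a]] by (simp add: lv_linv matrix_mul_assoc)
    finally show ?thesis using r t by (intro exI[of _ t]) (auto simp: reduced_Cons)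
  next
    case False
    then show ?thesis using r a by (intro exI[of _ "a # r"]) (auto simp: reduced_Cons val_Cons)
  qed
qed auto

lemma val_wpow: "set w \<subseteq> letters \<Longrightarrow> val (wpow w (Suc k)) = val (wpow w k) ** val w"
  and set_wpow: "set w \<subseteq> letters \<Longrightarrow> set (wpow w k) \<subseteq> letters"
proof -
  show s: "set (wpow w k) \<subseteq> letters" if "set w \<subseteq> letters" for k using that by (induction k) (auto simp: wpow_Suc)
  show "val (wpow w (Suc k)) = val (wpow w k) ** val w" if w: "set w \<subseteq> letters"
    using w
  proof (induction k)
    case (Suc k)
    have "val (wpow w (Suc (Suc k))) = val w ** val (wpow w (Suc k))"
      using Suc.prems by (simp add: wpow_Suc[of w "Suc k"] val_append)
    also have "\<dots> = (val w ** val (wpow w k)) ** val w" using Suc by (simp add: matrix_mul_assoc)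
    also have "val w ** val (wpow w k) = val (wpow w (Suc k))" using Suc.prems by (simp add: wpow_Suc val_append)
    finally show ?case .
  qed (simp add: wpow_Suc)
qed

text \<open>Writing \<open>w\<close> as u v u^(-1) with v cyclically reduced, u v^k u^(-1) is
  reduced and of length at least k, and a reduced word is determined by its value. Short words can
  therefore only be low powers.\<close>

lemma length_power_ge:
  assumes w: "set w \<subseteq> letters" "reduced_word w" "w \<noteq> []"
    and r: "set r \<subseteq> letters" "reduced_word r" "val r = val (wpow w k)"
  shows "k \<le> length r"
proof (cases "k = 0")
  case False
  then have k: "k \<ge> 1" by simp
  obtain u v where uv: "w = u @ v @ winv u" "v \<noteq> []" "hd v \<noteq> linv (last v)"
    using cyclic_reduction[OF w(2,3)] by blast
  have su: "set u \<subseteq> letters" "set v \<subseteq> letters" using w(1) uv(1) by auto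
  have rv: "reduced_word v" using w(2) unfolding uv(1) by (auto simp: reduced_append)
  note p = reduced_wpow[OF rv uv(2,3) k]
  define t where "t = u @ wpow v k @ winv u"
  have "reduced_word t"
    using w(2) p uv(2) unfolding t_def uv(1) by (auto simp: reduced_append)
  moreover have st: "set t \<subseteq> letters" unfolding t_def using su set_wpow[OF su(2)] set_winv[of u] by auto
  moreover have "val (wpow w n) = val u ** val (wpow v n) ** transpose (val u)" for n
  proof (induction n)
    case 0
    then show ?case using val_mult_transpose[OF su(1)] by simp
  next
    case (Suc n)
    have vw: "val w = val u ** val v ** transpose (val u)"
      unfolding uv(1) using su by (simp add: val_append val_winv matrix_mul_assoc)
    have "val (wpow w (Suc n)) = val w ** val (wpow w n)" using w(1) by (simp add: wpow_Suc val_append)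
    also have "\<dots> = val u ** val v ** (transpose (val u) ** val u) ** val (wpow v n) ** transpose (val u)"
      unfolding Suc vw by (simp add: matrix_mul_assoc)
    also have "\<dots> = val u ** val (wpow v (Suc n)) ** transpose (val u)"
      using su unfolding val_transpose_mult[OF su(1)] by (simp add: wpow_Suc val_append matrix_mul_assoc)
    finally show ?case .
  qed
  then have "val t = val (wpow w k)"
    unfolding t_def using su set_wpow[OF su(2)] by (simp add: val_append val_winv matrix_mul_assoc)
  ultimately have "r = t" using r by (intro val_inj) auto
  moreover have "length (wpow v k) \<ge> k" using uv(2) by (simp add: length_wpow Suc_leI)
  ultimately show ?thesis by (simp add: t_def)
qed simp

text \<open>The square of a nonempty reduced word has reduced length at least 2, whereas the
  identity is the value of the empty word.\<close>

lemma val_torsion_free: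
  assumes w: "set w \<subseteq> letters" and "val w ** val w = mat 1"
  shows "val w = mat 1"
proof -
  obtain r where r: "set r \<subseteq> letters" "reduced_word r" "val r = val w" using ex_reduced[OF w] by blast
  show ?thesis
  proof (cases "r = []")
    case False
    have "val [] = val (wpow r 2)"
      using assms r(1,3) by (simp add: numeral_2_eq_2 wpow_Suc val_append)
    from length_power_ge[OF r(1,2) False _ _ this] show ?thesis by simp
  qed (use r in auto)
qed

lemma subgroup_words:
  assumes "h \<in> carrier (subgroup_generated SO3 (g ` {1..M}))"
  shows "\<exists>w. set w \<subseteq> letters \<and> val w = h"
proof -
  have "h \<in> generate SO3 (carrier SO3 \<inter> g ` {1..M})" using assms by (simp add: carrier_subgroup_generated)
  then show ?thesis
  proof (induction h rule: generate.induct)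
    case one
    then show ?case by (intro exI[of _ "[]"]) simp
  next
    case (incl h)
    then obtain j where "j \<in> {1..M}" "h = g j" by auto
    then show ?case by (intro exI[of _ "[(j, True)]"]) (auto simp: letters_def val_Cons lv_def)
  next
    case (inv h)
    then obtain j where "j \<in> {1..M}" "h = g j" by auto
    then show ?case by (intro exI[of _ "[(j, False)]"]) (auto simp: letters_def val_Cons lv_def inv_SO3 g_rot)
  next
    case (eng h1 h2)
    then obtain u w where "set u \<subseteq> letters" "val u = h1" "set w \<subseteq> letters" "val w = h2" by blast
    then show ?case by (intro exI[of _ "u @ w"]) (auto simp: val_append)
  qed
qed

lemma val_in_subgroup: "set w \<subseteq> letters \<Longrightarrow> val w \<in> carrier (subgroup_generated SO3 (g ` {1..M}))"
proof (induction w)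
  case Nil
  then show ?case by (simp add: carrier_subgroup_generated generate.one[of SO3, simplified])
next
  case (Cons l w)
  obtain j b where l: "l = (j, b)" "j \<in> {1..M}" using Cons.prems by (cases l) (auto simp: letters_def)
  have gj: "g j \<in> carrier SO3 \<inter> g ` {1..M}" using l g_carrier by auto
  have "lv l \<in> generate SO3 (carrier SO3 \<inter> g ` {1..M})"
    using generate.incl[OF gj, of SO3] generate.inv[OF gj, of SO3] l by (simp add: lv_def inv_SO3 g_rot)
  then show ?case
    using generate.eng[of "lv l" SO3 _ "val w"] Cons by (simp add: carrier_subgroup_generated val_Cons)
qed

section \<open>Stabilizers of points\<close>

text \<open>A trivial group counts as cyclic, with the identity as generator. Negative exponents
  become transposes, so that only natural exponents have to be bounded afterwards.\<close>

lemma stabilizer_powers: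
  assumes cyc: "trivial_group (stabilizer_group (subgroup_generated SO3 (g ` {1..M})) x) \<or>
      cyclic_group (stabilizer_group (subgroup_generated SO3 (g ` {1..M})) x)"
  obtains wc where "set wc \<subseteq> letters" "reduced_word wc"
    "\<And>w. set w \<subseteq> letters \<Longrightarrow> val w *v x = x \<Longrightarrow> \<exists>k. val w = val (wpow wc k) \<or> val w = transpose (val (wpow wc k))"
proof -
  define G where "G = stabilizer_group (subgroup_generated SO3 (g ` {1..M})) x"
  have cG: "h \<in> carrier G \<longleftrightarrow> (\<exists>w. set w \<subseteq> letters \<and> val w = h \<and> h *v x = x)" for h
    unfolding G_def stabilizer_group_def stabilizer_def using subgroup_words val_in_subgroup by auto
  have mG: "mult G = (**)" "one G = mat 1"
    by (simp_all add: G_def stabilizer_group_def subgroup_generated_def SO3_def)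
  have trans: "transpose h \<in> carrier G" if h: "h \<in> carrier G" for h
  proof -
    obtain w where w: "set w \<subseteq> letters" "val w = h" "h *v x = x" using h cG by blast
    have "transpose h *v (h *v x) = x"
      using val_transpose_mult[OF w(1)] w(2) by (simp add: matrix_vector_mul_assoc del: transpose_matrix_vector)
    then show ?thesis unfolding cG using w val_winv[OF w(1)] set_winv[of w] by metis
  qed
  have inv1: "transpose h ** h = mat 1" if "h \<in> carrier G" for h
    using that cG val_transpose_mult by auto
  have group: "group G"
  proof (rule groupI)
    fix a b c assume a: "a \<in> carrier G" "b \<in> carrier G" "c \<in> carrier G"
    obtain u w where "set u \<subseteq> letters" "val u = a" "a *v x = x" "set w \<subseteq> letters" "val w = b" "b *v x = x"
      using a cG by metis
    then show "a \<otimes>\<^bsub>G\<^esub> b \<in> carrier G"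
      unfolding mG cG by (intro exI[of _ "u @ w"]) (auto simp: val_append matrix_vector_mul_assoc[symmetric])
    show "a \<otimes>\<^bsub>G\<^esub> b \<otimes>\<^bsub>G\<^esub> c = a \<otimes>\<^bsub>G\<^esub> (b \<otimes>\<^bsub>G\<^esub> c)" by (simp add: mG matrix_mul_assoc)
  next
    show "\<one>\<^bsub>G\<^esub> \<in> carrier G" unfolding mG cG by (intro exI[of _ "[]"]) simp
    fix a assume a: "a \<in> carrier G"
    then show "\<exists>y\<in>carrier G. y \<otimes>\<^bsub>G\<^esub> a = \<one>\<^bsub>G\<^esub>" using trans inv1 by (auto simp: mG)
  qed (simp add: mG)
  then interpret G: group G .
  have invG: "inv\<^bsub>G\<^esub> h = transpose h" if "h \<in> carrier G" for h
    using that trans inv1 by (intro G.inv_equality) (auto simp: mG)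
  have "cyclic_group G" using cyc trivial_imp_cyclic_group unfolding G_def by blast
  then obtain c where c: "c \<in> carrier G" "carrier G = range (\<lambda>n::int. c [^]\<^bsub>G\<^esub> n)"
    using G.cyclic_group by auto
  obtain w0 where w0: "set w0 \<subseteq> letters" "val w0 = c" using c(1) cG by blast
  obtain wc where wc: "set wc \<subseteq> letters" "reduced_word wc" "val wc = c" using ex_reduced[OF w0(1)] w0(2) by auto
  have pw: "c [^]\<^bsub>G\<^esub> (k::nat) = val (wpow wc k)" for k
    by (induction k) (auto simp: mG val_wpow wc(1,3))
  show thesis
  proof (rule that[OF wc(1,2)])
    fix w assume "set w \<subseteq> letters" "val w *v x = x"
    then have "val w \<in> carrier G" unfolding cG by blast
    then obtain n :: int where n: "val w = c [^]\<^bsub>G\<^esub> n" using c(2) by auto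
    show "\<exists>k. val w = val (wpow wc k) \<or> val w = transpose (val (wpow wc k))"
    proof (cases "n \<ge> 0")
      case True
      then obtain k where "n = int k" by (metis nonneg_int_cases)
      then show ?thesis using n pw by (auto simp: int_pow_int)
    next
      case False
      then obtain k where k: "n = - int k" by (metis int_cases2 of_nat_0_le_iff)
      have "c [^]\<^bsub>G\<^esub> k \<in> carrier G" using c(1) by simp
      then have "val w = transpose (val (wpow wc k))"
        unfolding n k using c(1) by (simp add: G.int_pow_neg int_pow_int invG pw)
      then show ?thesis by blast
    qed
  qed
qed

definition W :: "nat \<Rightarrow> (nat * bool) list set" where
  "W n = {w. length w = n \<and> set w \<subseteq> letters \<and> reduced_word w}"

lemma finite_letters: "finite letters"
  by (simp add: letters_def)

lemma finite_W: "finite (W n)"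
  by (rule finite_subset[OF _ finite_lists_length_eq[OF finite_letters, of n]]) (auto simp: W_def)

text \<open>The quotients w0^(-1) w have length 2n and are powers of one generator, so the exponent
  is at most 2n in absolute value by \<open>length_power_ge\<close>. A sign and an exponent in 0..2n
  leave 2 (2n + 1) possibilities.\<close>

lemma card_stabilizing_words:
  assumes cyc: "trivial_group (stabilizer_group (subgroup_generated SO3 (g ` {1..M})) x) \<or>
      cyclic_group (stabilizer_group (subgroup_generated SO3 (g ` {1..M})) x)"
    and S: "S \<subseteq> W n" "w0 \<in> S" and fix_x: "\<And>w. w \<in> S \<Longrightarrow> val (winv w0 @ w) *v x = x"
  shows "card S \<le> 4 * n + 2"
proof -
  obtain wc where wc: "set wc \<subseteq> letters" "reduced_word wc"
    "\<And>w. set w \<subseteq> letters \<Longrightarrow> val w *v x = x \<Longrightarrow> \<exists>k. val w = val (wpow wc k) \<or> val w = transpose (val (wpow wc k))"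
    using stabilizer_powers[OF cyc] by metis
  have w0: "set w0 \<subseteq> letters" using S by (auto simp: W_def)
  define F where "F = (\<lambda>b k. if b then val (wpow wc k) else transpose (val (wpow wc k)))"
  have ex: "\<exists>b k. k \<le> 2 * n \<and> val (winv w0 @ w) = F b k" if w: "w \<in> S" for w
  proof -
    have sw: "set (winv w0 @ w) \<subseteq> letters" "length (winv w0 @ w) = 2 * n"
      using subsetD[OF S(1) w] subsetD[OF S(1) S(2)] set_winv[of w0] by (auto simp: W_def)
    obtain k where k: "val (winv w0 @ w) = val (wpow wc k) \<or> val (winv w0 @ w) = transpose (val (wpow wc k))"
      using wc(3)[OF sw(1) fix_x[OF w]] by blast
    show ?thesis
    \<comment> \<open>An empty generating word means that the stabilizer is trivial; the exponent is
      then arbitrary and 0 is taken.\<close>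
    proof (cases "wc = []")
      case True
      then show ?thesis using k by (intro exI[of _ True] exI[of _ 0]) (auto simp: F_def transpose_mat)
    next
      case False
      obtain r where r: "set r \<subseteq> letters" "reduced_word r" "length r \<le> 2 * n" "val r = val (winv w0 @ w)"
        using ex_reduced[OF sw(1)] sw(2) by auto
      have "k \<le> 2 * n"
        using k
      proof
        assume "val (winv w0 @ w) = val (wpow wc k)"
        then show ?thesis using length_power_ge[OF wc(1,2) False r(1,2), of k] r(3,4) by simp
      next
        assume "val (winv w0 @ w) = transpose (val (wpow wc k))"
        then have "val (winv r) = val (wpow wc k)" using r by (simp add: val_winv transpose_transpose)
        then show ?thesis using length_power_ge[OF wc(1,2) False, of "winv r" k] r by simp
      qed
      then show ?thesis using k by (auto simp: F_def)
    qed
  qed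
  have inj: "inj_on (\<lambda>w. val (winv w0 @ w)) S"
  proof (rule inj_onI)
    fix u w assume uw: "u \<in> S" "w \<in> S" "val (winv w0 @ u) = val (winv w0 @ w)"
    then have "transpose (val w0) ** val u = transpose (val w0) ** val w"
      using w0 by (simp add: val_append val_winv)
    then have "val w0 ** (transpose (val w0) ** val u) = val w0 ** (transpose (val w0) ** val w)" by simp
    then have "val u = val w" using val_mult_transpose[OF w0] by (simp add: matrix_mul_assoc)
    then show "u = w" using uw S by (intro val_inj) (auto simp: W_def)
  qed
  have sub: "(\<lambda>w. val (winv w0 @ w)) ` S \<subseteq> (\<lambda>(b, k). F b k) ` (Sigma UNIV (\<lambda>_. {..2 * n}))"
    using ex by force
  have "card S = card ((\<lambda>w. val (winv w0 @ w)) ` S)" by (rule card_image[OF inj, symmetric])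
  also have "\<dots> \<le> card ((\<lambda>(b, k). F b k) ` (Sigma UNIV (\<lambda>_. {..2 * n})))" by (rule card_mono[OF _ sub]) auto
  also have "\<dots> \<le> card (Sigma (UNIV :: bool set) (\<lambda>_. {..2 * n}))" by (rule card_image_le) auto
  also have "\<dots> = 4 * n + 2" by (simp add: card_cartesian_product)
  finally show ?thesis .
qed

end

section \<open>A Diophantine gap for algebraic entries\<close>

definition zspan :: "real set \<Rightarrow> real set" where
  "zspan V = {x. \<exists>c::real \<Rightarrow> int. x = (\<Sum>v\<in>V. of_int (c v) * v)}"

lemma zspan_add: "x \<in> zspan V \<Longrightarrow> y \<in> zspan V \<Longrightarrow> x + y \<in> zspan V"
  unfolding zspan_def
proof clarify
  fix c e :: "real \<Rightarrow> int"
  show "\<exists>f::real \<Rightarrow> int. (\<Sum>v\<in>V. of_int (c v) * v) + (\<Sum>v\<in>V. of_int (e v) * v) = (\<Sum>v\<in>V. of_int (f v) * v)"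
    by (intro exI[of _ "\<lambda>v. c v + e v"]) (simp add: sum.distrib distrib_right)
qed

lemma zspan_mult: "x \<in> zspan V \<Longrightarrow> of_int k * x \<in> zspan V"
  unfolding zspan_def
proof clarify
  fix c :: "real \<Rightarrow> int"
  show "\<exists>f::real \<Rightarrow> int. of_int k * (\<Sum>v\<in>V. of_int (c v) * v) = (\<Sum>v\<in>V. of_int (f v) * v)"
    by (intro exI[of _ "\<lambda>v. k * c v"]) (simp add: sum_distrib_left mult.assoc)
qed

lemma zspan_0: "0 \<in> zspan V"
  unfolding zspan_def by (auto intro!: exI[of _ "\<lambda>_. 0"])

lemma zspan_sum: "(\<And>i. i \<in> I \<Longrightarrow> f i \<in> zspan V) \<Longrightarrow> sum f I \<in> zspan V"
  by (induction I rule: infinite_finite_induct) (auto intro: zspan_0 zspan_add)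

lemma zspan_base: "finite V \<Longrightarrow> v \<in> V \<Longrightarrow> v \<in> zspan V"
  unfolding zspan_def
proof clarify
  assume "finite V" "v \<in> V"
  then have "(\<Sum>u\<in>V. (if v = u then u else 0)) = v" by simp
  moreover have "(\<Sum>u\<in>V. (if v = u then u else 0)) = (\<Sum>u\<in>V. of_int (if v = u then 1 else 0) * u)"
    by (intro sum.cong) auto
  ultimately show "\<exists>c::real \<Rightarrow> int. v = (\<Sum>u\<in>V. of_int (c u) * u)" by (intro exI[of _ "\<lambda>u. if v = u then 1 else 0"]) simp
qed

lemma zspan_transfer:
  assumes "y \<in> zspan V" "\<And>u. u \<in> V \<Longrightarrow> t * u \<in> zspan V'"
  shows "t * y \<in> zspan V'"
proof -
  obtain c :: "real \<Rightarrow> int" where "y = (\<Sum>v\<in>V. of_int (c v) * v)" using assms(1) unfolding zspan_def by auto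
  then have "t * y = (\<Sum>v\<in>V. of_int (c v) * (t * v))" by (simp add: sum_distrib_left mult_ac)
  also have "\<dots> \<in> zspan V'" by (intro zspan_sum zspan_mult assms(2))
  finally show ?thesis .
qed

text \<open>The numbers are adjoined one at a time: the generators are multiplied by the powers of a
  below the degree m of an integer polynomial with root a. Multiplying by its leading coefficient
  rewrites a^m through lower powers, so that coefficient joins the common denominator d.\<close>

lemma algebraic_common_module:
  assumes "finite A" "\<And>a. a \<in> A \<Longrightarrow> algebraic (a::real)"
  shows "\<exists>V d. finite V \<and> 1 \<in> V \<and> d \<noteq> (0::int) \<and> (\<forall>a\<in>A. \<forall>v\<in>V. of_int d * a * v \<in> zspan V)"
  using assms
proof (induction A rule: finite_induct)
  case empty
  show ?case by (intro exI[of _ "{1}"] exI[of _ 1]) auto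
next
  case (insert a A)
  then obtain V d where V: "finite V" "1 \<in> V" "d \<noteq> 0" "\<And>b v. b \<in> A \<Longrightarrow> v \<in> V \<Longrightarrow> of_int d * b * v \<in> zspan V"
    by auto
  obtain p where p: "\<And>i. coeff p i \<in> \<int>" "p \<noteq> 0" "poly p a = 0"
    using insert.prems[of a] by (auto simp: algebraic_def)
  define m where "m = degree p"
  have m: "m \<ge> 1"
  proof (rule ccontr)
    assume "\<not> m \<ge> 1"
    then have "degree p = 0" by (simp add: m_def)
    then obtain c where "p = [:c:]" by (rule degree_eq_zeroE)
    then show False using p(2,3) by simp
  qed
  define e where "e = (\<lambda>i. \<lfloor>coeff p i\<rfloor>)"
  have e: "coeff p i = of_int (e i)" for i using p(1)[of i] by (auto simp: e_def elim!: Ints_cases)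
  have em: "e m \<noteq> 0" using p(2) e[of m] by (metis leading_coeff_0_iff m_def of_int_0)
  have top: "of_int (e m) * a ^ m = (\<Sum>i<m. of_int (- e i) * a ^ i)"
  proof -
    have "0 = (\<Sum>i\<le>m. of_int (e i) * a ^ i)" using p(3) by (simp add: poly_altdef m_def e)
    also have "\<dots> = (\<Sum>i<m. of_int (e i) * a ^ i) + of_int (e m) * a ^ m"
      by (simp flip: lessThan_Suc_atMost)
    finally show ?thesis by (simp add: sum_negf)
  qed
  define V' where "V' = (\<lambda>(v, k). v * a ^ k) ` (Sigma V (\<lambda>_. {..<m}))"
  have V': "finite V'" unfolding V'_def using V(1) by auto
  have inV': "v * a ^ k \<in> V'" if "v \<in> V" "k < m" for v k unfolding V'_def using that by force
  have "1 \<in> V'" using inV'[of 1 0] V m by simp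
  moreover have "of_int (d * e m) * b * v' \<in> zspan V'" if b: "b \<in> insert a A" and v': "v' \<in> V'" for b v'
  proof -
    obtain v k where vk: "v' = v * a ^ k" "v \<in> V" "k < m" using v' unfolding V'_def by auto
    show ?thesis
    proof (cases "b \<in> A")
      case True
      have "a ^ k * (of_int d * b * v) \<in> zspan V'"
        by (rule zspan_transfer[OF V(4)[OF True vk(2)]]) (use inV'[OF _ vk(3)] V' in \<open>auto intro: zspan_base simp: mult.commute\<close>)
      then have "of_int (e m) * (a ^ k * (of_int d * b * v)) \<in> zspan V'" by (rule zspan_mult)
      then show ?thesis by (simp add: vk mult_ac)
    next
      case False
      then have ba: "b = a" using b by auto
      have "of_int (e m) * a * v' \<in> zspan V'"
      proof (cases "Suc k < m")
        case True
        have "of_int (e m) * (v * a ^ Suc k) \<in> zspan V'" by (intro zspan_mult zspan_base V' inV' vk True)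
        then show ?thesis by (simp add: vk mult_ac)
      next
        case False
        then have k: "Suc k = m" using vk by simp
        have "of_int (e m) * a * v' = v * (of_int (e m) * a ^ m)" by (simp add: vk flip: k)
        also have "\<dots> = (\<Sum>i<m. of_int (- e i) * (v * a ^ i))" unfolding top by (simp add: sum_distrib_left mult_ac)
        also have "\<dots> \<in> zspan V'" by (intro zspan_sum zspan_mult zspan_base V' inV' vk) auto
        finally show ?thesis .
      qed
      then have "of_int d * (of_int (e m) * a * v') \<in> zspan V'" by (rule zspan_mult)
      then show ?thesis by (simp add: ba mult_ac)
    qed
  qed
  ultimately show ?case using V' V(3) em by (intro exI[of _ V'] exI[of _ "d * e m"]) auto
qed

section \<open>Integer matrices of multiplication and a lower bound by pigeonhole\<close>

locale integral_module =
  fixes V :: "real set" and d :: int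
  assumes finV: "finite V" and oneV: "1 \<in> V" and d0: "d \<noteq> 0"
begin

text \<open>\<open>K n Y x\<close>: multiplication by \<open>d\<^sup>n x\<close> acts on the generators by an integer matrix with entries at most \<open>Y\<close>.\<close>

definition K :: "nat \<Rightarrow> nat \<Rightarrow> real \<Rightarrow> bool" where
  "K n Y x \<longleftrightarrow> (\<forall>v\<in>V. \<exists>c::real \<Rightarrow> int. of_int d ^ n * x * v = (\<Sum>u\<in>V. of_int (c u) * u) \<and> (\<forall>u\<in>V. \<bar>c u\<bar> \<le> int Y))"

lemma K_mono: "K n Y x \<Longrightarrow> Y \<le> Z \<Longrightarrow> K n Z x"
  unfolding K_def by (meson order_trans of_nat_mono)

lemma K_E: "K n Y x \<Longrightarrow> v \<in> V \<Longrightarrow> \<exists>c::real \<Rightarrow> int. of_int d ^ n * x * v = (\<Sum>u\<in>V. of_int (c u) * u) \<and> (\<forall>u\<in>V. \<bar>c u\<bar> \<le> int Y)"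
  by (simp add: K_def)

lemma K_add:
  assumes "K n Y x" "K n Z y"
  shows "K n (Y + Z) (x + y)"
  unfolding K_def
proof
  fix v assume v: "v \<in> V"
  obtain c :: "real \<Rightarrow> int" where c: "of_int d ^ n * x * v = (\<Sum>u\<in>V. of_int (c u) * u)" "\<forall>u\<in>V. \<bar>c u\<bar> \<le> int Y"
    using K_E[OF assms(1) v] by blast
  obtain e :: "real \<Rightarrow> int" where e: "of_int d ^ n * y * v = (\<Sum>u\<in>V. of_int (e u) * u)" "\<forall>u\<in>V. \<bar>e u\<bar> \<le> int Z"
    using K_E[OF assms(2) v] by blast
  show "\<exists>c::real \<Rightarrow> int. of_int d ^ n * (x + y) * v = (\<Sum>u\<in>V. of_int (c u) * u) \<and> (\<forall>u\<in>V. \<bar>c u\<bar> \<le> int (Y + Z))"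
  proof (intro exI[of _ "\<lambda>u. c u + e u"] conjI ballI)
    show "of_int d ^ n * (x + y) * v = (\<Sum>u\<in>V. of_int (c u + e u) * u)"
      using c(1) e(1) by (simp add: distrib_left distrib_right sum.distrib)
    fix u assume "u \<in> V"
    then show "\<bar>c u + e u\<bar> \<le> int (Y + Z)" using c(2) e(2) by force
  qed
qed

lemma K_uminus:
  assumes "K n Y x"
  shows "K n Y (- x)"
  unfolding K_def
proof
  fix v assume v: "v \<in> V"
  obtain c :: "real \<Rightarrow> int" where c: "of_int d ^ n * x * v = (\<Sum>u\<in>V. of_int (c u) * u)" "\<forall>u\<in>V. \<bar>c u\<bar> \<le> int Y"
    using K_E[OF assms v] by blast
  then show "\<exists>c::real \<Rightarrow> int. of_int d ^ n * (- x) * v = (\<Sum>u\<in>V. of_int (c u) * u) \<and> (\<forall>u\<in>V. \<bar>c u\<bar> \<le> int Y)"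
    by (intro exI[of _ "\<lambda>u. - c u"]) (auto simp: sum_negf)
qed

lemma K_mult:
  assumes "K n Y x" "K m Z y"
  shows "K (n + m) (card V * Y * Z) (x * y)"
  unfolding K_def
proof
  fix v assume v: "v \<in> V"
  obtain e :: "real \<Rightarrow> int" where e: "of_int d ^ m * y * v = (\<Sum>u\<in>V. of_int (e u) * u)" "\<forall>u\<in>V. \<bar>e u\<bar> \<le> int Z"
    using K_E[OF assms(2) v] by blast
  have "\<exists>c. \<forall>u\<in>V. of_int d ^ n * x * u = (\<Sum>t\<in>V. of_int (c u t :: int) * t) \<and> (\<forall>t\<in>V. \<bar>c u t\<bar> \<le> int Y)"
    using assms(1) unfolding K_def by (rule bchoice)
  then obtain c :: "real \<Rightarrow> real \<Rightarrow> int" where c: "\<And>u. u \<in> V \<Longrightarrow> of_int d ^ n * x * u = (\<Sum>t\<in>V. of_int (c u t) * t)"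
    "\<And>u t. u \<in> V \<Longrightarrow> t \<in> V \<Longrightarrow> \<bar>c u t\<bar> \<le> int Y" by blast
  show "\<exists>c::real \<Rightarrow> int. of_int d ^ (n + m) * (x * y) * v = (\<Sum>u\<in>V. of_int (c u) * u) \<and> (\<forall>u\<in>V. \<bar>c u\<bar> \<le> int (card V * Y * Z))"
  proof (intro exI[of _ "\<lambda>t. \<Sum>u\<in>V. e u * c u t"] conjI ballI)
    have "of_int d ^ (n + m) * (x * y) * v = of_int d ^ n * x * (of_int d ^ m * y * v)" by (simp add: power_add mult_ac)
    also have "\<dots> = (\<Sum>u\<in>V. of_int (e u) * (of_int d ^ n * x * u))" unfolding e(1) by (simp add: sum_distrib_left mult_ac)
    also have "\<dots> = (\<Sum>u\<in>V. \<Sum>t\<in>V. of_int (e u * c u t) * t)" using c(1) by (simp add: sum_distrib_left mult_ac)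
    also have "\<dots> = (\<Sum>t\<in>V. \<Sum>u\<in>V. of_int (e u * c u t) * t)" by (rule sum.swap)
    also have "\<dots> = (\<Sum>t\<in>V. of_int (\<Sum>u\<in>V. e u * c u t) * t)" by (simp add: sum_distrib_right)
    finally show "of_int d ^ (n + m) * (x * y) * v = (\<Sum>t\<in>V. of_int (\<Sum>u\<in>V. e u * c u t) * t)" .
    fix t assume t: "t \<in> V"
    have "\<bar>\<Sum>u\<in>V. e u * c u t\<bar> \<le> (\<Sum>u\<in>V. \<bar>e u\<bar> * \<bar>c u t\<bar>)" unfolding abs_mult[symmetric] by (rule sum_abs)
    also have "\<dots> \<le> (\<Sum>u\<in>V. int Z * int Y)" using e(2) c(2) t by (intro sum_mono mult_mono) auto
    also have "\<dots> = int (card V * Y * Z)" by simp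
    finally show "\<bar>\<Sum>u\<in>V. e u * c u t\<bar> \<le> int (card V * Y * Z)" .
  qed
qed

text \<open>The number 1 is written with denominator d^n so that it can be subtracted from an entry
  of a word of length n.\<close>

lemma K_one: "K n (nat \<bar>d\<bar> ^ n) 1"
  unfolding K_def
proof
  fix v assume v: "v \<in> V"
  have "(\<Sum>u\<in>V. of_int (if v = u then d ^ n else 0) * u) = (\<Sum>u\<in>V. if v = u then of_int d ^ n * u else 0)"
    by (intro sum.cong) auto
  also have "\<dots> = of_int d ^ n * v" using finV v by simp
  finally have "of_int d ^ n * 1 * v = (\<Sum>u\<in>V. of_int (if v = u then d ^ n else 0) * u)" by simp
  then show "\<exists>c::real \<Rightarrow> int. of_int d ^ n * 1 * v = (\<Sum>u\<in>V. of_int (c u) * u) \<and> (\<forall>u\<in>V. \<bar>c u\<bar> \<le> int (nat \<bar>d\<bar> ^ n))"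
    by (intro exI[of _ "\<lambda>u. if v = u then d ^ n else 0"]) (auto simp: power_abs)
qed

lemma K_zero: "K n Y 0"
  unfolding K_def by (auto intro!: exI[of _ "\<lambda>_. 0"])

lemma K_sum:
  assumes "finite I" "\<And>i. i \<in> I \<Longrightarrow> K n Y (f i)"
  shows "K n (card I * Y) (\<Sum>i\<in>I. f i)"
  using assms
proof (induction I rule: finite_induct)
  case (insert i I)
  then have "K n (Y + card I * Y) (f i + (\<Sum>i\<in>I. f i))" by (intro K_add) auto
  then show ?case using insert by simp
qed (simp add: K_zero)

lemma K_generator:
  assumes "\<And>v. v \<in> V \<Longrightarrow> of_int d * a * v \<in> zspan V"
  shows "\<exists>Y. K 1 Y a"
proof -
  have "\<forall>v\<in>V. \<exists>c::real \<Rightarrow> int. of_int d * a * v = (\<Sum>u\<in>V. of_int (c u) * u)"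
    using assms unfolding zspan_def by blast
  then have "\<exists>c. \<forall>v\<in>V. of_int d * a * v = (\<Sum>u\<in>V. of_int (c v u :: int) * u)" by (rule bchoice)
  then obtain c :: "real \<Rightarrow> real \<Rightarrow> int" where c: "\<And>v. v \<in> V \<Longrightarrow> of_int d * a * v = (\<Sum>u\<in>V. of_int (c v u) * u)" by blast
  define Y where "Y = nat (\<Sum>v\<in>V. \<Sum>u\<in>V. \<bar>c v u\<bar>)"
  have Yi: "int Y = (\<Sum>v\<in>V. \<Sum>u\<in>V. \<bar>c v u\<bar>)" by (simp add: Y_def sum_nonneg)
  have "\<bar>c v u\<bar> \<le> int Y" if "v \<in> V" "u \<in> V" for v u
  proof -
    have "\<bar>c v u\<bar> \<le> (\<Sum>u\<in>V. \<bar>c v u\<bar>)" using that finV by (intro member_le_sum) auto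
    also have "\<dots> \<le> int Y" unfolding Yi using that finV by (intro member_le_sum[where f = "\<lambda>v. \<Sum>u\<in>V. \<bar>c v u\<bar>"]) (auto intro: sum_nonneg)
    finally show ?thesis .
  qed
  then have "K 1 Y a" unfolding K_def using c by (intro ballI exI[of _ "c _"]) auto
  then show ?thesis by blast
qed

text \<open>Powers of d^n x are expanded in the generators by applying the multiplication matrix
  repeatedly to the coordinates of 1; this is the use of \<open>1 \<in> V\<close>.\<close>

lemma K_power_coeffs:
  assumes "K n Y x"
  shows "\<exists>c::real \<Rightarrow> int. (of_int d ^ n * x) ^ k = (\<Sum>u\<in>V. of_int (c u) * u) \<and> (\<forall>u\<in>V. \<bar>c u\<bar> \<le> int ((card V * Y) ^ k))"
proof (induction k)
  case 0
  obtain c :: "real \<Rightarrow> int" where "of_int d ^ 0 * 1 * 1 = (\<Sum>u\<in>V. of_int (c u) * u)" "\<forall>u\<in>V. \<bar>c u\<bar> \<le> int (nat \<bar>d\<bar> ^ 0)"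
    using K_E[OF K_one[of 0] oneV] by blast
  then show ?case by (intro exI[of _ c]) simp
next
  case (Suc k)
  then obtain e :: "real \<Rightarrow> int" where e: "(of_int d ^ n * x) ^ k = (\<Sum>u\<in>V. of_int (e u) * u)" "\<forall>u\<in>V. \<bar>e u\<bar> \<le> int ((card V * Y) ^ k)" by blast
  have "\<exists>c. \<forall>u\<in>V. of_int d ^ n * x * u = (\<Sum>t\<in>V. of_int (c u t :: int) * t) \<and> (\<forall>t\<in>V. \<bar>c u t\<bar> \<le> int Y)"
    using assms(1) unfolding K_def by (rule bchoice)
  then obtain c :: "real \<Rightarrow> real \<Rightarrow> int" where c: "\<And>u. u \<in> V \<Longrightarrow> of_int d ^ n * x * u = (\<Sum>t\<in>V. of_int (c u t) * t)"
    "\<And>u t. u \<in> V \<Longrightarrow> t \<in> V \<Longrightarrow> \<bar>c u t\<bar> \<le> int Y" by blast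
  show ?case
  proof (intro exI[of _ "\<lambda>t. \<Sum>u\<in>V. e u * c u t"] conjI ballI)
    have "(of_int d ^ n * x) ^ Suc k = of_int d ^ n * x * ((of_int d ^ n * x) ^ k)" by simp
    also have "\<dots> = (\<Sum>u\<in>V. of_int (e u) * (of_int d ^ n * x * u))" unfolding e(1) by (simp add: sum_distrib_left mult_ac)
    also have "\<dots> = (\<Sum>u\<in>V. \<Sum>t\<in>V. of_int (e u * c u t) * t)" using c(1) by (simp add: sum_distrib_left mult_ac)
    also have "\<dots> = (\<Sum>t\<in>V. \<Sum>u\<in>V. of_int (e u * c u t) * t)" by (rule sum.swap)
    also have "\<dots> = (\<Sum>t\<in>V. of_int (\<Sum>u\<in>V. e u * c u t) * t)" by (simp add: sum_distrib_right)
    finally show "(of_int d ^ n * x) ^ Suc k = (\<Sum>t\<in>V. of_int (\<Sum>u\<in>V. e u * c u t) * t)" .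
    fix t assume t: "t \<in> V"
    have "\<bar>\<Sum>u\<in>V. e u * c u t\<bar> \<le> (\<Sum>u\<in>V. \<bar>e u\<bar> * \<bar>c u t\<bar>)" unfolding abs_mult[symmetric] by (rule sum_abs)
    also have "\<dots> \<le> (\<Sum>u\<in>V. int ((card V * Y) ^ k) * int Y)" using e(2) c(2) t by (intro sum_mono mult_mono) auto
    also have "\<dots> = int ((card V * Y) ^ Suc k)" by simp
    finally show "\<bar>\<Sum>u\<in>V. e u * c u t\<bar> \<le> int ((card V * Y) ^ Suc k)" .
  qed
qed

text \<open>
  By the pigeonhole principle \<open>X = d\<^sup>n x\<close> is a root of a nonzero integer polynomial of degree at most
  \<open>card V\<close> with controlled coefficients; its lowest nonzero coefficient bounds \<open>\<bar>X\<bar>\<close> from below.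
\<close>

lemma K_lower_bound:
  assumes Kx: "K n Y x" and Y: "Y \<ge> 1" and x: "x \<noteq> 0"
  defines "N \<equiv> card V"
  defines "H \<equiv> (2 * (N + 1) * (N * Y) ^ N + 1) ^ N"
  shows "1 \<le> real (N * H) * \<bar>of_int d\<bar> ^ n * \<bar>x\<bar>"
proof -
  define X where "X = of_int d ^ n * x"
  have X0: "X \<noteq> 0" using x d0 by (simp add: X_def)
  have N: "N \<ge> 1" unfolding N_def using finV oneV by (metis One_nat_def Suc_leI card_gt_0_iff empty_iff)
  have "\<exists>b. \<forall>k. X ^ k = (\<Sum>u\<in>V. of_int (b k u :: int) * u) \<and> (\<forall>u\<in>V. \<bar>b k u\<bar> \<le> int ((N * Y) ^ k))"
    using K_power_coeffs[OF Kx] unfolding X_def N_def by (intro choice) blast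
  then obtain b :: "nat \<Rightarrow> real \<Rightarrow> int" where b: "\<And>k. X ^ k = (\<Sum>u\<in>V. of_int (b k u) * u)"
    "\<And>k u. u \<in> V \<Longrightarrow> \<bar>b k u\<bar> \<le> int ((N * Y) ^ k)" by blast
  define Q where "Q = (N * Y) ^ N"
  have NY: "N * Y \<ge> 1" using N Y by simp
  have bQ: "\<bar>b k u\<bar> \<le> int Q" if "k \<le> N" "u \<in> V" for k u
  proof -
    have "(N * Y) ^ k \<le> Q" unfolding Q_def using NY that by (intro power_increasing) auto
    then show ?thesis using b(2)[OF that(2), of k] by linarith
  qed
  \<comment> \<open>With H = R^N there are (H+1)^(N+1) coefficient choices, while the resulting
    coordinate vectors number at most (R (H+1))^N = H (H+1)^N. Two choices collide.\<close>
  define R where "R = 2 * (N + 1) * Q + 1"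
  have HR: "H = R ^ N" by (simp add: H_def R_def Q_def)
  define C :: "(nat \<Rightarrow> int) set" where "C = {..N} \<rightarrow>\<^sub>E {0..int H}"
  define B where "B = int ((N + 1) * H * Q)"
  define D :: "(real \<Rightarrow> int) set" where "D = V \<rightarrow>\<^sub>E {- B..B}"
  define f where "f = (\<lambda>c::nat \<Rightarrow> int. \<lambda>u\<in>V. \<Sum>k\<le>N. c k * b k u)"
  have fC: "f ` C \<subseteq> D"
  proof
    fix z assume "z \<in> f ` C"
    then obtain c where c: "c \<in> C" "z = f c" by auto
    have "\<bar>\<Sum>k\<le>N. c k * b k u\<bar> \<le> B" if u: "u \<in> V" for u
    proof -
      have "\<bar>\<Sum>k\<le>N. c k * b k u\<bar> \<le> (\<Sum>k\<le>N. \<bar>c k\<bar> * \<bar>b k u\<bar>)" unfolding abs_mult[symmetric] by (rule sum_abs)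
      also have "\<dots> \<le> (\<Sum>k\<le>N. int H * int Q)"
        using c(1) bQ u by (intro sum_mono mult_mono) (auto simp: C_def PiE_iff)
      also have "\<dots> = B" by (simp add: B_def algebra_simps)
      finally show ?thesis .
    qed
    then show "z \<in> D" unfolding c(2) f_def D_def by (auto simp: abs_le_iff minus_le_iff)
  qed
  have cC: "card C = (H + 1) ^ (N + 1)" by (simp add: C_def card_PiE nat_add_distrib)
  have cD: "card D = (2 * ((N + 1) * H * Q) + 1) ^ N"
  proof -
    have "card {- B..B} = 2 * ((N + 1) * H * Q) + 1" by (simp add: B_def nat_add_distrib nat_mult_distrib algebra_simps)
    then show ?thesis unfolding D_def using finV by (simp add: card_PiE N_def)
  qed
  have "card D \<le> (R * (H + 1)) ^ N"
    unfolding cD by (intro power_mono) (auto simp: R_def algebra_simps)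
  also have "\<dots> = H * (H + 1) ^ N" by (simp only: power_mult_distrib HR)
  also have "\<dots> < card C" by (simp add: cC)
  finally have lt: "card D < card C" .
  have finD: "finite D" unfolding D_def using finV by (intro finite_PiE) auto
  have "\<not> inj_on f C"
  proof
    assume "inj_on f C"
    then have "card C = card (f ` C)" by (simp add: card_image)
    also have "\<dots> \<le> card D" by (rule card_mono[OF finD fC])
    finally show False using lt by simp
  qed
  then obtain c c' where cc: "c \<in> C" "c' \<in> C" "c \<noteq> c'" "f c = f c'" by (auto simp: inj_on_def)
  define e where "e = (\<lambda>k. c k - c' k)"
  have eH: "\<bar>e k\<bar> \<le> int H" if "k \<le> N" for k
    using cc(1,2) that unfolding e_def C_def by (force simp: PiE_iff)
  obtain k0 where k0: "c k0 \<noteq> c' k0" using cc(3) by auto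
  then have k0N: "k0 \<le> N" using cc(1,2) unfolding C_def by (metis PiE_arb atMost_iff)
  define j where "j = (LEAST k. e k \<noteq> 0)"
  have j: "e j \<noteq> 0" unfolding j_def by (rule LeastI[of _ k0]) (use k0 in \<open>simp add: e_def\<close>)
  have jl: "e k = 0" if "k < j" for k using not_less_Least[of k "\<lambda>k. e k \<noteq> 0"] that unfolding j_def by auto
  have jN: "j \<le> N" unfolding j_def using k0 k0N by (metis (mono_tags, lifting) Least_le e_def eq_iff_diff_eq_0 le_trans)
  have rel: "(\<Sum>k\<le>N. of_int (e k) * X ^ k) = 0"
  proof -
    have z: "(\<Sum>k\<le>N. e k * b k u) = 0" if "u \<in> V" for u
      using fun_cong[OF cc(4), of u] that by (simp add: f_def e_def left_diff_distrib sum_subtractf)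
    have "(\<Sum>k\<le>N. of_int (e k) * X ^ k) = (\<Sum>k\<le>N. \<Sum>u\<in>V. of_int (e k * b k u) * u)"
      unfolding b(1) by (simp add: sum_distrib_left mult_ac)
    also have "\<dots> = (\<Sum>u\<in>V. \<Sum>k\<le>N. of_int (e k * b k u) * u)" by (rule sum.swap)
    also have "\<dots> = (\<Sum>u\<in>V. of_int (\<Sum>k\<le>N. e k * b k u) * u)" by (simp add: sum_distrib_right)
    also have "\<dots> = 0" using z by simp
    finally show ?thesis .
  qed
  \<comment> \<open>If |X| <= 1, dividing the relation by X^j isolates the integer
    \<open>e j\<close>, and each of the at most N other terms is bounded by H |X|. If |X| > 1, the
    claim holds because N H >= 1.\<close>
  have "1 \<le> real (N * H) * \<bar>X\<bar>"
  proof (cases "\<bar>X\<bar> \<le> 1")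
    case True
    have "(\<Sum>k\<le>N. of_int (e k) * X ^ k) = (\<Sum>k\<in>{j..N}. of_int (e k) * X ^ k)"
      by (rule sum.mono_neutral_right) (auto simp: jl)
    also have "\<dots> = X ^ j * (\<Sum>k\<in>{j..N}. of_int (e k) * X ^ (k - j))"
      unfolding sum_distrib_left
      by (intro sum.cong refl) (simp add: mult.left_commute flip: power_add)
    finally have "(\<Sum>k\<in>{j..N}. of_int (e k) * X ^ (k - j)) = 0" using rel X0 by simp
    moreover have "{j..N} = insert j {j<..N}" using jN by auto
    ultimately have ej: "of_int (e j) = - (\<Sum>k\<in>{j<..N}. of_int (e k) * X ^ (k - j))" by simp
    have "1 \<le> \<bar>of_int (e j) :: real\<bar>" using j by simp
    also have "\<dots> \<le> (\<Sum>k\<in>{j<..N}. \<bar>of_int (e k)\<bar> * \<bar>X\<bar> ^ (k - j))"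
      unfolding ej abs_minus_cancel power_abs[symmetric] abs_mult[symmetric] by (rule sum_abs)
    also have "\<dots> \<le> (\<Sum>k\<in>{j<..N}. real H * \<bar>X\<bar>)"
    proof (intro sum_mono mult_mono)
      fix k assume k: "k \<in> {j<..N}"
      show "\<bar>of_int (e k)\<bar> \<le> real H" using eH[of k] k by (simp flip: of_int_abs)
      show "\<bar>X\<bar> ^ (k - j) \<le> \<bar>X\<bar>" using k True power_decreasing[of 1 "k - j" "\<bar>X\<bar>"] by (simp add: Suc_le_eq)
    qed auto
    also have "\<dots> = real (N - j) * (real H * \<bar>X\<bar>)" by simp
    also have "\<dots> \<le> real N * (real H * \<bar>X\<bar>)" by (intro mult_right_mono) auto
    finally show ?thesis by (simp add: mult.assoc)
  next
    case False
    have "H \<ge> 1" unfolding HR R_def by simp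
    then have "real (N * H) \<ge> 1" using N by (simp flip: of_nat_mult) 
    then show ?thesis using False mult_mono[of 1 "real (N * H)" 1 "\<bar>X\<bar>"] by simp
  qed
  then show ?thesis by (simp add: X_def abs_mult power_abs mult.assoc)
qed

end

section \<open>Words that almost fix a point\<close>

lemma rotation_orthogonal: "rotation_matrix A \<Longrightarrow> orthogonal_transformation ((*v) A)" for A :: "real^3^3"
  by (simp add: orthogonal_transformation_matrix rotation_matrix_def)

lemma rotation_norm: "rotation_matrix A \<Longrightarrow> norm (A *v x) = norm x" for A :: "real^3^3"
  by (rule orthogonal_transformation_norm[OF rotation_orthogonal])

lemma norm_cross_le: "norm (x \<times> y) \<le> norm x * norm y" for x y :: "real^3"
proof -
  have "(norm (x \<times> y))\<^sup>2 \<le> (norm x * norm y)\<^sup>2" using norm_cross_dot[of x y] by (metis le_add_same_cancel1 zero_le_power2)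
  then show ?thesis by (rule power2_le_imp_le) simp
qed

text \<open>
  Rotations that almost fix \<open>y\<close> almost commute with \<open>J v = y \<times> v\<close>, so on the plane orthogonal to \<open>y\<close>
  they are close to complex multiplications.
\<close>

lemma almost_stabilizers_commute:
  fixes A B :: "real^3^3"
  assumes A: "rotation_matrix A" and B: "rotation_matrix B" and y: "norm y = 1"
    and a: "norm (A *v y - y) \<le> \<eta>" and b: "norm (B *v y - y) \<le> \<eta>" and v: "norm v = 1"
  shows "norm (A *v (B *v v) - B *v (A *v v)) \<le> 24 * \<eta>"
proof -
  obtain Q :: "real^3^3" where Q: "rotation_matrix Q" "Q *v axis 3 1 = y"
    using rotation_matrix_exists_basis[of y 3] y by auto
  \<comment> \<open>\<open>w\<close>, \<open>J w\<close> and \<open>y\<close> form a positively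
    oriented orthonormal frame, and \<open>J\<close> is the quarter turn in the plane orthogonal to
    \<open>y\<close>.\<close>
  define w where "w = Q *v axis 1 1"
  define J where "J = (\<lambda>x::real^3. y \<times> x)"
  have Jw: "J w = Q *v axis 2 1"
    unfolding J_def w_def Q(2)[symmetric] cross_rotation_matrix[OF Q(1)] by (simp add: cross_basis)
  have JJw: "J (J w) = - w"
    unfolding Jw unfolding J_def w_def Q(2)[symmetric] cross_rotation_matrix[OF Q(1)]
    by (simp add: cross_basis linear_neg[OF matrix_vector_mul_linear])
  have "norm w = 1" unfolding w_def by (simp add: rotation_norm[OF Q(1)])
  moreover have "norm (J w) = 1" unfolding Jw by (simp add: rotation_norm[OF Q(1)])
  ultimately have nw: "norm w = 1" "norm (J w) = 1" by auto
  have lin: "A *v (x + z) = A *v x + A *v z" "A *v (x - z) = A *v x - A *v z" "A *v (c *\<^sub>R x) = c *\<^sub>R (A *v x)"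
    for A :: "real^3^3" and x z c
    by (simp_all add: matrix_vector_right_distrib matrix_vector_mult_diff_distrib matrix_vector_mult_scaleR)
  have Jlin: "J (x + z) = J x + J z" "J (x - z) = J x - J z" "J (c *\<^sub>R x) = c *\<^sub>R J x" for x z c
    by (simp_all add: J_def cross_add_right cross_mult_right Cross3.right_diff_distrib)
  have nJ: "norm (J x) \<le> norm x" for x unfolding J_def using norm_cross_le[of y x] y by simp
  have expand: "x = (x \<bullet> w) *\<^sub>R w + (x \<bullet> J w) *\<^sub>R J w + (x \<bullet> y) *\<^sub>R y" for x
  proof -
    define z where "z = transpose Q *v x"
    have x: "x = Q *v z" unfolding z_def using rotation_matrix_transpose(3)[OF Q(1)]
      by (simp add: matrix_vector_mul_assoc del: transpose_matrix_vector)
    have z: "z = (z$1) *\<^sub>R axis 1 1 + (z$2) *\<^sub>R axis 2 1 + (z$3) *\<^sub>R axis 3 1"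
      by (simp add: vec_eq_iff axis_def forall_3)
    have ip: "x \<bullet> (Q *v axis i 1) = z$i" for i
      unfolding x using rotation_orthogonal[OF Q(1)] by (simp add: orthogonal_transformation_def inner_axis)
    show ?thesis
      unfolding Jw unfolding w_def ip Q(2)[symmetric] by (subst x, subst z) (simp only: lin)
  qed
  have eta: "\<eta> \<ge> 0" using a norm_ge_zero order_trans by blast
  have commJ: "norm (h *v J x - J (h *v x)) \<le> \<eta> * norm x" if h: "rotation_matrix h" "norm (h *v y - y) \<le> \<eta>" for h x
  proof -
    \<comment> \<open>Rotations preserve the cross product, so the failure of \<open>h\<close> to
      commute with \<open>J\<close> is a cross product with h y - y.\<close>
    have "h *v J x - J (h *v x) = (h *v y - y) \<times> (h *v x)"
      unfolding J_def cross_rotation_matrix[OF h(1), symmetric] by (simp add: Cross3.left_diff_distrib)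
    then have "norm (h *v J x - J (h *v x)) \<le> norm (h *v y - y) * norm (h *v x)" using norm_cross_le by simp
    also have "\<dots> \<le> \<eta> * norm x" unfolding rotation_norm[OF h(1)] using h(2) by (intro mult_right_mono) auto
    finally show ?thesis .
  qed
  \<comment> \<open>h w is orthogonal to h y, which is within \<eta> of y; hence h w has only a
    small component along y.\<close>
  have plane: "\<exists>\<beta> \<gamma> \<delta>. h *v w = \<beta> *\<^sub>R w + \<gamma> *\<^sub>R J w + \<delta> \<and> norm \<delta> \<le> \<eta> \<and> \<bar>\<beta>\<bar> \<le> 1 \<and> \<bar>\<gamma>\<bar> \<le> 1"
    if h: "rotation_matrix h" "norm (h *v y - y) \<le> \<eta>" for h
  proof -
    have nh: "norm (h *v w) = 1" using rotation_norm[OF h(1)] nw by simp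
    have "w \<bullet> y = 0" unfolding w_def Q(2)[symmetric]
      using rotation_orthogonal[OF Q(1)] by (simp add: orthogonal_transformation_def inner_axis_axis)
    then have "(h *v w) \<bullet> (h *v y) = 0" using rotation_orthogonal[OF h(1)] by (simp add: orthogonal_transformation_def)
    then have "(h *v w) \<bullet> y = - ((h *v w) \<bullet> (h *v y - y))" by (simp add: inner_diff_right)
    then have "\<bar>(h *v w) \<bullet> y\<bar> \<le> \<eta>"
      using Cauchy_Schwarz_ineq2[of "h *v w" "h *v y - y"] h(2) nh by simp
    then have "norm (((h *v w) \<bullet> y) *\<^sub>R y) \<le> \<eta>" using y by simp
    moreover have "\<bar>(h *v w) \<bullet> w\<bar> \<le> 1" "\<bar>(h *v w) \<bullet> J w\<bar> \<le> 1"
      using Cauchy_Schwarz_ineq2[of "h *v w" w] Cauchy_Schwarz_ineq2[of "h *v w" "J w"] nh nw by auto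
    ultimately show ?thesis using expand[of "h *v w"] by blast
  qed
  obtain \<beta>1 \<gamma>1 \<delta>1 where p1: "A *v w = \<beta>1 *\<^sub>R w + \<gamma>1 *\<^sub>R J w + \<delta>1" "norm \<delta>1 \<le> \<eta>" "\<bar>\<beta>1\<bar> \<le> 1" "\<bar>\<gamma>1\<bar> \<le> 1"
    using plane[OF A a] by blast
  obtain \<beta>2 \<gamma>2 \<delta>2 where p2: "B *v w = \<beta>2 *\<^sub>R w + \<gamma>2 *\<^sub>R J w + \<delta>2" "norm \<delta>2 \<le> \<eta>" "\<bar>\<beta>2\<bar> \<le> 1" "\<bar>\<gamma>2\<bar> \<le> 1"
    using plane[OF B b] by blast
  \<comment> \<open>Up to four errors of size \<eta>, h acts on the plane as multiplication by the
    complex number \<beta> + i \<gamma>. The product formula is symmetric in the two numbers, so A B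
    w and B A w share the same main term.\<close>
  have half: "norm (h *v (\<beta>' *\<^sub>R w + \<gamma>' *\<^sub>R J w + \<delta>') - ((\<beta>' * \<beta>) *\<^sub>R w + (\<beta>' * \<gamma> + \<gamma>' * \<beta>) *\<^sub>R J w - (\<gamma>' * \<gamma>) *\<^sub>R w)) \<le> 4 * \<eta>"
    if h: "rotation_matrix h" "norm (h *v y - y) \<le> \<eta>" and p: "h *v w = \<beta> *\<^sub>R w + \<gamma> *\<^sub>R J w + \<delta>" "norm \<delta> \<le> \<eta>"
      and q: "norm \<delta>' \<le> \<eta>" "\<bar>\<beta>'\<bar> \<le> 1" "\<bar>\<gamma>'\<bar> \<le> 1" for h \<beta> \<gamma> \<delta> \<beta>' \<gamma>' \<delta>'
  proof -
    define e where "e = h *v J w - J (h *v w)"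
    have e: "norm e \<le> \<eta>" unfolding e_def using commJ[OF h, of w] nw by simp
    have hJ: "h *v J w = \<beta> *\<^sub>R J w - \<gamma> *\<^sub>R w + J \<delta> + e" unfolding e_def p(1) Jlin JJw by simp
    have eq: "h *v (\<beta>' *\<^sub>R w + \<gamma>' *\<^sub>R J w + \<delta>') - ((\<beta>' * \<beta>) *\<^sub>R w + (\<beta>' * \<gamma> + \<gamma>' * \<beta>) *\<^sub>R J w - (\<gamma>' * \<gamma>) *\<^sub>R w)
       = \<beta>' *\<^sub>R \<delta> + \<gamma>' *\<^sub>R J \<delta> + \<gamma>' *\<^sub>R e + h *v \<delta>'"
      unfolding lin hJ p(1) by (simp add: algebra_simps)
    have "norm (\<beta>' *\<^sub>R \<delta> + \<gamma>' *\<^sub>R J \<delta> + \<gamma>' *\<^sub>R e + h *v \<delta>') \<le> norm (\<beta>' *\<^sub>R \<delta>) + norm (\<gamma>' *\<^sub>R J \<delta>) + norm (\<gamma>' *\<^sub>R e) + norm (h *v \<delta>')"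
      by (meson norm_triangle_mono order_refl)
    also have "\<dots> \<le> 1 * \<eta> + 1 * \<eta> + 1 * \<eta> + \<eta>"
      unfolding norm_scaleR rotation_norm[OF h(1)]
      by (intro add_mono mult_mono q p e order_trans[OF nJ p(2)]) auto
    finally show ?thesis unfolding eq by simp
  qed
  define D where "D = (\<lambda>x. A *v (B *v x) - B *v (A *v x))"
  have Dlin: "D (x + z) = D x + D z" "D (c *\<^sub>R x) = c *\<^sub>R D x" for x z c
    by (simp_all add: D_def lin algebra_simps)
  have Dw: "norm (D w) \<le> 8 * \<eta>"
  proof -
    define m where "m = (\<beta>2 * \<beta>1) *\<^sub>R w + (\<beta>2 * \<gamma>1 + \<gamma>2 * \<beta>1) *\<^sub>R J w - (\<gamma>2 * \<gamma>1) *\<^sub>R w"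
    have 1: "norm (A *v (B *v w) - m) \<le> 4 * \<eta>" unfolding m_def p2(1) by (rule half[OF A a p1(1,2) p2(2,3,4)])
    have "m = (\<beta>1 * \<beta>2) *\<^sub>R w + (\<beta>1 * \<gamma>2 + \<gamma>1 * \<beta>2) *\<^sub>R J w - (\<gamma>1 * \<gamma>2) *\<^sub>R w" by (simp add: m_def algebra_simps)
    then have 2: "norm (B *v (A *v w) - m) \<le> 4 * \<eta>" unfolding p1(1) using half[OF B b p2(1,2) p1(2,3,4)] by simp
    have "D w = (A *v (B *v w) - m) - (B *v (A *v w) - m)" by (simp add: D_def)
    then have "norm (D w) \<le> norm (A *v (B *v w) - m) + norm (B *v (A *v w) - m)" by (metis norm_triangle_ineq4)
    then show ?thesis using 1 2 by linarith
  qed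
  have Dy: "norm (D y) \<le> 4 * \<eta>"
  proof -
    have "D y = A *v (B *v y - y) + (A *v y - y) - (B *v (A *v y - y) + (B *v y - y))" by (simp add: D_def lin)
    also have "norm \<dots> \<le> (norm (A *v (B *v y - y)) + norm (A *v y - y)) + (norm (B *v (A *v y - y)) + norm (B *v y - y))"
      by (intro order_trans[OF norm_triangle_ineq4] add_mono norm_triangle_ineq)
    finally show ?thesis unfolding rotation_norm[OF A] rotation_norm[OF B] using a b by linarith
  qed
  have DJ: "norm (D (J w)) \<le> 12 * \<eta>"
  proof -
    define e1 e2 e3 e4 where "e1 = B *v J w - J (B *v w)" and "e2 = A *v J (B *v w) - J (A *v (B *v w))"
      and "e3 = A *v J w - J (A *v w)" and "e4 = B *v J (A *v w) - J (B *v (A *v w))"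
    have n: "norm e1 \<le> \<eta>" "norm e2 \<le> \<eta>" "norm e3 \<le> \<eta>" "norm e4 \<le> \<eta>"
      unfolding e1_def e2_def e3_def e4_def
      using commJ[OF B b, of w] commJ[OF A a, of "B *v w"] commJ[OF A a, of w] commJ[OF B b, of "A *v w"] nw
      by (simp_all add: rotation_norm[OF A] rotation_norm[OF B])
    have "D (J w) = J (D w) + ((A *v e1 + e2) - (B *v e3 + e4))"
      unfolding D_def e1_def e2_def e3_def e4_def lin Jlin by simp
    also have "norm \<dots> \<le> norm (J (D w)) + ((norm (A *v e1) + norm e2) + (norm (B *v e3) + norm e4))"
      by (intro order_trans[OF norm_triangle_ineq] add_mono order_refl order_trans[OF norm_triangle_ineq4] norm_triangle_ineq)
    finally show ?thesis unfolding rotation_norm[OF A] rotation_norm[OF B] using n nJ[of "D w"] Dw by linarith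
  qed
  have c: "\<bar>v \<bullet> w\<bar> \<le> 1" "\<bar>v \<bullet> J w\<bar> \<le> 1" "\<bar>v \<bullet> y\<bar> \<le> 1"
    using Cauchy_Schwarz_ineq2[of v w] Cauchy_Schwarz_ineq2[of v "J w"] Cauchy_Schwarz_ineq2[of v y] v nw y by auto
  \<comment> \<open>The defects 8 \<eta>, 12 \<eta> and 4 \<eta> on the three vectors of the frame
    add up to the constant 24.\<close>
  have "D v = (v \<bullet> w) *\<^sub>R D w + (v \<bullet> J w) *\<^sub>R D (J w) + (v \<bullet> y) *\<^sub>R D y"
    by (subst expand[of v]) (simp only: Dlin)
  also have "norm \<dots> \<le> norm ((v \<bullet> w) *\<^sub>R D w) + norm ((v \<bullet> J w) *\<^sub>R D (J w)) + norm ((v \<bullet> y) *\<^sub>R D y)"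
    by (meson norm_triangle_mono order_refl)
  also have "\<dots> \<le> 1 * (8 * \<eta>) + 1 * (12 * \<eta>) + 1 * (4 * \<eta>)"
    unfolding norm_scaleR by (intro add_mono mult_mono c Dw DJ Dy) auto
  finally show ?thesis by (simp add: D_def)
qed

section \<open>Axes of rotations and the Diophantine gap for words\<close>

text \<open>The vector of the antisymmetric part A - A^T; for a rotation by the angle \<theta> it is
  2 sin \<theta> times the unit axis.\<close>

definition axis_vec :: "real^3^3 \<Rightarrow> real^3" where
  "axis_vec A = vector [A$3$2 - A$2$3, A$1$3 - A$3$1, A$2$1 - A$1$2]"

lemma axis_vec_cross: "axis_vec A \<times> v = A *v v - transpose A *v v"
  by (simp add: axis_vec_def cross3_def vec_eq_iff forall_3 matrix_vector_mult_def transpose_def sum_3 vector_3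
      algebra_simps del: transpose_matrix_vector)

text \<open>A rotation commuting with A commutes with its transpose too, hence with the operator
  \<open>axis_vec A \<times> _\<close>; and a vector is determined by its cross products.\<close>

lemma axis_vec_fixed:
  assumes A: "rotation_matrix A" and h: "rotation_matrix h" and comm: "h ** A = A ** h"
  shows "h *v axis_vec A = axis_vec A"
proof -
  have "transpose A ** h = transpose A ** h ** (A ** transpose A)"
    using rotation_matrix_transpose(3)[OF A] by simp
  also have "\<dots> = transpose A ** (h ** A) ** transpose A" by (simp add: matrix_mul_assoc)
  also have "\<dots> = transpose A ** A ** h ** transpose A" unfolding comm by (simp add: matrix_mul_assoc)
  also have "\<dots> = h ** transpose A" using rotation_matrix_transpose(2)[OF A] by simp
  finally have comm': "h ** transpose A = transpose A ** h" by simp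
  have "(h *v axis_vec A) \<times> u = axis_vec A \<times> u" for u
  proof -
    define v where "v = transpose h *v u"
    have u: "u = h *v v" unfolding v_def using rotation_matrix_transpose(3)[OF h]
      by (simp add: matrix_vector_mul_assoc del: transpose_matrix_vector)
    have "(h *v axis_vec A) \<times> u = h *v (axis_vec A \<times> v)" unfolding u by (rule cross_rotation_matrix[OF h])
    also have "\<dots> = (h ** A) *v v - (h ** transpose A) *v v"
      unfolding axis_vec_cross by (simp add: matrix_vector_mult_diff_distrib matrix_vector_mul_assoc del: transpose_matrix_vector)
    also have "\<dots> = axis_vec A \<times> u"
      unfolding comm comm' axis_vec_cross u by (simp add: matrix_vector_mul_assoc del: transpose_matrix_vector)
    finally show ?thesis .
  qed
  then have "(h *v axis_vec A - axis_vec A) \<times> u = 0" for u by (simp add: Cross3.left_diff_distrib)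
  from this[of "axis 1 1"] this[of "axis 2 1"] have "h *v axis_vec A - axis_vec A = 0"
    by (simp add: cross3_def axis_def vec_eq_iff forall_3 vector_3)
  then show ?thesis by simp
qed

text \<open>The stabilizer hypothesis is stated for all points of the sphere because the common
  fixed point found in \<open>few_words_near\<close> can be an axis unrelated to the points x and
  y.\<close>

locale algebraic_rotation_words = rotation_words +
  assumes alg: "j \<in> {1..M} \<Longrightarrow> algebraic (g j $ a $ b)"
    and cyc: "x \<in> S2 \<Longrightarrow> trivial_group (stabilizer_group (subgroup_generated SO3 (g ` {1..M})) x) \<or>
      cyclic_group (stabilizer_group (subgroup_generated SO3 (g ` {1..M})) x)"
begin

text \<open>An entry of a word of length n has denominator d^n and a multiplication matrix whose
  entries grow at most geometrically in n. The pigeonhole bound has fixed degree in those entries,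
  so it also decays at most geometrically.\<close>

lemma word_entry_gap:
  obtains C b :: real where "C \<ge> 1" "b \<ge> 1"
    "\<And>w i j. set w \<subseteq> letters \<Longrightarrow> (val w - mat 1) $ i $ j \<noteq> 0 \<Longrightarrow> 1 \<le> C * b ^ length w * \<bar>(val w - mat 1) $ i $ j\<bar>"
proof -
  define E where "E = (\<lambda>(j, a, b). g j $ a $ b) ` Sigma {1..M} (\<lambda>_. (UNIV :: (3 * 3) set))"
  have "finite E" unfolding E_def by (intro finite_imageI finite_SigmaI) auto
  moreover have "algebraic a" if "a \<in> E" for a using that alg unfolding E_def by auto
  ultimately obtain V d where V: "finite V" "1 \<in> V" "d \<noteq> (0::int)" "\<And>a v. a \<in> E \<Longrightarrow> v \<in> V \<Longrightarrow> of_int d * a * v \<in> zspan V"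
    using algebraic_common_module[of E] by metis
  interpret integral_module V d by unfold_locales (use V in auto)
  have "\<forall>a\<in>E. \<exists>Y. K 1 Y a" using K_generator V(4) by blast
  then obtain Yf where Yf: "\<And>a. a \<in> E \<Longrightarrow> K 1 (Yf a) a" by metis
  define Y0 where "Y0 = (\<Sum>a\<in>E. Yf a) + 1"
  have KE: "K 1 Y0 a" if "a \<in> E" for a
  proof -
    have "Yf a \<le> (\<Sum>a\<in>E. Yf a)" using \<open>finite E\<close> that by (intro member_le_sum) auto
    then show ?thesis using Yf[OF that] by (auto simp: Y0_def intro: K_mono)
  qed
  define N where "N = card V"
  have N: "N \<ge> 1" unfolding N_def using V(1,2) by (metis One_nat_def Suc_leI card_gt_0_iff empty_iff)
  \<comment> \<open>The growth per letter: 3 summands in a matrix product, the factor N lost in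
    multiplying two module elements, and the bound \<open>Y0\<close> for the generators.\<close>
  define Y1 where "Y1 = 3 * N * Y0"
  have entry: "K (length w) (Y1 ^ length w) (val w $ i $ j)" if "set w \<subseteq> letters" for w i j
    using that
  proof (induction w arbitrary: i j)
    case Nil
    then show ?case using K_one[of 0] by (simp add: mat_def K_zero)
  next
    case (Cons l w)
    obtain a b where l: "l = (a, b)" "a \<in> {1..M}" using Cons.prems by (cases l) (auto simp: letters_def)
    have "g a $ i $ k \<in> E" for i k unfolding E_def using l by (intro image_eqI[of _ _ "(a, i, k)"]) auto
    then have lE: "K 1 Y0 (lv l $ i $ k)" for k
      using l by (auto intro!: KE[simplified] simp: lv_def transpose_def)
    have "val (l # w) $ i $ j = (\<Sum>k\<in>UNIV. lv l $ i $ k * val w $ k $ j)"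
      using Cons.prems by (simp add: val_Cons matrix_matrix_mult_def)
    moreover have "K (1 + length w) (card (UNIV :: 3 set) * (N * Y0 * Y1 ^ length w)) (\<Sum>k\<in>UNIV. lv l $ i $ k * val w $ k $ j)"
      unfolding N_def by (intro K_sum K_mult lE Cons.IH) (use Cons.prems in auto)
    ultimately show ?case by (simp add: Y1_def mult_ac)
  qed
  define Y2 where "Y2 = Y1 + nat \<bar>d\<bar> + 1"
  have gap: "K (length w) (2 * Y2 ^ length w) ((val w - mat 1) $ i $ j)" if "set w \<subseteq> letters" for w i j
  proof -
    have m: "K (length w) (nat \<bar>d\<bar> ^ length w) (- (mat 1 $ i $ j))"
      using K_uminus[OF K_one[of "length w"]] K_zero by (auto simp: mat_def)
    have "K (length w) (Y1 ^ length w + nat \<bar>d\<bar> ^ length w) (val w $ i $ j + - (mat 1 $ i $ j))"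
      by (intro K_add entry that m)
    moreover have "Y1 ^ length w + nat \<bar>d\<bar> ^ length w \<le> 2 * Y2 ^ length w"
      using power_mono[of Y1 Y2 "length w"] power_mono[of "nat \<bar>d\<bar>" Y2 "length w"] by (simp add: Y2_def)
    ultimately show ?thesis by (auto intro: K_mono)
  qed
  \<comment> \<open>The bound of \<open>K_lower_bound\<close> for Y = 2 Y2^n is separated into a
    constant \<open>C\<close> and the n-th power of \<open>b\<close>.\<close>
  define c0 where "c0 = 2 * (N + 1) * (N * 2) ^ N + 1"
  define C where "C = real (N * c0 ^ N)"
  define b where "b = real (Y2 ^ (N * N)) * \<bar>of_int d\<bar>"
  show thesis
  proof (rule that)
    have "c0 > 0" by (simp add: c0_def)
    then have "1 \<le> N * c0 ^ N" using N by (simp add: Suc_le_eq)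
    then show "C \<ge> 1" unfolding C_def by linarith
    have "1 \<le> \<bar>of_int d :: real\<bar>" using V(3) by simp
    moreover have "1 \<le> real (Y2 ^ (N * N))" by (simp add: Y2_def)
    ultimately show "b \<ge> 1" unfolding b_def using mult_mono[of 1 _ 1] by fastforce
    fix w i j assume w: "set w \<subseteq> letters" and nz: "(val w - mat 1) $ i $ j \<noteq> 0"
    define n where "n = length w"
    define Y where "Y = 2 * Y2 ^ n"
    have "1 \<le> Y" by (simp add: Y_def Y2_def)
    from K_lower_bound[OF gap[OF w, folded n_def, folded Y_def] this nz]
    have low: "1 \<le> real (N * (2 * (N + 1) * (N * Y) ^ N + 1) ^ N) * \<bar>of_int d\<bar> ^ n * \<bar>(val w - mat 1) $ i $ j\<bar>"
      by (simp add: N_def)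
    have "2 * (N + 1) * (N * Y) ^ N + 1 \<le> c0 * Y2 ^ (n * N)"
    proof -
      have e: "(N * Y) ^ N = (N * 2) ^ N * Y2 ^ (n * N)" by (simp add: Y_def power_mult_distrib power_mult)
      have "1 \<le> Y2 ^ (n * N)" by (simp add: Y2_def)
      then show ?thesis unfolding e c0_def by (simp add: algebra_simps)
    qed
    then have "(2 * (N + 1) * (N * Y) ^ N + 1) ^ N \<le> (c0 * Y2 ^ (n * N)) ^ N" by (rule power_mono) simp
    also have "\<dots> = c0 ^ N * (Y2 ^ (N * N)) ^ n" by (simp add: power_mult_distrib mult_ac flip: power_mult)
    finally have "N * (2 * (N + 1) * (N * Y) ^ N + 1) ^ N \<le> N * c0 ^ N * (Y2 ^ (N * N)) ^ n" by simp
    then have "real (N * (2 * (N + 1) * (N * Y) ^ N + 1) ^ N) \<le> C * real (Y2 ^ (N * N)) ^ n"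
      unfolding C_def by (metis of_nat_le_iff of_nat_mult of_nat_power)
    then have "real (N * (2 * (N + 1) * (N * Y) ^ N + 1) ^ N) * \<bar>of_int d\<bar> ^ n \<le> C * real (Y2 ^ (N * N)) ^ n * \<bar>of_int d\<bar> ^ n"
      by (intro mult_right_mono) auto
    also have "\<dots> = C * b ^ n" by (simp add: b_def power_mult_distrib)
    finally have "real (N * (2 * (N + 1) * (N * Y) ^ N + 1) ^ N) * \<bar>of_int d\<bar> ^ n * \<bar>(val w - mat 1) $ i $ j\<bar>
        \<le> C * b ^ n * \<bar>(val w - mat 1) $ i $ j\<bar>" by (intro mult_right_mono) auto
    with low show "1 \<le> C * b ^ length w * \<bar>(val w - mat 1) $ i $ j\<bar>" unfolding n_def by linarith
  qed
qed

lemma few_words_near: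
  obtains C b :: real where "C \<ge> 1" "b \<ge> 1"
    "\<And>n r x y. x \<in> S2 \<Longrightarrow> y \<in> S2 \<Longrightarrow> r * (C * b ^ n) < 1 \<Longrightarrow> card {w \<in> W n. norm (val w *v y - x) < r} \<le> 4 * n + 2"
proof -
  obtain C0 b0 :: real where C0: "C0 \<ge> 1" "b0 \<ge> 1"
    and gap: "\<And>w i j. set w \<subseteq> letters \<Longrightarrow> (val w - mat 1) $ i $ j \<noteq> 0 \<Longrightarrow> 1 \<le> C0 * b0 ^ length w * \<bar>(val w - mat 1) $ i $ j\<bar>"
    using word_entry_gap by metis
  show thesis
  \<comment> \<open>A commutator of two quotients of length 2n has 8n letters, whence the eighth
    power. Quotients move \<open>y\<close> by at most 2r, so
    \<open>almost_stabilizers_commute\<close> yields the factor 24 * 2 = 48.\<close>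
  proof (rule that[of "48 * C0" "b0 ^ 8"])
    fix n r x y assume x: "x \<in> S2" and y: "y \<in> S2" and r: "r * (48 * C0 * (b0 ^ 8) ^ n) < 1"
    define S where "S = {w \<in> W n. norm (val w *v y - x) < r}"
    have SW: "S \<subseteq> W n" by (auto simp: S_def)
    then have finS: "finite S" using finite_W finite_subset by blast
    have ny: "norm y = 1" using y by simp
    show "card S \<le> 4 * n + 2"
    proof (cases "S = {}")
      case False
      then obtain w0 where w0: "w0 \<in> S" by auto
      have Sl: "set w \<subseteq> letters" "length w = n" if "w \<in> S" for w using that by (auto simp: S_def W_def)
      define h where "h = (\<lambda>w. val (winv w0 @ w))"
      have sh: "set (winv w0 @ w) \<subseteq> letters" if "w \<in> S" for w using Sl[OF that] Sl[OF w0] set_winv[of w0] by auto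
      have hrot: "rotation_matrix (h w)" if "w \<in> S" for w unfolding h_def by (rule val_rot[OF sh[OF that]])
      have hy: "norm (h w *v y - y) \<le> 2 * r" if w: "w \<in> S" for w
      proof -
        have "h w = transpose (val w0) ** val w" unfolding h_def using Sl[OF w0] by (simp add: val_append val_winv)
        then have e: "val w0 *v (h w *v y) = val w *v y"
          using val_mult_transpose[OF Sl(1)[OF w0]] by (simp add: matrix_vector_mul_assoc matrix_mul_assoc)
        have "norm (h w *v y - y) = norm (val w0 *v (h w *v y - y))"
          by (rule rotation_norm[OF val_rot[OF Sl(1)[OF w0]], symmetric])
        also have "val w0 *v (h w *v y - y) = (val w *v y - x) - (val w0 *v y - x)"
          using e by (simp add: matrix_vector_mult_diff_distrib)
        also have "norm \<dots> \<le> norm (val w *v y - x) + norm (val w0 *v y - x)" by (rule norm_triangle_ineq4)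
        also have "\<dots> \<le> 2 * r" using w w0 by (auto simp: S_def)
        finally show ?thesis .
      qed
      have comm: "h u ** h w = h w ** h u" if u: "u \<in> S" and w: "w \<in> S" for u w
      proof -
        define wu ww where "wu = winv w0 @ u" and "ww = winv w0 @ w"
        note s = sh[OF u, folded wu_def] sh[OF w, folded ww_def]
        define c where "c = wu @ ww @ winv wu @ winv ww"
        have sc: "set c \<subseteq> letters" unfolding c_def using s set_winv[of wu] set_winv[of ww] by auto
        have lc: "length c = 8 * n" unfolding c_def wu_def ww_def using Sl(2)[OF u] Sl(2)[OF w] Sl(2)[OF w0] by simp
        have hu: "h u = val wu" "h w = val ww" by (simp_all add: h_def wu_def ww_def)
        have vc: "val c = h u ** h w ** transpose (h u) ** transpose (h w)"
          unfolding c_def hu using s by (simp add: val_append val_winv matrix_mul_assoc)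
        have "val c = mat 1"
        proof (rule ccontr)
          assume "val c \<noteq> mat 1"
          then have "\<exists>i j. val c $ i $ j \<noteq> mat 1 $ i $ j" by (metis vec_eq_iff)
          then obtain i j where ij: "(val c - mat 1) $ i $ j \<noteq> 0" by auto
          \<comment> \<open>The preimage of a basis vector under \<open>h w ** h u\<close>: at
            \<open>v\<close> the commutator defect of the two rotations is a column of the
            commutator minus the identity.\<close>
          define v where "v = transpose (h u) *v (transpose (h w) *v axis j 1)"
          have nv: "norm v = 1" unfolding v_def
            using rotation_norm[OF rotation_matrix_transpose(1)[OF hrot[OF u]]] rotation_norm[OF rotation_matrix_transpose(1)[OF hrot[OF w]]]
            by (simp del: transpose_matrix_vector)
          have e1: "val c *v axis j 1 = h u *v (h w *v v)"
            unfolding vc v_def by (simp add: matrix_vector_mul_assoc matrix_mul_assoc del: transpose_matrix_vector)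
          have "h w ** h u ** transpose (h u) ** transpose (h w) = h w ** (h u ** transpose (h u)) ** transpose (h w)"
            by (simp add: matrix_mul_assoc)
          also have "\<dots> = mat 1"
            using rotation_matrix_transpose(3)[OF hrot[OF u]] rotation_matrix_transpose(3)[OF hrot[OF w]] by simp
          finally have "mat 1 *v axis j 1 = (h w ** h u ** transpose (h u) ** transpose (h w)) *v axis j 1" by simp
          then have e2: "axis j 1 = h w *v (h u *v v)"
            unfolding v_def by (simp add: matrix_vector_mul_assoc matrix_mul_assoc del: transpose_matrix_vector)
          have "(val c - mat 1) $ i $ j = (val c *v axis j 1 - axis j 1) $ i"
            unfolding matrix_vector_mult_basis by (simp add: column_def mat_def axis_def)
          also have "val c *v axis j 1 - axis j 1 = h u *v (h w *v v) - h w *v (h u *v v)" using e1 e2 by simp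
          finally have "\<bar>(val c - mat 1) $ i $ j\<bar> \<le> norm (h u *v (h w *v v) - h w *v (h u *v v))"
            using component_le_norm_cart by metis
          also have "\<dots> \<le> 24 * (2 * r)"
            by (rule almost_stabilizers_commute[OF hrot[OF u] hrot[OF w] ny hy[OF u] hy[OF w] nv])
          finally have le: "\<bar>(val c - mat 1) $ i $ j\<bar> \<le> 48 * r" by simp
          have "1 \<le> C0 * b0 ^ (8 * n) * \<bar>(val c - mat 1) $ i $ j\<bar>" using gap[OF sc ij] lc by simp
          also have "\<dots> \<le> C0 * b0 ^ (8 * n) * (48 * r)" using le C0 by (intro mult_left_mono) auto
          also have "\<dots> = r * (48 * C0 * (b0 ^ 8) ^ n)" unfolding power_mult[of b0 8 n] by simp
          finally show False using r by simp
        qed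
        then have "h u ** h w ** transpose (h u) ** transpose (h w) ** (h w ** h u) = h w ** h u" using vc by simp
        moreover have "h u ** h w ** transpose (h u) ** transpose (h w) ** (h w ** h u)
            = h u ** h w ** (transpose (h u) ** ((transpose (h w) ** h w) ** h u))" by (simp add: matrix_mul_assoc)
        ultimately show ?thesis
          using rotation_matrix_transpose(2)[OF hrot[OF u]] rotation_matrix_transpose(2)[OF hrot[OF w]] by simp
      qed
      show ?thesis
      \<comment> \<open>A common fixed point is needed for counting. If all quotients are trivial,
        \<open>y\<close> serves; otherwise the axis of a nontrivial one is fixed by everything
        commuting with it.\<close>
      proof (cases "\<forall>w\<in>S. h w = mat 1")
        case True
        show ?thesis
          by (rule card_stabilizing_words[OF cyc[OF y] SW w0]) (use True in \<open>simp add: h_def\<close>)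
      next
        case False
        then obtain w1 where w1: "w1 \<in> S" "h w1 \<noteq> mat 1" by auto
        define x' where "x' = axis_vec (h w1)"
        \<comment> \<open>The axis vector vanishes only for a symmetric rotation, which is an
          involution; a free group has none besides the identity.\<close>
        have "x' \<noteq> 0"
        proof
          assume "x' = 0"
          then have eq: "h w1 *v v = transpose (h w1) *v v" for v using axis_vec_cross[of "h w1" v] by (simp add: x'_def)
          then have "h w1 = transpose (h w1)" by (metis matrix_eq)
          then have "h w1 ** h w1 = mat 1" using rotation_matrix_transpose(3)[OF hrot[OF w1(1)]] by simp
          then have "h w1 = mat 1" unfolding h_def by (rule val_torsion_free[OF sh[OF w1(1)]])
          then show False using w1 by simp
        qed
        then have xS: "x' /\<^sub>R norm x' \<in> S2" by simp
        have "h w *v (x' /\<^sub>R norm x') = x' /\<^sub>R norm x'" if w: "w \<in> S" for w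
          using axis_vec_fixed[OF hrot[OF w1(1)] hrot[OF w] comm[OF w w1(1)]]
          by (simp add: matrix_vector_mult_scaleR x'_def)
        then show ?thesis by (intro card_stabilizing_words[OF cyc[OF xS] SW w0]) (simp add: h_def)
      qed
    qed simp
  qed (use C0 in auto)
qed

end

section \<open>Amplification by the averaging operator\<close>

text \<open>The Chebyshev polynomial of the first kind at \<mu>/2, scaled so that \<mu> = 2 cos
  \<alpha> gives cos(n \<alpha>).\<close>

fun cheb_real :: "real \<Rightarrow> nat \<Rightarrow> real" where
  "cheb_real \<mu> 0 = 1"
| "cheb_real \<mu> (Suc 0) = \<mu> / 2"
| "cheb_real \<mu> (Suc (Suc n)) = \<mu> * cheb_real \<mu> (Suc n) - cheb_real \<mu> n"

lemma cheb_real_cos: "cheb_real (2 * cos \<alpha>) n = cos (real n * \<alpha>)"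
proof (induction n rule: induct_nat_012)
  case (ge2 n)
  have "cos (real (Suc (Suc n)) * \<alpha>) + cos (real n * \<alpha>) = 2 * cos \<alpha> * cos (real (Suc n) * \<alpha>)"
  proof -
    have "real (Suc (Suc n)) * \<alpha> = real (Suc n) * \<alpha> + \<alpha>" "real n * \<alpha> = real (Suc n) * \<alpha> - \<alpha>"
      by (simp_all add: algebra_simps)
    then show ?thesis by (simp only: cos_add cos_diff) (simp add: algebra_simps)
  qed
  then show ?case using ge2 by (simp add: algebra_simps)
qed auto

lemma cheb_real_minus: "cheb_real (- \<mu>) n = (-1) ^ n * cheb_real \<mu> n"
  by (induction \<mu> n rule: cheb_real.induct) (auto simp: algebra_simps)

text \<open>Eigenvalues beyond 2 in absolute value give no oscillation: the sequence grows, and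
  constant or alternating weights suffice.\<close>

lemma cheb_real_ge_1:
  assumes "\<mu> \<ge> 2"
  shows "cheb_real \<mu> n \<ge> 1 \<and> cheb_real \<mu> (Suc n) \<ge> cheb_real \<mu> n"
proof (induction n)
  case (Suc n)
  have "2 * cheb_real \<mu> (Suc n) \<le> \<mu> * cheb_real \<mu> (Suc n)" using Suc assms by (intro mult_right_mono) auto
  then show ?case using Suc unfolding cheb_real.simps(3) by linarith
qed (use assms in auto)

text \<open>For |\<mu>| <= 2 the weights resonate with the sequence itself, so the sum is one of
  squares of cosines; it remains to show that these are not small on average.\<close>

lemma cheb_real_amplifier:
  obtains a where "\<And>n. \<bar>a n\<bar> \<le> 1" "(\<Sum>n<N. a n * cheb_real \<mu> n) \<ge> real N / 10"
proof (cases "\<bar>\<mu>\<bar> \<le> 2")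
  case True
  define \<alpha> where "\<alpha> = arccos (\<mu> / 2)"
  have \<mu>: "\<mu> = 2 * cos \<alpha>" unfolding \<alpha>_def using True by (simp add: abs_le_iff cos_arccos)
  define c where "c = (\<lambda>n. cos (real n * \<alpha>))"
  have x: "cheb_real \<mu> n = c n" for n unfolding \<mu> c_def by (rule cheb_real_cos)
  have "(\<Sum>n<N. c n * c n) \<ge> real N / 10"
  proof (cases "N = 0")
    case False
    define K where "K = (N - 1) div 2"
    have KN: "2 * K < N" "2 * (K + 1) \<ge> N" using False by (auto simp: K_def)
    \<comment> \<open>The cosines at n and 2n cannot both be small: with x = cos^2, the value x +
      (2x - 1)^2 is smallest at x = 3/8, where it is 7/16. Pairing n with 2n over about N/2 indices
      gives 7N/64, more than N/10.\<close>
    have p: "c n * c n + c (2 * n) * c (2 * n) \<ge> 7 / 16" for n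
    proof -
      have "c (2 * n) = 2 * (c n)\<^sup>2 - 1" unfolding c_def using cos_double_cos[of "real n * \<alpha>"] by (simp add: mult.assoc)
      then have "c n * c n + c (2 * n) * c (2 * n) - 7 / 16 = (2 * (c n)\<^sup>2 - 3 / 4)\<^sup>2"
        by (simp only:) (simp add: power2_eq_square algebra_simps)
      then show ?thesis by (metis diff_ge_0_iff_ge zero_le_power2)
    qed
    have "real (K + 1) * (7 / 16) = (\<Sum>n\<le>K. 7 / 16)" by simp
    also have "\<dots> \<le> (\<Sum>n\<le>K. c n * c n + c (2 * n) * c (2 * n))" by (intro sum_mono p)
    also have "\<dots> = (\<Sum>n\<le>K. c n * c n) + (\<Sum>n\<le>K. c (2 * n) * c (2 * n))" by (rule sum.distrib)
    also have "(\<Sum>n\<le>K. c n * c n) \<le> (\<Sum>n<N. c n * c n)" using KN by (intro sum_mono2) auto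
    also have "(\<Sum>n\<le>K. c (2 * n) * c (2 * n)) = (\<Sum>n\<in>(\<lambda>n. 2 * n) ` {..K}. c n * c n)"
      by (subst sum.reindex) (auto simp: inj_on_def)
    also have "\<dots> \<le> (\<Sum>n<N. c n * c n)" using KN by (intro sum_mono2) auto
    finally have "real (K + 1) * (7 / 16) \<le> 2 * (\<Sum>n<N. c n * c n)" by simp
    moreover have "real N / 2 \<le> real (K + 1)" using of_nat_mono[OF KN(2), where 'a = real] by simp
    then have "(real N / 2) * (7 / 16) \<le> real (K + 1) * (7 / 16)" by (rule mult_right_mono) simp
    ultimately show ?thesis by simp
  qed simp
  then show thesis using x by (intro that[of c]) (auto simp: c_def)
next
  case False
  show thesis
  proof (cases "\<mu> > 2")
    case True
    have "(\<Sum>n<N. 1 * cheb_real \<mu> n) \<ge> (\<Sum>n<N. 1)" using cheb_real_ge_1[of \<mu>] True by (intro sum_mono) auto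
    then show thesis by (intro that[of "\<lambda>_. 1"]) auto
  next
    case F: False
    then have m: "- \<mu> \<ge> 2" using False by linarith
    have "(-1) ^ n * cheb_real \<mu> n \<ge> 1" for n using cheb_real_ge_1[OF m, of n] cheb_real_minus[of \<mu> n] by simp
    then have "(\<Sum>n<N. (-1) ^ n * cheb_real \<mu> n) \<ge> (\<Sum>n<N. 1)" by (intro sum_mono) auto
    then show thesis by (intro that[of "\<lambda>n. (-1) ^ n"]) auto
  qed
qed

section \<open>Sphere sums on the tree and Chebyshev polynomials of the averaging operator\<close>

context rotation_words
begin

definition q :: real where "q = 2 * real M - 1"

lemma q3: "q \<ge> 3" using M2 by (simp add: q_def)

definition T :: "(real^3 \<Rightarrow> real) \<Rightarrow> real^3 \<Rightarrow> real" where
  "T F x = (1 / sqrt q) * (\<Sum>l\<in>letters. F (lv l *v x))"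

text \<open>The normalised sum over the sphere of radius n in the Cayley graph of the free group, a
  (q+1)-regular tree.\<close>

definition Q :: "nat \<Rightarrow> (real^3 \<Rightarrow> real) \<Rightarrow> real^3 \<Rightarrow> real" where
  "Q n F x = (1 / sqrt q) ^ n * (\<Sum>w\<in>W n. F (val w *v x))"

lemma W_0: "W 0 = {[]}"
  by (auto simp: W_def)

lemma sum_W_Suc: "(\<Sum>w\<in>W (Suc n). f w) = (\<Sum>w\<in>W n. \<Sum>l\<in>{l\<in>letters. reduced_word (l # w)}. f (l # w))"
  for f :: "_ \<Rightarrow> real"
proof -
  have "(\<Sum>w\<in>W n. \<Sum>l\<in>{l\<in>letters. reduced_word (l # w)}. f (l # w))
     = (\<Sum>(w, l)\<in>Sigma (W n) (\<lambda>w. {l\<in>letters. reduced_word (l # w)}). f (l # w))"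
    by (rule sum.Sigma) (auto simp: finite_W finite_letters)
  also have "\<dots> = (\<Sum>w\<in>W (Suc n). f w)"
    by (rule sum.reindex_bij_witness[where i = "\<lambda>w. (tl w, hd w)" and j = "\<lambda>(w, l). l # w"])
      (auto simp: W_def length_Suc_conv reduced_Cons)
  finally show ?thesis by simp
qed

lemma card_letters: "card letters = 2 * M"
  by (simp add: letters_def card_cartesian_product)

lemma card_extensions:
  assumes "w \<in> W n"
  shows "real (card {l\<in>letters. reduced_word (l # w)}) = (if n = 0 then q + 1 else q)"
proof (cases w)
  case Nil
  then have "n = 0" using assms by (simp add: W_def)
  moreover have "{l\<in>letters. reduced_word (l # w)} = letters" using Nil by (auto simp: reduced_Cons)
  ultimately show ?thesis by (simp add: card_letters q_def)
next
  case (Cons a r)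
  then have a: "a \<in> letters" "n \<noteq> 0" "reduced_word w" using assms by (auto simp: W_def)
  have "{l\<in>letters. reduced_word (l # w)} = letters - {linv a}"
    using Cons a(3) by (auto simp: reduced_Cons)
  then have "card {l\<in>letters. reduced_word (l # w)} = 2 * M - 1"
    using a finite_letters by (simp add: card_letters)
  then show ?thesis using a(2) M2 by (simp add: q_def of_nat_diff)
qed

lemma card_W_le: "real (card (W n)) \<le> 2 * q ^ n"
proof -
  have "real (card (W (Suc n))) = (if n = 0 then q + 1 else q) * real (card (W n))" for n
  proof -
    have "real (card (W (Suc n))) = (\<Sum>w\<in>W (Suc n). 1)" by simp
    also have "\<dots> = (\<Sum>w\<in>W n. real (card {l\<in>letters. reduced_word (l # w)}))" unfolding sum_W_Suc by simp
    also have "\<dots> = (\<Sum>w\<in>W n. (if n = 0 then q + 1 else q))" by (intro sum.cong refl card_extensions)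
    finally show ?thesis by simp
  qed
  note step = this
  show ?thesis
  proof (induction n)
    case (Suc n)
    show ?case
    proof (cases "n = 0")
      case True
      then show ?thesis unfolding step using q3 by (simp add: W_0)
    next
      case False
      have "real (card (W (Suc n))) = q * real (card (W n))" unfolding step using False by simp
      also have "\<dots> \<le> q * (2 * q ^ n)" using Suc q3 by (intro mult_left_mono) auto
      finally show ?thesis by simp
    qed
  qed (simp add: W_0)
qed

text \<open>Prepending a letter either extends a reduced word or cancels its first letter. A word of
  length n arises by cancellation in q ways, the empty word in q + 1 ways.\<close>

lemma sum_W_letters:
  "(\<Sum>w\<in>W (Suc n). \<Sum>l\<in>letters. f (lv l ** val w)) =
     (\<Sum>w\<in>W (Suc (Suc n)). f (val w)) + (if n = 0 then q + 1 else q) * (\<Sum>w\<in>W n. f (val w))"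
  for f :: "real^3^3 \<Rightarrow> real"
proof -
  have sl: "(\<Sum>l\<in>letters. f (lv l ** val w)) = (\<Sum>l\<in>{l\<in>letters. reduced_word (l # w)}. f (val (l # w))) + f (val (tl w))"
    if w: "w \<in> W (Suc n)" for w
  proof -
    obtain a r where ar: "w = a # r" "a \<in> letters" "set r \<subseteq> letters" "reduced_word w" using w by (auto simp: W_def length_Suc_conv)
    have e: "{l\<in>letters. reduced_word (l # w)} = letters - {linv a}"
      using ar(1,4) by (auto simp: reduced_Cons)
    have "lv (linv a) ** val w = val r"
      unfolding ar(1) using ar rotation_matrix_transpose(2)[OF lv_rot[OF ar(2)]] by (simp add: val_Cons lv_linv matrix_mul_assoc)
    then have "(\<Sum>l\<in>letters. f (lv l ** val w)) = f (val r) + (\<Sum>l\<in>letters - {linv a}. f (lv l ** val w))"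
      using ar finite_letters by (subst sum.remove[of _ "linv a"]) auto
    also have "(\<Sum>l\<in>letters - {linv a}. f (lv l ** val w)) = (\<Sum>l\<in>letters - {linv a}. f (val (l # w)))"
      by (intro sum.cong) (auto simp: val_Cons)
    finally show ?thesis unfolding e using ar by simp
  qed
  have "(\<Sum>w\<in>W (Suc n). \<Sum>l\<in>letters. f (lv l ** val w))
      = (\<Sum>w\<in>W (Suc n). (\<Sum>l\<in>{l\<in>letters. reduced_word (l # w)}. f (val (l # w))) + f (val (tl w)))"
    by (intro sum.cong refl sl)
  also have "\<dots> = (\<Sum>w\<in>W (Suc (Suc n)). f (val w)) + (\<Sum>w\<in>W (Suc n). f (val (tl w)))"
    unfolding sum.distrib sum_W_Suc[of _ "Suc n"] ..
  also have "(\<Sum>w\<in>W (Suc n). f (val (tl w))) = (\<Sum>w\<in>W n. real (card {l\<in>letters. reduced_word (l # w)}) * f (val w))"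
    unfolding sum_W_Suc by simp
  also have "\<dots> = (\<Sum>w\<in>W n. (if n = 0 then q + 1 else q) * f (val w))"
    by (intro sum.cong refl arg_cong2[where f = "(*)"] card_extensions)
  finally show ?thesis by (simp add: sum_distrib_left)
qed

lemma Q_0: "Q 0 F x = F x"
  by (simp add: Q_def W_0)

lemma Q_T_0: "Q 0 (T F) x = Q 1 F x"
proof -
  have "(\<Sum>w\<in>W (Suc 0). F (val w *v x)) = (\<Sum>l\<in>letters. F (lv l *v x))"
    unfolding sum_W_Suc W_0 by (simp add: reduced_Cons val_Cons)
  then show ?thesis by (simp add: Q_def W_0 T_def)
qed

text \<open>The three-term recursion of the tree; its irregularity 1 + 1/q at the bottom reflects
  that the root has one more successor than the other vertices.\<close>

lemma Q_T_Suc: "Q (Suc n) (T F) x = Q (Suc (Suc n)) F x + (if n = 0 then 1 + 1 / q else 1) * Q n F x"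
proof -
  define r where "r = 1 / sqrt q"
  have rq: "r * r * q = 1" using q3 by (simp add: r_def)
  have "Q (Suc n) (T F) x = r ^ Suc n * (\<Sum>w\<in>W (Suc n). r * (\<Sum>l\<in>letters. F ((lv l ** val w) *v x)))"
    by (simp add: Q_def T_def r_def matrix_vector_mul_assoc)
  also have "\<dots> = r ^ Suc (Suc n) * (\<Sum>w\<in>W (Suc n). \<Sum>l\<in>letters. F ((lv l ** val w) *v x))"
    by (simp add: sum_distrib_left mult_ac)
  also have "\<dots> = r ^ Suc (Suc n) * ((\<Sum>w\<in>W (Suc (Suc n)). F (val w *v x)) + (if n = 0 then q + 1 else q) * (\<Sum>w\<in>W n. F (val w *v x)))"
    using sum_W_letters[of "\<lambda>A. F (A *v x)" n] by simp
  also have "\<dots> = Q (Suc (Suc n)) F x + (r * r * (if n = 0 then q + 1 else q)) * Q n F x"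
    by (simp add: Q_def r_def[symmetric] distrib_left mult_ac)
  also have "r * r * (if n = 0 then q + 1 else q) = (if n = 0 then 1 + 1 / q else 1)"
    using rq q3 by (auto simp: distrib_left) (simp add: field_simps)
  finally show ?thesis .
qed

fun cheb :: "nat \<Rightarrow> (real^3 \<Rightarrow> real) \<Rightarrow> real^3 \<Rightarrow> real" where
  "cheb 0 F = F"
| "cheb (Suc 0) F = (\<lambda>x. T F x / 2)"
| "cheb (Suc (Suc n)) F = (\<lambda>x. T (cheb (Suc n) F) x - cheb n F x)"

lemma T_diff: "T (\<lambda>x. F x - G x) = (\<lambda>x. T F x - T G x)"
  and T_divide: "T (\<lambda>x. F x / c) = (\<lambda>x. T F x / c)"
  by (auto simp: T_def fun_eq_iff sum_subtractf right_diff_distrib sum_divide_distrib[symmetric] divide_divide_eq_left mult.commute)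

lemma cheb_T: "cheb n (T F) = T (cheb n F)"
  by (induction n F rule: cheb.induct) (simp_all add: T_diff T_divide)

text \<open>The Chebyshev polynomials follow the same recursion without the irregularity at the
  root. Comparing the two leaves a feedback in steps of two whose factor is only 1/q, small enough
  to be summed away.\<close>

lemma cheb_Q:
  "cheb (n + 3) F x = (Q (n + 3) F x - Q (n + 1) F x) / 2 + cheb (n + 1) F x / q"
  and cheb_Q_2: "cheb 2 F x = (Q 2 F x - Q 0 F x) / 2 + cheb 0 F x / (2 * q)"
  and cheb_Q_1: "cheb 1 F x = Q 1 F x / 2"
proof -
  \<comment> \<open>Since \<open>cheb\<close> commutes with \<open>T\<close>, the operator can be
    moved to the argument, where the recursion for \<open>Q\<close> applies.\<close>
  have rec: "cheb (Suc (Suc n)) F x = cheb (Suc n) (T F) x - cheb n F x" for n F x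
    by (simp add: cheb_T)
  have c1: "cheb 1 F x = Q 1 F x / 2" for F x
    using Q_T_0[of F x] by (simp add: Q_0)
  show "cheb 1 F x = Q 1 F x / 2" by (rule c1)
  have c2: "cheb 2 F x = (Q 2 F x - Q 0 F x) / 2 + cheb 0 F x / (2 * q)" for F x
    using Q_T_Suc[of 0 F x] c1[of "T F" x] q3 unfolding numeral_2_eq_2 rec One_nat_def
    by (simp add: Q_0 add_divide_distrib diff_divide_distrib distrib_right)
  show "cheb 2 F x = (Q 2 F x - Q 0 F x) / 2 + cheb 0 F x / (2 * q)" by (rule c2)
  have c3: "cheb 3 F x = (Q 3 F x - Q 1 F x) / 2 + cheb 1 F x / q" for F x
  proof -
    have "cheb 3 F x = cheb 2 (T F) x - cheb 1 F x" using rec[of 1 F x] by (simp add: eval_nat_numeral)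
    moreover have "Q 2 (T F) x = Q 3 F x + Q 1 F x" using Q_T_Suc[of 1 F x] by (simp add: eval_nat_numeral)
    moreover have "Q 0 (T F) x = Q 1 F x" "T F x = Q 1 F x" using Q_T_0[of F x] by (simp_all add: Q_0)
    ultimately show ?thesis unfolding c2 c1 by (simp add: field_simps)
  qed
  have c4: "cheb 4 F x = (Q 4 F x - Q 2 F x) / 2 + cheb 2 F x / q" for F x
  proof -
    have f1: "cheb 4 F x = cheb 3 (T F) x - cheb 2 F x" using rec[of 2 F x] by (simp add: eval_nat_numeral)
    have f2: "Q 3 (T F) x = Q 4 F x + Q 2 F x" using Q_T_Suc[of 2 F x] by (simp add: eval_nat_numeral)
    have f3: "Q 1 (T F) x = Q 2 F x + (1 + 1 / q) * Q 0 F x" using Q_T_Suc[of 0 F x] by (simp add: eval_nat_numeral)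
    have f4: "cheb 1 (T F) x = cheb 2 F x + cheb 0 F x" using rec[of 0 F x] by (simp add: eval_nat_numeral)
    have f5: "cheb 0 F x = Q 0 F x" by (simp add: Q_0)
    have gen: "X = (a4 - a2) / 2 + e / k"
      if "X = (a4 + a2 - (a2 + (1 + 1 / k) * a0)) / 2 + (e + a0) / k - e" "e = (a2 - a0) / 2 + a0 / (2 * k)" "k > 0"
      for X a4 a2 a0 e k :: real
      unfolding that(1) unfolding that(2) using that(3) by (simp add: field_simps)
    show ?thesis
    proof (rule gen)
      show "cheb 4 F x = (Q 4 F x + Q 2 F x - (Q 2 F x + (1 + 1 / q) * Q 0 F x)) / 2 + (cheb 2 F x + Q 0 F x) / q - cheb 2 F x"
        by (simp only: f1 c3 f2 f3 f4 f5)
      show "cheb 2 F x = (Q 2 F x - Q 0 F x) / 2 + Q 0 F x / (2 * q)" using c2[of F x] unfolding f5 .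
    qed (use q3 in simp)
  qed
  \<comment> \<open>Two consecutive indices are carried for all F at once: the step uses the lower
    index at F and the higher one at T F.\<close>
  have "cheb (n + 3) F x = (Q (n + 3) F x - Q (n + 1) F x) / 2 + cheb (n + 1) F x / q \<and>
        cheb (n + 4) F x = (Q (n + 4) F x - Q (n + 2) F x) / 2 + cheb (n + 2) F x / q" for n F x
  proof (induction n arbitrary: F)
    case 0
    show ?case unfolding add_0 by (rule conjI[OF c3 c4])
  next
    case (Suc n)
    have g1: "cheb (n + 5) F x = cheb (n + 4) (T F) x - cheb (n + 3) F x" using rec[of "n + 3" F x] by (simp add: eval_nat_numeral)
    have g2: "cheb (n + 3) F x = cheb (n + 2) (T F) x - cheb (n + 1) F x" using rec[of "n + 1" F x] by (simp add: eval_nat_numeral)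
    have g3: "Q (n + 4) (T F) x = Q (n + 5) F x + Q (n + 3) F x" using Q_T_Suc[of "n + 3" F x] by (simp add: eval_nat_numeral)
    have g4: "Q (n + 2) (T F) x = Q (n + 3) F x + Q (n + 1) F x" using Q_T_Suc[of "n + 1" F x] by (simp add: eval_nat_numeral)
    have gen: "A5 = (Q5 - Q3) / 2 + A3 / k"
      if "A5 = B4 - A3" "A3 = B2 - A1" "A3 = (Q3 - Q1) / 2 + A1 / k" "B4 = (Q5 + Q3 - (Q3 + Q1)) / 2 + B2 / k"
      for A5 B4 A3 B2 A1 Q1 Q3 Q5 k :: real
    proof -
      have "B2 / k = A3 / k + A1 / k" using that(2) by (simp flip: add_divide_distrib)
      then show ?thesis unfolding that(1) that(4) using that(3) by (simp add: diff_divide_distrib add_divide_distrib)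
    qed
    have "cheb (n + 5) F x = (Q (n + 5) F x - Q (n + 3) F x) / 2 + cheb (n + 3) F x / q"
      by (rule gen[OF g1 g2 conjunct1[OF Suc[of F]] conjunct2[OF Suc[of "T F"], unfolded g3 g4]])
    then show ?case using Suc[of F] by (simp add: eval_nat_numeral)
  qed
  then show "cheb (n + 3) F x = (Q (n + 3) F x - Q (n + 1) F x) / 2 + cheb (n + 1) F x / q" by blast
qed

section \<open>Inner products and the amplified inequality\<close>

lemma matrix_continuous: "continuous_on S (\<lambda>x. A *v x)" for A :: "real^3^3"
  by (intro linear_continuous_on) (simp add: linear_linear[symmetric])

lemma comp_matrix_continuous: "continuous_on UNIV F \<Longrightarrow> continuous_on UNIV (\<lambda>x. F (A *v x))" for A :: "real^3^3" and F :: "real^3 \<Rightarrow> real"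
  by (rule continuous_on_compose2[OF _ matrix_continuous]) auto

lemma T_continuous: "continuous_on UNIV F \<Longrightarrow> continuous_on UNIV (T F)"
  unfolding T_def[abs_def] by (intro continuous_intros comp_matrix_continuous)

lemma cheb_continuous: "continuous_on UNIV F \<Longrightarrow> continuous_on UNIV (cheb n F)"
  by (induction n F rule: cheb.induct) (auto intro!: continuous_intros T_continuous)

lemma cont_bfun: "continuous_on UNIV F \<Longrightarrow> bfun F"
  by (rule bfun_continuous) (rule continuous_on_subset, auto)

lemma bfun_T: "bfun F \<Longrightarrow> bfun (T F)"
proof -
  assume F: "bfun F"
  have "bfun (\<lambda>x. \<Sum>l\<in>L. F (lv l *v x))" if "finite L" "L \<subseteq> letters" for L
    using that
    by (induction L rule: finite_induct)
      (auto intro!: bfun_const[of 0] bfun_add bfun_orthogonal[OF rotation_orthogonal[OF lv_rot] F])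
  then show ?thesis unfolding T_def[abs_def] by (intro bfun_cmult) (auto simp: finite_letters)
qed

text \<open>The adjoint of composing with a letter is composing with its inverse, and the letters
  are closed under inversion.\<close>

lemma T_self_adjoint:
  assumes F: "bfun F" and G: "bfun G"
  shows "(\<integral>x. T F x * G x \<partial>\<sigma>) = (\<integral>x. F x * T G x \<partial>\<sigma>)"
proof -
  have i: "bfun (\<lambda>x. F (lv l *v x) * G x)" "bfun (\<lambda>x. F x * G (lv l *v x))" if "l \<in> letters" for l
    using that by (auto intro!: bfun_mult bfun_orthogonal[OF rotation_orthogonal[OF lv_rot]] F G)
  have sw: "(\<integral>x. F (lv l *v x) * G x \<partial>\<sigma>) = (\<integral>x. F x * G (lv (linv l) *v x) \<partial>\<sigma>)" if l: "l \<in> letters" for l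
  proof -
    have l': "linv l \<in> letters" using l by simp
    have "(\<integral>x. F x * G (lv (linv l) *v x) \<partial>\<sigma>) = (\<integral>x. F (lv l *v x) * G (lv (linv l) *v (lv l *v x)) \<partial>\<sigma>)"
      by (rule integral_sphere_orthogonal[OF rotation_orthogonal[OF lv_rot[OF l]], symmetric])
        (intro bfun_measurable i l')
    then show ?thesis using rotation_matrix_transpose(2)[OF lv_rot[OF l]]
      by (simp add: lv_linv matrix_vector_mul_assoc del: transpose_matrix_vector)
  qed
  have "(\<integral>x. T F x * G x \<partial>\<sigma>) = (1 / sqrt q) * (\<integral>x. (\<Sum>l\<in>letters. F (lv l *v x) * G x) \<partial>\<sigma>)"
    by (simp add: T_def sum_distrib_right)
  also have "(\<integral>x. (\<Sum>l\<in>letters. F (lv l *v x) * G x) \<partial>\<sigma>) = (\<Sum>l\<in>letters. \<integral>x. F (lv l *v x) * G x \<partial>\<sigma>)"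
    by (intro Bochner_Integration.integral_sum bfun_integrable i)
  also have "\<dots> = (\<Sum>l\<in>letters. \<integral>x. F x * G (lv (linv l) *v x) \<partial>\<sigma>)" by (intro sum.cong refl sw)
  also have "\<dots> = (\<Sum>l\<in>letters. \<integral>x. F x * G (lv l *v x) \<partial>\<sigma>)"
    by (rule sum.reindex_bij_witness[where i = linv and j = linv]) auto
  also have "\<dots> = (\<integral>x. (\<Sum>l\<in>letters. F x * G (lv l *v x)) \<partial>\<sigma>)"
    by (intro Bochner_Integration.integral_sum[symmetric] bfun_integrable i)
  also have "(1 / sqrt q) * (\<integral>x. (\<Sum>l\<in>letters. F x * G (lv l *v x)) \<partial>\<sigma>) = (\<integral>x. F x * T G x \<partial>\<sigma>)"
    unfolding T_def mult.left_commute[of "F _" "1 / sqrt q"] integral_mult_right_zero sum_distrib_left[of "F _"] ..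
  finally show ?thesis .
qed

definition ip :: "(real^3 \<Rightarrow> real) \<Rightarrow> (real^3 \<Rightarrow> real) \<Rightarrow> real" where
  "ip F G = (\<integral>x. F x * G x \<partial>\<sigma>)"

lemma ip_commute: "ip F G = ip G F"
  by (simp add: ip_def mult.commute)

lemma ip_add_left: "bfun F \<Longrightarrow> bfun G \<Longrightarrow> bfun H \<Longrightarrow> ip (\<lambda>x. F x + G x) H = ip F H + ip G H"
  and ip_diff_left: "bfun F \<Longrightarrow> bfun G \<Longrightarrow> bfun H \<Longrightarrow> ip (\<lambda>x. F x - G x) H = ip F H - ip G H"
  by (simp_all add: ip_def distrib_right left_diff_distrib bfun_integrable bfun_mult)

text \<open>The product formula 2 cos a cos b = cos(a+b) + cos(a-b), lifted to the self-adjoint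
  operator by induction on the second index.\<close>

lemma cheb_inner:
  assumes F: "continuous_on UNIV F"
  shows "ip (cheb n F) (cheb m F) = (ip (cheb (n + m) F) F + ip (cheb (nat \<bar>int n - int m\<bar>) F) F) / 2"
proof -
  define c where "c = (\<lambda>n. ip (cheb n F) F)"
  note b = cont_bfun[OF cheb_continuous[OF F]]
  have T1: "ip (T (cheb (Suc n) F)) G = ip (cheb (Suc (Suc n)) F) G + ip (cheb n F) G" if "bfun G" for n G
    using ip_diff_left[OF bfun_T[OF b[of "Suc n"]] b[of n] that] by simp
  have T0: "ip (T F) G = 2 * ip (cheb (Suc 0) F) G" for G by (simp add: ip_def)
  have TT: "ip G (T H) = ip (T G) H" if "bfun G" "bfun H" for G H
    unfolding ip_def using T_self_adjoint[OF that] by simp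
  have "ip (cheb n F) (cheb m F) = (c (n + m) + c (nat \<bar>int n - int m\<bar>)) / 2" for n
  proof (induction m arbitrary: n rule: induct_nat_012)
    case (0 n)
    then show ?case by (simp add: c_def)
  next
    case (1 n)
    have e: "ip (cheb n F) (cheb (Suc 0) F) = ip (T (cheb n F)) F / 2"
      using TT[OF b[of n] cont_bfun[OF F]] by (simp add: ip_def)
    show ?case
    proof (cases n)
      case 0
      then show ?thesis unfolding e using T0[of F] by (simp add: c_def)
    next
      case (Suc k)
      then show ?thesis unfolding e unfolding Suc T1[OF cont_bfun[OF F]] by (simp add: c_def)
    qed
  next
    case (ge2 m n)
    have e: "ip (cheb n F) (cheb (Suc (Suc m)) F) = ip (T (cheb n F)) (cheb (Suc m) F) - ip (cheb n F) (cheb m F)"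
      using ip_diff_left[OF bfun_T[OF b[of "Suc m"]] b[of m] b[of n]] TT[OF b[of n] b[of "Suc m"]]
      by (simp add: ip_commute[of "cheb n F"])
    show ?case
    proof (cases n)
      case 0
      have "ip (T F) (cheb (Suc m) F) = 2 * ip (cheb (Suc 0) F) (cheb (Suc m) F)" by (rule T0)
      then show ?thesis unfolding e unfolding 0 using ge2(2)[of "Suc 0"] ge2(1)[of 0] by (simp add: nat_add_distrib)
    next
      case (Suc k)
      have a: "nat \<bar>int (Suc (Suc k)) - int (Suc m)\<bar> = nat \<bar>int (Suc k) - int m\<bar>"
        "nat \<bar>int k - int (Suc m)\<bar> = nat \<bar>int (Suc k) - int (Suc (Suc m))\<bar>" by auto
      show ?thesis unfolding e unfolding Suc T1[OF b]
        using ge2(2)[of "Suc (Suc k)"] ge2(2)[of k] ge2(1)[of "Suc k"] a by simp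
    qed
  qed
  then show ?thesis by (simp add: c_def)
qed

definition corr :: "nat \<Rightarrow> (real^3 \<Rightarrow> real) \<Rightarrow> real" where "corr n F = ip (Q n F) F"

lemma bfun_Q: "bfun F \<Longrightarrow> bfun (Q n F)"
proof -
  assume F: "bfun F"
  have "bfun (\<lambda>x. \<Sum>w\<in>L. F (val w *v x))" if "finite L" "L \<subseteq> W n" for L
    using that
    by (induction L rule: finite_induct)
      (auto intro!: bfun_const[of 0] bfun_add bfun_orthogonal[OF rotation_orthogonal[OF val_rot] F] simp: W_def)
  then show ?thesis unfolding Q_def[abs_def] by (intro bfun_cmult) (auto simp: finite_W)
qed

text \<open>As q >= 3, the feedback term in \<open>cheb_Q\<close> contributes at most a third of the
  sum being estimated and is absorbed: two thirds of it is at most twice the sum of the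
  correlations.\<close>

lemma sum_cheb_le:
  assumes F: "continuous_on UNIV F"
  shows "(\<Sum>n<K. \<bar>ip (cheb n F) F\<bar>) \<le> 3 * (\<Sum>n<K. \<bar>corr n F\<bar>)"
proof -
  define c t where "c = (\<lambda>n. \<bar>ip (cheb n F) F\<bar>)" and "t = (\<lambda>n. \<bar>corr n F\<bar>)"
  have c0: "c n \<ge> 0" "t n \<ge> 0" for n by (simp_all add: c_def t_def)
  note bF = cont_bfun[OF F]
  note b = cont_bfun[OF cheb_continuous[OF F]] bfun_Q[OF bF]
  have lin: "ip (\<lambda>x. (Q i F x - Q j F x) / 2 + cheb k F x / r) F = (corr i F - corr j F) / 2 + ip (cheb k F) F / r" for i j k r
  proof -
    have "ip (\<lambda>x. (Q i F x - Q j F x) / 2 + cheb k F x / r) F = (\<integral>x. (Q i F x * F x - Q j F x * F x) / 2 + (cheb k F x * F x) / r \<partial>\<sigma>)"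
      unfolding ip_def by (simp add: distrib_right left_diff_distrib)
    also have "\<dots> = (corr i F - corr j F) / 2 + ip (cheb k F) F / r"
      unfolding ip_def corr_def using b bF by (simp add: bfun_integrable bfun_mult)
    finally show ?thesis .
  qed
  have bound: "\<bar>(u - v) / 2 + w / r\<bar> \<le> (\<bar>u\<bar> + \<bar>v\<bar>) / 2 + \<bar>w\<bar> / 3" if "r \<ge> 3" for u v w r :: real
  proof -
    have "\<bar>w\<bar> / \<bar>r\<bar> \<le> \<bar>w\<bar> / 3" using that by (intro frac_le) auto
    moreover define z where "z = w / r"
    ultimately have "\<bar>z\<bar> \<le> \<bar>w\<bar> / 3" by (simp only: abs_divide)
    moreover have "\<bar>(u - v) / 2\<bar> \<le> (\<bar>u\<bar> + \<bar>v\<bar>) / 2" by (simp add: abs_divide abs_triangle_ineq4)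
    ultimately have "\<bar>(u - v) / 2 + z\<bar> \<le> (\<bar>u\<bar> + \<bar>v\<bar>) / 2 + \<bar>w\<bar> / 3"
      by (intro order_trans[OF abs_triangle_ineq] add_mono)
    then show ?thesis unfolding z_def .
  qed
  have step: "c (n + 2) \<le> (t (n + 2) + t n) / 2 + c n / 3" for n
  proof (cases n)
    case 0
    have "cheb 2 F = (\<lambda>x. (Q 2 F x - Q 0 F x) / 2 + cheb 0 F x / (2 * q))" using cheb_Q_2 by (simp add: fun_eq_iff)
    then have e: "ip (cheb 2 F) F = (corr 2 F - corr 0 F) / 2 + ip (cheb 0 F) F / (2 * q)" using lin[of 2 0 0 "2 * q"] by simp
    have "c 2 \<le> (t 2 + t 0) / 2 + c 0 / 3" unfolding c_def t_def e by (rule bound) (use q3 in simp)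
    then show ?thesis unfolding 0 by (simp only: add_0)
  next
    case (Suc k)
    have "cheb (k + 3) F = (\<lambda>x. (Q (k + 3) F x - Q (k + 1) F x) / 2 + cheb (k + 1) F x / q)" using cheb_Q by (simp add: fun_eq_iff)
    then have "ip (cheb (k + 3) F) F = (corr (k + 3) F - corr (k + 1) F) / 2 + ip (cheb (k + 1) F) F / q" using lin[of "k + 3" "k + 1" "k + 1" q] by simp
    then show ?thesis unfolding c_def t_def Suc using bound[of q] q3 by (simp add: eval_nat_numeral)
  qed
  have i0: "c 0 = t 0" by (simp add: c_def t_def corr_def Q_0[abs_def] eta_contract_eq)
  have i1: "c 1 = t 1 / 2"
  proof -
    have "cheb 1 F = (\<lambda>x. Q 1 F x / 2)" using cheb_Q_1 by (simp add: fun_eq_iff)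
    then show ?thesis by (simp add: c_def t_def corr_def ip_def)
  qed
  have "(\<Sum>n<K. c n) \<le> 3 * (\<Sum>n<K. t n)"
  proof (cases "K < 2")
    case True
    then have "K = 0 \<or> K = 1" by auto
    then show ?thesis using i0 c0 by auto
  next
    case False
    then obtain m where K: "K = Suc (Suc m)" by (metis Suc_1 add_2_eq_Suc le_Suc_ex not_less)
    have split: "(\<Sum>n<K. f n) = f 0 + f 1 + (\<Sum>n<m. f (n + 2))" for f :: "nat \<Rightarrow> real"
      unfolding K by (simp only: sum.lessThan_Suc_shift) (simp add: eval_nat_numeral)
    have sub: "(\<Sum>n<m. f n) \<le> (\<Sum>n<K. f n)" if "\<And>n. f n \<ge> 0" for f :: "nat \<Rightarrow> real"
      unfolding K using that by (intro sum_mono2) auto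
    have "(\<Sum>n<K. c n) \<le> t 0 + t 1 / 2 + (\<Sum>n<m. (t (n + 2) + t n) / 2 + c n / 3)"
      unfolding split i0 i1 using step by (intro add_mono order_refl sum_mono)
    also have "\<dots> = t 0 + t 1 / 2 + ((\<Sum>n<m. t (n + 2)) + (\<Sum>n<m. t n)) / 2 + (\<Sum>n<m. c n) / 3"
      by (simp add: sum.distrib sum_divide_distrib add_divide_distrib)
    also have "\<dots> \<le> t 0 + t 1 / 2 + ((\<Sum>n<m. t (n + 2)) + (\<Sum>n<K. t n)) / 2 + (\<Sum>n<K. c n) / 3"
      using sub[of t] sub[of c] c0 by (intro add_mono divide_right_mono order_refl) auto
    finally have "(\<Sum>n<K. c n) \<le> t 0 + t 1 / 2 + ((\<Sum>n<m. t (n + 2)) + (\<Sum>n<K. t n)) / 2 + (\<Sum>n<K. c n) / 3" .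
    moreover have "2 / 3 * X \<le> Y" if "X \<le> Y + X / 3" for X Y :: real using that by linarith
    ultimately have "2 / 3 * (\<Sum>n<K. c n) \<le> t 0 + t 1 / 2 + ((\<Sum>n<m. t (n + 2)) + (\<Sum>n<K. t n)) / 2" by blast
    also have "\<dots> \<le> (\<Sum>n<K. t n) + (\<Sum>n<K. t n)"
    proof -
      have "(\<Sum>n<m. t (n + 2)) \<ge> 0" using c0 by (intro sum_nonneg) auto
      moreover have "a + b / 2 + (x + (a + b + x)) / 2 \<le> (a + b + x) + (a + b + x)" if "a \<ge> 0" "b \<ge> 0" "x \<ge> 0" for a b x :: real
        using that by (simp add: field_simps)
      ultimately show ?thesis unfolding split[of t] using c0(2)[of 0] c0(2)[of 1] by blast
    qed
    finally show ?thesis by simp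
  qed
  then show ?thesis by (simp add: c_def t_def)
qed

lemma ip_sum_left: "finite I \<Longrightarrow> (\<And>i. i \<in> I \<Longrightarrow> bfun (f i)) \<Longrightarrow> bfun G \<Longrightarrow> ip (\<lambda>x. \<Sum>i\<in>I. f i x) G = (\<Sum>i\<in>I. ip (f i) G)"
  unfolding ip_def sum_distrib_right by (intro Bochner_Integration.integral_sum bfun_integrable bfun_mult)

lemma ip_scale_left: "ip (\<lambda>x. c * F x) G = c * ip F G"
  by (simp add: ip_def mult.assoc)

text \<open>Cauchy-Schwarz against h = sum of a_n times the n-th Chebyshev iterate of F. The pairing
  with u gains at least N/10, while the product formula bounds the square norm of h by 3/2 N times a
  sum over indices below 2N. The constant is 100 * (3/2) * 3 = 450.\<close>

lemma hecke_amplification: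
  assumes F: "continuous_on UNIV F" and u: "bfun u" "ip u u \<le> 1" and eig: "AE x in \<sigma>. T u x = \<mu> * u x" and N: "N \<ge> 1"
  shows "real N * (ip u F)\<^sup>2 \<le> 500 * (\<Sum>n<2 * N. \<bar>corr n F\<bar>)"
proof -
  obtain a where a: "\<And>n. \<bar>a n\<bar> \<le> 1" "(\<Sum>n<N. a n * cheb_real \<mu> n) \<ge> real N / 10"
    using cheb_real_amplifier[of N \<mu>] by blast
  note bc = cont_bfun[OF cheb_continuous[OF F]]
  have uT: "ip u (T G) = \<mu> * ip u G" if G: "bfun G" for G
  proof -
    have "ip u (T G) = (\<integral>x. T u x * G x \<partial>\<sigma>)" unfolding ip_def by (rule T_self_adjoint[OF u(1) G, symmetric])
    also have "\<dots> = (\<integral>x. \<mu> * (u x * G x) \<partial>\<sigma>)"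
      by (rule integral_cong_AE) (use eig in \<open>auto intro!: bfun_measurable bfun_mult bfun_T bfun_cmult u G\<close>)
    finally show ?thesis by (simp add: ip_def)
  qed
  have uc: "ip u (cheb n F) = cheb_real \<mu> n * ip u F" for n
  proof (induction n rule: induct_nat_012)
    case 1
    have "ip u (cheb (Suc 0) F) = ip u (T F) / 2" by (simp add: ip_def)
    then show ?case using uT[OF cont_bfun[OF F]] by simp
  next
    case (ge2 n)
    have "ip u (cheb (Suc (Suc n)) F) = ip u (T (cheb (Suc n) F)) - ip u (cheb n F)"
      using ip_diff_left[OF bfun_T[OF bc[of "Suc n"]] bc[of n] u(1)] by (simp add: ip_commute[of u])
    then show ?case using ge2 uT[OF bc[of "Suc n"]] by (simp add: algebra_simps)
  qed simp
  define h where "h = (\<lambda>x. \<Sum>n<N. a n * cheb n F x)"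
  have bh: "bfun h" unfolding h_def
    by (rule cont_bfun) (intro continuous_intros cheb_continuous F)
  have hG: "ip h G = (\<Sum>n<N. a n * ip (cheb n F) G)" if "bfun G" for G
    unfolding h_def using that by (subst ip_sum_left) (auto intro!: bfun_cmult bc simp: ip_scale_left)
  have uh: "ip u h = (\<Sum>n<N. a n * cheb_real \<mu> n) * ip u F"
    using hG[OF u(1)] uc by (simp add: ip_commute[of u] sum_distrib_right mult.assoc)
  define c where "c = (\<lambda>n. \<bar>ip (cheb n F) F\<bar>)"
  define S where "S = (\<Sum>n<2 * N. c n)"
  have c0: "c n \<ge> 0" for n by (simp add: c_def)
  have hh: "ip h h \<le> 3 / 2 * real N * S"
  proof -
    have "ip h h = (\<Sum>n<N. a n * ip h (cheb n F))" using hG[OF bh] by (simp add: ip_commute)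
    also have "\<dots> = (\<Sum>n<N. a n * (\<Sum>m<N. a m * ip (cheb m F) (cheb n F)))" using hG[OF bc] by simp
    also have "\<dots> = (\<Sum>n<N. \<Sum>m<N. a n * a m * ip (cheb m F) (cheb n F))" by (simp add: sum_distrib_left mult.assoc)
    also have "\<dots> \<le> (\<Sum>n<N. \<Sum>m<N. (c (m + n) + c (nat \<bar>int m - int n\<bar>)) / 2)"
    proof (intro sum_mono)
      fix n m
      have "a n * a m * ip (cheb m F) (cheb n F) \<le> \<bar>a n\<bar> * \<bar>a m\<bar> * \<bar>ip (cheb m F) (cheb n F)\<bar>"
        by (metis abs_ge_self abs_mult)
      also have "\<dots> \<le> 1 * 1 * \<bar>ip (cheb m F) (cheb n F)\<bar>" using a(1) by (intro mult_mono) auto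
      also have "\<dots> \<le> (c (m + n) + c (nat \<bar>int m - int n\<bar>)) / 2"
        unfolding cheb_inner[OF F] c_def by (simp add: abs_divide abs_triangle_ineq)
      finally show "a n * a m * ip (cheb m F) (cheb n F) \<le> (c (m + n) + c (nat \<bar>int m - int n\<bar>)) / 2" .
    qed
    also have "\<dots> \<le> (\<Sum>n<N. 3 / 2 * S)"
    proof (rule sum_mono)
      fix n assume n: "n \<in> {..<N}"
      have inj: "(\<Sum>m\<in>A. c (f m)) \<le> S" if "inj_on f A" "f ` A \<subseteq> {..<2 * N}" for f :: "nat \<Rightarrow> nat" and A
      proof -
        have "(\<Sum>m\<in>A. c (f m)) = (\<Sum>m\<in>f ` A. c m)" using sum.reindex[OF that(1), of c] by (simp add: o_def)
        also have "\<dots> \<le> S" unfolding S_def by (intro sum_mono2 that(2) c0) auto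
        finally show ?thesis .
      qed
      have s1: "(\<Sum>m<N. c (m + n)) \<le> S" using n by (intro inj) (auto simp: inj_on_def)
      \<comment> \<open>Splitting at m = n makes |m - n| injective on each piece, so it meets every
        index at most twice.\<close>
      have "(\<Sum>m<N. c (nat \<bar>int m - int n\<bar>)) = (\<Sum>m\<in>{..n}. c (nat \<bar>int m - int n\<bar>)) + (\<Sum>m\<in>{n<..<N}. c (nat \<bar>int m - int n\<bar>))"
      proof -
        have "{..<N} = {..n} \<union> {n<..<N}" using n by auto
        then show ?thesis by (metis (no_types, lifting) finite_atMost finite_greaterThanLessThan sum.union_disjoint
              disjoint_iff atMost_iff greaterThanLessThan_iff not_less)
      qed
      also have "\<dots> \<le> S + S"
        using n by (intro add_mono inj) (auto simp: inj_on_def)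
      finally have s2: "(\<Sum>m<N. c (nat \<bar>int m - int n\<bar>)) \<le> S + S" .
      have "(\<Sum>m<N. (c (m + n) + c (nat \<bar>int m - int n\<bar>)) / 2) = ((\<Sum>m<N. c (m + n)) + (\<Sum>m<N. c (nat \<bar>int m - int n\<bar>))) / 2"
        by (simp add: sum.distrib sum_divide_distrib[symmetric])
      then show "(\<Sum>m<N. (c (m + n) + c (nat \<bar>int m - int n\<bar>)) / 2) \<le> 3 / 2 * S" using s1 s2 by simp
    qed
    finally show ?thesis by simp
  qed
  have CS: "(ip u h)\<^sup>2 \<le> ip h h"
  proof -
    define t where "t = ip u h"
    have "0 \<le> (\<integral>x. (h x - t * u x)\<^sup>2 \<partial>\<sigma>)" by simp
    also have "\<dots> = (\<integral>x. h x * h x - 2 * t * (u x * h x) + t * t * (u x * u x) \<partial>\<sigma>)"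
      by (rule Bochner_Integration.integral_cong) (auto simp: power2_eq_square algebra_simps)
    also have "\<dots> = ip h h - 2 * t * ip u h + t * t * ip u u"
      unfolding ip_def using bh u by (simp add: bfun_integrable bfun_mult)
    finally have "0 \<le> ip h h - 2 * t\<^sup>2 + t\<^sup>2 * ip u u" by (simp add: t_def power2_eq_square)
    moreover have "t\<^sup>2 * ip u u \<le> t\<^sup>2 * 1" using u by (intro mult_left_mono) auto
    ultimately show ?thesis by (simp add: t_def)
  qed
  have "(real N / 10)\<^sup>2 * (ip u F)\<^sup>2 \<le> (\<Sum>n<N. a n * cheb_real \<mu> n)\<^sup>2 * (ip u F)\<^sup>2"
    using a(2) by (intro mult_right_mono power_mono) auto
  also have "\<dots> = (ip u h)\<^sup>2" unfolding uh by (simp add: power_mult_distrib)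
  also have "\<dots> \<le> 3 / 2 * real N * S" using CS hh by linarith
  also have "\<dots> \<le> 3 / 2 * real N * (3 * (\<Sum>n<2 * N. \<bar>corr n F\<bar>))"
    unfolding S_def c_def by (intro mult_left_mono sum_cheb_le F) auto
  finally have "real N * (real N * (ip u F)\<^sup>2) \<le> real N * (450 * (\<Sum>n<2 * N. \<bar>corr n F\<bar>))"
    by (simp add: power2_eq_square field_simps)
  then have "real N * (ip u F)\<^sup>2 \<le> 450 * (\<Sum>n<2 * N. \<bar>corr n F\<bar>)" using N by simp
  also have "\<dots> \<le> 500 * (\<Sum>n<2 * N. \<bar>corr n F\<bar>)" by (intro mult_right_mono sum_nonneg) auto
  finally show ?thesis .
qed

end

section \<open>Level sets\<close>

text \<open>The value \<open>\<rho> = 0\<close> is admitted: then \<open>far 0\<close> holds everywhere and the near part is empty.\<close>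

lemma near_far':
  assumes f: "bfun f" and g: "bfun g" and \<rho>: "\<rho> = 0 \<or> real s * \<rho> \<ge> 1 \<and> \<rho> > 0"
  shows "\<bar>\<integral>x. Pi_proj s f x * g x \<partial>\<sigma>\<bar>
     \<le> near_const * \<rho> * ((\<integral>x. (f x)\<^sup>2 \<partial>\<sigma>) + (\<integral>x. (g x)\<^sup>2 \<partial>\<sigma>))
       + dint (\<lambda>x y. of_bool (far \<rho> x y) * \<bar>kern s x y\<bar> * \<bar>f y\<bar> * \<bar>g x\<bar>)"
proof (cases "\<rho> = 0")
  case True
  have "bfun2 (\<lambda>x y. kern s x y * f y * g x)" by (intro bfun2_mult bfun2_kern bfun2_fst bfun2_snd f g)
  from abs_dint_le[OF this] show ?thesis
    unfolding Pi_proj_dint True by (simp add: far_def abs_mult)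
next
  case False
  then show ?thesis using near_far[OF f g] \<rho> by blast
qed

text \<open>The maximum with 1 merges the decay away from the poles with the uniform bound, which
  takes over when \<rho> = 0.\<close>

lemma far_kern_bound':
  assumes s: "s \<ge> 1" and xy: "x \<in> S2" "y \<in> S2" and \<rho>: "\<rho> = 0 \<or> real s * \<rho> \<ge> 1 \<and> \<rho> > 0"
  shows "of_bool (far \<rho> x y) * \<bar>kern s x y\<bar> \<le> 2 * real s / sqrt (max 1 (real s * \<rho>))"
proof (cases "\<rho> = 0")
  case True
  have "\<bar>kern s x y\<bar> \<le> 2 * real s" using kern_bound[OF s xy] by simp
  then show ?thesis using True by (simp add: far_def)
next
  case False
  then have \<rho>: "real s * \<rho> \<ge> 1" "\<rho> > 0" using \<rho> by auto
  have "2 * sqrt (real s / \<rho>) = 2 * real s / sqrt (real s * \<rho>)"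
  proof -
    have "sqrt (real s / \<rho>) * sqrt (real s * \<rho>) = sqrt (real s * real s)" using \<rho> by (simp flip: real_sqrt_mult)
    also have "\<dots> = real s" by simp
    finally show ?thesis using \<rho> s by (simp add: field_simps)
  qed
  moreover have "max 1 (real s * \<rho>) = real s * \<rho>" using \<rho> by simp
  moreover have "2 * real s / sqrt (real s * \<rho>) \<ge> 0" using \<rho> by simp
  ultimately show ?thesis using far_kern_bound[OF s xy \<rho>(2)] by (cases "far \<rho> x y") simp_all
qed

lemma bfun2_far: "bfun2 (\<lambda>x y. of_bool (far \<rho> x y))"
proof (rule bfun2_borel[where B = 1])
  have e: "(\<lambda>z. of_bool (far \<rho> (fst z) (snd z)) :: real)
    = indicator ({z. \<rho> \<le> norm (fst z - snd z)} \<inter> {z. \<rho> \<le> norm (fst z + snd z)})"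
    by (auto simp: fun_eq_iff far_def indicator_def)
  show "(\<lambda>z. of_bool (far \<rho> (fst z) (snd z)) :: real) \<in> borel_measurable borel" unfolding e
    by (intro borel_measurable_indicator sets.Int borel_closed closed_Collect_le continuous_intros)
qed auto

lemma bfun2_orthogonal_snd:
  assumes A: "orthogonal_transformation A" and h: "bfun2 h"
  shows "bfun2 (\<lambda>x y. h x (A y))"
proof -
  have [measurable]: "A \<in> \<sigma> \<rightarrow>\<^sub>M \<sigma>" by (rule orthogonal_measurable_sphere[OF A])
  have "(\<lambda>z. (fst z, A (snd z))) \<in> \<sigma> \<Otimes>\<^sub>M \<sigma> \<rightarrow>\<^sub>M \<sigma> \<Otimes>\<^sub>M \<sigma>" by measurable
  from measurable_compose[OF this] h have "(\<lambda>z. case_prod h (fst z, A (snd z))) \<in> borel_measurable (\<sigma> \<Otimes>\<^sub>M \<sigma>)"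
    unfolding bfun2_def by blast
  then have "(\<lambda>(x, y). h x (A y)) \<in> borel_measurable (\<sigma> \<Otimes>\<^sub>M \<sigma>)" by (simp add: split_beta')
  moreover obtain B where "\<forall>x\<in>S2. \<forall>y\<in>S2. \<bar>h x y\<bar> \<le> B" using h unfolding bfun2_def by blast
  then have "\<forall>x\<in>S2. \<forall>y\<in>S2. \<bar>h x (A y)\<bar> \<le> B" using orthogonal_transformation_norm[OF A] by simp
  ultimately show ?thesis unfolding bfun2_def by blast
qed

context rotation_words
begin

lemma winv_W: "w \<in> W n \<Longrightarrow> winv w \<in> W n"
  by (auto simp: W_def)

lemma sum_W_winv: "(\<Sum>w\<in>W n. f (winv w)) = (\<Sum>w\<in>W n. f w)" for f :: "_ \<Rightarrow> real"
  by (rule sum.reindex_bij_witness[where i = winv and j = winv]) (auto intro: winv_W)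

lemma W_rot: "w \<in> W n \<Longrightarrow> rotation_matrix (val w)"
  by (rule val_rot) (auto simp: W_def)

text \<open>
  The contribution of the reduced words of length \<open>n\<close>, for the indicator function \<open>f\<close> of a set of
  measure \<open>m\<close>: the near part is estimated in \<open>L\<^sup>2\<close>, word by word, the far part pointwise, after
  summation over the words.
\<close>

lemma corr_bound:
  assumes f: "bfun f" "\<And>x. x \<in> S2 \<Longrightarrow> f x = 0 \<or> f x = 1" and s: "s \<ge> 1"
    and \<rho>: "\<rho> = 0 \<or> real s * \<rho> \<ge> 1 \<and> \<rho> > 0"
    and B: "\<And>x y. x \<in> S2 \<Longrightarrow> y \<in> S2 \<Longrightarrow> (\<Sum>w\<in>W n. of_bool (far \<rho> x (val w *v y)) * \<bar>kern s x (val w *v y)\<bar>) \<le> B"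
  defines "m \<equiv> \<integral>x. f x \<partial>\<sigma>"
  shows "\<bar>corr n (Pi_proj s f)\<bar> \<le> (1 / sqrt q) ^ n * (real (card (W n)) * (near_const * \<rho> * (2 * m)) + B * m\<^sup>2)"
proof -
  have f2: "(\<integral>x. (f x)\<^sup>2 \<partial>\<sigma>) = m" unfolding m_def
    by (rule Bochner_Integration.integral_cong) (use f(2) in force)+
  have rotw: "orthogonal_transformation ((*v) (val w))" if "w \<in> W n" for w by (rule rotation_orthogonal[OF W_rot[OF that]])
  have bP: "bfun (Pi_proj s f)" by (rule bfun_Pi_proj[OF f(1)])
  have fw: "bfun (\<lambda>x. f (val w *v x))" if "w \<in> W n" for w by (rule bfun_orthogonal[OF rotw[OF that] f(1)])
  define h where "h = (\<lambda>x y. of_bool (far \<rho> x y) * \<bar>kern s x y\<bar>)"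
  have bh: "bfun2 h" unfolding h_def by (intro bfun2_mult bfun2_far bfun2_abs bfun2_kern)
  have fa: "\<bar>f x\<bar> = f x" if "x \<in> S2" for x using f(2)[OF that] by auto
  have wS: "val w *v x \<in> S2" if "w \<in> W n" "x \<in> S2" for w x using that rotation_norm[OF W_rot[OF that(1)]] by simp
  have per_word: "\<bar>\<integral>x. Pi_proj s f (val w *v x) * Pi_proj s f x \<partial>\<sigma>\<bar>
      \<le> near_const * \<rho> * (2 * m) + dint (\<lambda>x y. h x (val (winv w) *v y) * f y * f x)" if w: "w \<in> W n" for w
  proof -
    have sw: "set w \<subseteq> letters" using w by (simp add: W_def)
    have "(\<integral>x. Pi_proj s f (val w *v x) * Pi_proj s f x \<partial>\<sigma>) = (\<integral>x. Pi_proj s (\<lambda>y. f (val w *v y)) x * Pi_proj s f x \<partial>\<sigma>)"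
      by (simp add: Pi_proj_orthogonal[OF rotw[OF w] f(1)])
    also have "\<dots> = (\<integral>x. Pi_proj s (\<lambda>y. f (val w *v y)) x * f x \<partial>\<sigma>)" by (rule Pi_proj_inner[OF fw[OF w] f(1)])
    finally have eq: "(\<integral>x. Pi_proj s f (val w *v x) * Pi_proj s f x \<partial>\<sigma>) = (\<integral>x. Pi_proj s (\<lambda>y. f (val w *v y)) x * f x \<partial>\<sigma>)" .
    have "(\<integral>x. (f (val w *v x))\<^sup>2 \<partial>\<sigma>) = (\<integral>x. (f x)\<^sup>2 \<partial>\<sigma>)"
      by (rule integral_sphere_orthogonal[OF rotw[OF w], of "\<lambda>x. (f x)\<^sup>2"])
        (use bfun_measurable[OF f(1)] in measurable)
    then have n1: "(\<integral>x. (f (val w *v x))\<^sup>2 \<partial>\<sigma>) = m" using f2 by simp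
    \<comment> \<open>Substituting w^(-1) y for y moves the word from the indicator into the kernel,
      so that words can be summed pointwise.\<close>
    have "dint (\<lambda>x y. of_bool (far \<rho> x y) * \<bar>kern s x y\<bar> * \<bar>f (val w *v y)\<bar> * \<bar>f x\<bar>)
        = dint (\<lambda>x y. h x (val (winv w) *v y) * f y * f x)"
    proof (rule Bochner_Integration.integral_cong[OF refl])
      fix x assume "x \<in> space \<sigma>"
      then have x: "x \<in> S2" by simp
      have o: "orthogonal_transformation ((*v) (val (winv w)))" by (rule rotw[OF winv_W[OF w]])
      define k where "k = (\<lambda>y. h x y * f (val w *v y) * f x)"
      have "bfun k" unfolding k_def by (intro bfun_mult bfun2_section[OF bh x] fw[OF w] bfun_const)
      then have "(\<integral>y. k (val (winv w) *v y) \<partial>\<sigma>) = (\<integral>y. k y \<partial>\<sigma>)"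
        by (intro integral_sphere_orthogonal[OF o] bfun_measurable)
      moreover have "val w *v (val (winv w) *v y) = y" for y
        using val_mult_transpose[OF sw] by (simp add: val_winv[OF sw] matrix_vector_mul_assoc del: transpose_matrix_vector)
      moreover have "(\<integral>y. of_bool (far \<rho> x y) * \<bar>kern s x y\<bar> * \<bar>f (val w *v y)\<bar> * \<bar>f x\<bar> \<partial>\<sigma>) = (\<integral>y. k y \<partial>\<sigma>)"
        by (rule Bochner_Integration.integral_cong[OF refl])
          (use fa[OF x] fa[OF wS[OF w]] in \<open>simp add: k_def h_def\<close>)
      ultimately show "(\<integral>y. of_bool (far \<rho> x y) * \<bar>kern s x y\<bar> * \<bar>f (val w *v y)\<bar> * \<bar>f x\<bar> \<partial>\<sigma>)
          = (\<integral>y. h x (val (winv w) *v y) * f y * f x \<partial>\<sigma>)" by (auto simp: k_def)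
    qed
    then show ?thesis unfolding eq using near_far'[OF fw[OF w] f(1) \<rho>] unfolding n1 f2 by simp
  qed
  have bt: "bfun2 (\<lambda>x y. h x (val (winv w) *v y) * f y * f x)" if "w \<in> W n" for w
    by (intro bfun2_mult bfun2_orthogonal_snd[OF rotw[OF winv_W[OF that]] bh] bfun2_fst bfun2_snd f)
  have "(\<Sum>w\<in>W n. dint (\<lambda>x y. h x (val (winv w) *v y) * f y * f x)) = dint (\<lambda>x y. \<Sum>w\<in>W n. h x (val (winv w) *v y) * f y * f x)"
    by (rule dint_sum[symmetric, OF bt])
  also have "\<dots> \<le> dint (\<lambda>x y. B * f y * f x)"
  proof (rule dint_mono)
    fix x y assume xy: "x \<in> S2" "y \<in> S2"
    have "(\<Sum>w\<in>W n. h x (val (winv w) *v y) * f y * f x) = (\<Sum>w\<in>W n. h x (val w *v y)) * (f y * f x)"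
      unfolding sum_W_winv[symmetric, of "\<lambda>w. h x (val w *v y)"] by (simp add: sum_distrib_right mult.assoc)
    also have "\<dots> \<le> B * (f y * f x)"
      using B[OF xy] f(2)[OF xy(1)] f(2)[OF xy(2)] unfolding h_def by (intro mult_right_mono) auto
    finally show "(\<Sum>w\<in>W n. h x (val (winv w) *v y) * f y * f x) \<le> B * f y * f x" by (simp add: mult.assoc)
  qed (intro bfun2_sum bt bfun2_mult bfun2_const bfun2_fst bfun2_snd f | assumption)+
  also have "\<dots> = B * m\<^sup>2" by (simp add: m_def power2_eq_square mult.assoc)
  finally have far: "(\<Sum>w\<in>W n. dint (\<lambda>x y. h x (val (winv w) *v y) * f y * f x)) \<le> B * m\<^sup>2" .
  have "corr n (Pi_proj s f) = (1 / sqrt q) ^ n * (\<integral>x. (\<Sum>w\<in>W n. Pi_proj s f (val w *v x) * Pi_proj s f x) \<partial>\<sigma>)"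
    unfolding corr_def ip_def Q_def sum_distrib_right[symmetric] mult.assoc by simp
  also have "(\<integral>x. (\<Sum>w\<in>W n. Pi_proj s f (val w *v x) * Pi_proj s f x) \<partial>\<sigma>) = (\<Sum>w\<in>W n. \<integral>x. Pi_proj s f (val w *v x) * Pi_proj s f x \<partial>\<sigma>)"
    by (intro Bochner_Integration.integral_sum bfun_integrable bfun_mult bP bfun_orthogonal[OF rotw bP])
  finally have "\<bar>corr n (Pi_proj s f)\<bar> = (1 / sqrt q) ^ n * \<bar>\<Sum>w\<in>W n. \<integral>x. Pi_proj s f (val w *v x) * Pi_proj s f x \<partial>\<sigma>\<bar>"
    using q3 by (simp add: abs_mult power_abs)
  also have "\<bar>\<Sum>w\<in>W n. \<integral>x. Pi_proj s f (val w *v x) * Pi_proj s f x \<partial>\<sigma>\<bar>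
      \<le> (\<Sum>w\<in>W n. near_const * \<rho> * (2 * m) + dint (\<lambda>x y. h x (val (winv w) *v y) * f y * f x))"
    by (intro order_trans[OF sum_abs] sum_mono per_word)
  also have "\<dots> = real (card (W n)) * (near_const * \<rho> * (2 * m)) + (\<Sum>w\<in>W n. dint (\<lambda>x y. h x (val (winv w) *v y) * f y * f x))"
    by (simp add: sum.distrib)
  finally show ?thesis using far q3
    by (smt (verit) mult_left_mono zero_le_power real_sqrt_ge_zero zero_le_divide_1_iff)
qed

text \<open>An eigenfunction is fixed by the self-adjoint projection, so pairing it with the
  projected indicator is integrating it over its level set.\<close>

lemma level_set_inner:
  assumes u: "sph_eigen s u" and a: "\<alpha> > 0" and f_def: "f = (\<lambda>x. of_bool (u x > \<alpha>))"
  shows "bfun f" "x \<in> S2 \<Longrightarrow> f x = 0 \<or> f x = 1" "ip u (Pi_proj s f) \<ge> \<alpha> * (\<integral>x. f x \<partial>\<sigma>)" "(\<integral>x. f x \<partial>\<sigma>) \<ge> 0"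
proof -
  have uc: "continuous_on S2 u" by (rule sph_eigen_continuous[OF u])
  have [measurable]: "u \<in> borel_measurable \<sigma>" by (rule continuous_on_imp_borel_measurable_sphere_measure[OF uc])
  have bu: "bfun u" by (rule bfun_continuous[OF uc])
  show bf: "bfun f" unfolding bfun_def
  proof
    show "f \<in> borel_measurable \<sigma>" unfolding f_def by measurable
  qed (auto simp: f_def intro!: exI[of _ 1])
  show "x \<in> S2 \<Longrightarrow> f x = 0 \<or> f x = 1" by (auto simp: f_def)
  have "ip u (Pi_proj s f) = (\<integral>x. Pi_proj s u x * f x \<partial>\<sigma>)"
    unfolding ip_def by (rule Pi_proj_self_adjoint[OF bu bf, symmetric])
  also have "\<dots> = (\<integral>x. u x * f x \<partial>\<sigma>)"
    by (rule Bochner_Integration.integral_cong) (auto simp: Pi_proj_eigen[OF u])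
  also have "\<dots> \<ge> (\<integral>x. \<alpha> * f x \<partial>\<sigma>)"
    by (intro integral_mono bfun_integrable bfun_cmult bfun_mult bf bu) (auto simp: f_def)
  finally show "ip u (Pi_proj s f) \<ge> \<alpha> * (\<integral>x. f x \<partial>\<sigma>)" by simp
  show "(\<integral>x. f x \<partial>\<sigma>) \<ge> 0" by (auto simp: f_def)
qed

definition lev :: "(real^3 \<Rightarrow> real) \<Rightarrow> real \<Rightarrow> real" where "lev u \<alpha> = (\<integral>x. of_bool (u x > \<alpha>) \<partial>\<sigma>)"

lemma near_const_pos: "near_const > 0"
  by (simp add: near_const_def add_nonneg_pos)

text \<open>The argument with the empty word alone: the weak-type bound at the critical exponent 6
  valid for all spherical harmonics, without any logarithm.\<close>

lemma weak_type_plain: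
  assumes u: "sph_eigen s u" "ip u u \<le> 1" and s: "s \<ge> 1" and a: "\<alpha> > 0"
  shows "lev u \<alpha> \<le> 64 * near_const * real s / \<alpha> ^ 6"
proof -
  define f :: "real^3 \<Rightarrow> real" where "f = (\<lambda>x. of_bool (u x > \<alpha>))"
  note L = level_set_inner[OF u(1) a f_def]
  define m where "m = lev u \<alpha>"
  have m: "m = (\<integral>x. f x \<partial>\<sigma>)" by (simp add: m_def lev_def f_def)
  have m0: "m \<ge> 0" using L(4) m by simp
  \<comment> \<open>\<open>R\<close> is the square root of s \<rho>. It is chosen so that the far
    bound 2s/R equals \<alpha>^2/2, half of what stands on the left.\<close>
  define R where "R = 4 * real s / \<alpha>\<^sup>2"
  have R: "R > 0" using s a by (simp add: R_def)
  define \<rho> where "\<rho> = (if R\<^sup>2 \<ge> 1 then R\<^sup>2 / real s else 0)"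
  have \<rho>: "\<rho> = 0 \<or> real s * \<rho> \<ge> 1 \<and> \<rho> > 0" using s R by (auto simp: \<rho>_def)
  have \<rho>le: "0 \<le> \<rho>" "\<rho> \<le> R\<^sup>2 / real s" using s by (auto simp: \<rho>_def)
  have mx: "max 1 (real s * \<rho>) \<ge> R\<^sup>2" using s by (auto simp: \<rho>_def)
  have "R \<le> sqrt (max 1 (real s * \<rho>))" using mx R by (intro real_le_rsqrt)
  then have B: "2 * real s / sqrt (max 1 (real s * \<rho>)) \<le> 2 * real s / R" using R s by (intro divide_left_mono) auto
  have bf: "bfun f" by (rule L(1))
  have P: "bfun (Pi_proj s f)" by (rule bfun_Pi_proj[OF bf])
  have bu: "bfun u" by (rule bfun_continuous[OF sph_eigen_continuous[OF u(1)]])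
  have CS: "(ip u (Pi_proj s f))\<^sup>2 \<le> corr 0 (Pi_proj s f)"
  proof -
    define t where "t = ip u (Pi_proj s f)"
    have "0 \<le> (\<integral>x. (Pi_proj s f x - t * u x)\<^sup>2 \<partial>\<sigma>)" by simp
    also have "\<dots> = (\<integral>x. Pi_proj s f x * Pi_proj s f x - 2 * t * (u x * Pi_proj s f x) + t * t * (u x * u x) \<partial>\<sigma>)"
      by (rule Bochner_Integration.integral_cong) (auto simp: power2_eq_square algebra_simps)
    also have "\<dots> = ip (Pi_proj s f) (Pi_proj s f) - 2 * t * ip u (Pi_proj s f) + t * t * ip u u"
      unfolding ip_def using P bu by (simp add: bfun_integrable bfun_mult)
    finally have "0 \<le> ip (Pi_proj s f) (Pi_proj s f) - 2 * t\<^sup>2 + t\<^sup>2 * ip u u" by (simp add: t_def power2_eq_square)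
    moreover have "t\<^sup>2 * ip u u \<le> t\<^sup>2 * 1" using u by (intro mult_left_mono) auto
    moreover have "corr 0 (Pi_proj s f) = ip (Pi_proj s f) (Pi_proj s f)" by (simp add: corr_def ip_def Q_0)
    ultimately show ?thesis by (simp add: t_def)
  qed
  have "\<bar>corr 0 (Pi_proj s f)\<bar> \<le> (1 / sqrt q) ^ 0 * (real (card (W 0)) * (near_const * \<rho> * (2 * m)) + (2 * real s / R) * m\<^sup>2)"
    unfolding m
  proof (rule corr_bound[OF L(1,2) s \<rho>])
    fix x y assume "x \<in> S2" "y \<in> S2"
    then show "(\<Sum>w\<in>W 0. of_bool (far \<rho> x (val w *v y)) * \<bar>kern s x (val w *v y)\<bar>) \<le> 2 * real s / R"
      using far_kern_bound'[OF s _ _ \<rho>, of x y] B by (simp add: W_0)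
  qed
  then have c0: "corr 0 (Pi_proj s f) \<le> near_const * \<rho> * (2 * m) + (2 * real s / R) * m\<^sup>2" by (simp add: W_0)
  have "(\<alpha> * m)\<^sup>2 \<le> (ip u (Pi_proj s f))\<^sup>2" using L(3) m m0 a by (intro power_mono) auto
  also have "\<dots> \<le> near_const * \<rho> * (2 * m) + (2 * real s / R) * m\<^sup>2" using CS c0 by linarith
  also have "near_const * \<rho> * (2 * m) \<le> near_const * (R\<^sup>2 / real s) * (2 * m)"
    using \<rho>le m0 near_const_pos by (intro mult_right_mono mult_left_mono) auto
  also have "2 * real s / R = \<alpha>\<^sup>2 / 2" using s a by (simp add: R_def field_simps)
  also have "near_const * (R\<^sup>2 / real s) * (2 * m) = 32 * near_const * real s / \<alpha> ^ 4 * m"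
    using s a by (simp add: R_def field_simps power2_eq_square eval_nat_numeral)
  finally have main: "\<alpha>\<^sup>2 / 2 * m\<^sup>2 \<le> 32 * near_const * real s / \<alpha> ^ 4 * m" by (simp add: power_mult_distrib)
  show ?thesis
  proof (cases "m = 0")
    case True
    then show ?thesis using near_const_pos a by (simp add: m_def)
  next
    case False
    then have mp: "m > 0" using m0 by simp
    have "\<alpha>\<^sup>2 / 2 * m * m \<le> 32 * near_const * real s / \<alpha> ^ 4 * m" using main by (simp add: power2_eq_square mult.assoc)
    then have "\<alpha>\<^sup>2 / 2 * m \<le> 32 * near_const * real s / \<alpha> ^ 4" using mp by (simp only: mult_le_cancel_right_pos)
    then have "m * (\<alpha>\<^sup>2 * \<alpha> ^ 4) \<le> 64 * near_const * real s" using a by (simp add: field_simps)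
    also have "\<alpha>\<^sup>2 * \<alpha> ^ 4 = \<alpha> ^ 6" by (simp flip: power_add)
    finally show ?thesis using a by (simp add: m_def field_simps)
  qed
qed

end

context algebraic_rotation_words
begin

text \<open>The fourth power is the normalisation q^(-1/2) per letter. Working with the eighth root
  of 1/q lets the radius shrink like p0^(6n) and still leaves p0^(2n) for the near part and p0^n for
  the far part.\<close>

definition p0 :: real where "p0 = q powr (-1/8)"

lemma p0: "0 < p0" "p0 < 1" "p0 ^ 4 = 1 / sqrt q" "p0 ^ 8 * q = 1"
proof -
  show "0 < p0" using q3 by (simp add: p0_def)
  have "q powr (-1/8) < q powr 0" using q3 by (intro powr_less_mono) auto
  then show "p0 < 1" using q3 by (simp add: p0_def)
  have "p0 ^ 8 = q powr (-1/8 * 8)" unfolding p0_def using q3 by (simp add: powr_power)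
  then show e: "p0 ^ 8 * q = 1" using q3 by (simp add: powr_minus)
  have "(p0 ^ 4)\<^sup>2 = p0 ^ 8" by (simp flip: power_mult)
  also have "\<dots> = 1 / q" unfolding eq_divide_eq using e q3 by simp
  also have "\<dots> = (1 / sqrt q)\<^sup>2" using q3 by (simp only: power_divide) simp
  finally have "(p0 ^ 4)\<^sup>2 = (1 / sqrt q)\<^sup>2" .
  then show "p0 ^ 4 = 1 / sqrt q"
    by (rule power2_eq_imp_eq) (use \<open>0 < p0\<close> q3 in simp_all)
qed

text \<open>\<open>K1\<close> and \<open>K2\<close> sum over all word lengths the cost of the near
  regions and of the exceptional words.\<close>

definition K1 :: real where "K1 = 4 * near_const * (\<Sum>n. p0 ^ n)"
definition K2 :: real where "K2 = (\<Sum>n. (16 * real n + 8) * p0 ^ n)"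

lemma summable_K1: "summable (\<lambda>n. p0 ^ n)"
  using p0 by (intro summable_geometric) auto

lemma summable_K2: "summable (\<lambda>n. (16 * real n + 8) * p0 ^ n)"
proof -
  have "summable (\<lambda>n. diffs (\<lambda>_. 1) n * p0 ^ n)"
    by (rule termdiff_converges[of p0 1]) (use p0 in \<open>auto intro: summable_geometric\<close>)
  then have "summable (\<lambda>n. (real n * p0 ^ n + p0 ^ n) - p0 ^ n)"
    by (intro summable_diff summable_K1) (simp add: diffs_def algebra_simps)
  then have "summable (\<lambda>n. real n * p0 ^ n)" by simp
  then have "summable (\<lambda>n. 16 * (real n * p0 ^ n) + 8 * p0 ^ n)"
    by (intro summable_add summable_mult summable_K1)
  then show ?thesis by (simp add: algebra_simps)
qed

lemma K1_pos: "K1 > 0"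
  unfolding K1_def using near_const_pos p0 by (intro mult_pos_pos suminf_pos summable_K1) auto

lemma K2_ge: "K2 \<ge> 8"
proof -
  have "(\<Sum>n<1. (16 * real n + 8) * p0 ^ n) \<le> K2"
    unfolding K2_def using p0 by (intro sum_le_suminf summable_K2) auto
  then show ?thesis by simp
qed

end

section \<open>From distribution functions to norms\<close>

lemma partial_derivative_eq:
  assumes D: "(F has_derivative D) (at x)"
  shows "partial_derivative i F x = D (axis i 1)"
proof -
  have lin: "bounded_linear D" by (rule has_derivative_bounded_linear[OF D])
  have "((\<lambda>t. x + t *\<^sub>R axis i 1) has_derivative (\<lambda>t. t *\<^sub>R axis i 1)) (at (0::real))"
    by (auto intro!: derivative_eq_intros)
  then have "((\<lambda>t. F (x + t *\<^sub>R axis i 1)) has_derivative (\<lambda>t. D (t *\<^sub>R axis i 1))) (at (0::real))"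
    by (rule has_derivative_compose) (use D in simp)
  then have "((\<lambda>t. F (x + t *\<^sub>R axis i 1)) has_vector_derivative D (axis i 1)) (at 0)"
    unfolding has_vector_derivative_def by (simp add: linear_simps(5)[OF lin])
  then show ?thesis unfolding partial_derivative_def by (rule vector_derivative_at)
qed

lemma has_derivative_partial_derivatives:
  assumes "F differentiable (at x)"
  shows "(F has_derivative (\<lambda>v. \<Sum>i\<in>UNIV. (v$i) *\<^sub>R partial_derivative i F x)) (at x)"
proof -
  from assms obtain D where D: "(F has_derivative D) (at x)" unfolding differentiable_def by blast
  have lin: "bounded_linear D" by (rule has_derivative_bounded_linear[OF D])
  interpret bounded_linear D by (rule lin)
  have "D v = (\<Sum>i\<in>UNIV. (v$i) *\<^sub>R partial_derivative i F x)" for v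
  proof -
    have "D v = D (\<Sum>i\<in>UNIV. (v$i) *\<^sub>R axis i 1)"
      using basis_expansion[of v] by (simp add: scalar_mult_eq_scaleR)
    also have "\<dots> = (\<Sum>i\<in>UNIV. (v$i) *\<^sub>R partial_derivative i F x)"
      by (simp add: sum scaleR partial_derivative_eq[OF D])
    finally show ?thesis .
  qed
  then have "D = (\<lambda>v. \<Sum>i\<in>UNIV. (v$i) *\<^sub>R partial_derivative i F x)" by blast
  then show ?thesis using D by simp
qed

lemma radial_extension_scale: "t > 0 \<Longrightarrow> radial_extension f (t *\<^sub>R x) = radial_extension f x"
proof -
  assume t: "t > 0"
  have e: "inverse t * n * t = n" for n using t by (simp add: field_simps)
  show ?thesis using t by (simp add: radial_extension_def e)
qed

lemma radial_extension_S2: "x \<in> S2 \<Longrightarrow> radial_extension f x = f x"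
  by (simp add: radial_extension_def)

text \<open>An extension constant along rays has no radial first or second derivative, so
  \<open>lap\<close> reduces to the Euclidean Laplacian. The functional \<open>L\<close> stands for
  the real or the imaginary part.\<close>

lemma sph_eigen_radial_extension:
  fixes L :: "complex \<Rightarrow> real"
  assumes L: "bounded_linear L" and C2: "C2_sphere \<psi>"
    and eig: "\<And>x. x \<in> S2 \<Longrightarrow> sphere_laplacian \<psi> x = of_nat (s * (s + 1)) * \<psi> x"
  shows "sph_eigen s (\<lambda>x. L (radial_extension \<psi> x))"
proof -
  interpret L: bounded_linear L by (rule L)
  define F where "F = radial_extension \<psi>"
  define d where "d i = partial_derivative i F" for i
  define dd where "dd i j = partial_derivative j (d i)" for i j
  have op: "open (- {0 :: real^3})" by auto
  have c2: "C2_on (- {0}) F" using C2 by (simp add: C2_sphere_def F_def)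
  have dF: "F differentiable (at x)" and ddF: "d i differentiable (at x)" if "x \<noteq> 0" for x i
    using c2 that unfolding C2_on_def C1_on_def d_def differentiable_on_eq_differentiable_at[OF op] by auto
  have cdd: "continuous_on (- {0}) (dd i j)" for i j
    using c2 unfolding C2_on_def C1_on_def d_def dd_def by auto
  define u where "u = (\<lambda>x. L (F x))"
  define G :: "real^3 \<Rightarrow> real^3" where "G = (\<lambda>x. \<chi> i. L (d i x))"
  define H :: "real^3 \<Rightarrow> real^3^3" where "H = (\<lambda>x. \<chi> i j. L (dd i j x))"
  have comp: "((\<lambda>x. L (f x)) has_derivative (\<lambda>v. \<Sum>i\<in>UNIV. L (partial_derivative i f x) * v$i)) (at x)"
    if "f differentiable (at x)" for f :: "real^3 \<Rightarrow> complex" and x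
    using L.has_derivative[OF has_derivative_partial_derivatives[OF that]]
    by (simp add: L.sum L.scaleR mult.commute)
  have du: "(u has_derivative (\<lambda>v. G x \<bullet> v)) (at x)" if "x \<noteq> 0" for x
    using comp[OF dF[OF that]] by (simp add: u_def G_def inner_vec_def d_def)
  have dG: "(G has_derivative (\<lambda>v. H x *v v)) (at x)" if x: "x \<noteq> 0" for x
    unfolding has_derivative_componentwise_within[of G]
  proof
    fix b :: "real^3" assume "b \<in> Basis"
    then obtain k where b: "b = axis k 1" by (auto simp: Basis_vec_def)
    show "((\<lambda>x. G x \<bullet> b) has_derivative (\<lambda>v. (H x *v v) \<bullet> b)) (at x)"
      using comp[OF ddF[OF x, of k]] by (simp add: b inner_axis G_def H_def matrix_vector_mult_def dd_def)
  qed
  have cH: "continuous_on S2 H"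
    unfolding H_def
    by (intro continuous_on_vec_lambda L.continuous_on continuous_on_subset[OF cdd]) auto
  have hom: "G x \<bullet> x = 0" if x: "x \<noteq> 0" for x
  proof -
    have "((\<lambda>t. x + t *\<^sub>R x) has_derivative (\<lambda>t. t *\<^sub>R x)) (at (0::real))"
      by (auto intro!: derivative_eq_intros)
    then have "((\<lambda>t. u (x + t *\<^sub>R x)) has_derivative (\<lambda>t. G x \<bullet> (t *\<^sub>R x))) (at (0::real))"
      by (rule has_derivative_compose) (use du[OF x] in simp)
    moreover have "((\<lambda>t. u (x + t *\<^sub>R x)) has_derivative (\<lambda>t. 0)) (at (0::real))"
    proof (rule has_derivative_transform_within_open[OF has_derivative_const open_greaterThan[of "-1"]])
      fix t :: real assume "t \<in> {-1<..}"
      then have "F ((1 + t) *\<^sub>R x) = F x" unfolding F_def by (intro radial_extension_scale) simp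
      then show "u x = u (x + t *\<^sub>R x)" by (simp add: u_def scaleR_add_left)
    qed auto
    ultimately have "(\<lambda>t. G x \<bullet> (t *\<^sub>R x)) = (\<lambda>t. 0)" by (rule has_derivative_unique)
    from fun_cong[OF this, of 1] show ?thesis by simp
  qed
  \<comment> \<open>Differentiating the identity G(y) . y = 0 at x in the direction x leaves exactly
    this term, since G(x) . x vanishes.\<close>
  have hom2: "x \<bullet> (H x *v x) = 0" if x: "x \<noteq> 0" for x
  proof -
    have "((\<lambda>y. G y \<bullet> y) has_derivative (\<lambda>v. G x \<bullet> v + (H x *v v) \<bullet> x)) (at x)"
      by (rule has_derivative_inner[OF dG[OF x] has_derivative_ident])
    moreover have "((\<lambda>y. G y \<bullet> y) has_derivative (\<lambda>v. 0)) (at x)"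
      by (rule has_derivative_transform_within_open[OF has_derivative_const op]) (use x hom in auto)
    ultimately have "(\<lambda>v. G x \<bullet> v + (H x *v v) \<bullet> x) = (\<lambda>v. 0)" by (rule has_derivative_unique)
    from fun_cong[OF this, of x] show ?thesis using hom[OF x] by (simp add: inner_commute)
  qed
  have lap_eq: "lap x (G x) (H x) = - real (s * (s + 1)) * u x" if x: "x \<in> S2" for x
  proof -
    have x0: "x \<noteq> 0" using x by auto
    have "trace (H x) = L (\<Sum>i\<in>UNIV. dd i i x)" by (simp add: trace_def H_def L.sum)
    also have "(\<Sum>i\<in>UNIV. dd i i x) = - sphere_laplacian \<psi> x"
      by (simp add: sphere_laplacian_def dd_def d_def F_def)
    also have "\<dots> = (- real (s * (s + 1))) *\<^sub>R F x"
      using eig[OF x] radial_extension_S2[OF x, of \<psi>] by (simp add: F_def scaleR_conv_of_real algebra_simps)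
    also have "L \<dots> = - real (s * (s + 1)) * u x" by (simp only: L.scaleR u_def real_scaleR_def)
    finally show ?thesis using hom[OF x0] hom2[OF x0] by (simp add: lap_def inner_commute)
  qed
  have C2u: "C2_fun u G H" unfolding C2_fun_def
  proof (intro conjI ballI cH)
    fix x :: "real^3" assume "x \<in> S2"
    then have x: "x \<noteq> 0" by auto
    show "(u has_derivative (\<lambda>v. G x \<bullet> v)) (at x)" by (rule du[OF x])
    show "(G has_derivative (\<lambda>v. H x *v v)) (at x)" by (rule dG[OF x])
  qed
  have "sph_eigen s u" unfolding sph_eigen_def
    by (intro exI[of _ G] exI[of _ H] conjI ballI C2u lap_eq)
  then show ?thesis unfolding u_def F_def .
qed

lemma sph_eigen_uminus:
  assumes "sph_eigen s u"
  shows "sph_eigen s (\<lambda>x. - u x)"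
proof -
  obtain g H where gH: "C2_fun u g H" "\<And>x. x \<in> S2 \<Longrightarrow> lap x (g x) (H x) = - real (s * (s + 1)) * u x"
    using assms unfolding sph_eigen_def by blast
  have neg: "(- (H x)) *v v = - (H x *v v)" for x v
    by (simp add: vec_eq_iff matrix_vector_mult_def sum_negf)
  have "C2_fun (\<lambda>x. - u x) (\<lambda>x. - g x) (\<lambda>x. - H x)"
    unfolding C2_fun_def
  proof (intro conjI ballI)
    fix x assume x: "x \<in> S2"
    note h = gH(1)[unfolded C2_fun_def]
    show "((\<lambda>x. - u x) has_derivative (\<lambda>v. - g x \<bullet> v)) (at x)"
      using has_derivative_minus[OF bspec[OF conjunct1[OF h] x]] by simp
    show "((\<lambda>x. - g x) has_derivative (\<lambda>v. - H x *v v)) (at x)"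
      unfolding neg by (rule has_derivative_minus[OF bspec[OF conjunct1[OF conjunct2[OF h]] x]])
  next
    show "continuous_on S2 (\<lambda>x. - H x)"
      by (rule continuous_on_minus[OF conjunct2[OF conjunct2[OF gH(1)[unfolded C2_fun_def]]]])
  qed
  moreover have "lap x (- g x) (- H x) = - real (s * (s + 1)) * (- u x)" if "x \<in> S2" for x
    using gH(2)[OF that] by (simp add: lap_def neg trace_def sum_negf)
  ultimately show ?thesis unfolding sph_eigen_def by blast
qed

text \<open>A dyadic layer-cake argument: the layers below \<open>A\<close> contribute a geometric
  series of ratio 2^(6+\<delta>-p), which converges because p exceeds 6 + \<delta>.\<close>

lemma Lp_from_distribution:
  fixes w :: "'a \<Rightarrow> real"
  assumes w: "w \<in> borel_measurable M" "\<And>x. x \<in> space M \<Longrightarrow> w x \<ge> 0"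
    and A: "A > 0" and B: "B \<ge> 0" and p: "p > 6 + \<delta>" "\<delta> > 0"
    and distr: "\<And>\<alpha>. \<alpha> > 0 \<Longrightarrow> emeasure M {x \<in> space M. w x > \<alpha>} \<le> ennreal (if \<alpha> \<ge> A then 0 else B / \<alpha> ^ 6 * (A / \<alpha>) powr \<delta>)"
  shows "(\<integral>\<^sup>+x. ennreal (w x powr p) \<partial>M) \<le> ennreal (B * A powr (p - 6) * (2 powr (6 + \<delta>) / (1 - 2 powr (6 + \<delta> - p))))"
proof -
  define a where "a i = A * 2 powr (- real i)" for i
  define E where "E i = {x \<in> space M. w x > a (Suc i)}" for i
  define \<theta> where "\<theta> = 2 powr (6 + \<delta> - p)"
  have \<theta>: "0 < \<theta>" "\<theta> < 1" using p powr_less_mono[of "6 + \<delta> - p" 0 2] by (auto simp: \<theta>_def)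
  have a0: "a i > 0" for i using A by (simp add: a_def)
  have meas: "E i \<in> sets M" for i unfolding E_def using w(1) by measurable
  have AEw: "AE x in M. w x \<le> A"
  proof (rule AE_I)
    show "{x \<in> space M. \<not> w x \<le> A} \<subseteq> {x \<in> space M. w x > A}" by auto
    show "emeasure M {x \<in> space M. w x > A} = 0" using distr[OF A] by simp
    show "{x \<in> space M. w x > A} \<in> sets M" using w(1) by measurable
  qed
  \<comment> \<open>A positive v up to \<open>A\<close> lies between two consecutive heights: the
    first height below v is not the top one, and its predecessor bounds v from above.\<close>
  have pt: "ennreal (v powr p) \<le> (\<Sum>i. ennreal (a i powr p) * of_bool (v > a (Suc i)))" if v: "0 \<le> v" "v \<le> A" for v
  proof (cases "v = 0")
    case False
    have lim: "a \<longlonglongrightarrow> 0"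
    proof -
      have "(\<lambda>i. A * (1/2) ^ i) \<longlonglongrightarrow> A * 0" by (intro tendsto_mult tendsto_const LIMSEQ_power_zero) auto
      moreover have "(\<lambda>i. A * (1/2) ^ i) = a" by (auto simp: a_def fun_eq_iff powr_minus powr_realpow power_divide divide_simps)
      ultimately show ?thesis by simp
    qed
    have ex: "\<exists>i. a i < v" using order_tendstoD(2)[OF lim, of v] False v by (auto simp: eventually_sequentially)
    define k where "k = (LEAST i. a i < v)"
    have k: "a k < v" unfolding k_def using ex by (rule LeastI_ex)
    have "k \<noteq> 0" by (rule notI) (use k v in \<open>auto simp: a_def\<close>)
    then obtain i where i: "k = Suc i" using not0_implies_Suc by blast
    have "\<not> a i < v" using not_less_Least[of i "\<lambda>i. a i < v"] i by (simp add: k_def)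
    then have "v powr p \<le> a i powr p" using v p by (intro powr_mono2) auto
    then have "ennreal (v powr p) \<le> ennreal (a i powr p) * of_bool (v > a (Suc i))" using k i by (simp add: ennreal_leI)
    also have "\<dots> \<le> (\<Sum>i. ennreal (a i powr p) * of_bool (v > a (Suc i)))"
    proof -
      have "f i \<le> suminf f" for f :: "nat \<Rightarrow> ennreal" using sum_le_suminf[of f "{i}"] by simp
      then show ?thesis .
    qed
    finally show ?thesis .
  qed simp
  have bnd: "a i powr p * (B / a (Suc i) ^ 6 * (A / a (Suc i)) powr \<delta>) = B * A powr (p - 6) * 2 powr (6 + \<delta>) * \<theta> ^ i" for i
  proof -
    have 1: "a i powr p = A powr p * 2 powr (- real i * p)" using A by (simp add: a_def powr_mult powr_powr)
    have 2: "a (Suc i) ^ 6 = A powr 6 * 2 powr (- (real i + 1) * 6)"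
      using A by (simp add: a_def power_mult_distrib powr_power algebra_simps)
    have 3: "(A / a (Suc i)) powr \<delta> = 2 powr ((real i + 1) * \<delta>)"
    proof -
      have "a (Suc i) * 2 powr (real i + 1) = A" by (simp add: a_def mult.assoc flip: powr_add)
      then have "A / a (Suc i) = 2 powr (real i + 1)" using a0[of "Suc i"] by (simp add: divide_eq_eq mult.commute)
      then show ?thesis by (simp add: powr_powr)
    qed
    have 4: "\<theta> ^ i = 2 powr ((6 + \<delta> - p) * real i)" by (simp add: \<theta>_def powr_power mult.commute)
    have 5: "A powr (p - 6) = A powr p / A powr 6" by (rule powr_diff)
    have 6: "2 powr (- real i * p) / 2 powr (- (real i + 1) * 6) * 2 powr ((real i + 1) * \<delta>) = 2 powr (6 + \<delta>) * (2 powr ((6 + \<delta> - p) * real i) :: real)"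
      unfolding powr_diff[symmetric] powr_add[symmetric] by (simp add: algebra_simps)
    have "a i powr p * (B / a (Suc i) ^ 6 * (A / a (Suc i)) powr \<delta>)
      = B * (A powr p / A powr 6) * (2 powr (- real i * p) / 2 powr (- (real i + 1) * 6) * 2 powr ((real i + 1) * \<delta>))"
      unfolding 1 2 3 by simp
    then show ?thesis unfolding 6 4 5 by simp
  qed
  have "(\<integral>\<^sup>+x. ennreal (w x powr p) \<partial>M) \<le> (\<integral>\<^sup>+x. (\<Sum>i. ennreal (a i powr p) * indicator (E i) x) \<partial>M)"
  proof (rule nn_integral_mono_AE)
    show "AE x in M. ennreal (w x powr p) \<le> (\<Sum>i. ennreal (a i powr p) * indicator (E i) x)"
      using AEw AE_space
    proof eventually_elim
      case (elim x)
      then show ?case using pt[of "w x"] w(2)[of x] by (simp add: E_def indicator_def of_bool_def)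
    qed
  qed
  also have "\<dots> = (\<Sum>i. \<integral>\<^sup>+x. ennreal (a i powr p) * indicator (E i) x \<partial>M)"
    by (rule nn_integral_suminf) (use meas in measurable)
  also have "\<dots> = (\<Sum>i. ennreal (a i powr p) * emeasure M (E i))"
    using meas by (simp add: nn_integral_cmult)
  also have "\<dots> \<le> (\<Sum>i. ennreal (B * A powr (p - 6) * 2 powr (6 + \<delta>) * \<theta> ^ i))"
  proof (rule suminf_le)
    fix i
    have lt: "\<not> a (Suc i) \<ge> A"
      using A powr_less_mono[of "- real (Suc i)" 0 2] by (simp add: a_def not_le)
    have "emeasure M (E i) \<le> ennreal (B / a (Suc i) ^ 6 * (A / a (Suc i)) powr \<delta>)"
      using distr[OF a0[of "Suc i"]] lt by (simp add: E_def)
    then have "ennreal (a i powr p) * emeasure M (E i) \<le> ennreal (a i powr p) * ennreal (B / a (Suc i) ^ 6 * (A / a (Suc i)) powr \<delta>)"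
      by (intro mult_left_mono) auto
    also have "\<dots> = ennreal (B * A powr (p - 6) * 2 powr (6 + \<delta>) * \<theta> ^ i)"
      unfolding bnd[symmetric] using B a0[of "Suc i"] by (subst ennreal_mult) auto
    finally show "ennreal (a i powr p) * emeasure M (E i) \<le> ennreal (B * A powr (p - 6) * 2 powr (6 + \<delta>) * \<theta> ^ i)" .
  qed auto
  also have "\<dots> = ennreal (\<Sum>i. B * A powr (p - 6) * 2 powr (6 + \<delta>) * \<theta> ^ i)"
    by (rule suminf_ennreal2) (use B \<theta> in \<open>auto intro!: summable_mult summable_geometric\<close>)
  also have "(\<Sum>i. B * A powr (p - 6) * 2 powr (6 + \<delta>) * \<theta> ^ i) = B * A powr (p - 6) * 2 powr (6 + \<delta>) * (1 / (1 - \<theta>))"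
    using \<theta> by (subst suminf_mult) (auto intro!: summable_geometric simp: suminf_geometric)
  finally show ?thesis by (simp add: \<theta>_def mult.assoc)
qed

lemma eventually_ln_le:
  fixes a e :: real
  assumes "a > 0" "e > 0"
  shows "\<forall>\<^sub>F n in sequentially. ln (real n) \<le> e * real n powr a"
  using order_tendstoD(2)[OF lim_ln_over_power[OF assms(1)] assms(2)] eventually_gt_at_top[of 0]
  by eventually_elim (simp add: field_simps)

text \<open>The list of growth conditions under which the asymptotic argument works; the exponents
  are those left over from s^(1/2) in \<open>large_level\<close> and
  \<open>distribution_bound_large\<close>.\<close>

lemma eventually_large:
  fixes c C \<delta> :: real
  assumes c: "c > 0" and \<delta>: "\<delta> > 0"
  obtains s0 :: nat where "s0 \<ge> 3" "\<And>s. s \<ge> s0 \<Longrightarrow> 2 / c \<le> ln (real s)" "\<And>s. s \<ge> s0 \<Longrightarrow> C < real s powr (3/8)"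
    "\<And>s. s \<ge> s0 \<Longrightarrow> c * ln (real s) \<le> real s powr (3/16)" "\<And>s. s \<ge> s0 \<Longrightarrow> ln (real s) \<le> real s powr (3/16)"
    "\<And>s. s \<ge> s0 \<Longrightarrow> ln (real s) ^ 3 \<le> (real s powr (3/32) / sqrt (ln (real s))) powr \<delta>"
proof -
  \<comment> \<open>Once ln s <= s^a, the last condition reads 3a <= (3/32 - a/2) \<delta>. The
    bound a <= 3/32 makes the bracket at least 3/64, and a <= \<delta>/64 does the rest.\<close>
  define a where "a = min (3/32) (\<delta> / 64)"
  have a: "a > 0" "a \<le> 3/32" "a \<le> \<delta> / 64" using \<delta> by (auto simp: a_def)
  have "filterlim (\<lambda>n. ln (real n)) at_top sequentially"
    by (rule filterlim_compose[OF ln_at_top filterlim_real_sequentially])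
  then have lnge: "\<forall>\<^sub>F n in sequentially. Z \<le> ln (real n)" for Z by (simp add: filterlim_at_top)
  have "\<forall>\<^sub>F n in sequentially. n \<ge> 3 \<and> 2 / c \<le> ln (real n) \<and> C + 1 \<le> ln (real n) \<and> ln (real n) \<le> 1 * real n powr (3/8)
      \<and> ln (real n) \<le> (1 / c) * real n powr (3/16) \<and> ln (real n) \<le> 1 * real n powr (3/16) \<and> ln (real n) \<le> 1 * real n powr a"
    using a c by (intro eventually_conj lnge eventually_ln_le eventually_ge_at_top) auto
  then obtain s0 where s0: "\<And>n. n \<ge> s0 \<Longrightarrow> n \<ge> 3 \<and> 2 / c \<le> ln (real n) \<and> C + 1 \<le> ln (real n) \<and> ln (real n) \<le> 1 * real n powr (3/8)
      \<and> ln (real n) \<le> (1 / c) * real n powr (3/16) \<and> ln (real n) \<le> 1 * real n powr (3/16) \<and> ln (real n) \<le> 1 * real n powr a"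
    unfolding eventually_sequentially by blast
  show ?thesis
  proof (rule that[of s0])
    show "s0 \<ge> 3" using s0[of s0] by simp
    fix s assume s: "s \<ge> s0"
    show "2 / c \<le> ln (real s)" "C < real s powr (3/8)" "ln (real s) \<le> real s powr (3/16)" using s0[OF s] by linarith+
    show "c * ln (real s) \<le> real s powr (3/16)" using s0[OF s] c by (simp add: field_simps)
    have S: "real s \<ge> 3" "ln (real s) \<le> real s powr a" using s0[OF s] by auto
    have l0: "ln (real s) > 0" using S by (intro ln_gt_zero) auto
    have "ln (real s) ^ 3 \<le> (real s powr a) ^ 3" using S l0 by (intro power_mono) auto
    also have "\<dots> = real s powr (3 * a)" using S by (simp add: powr_power mult.commute)
    also have "\<dots> \<le> real s powr ((3/32 - a/2) * \<delta>)"
    proof (intro powr_mono)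
      have "(3/64) * \<delta> \<le> (3/32 - a/2) * \<delta>" using a \<delta> by (intro mult_right_mono) auto
      then show "3 * a \<le> (3/32 - a/2) * \<delta>" using a by linarith
    qed (use S in auto)
    also have "\<dots> = (real s powr (3/32 - a/2)) powr \<delta>" by (simp add: powr_powr)
    also have "\<dots> \<le> (real s powr (3/32) / sqrt (ln (real s))) powr \<delta>"
    proof (rule powr_mono2)
      have "sqrt (ln (real s)) \<le> sqrt (real s powr a)" using S by simp
      also have "\<dots> = real s powr (a/2)" by (simp add: powr_half_sqrt[symmetric] powr_powr)
      finally have "real s powr (3/32) / real s powr (a/2) \<le> real s powr (3/32) / sqrt (ln (real s))"
        using l0 S by (intro divide_left_mono) auto
      then show "real s powr (3/32 - a/2) \<le> real s powr (3/32) / sqrt (ln (real s))" by (simp add: powr_diff)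
    qed (use \<delta> in auto)
    finally show "ln (real s) ^ 3 \<le> (real s powr (3/32) / sqrt (ln (real s))) powr \<delta>" .
  qed
qed

section \<open>Crude bounds and the target form of the distribution function\<close>

context rotation_words
begin

text \<open>The reproducing formula with |kern| <= s; the constant comes from (4 pi + 1)/2 < 8. This
  crude bound settles the finitely many small s.\<close>

lemma sph_eigen_sup_bound:
  assumes u: "sph_eigen s u" "ip u u \<le> 1" and s: "s \<ge> 1" and x: "x \<in> S2"
  shows "u x \<le> 8 * real s"
proof -
  have bu: "bfun u" by (rule bfun_continuous[OF sph_eigen_continuous[OF u(1)]])
  have "u x = (\<integral>y. kern s x y * u y \<partial>\<sigma>)" using Pi_proj_eigen[OF u(1) x] by (simp add: Pi_proj_kern)
  also have "\<dots> \<le> (\<integral>y. real s * ((1 + u y * u y) / 2) \<partial>\<sigma>)"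
  proof (rule integral_mono)
    show "integrable \<sigma> (\<lambda>y. kern s x y * u y)"
      by (intro bfun_integrable bfun_mult bu bfun2_section[OF bfun2_kern x])
    show "integrable \<sigma> (\<lambda>y. real s * ((1 + u y * u y) / 2))"
      using bfun_integrable[OF bfun_mult[OF bu bu]] by (intro Bochner_Integration.integrable_mult_right Bochner_Integration.integrable_divide Bochner_Integration.integrable_add) auto
    fix y assume "y \<in> space \<sigma>"
    then have y: "y \<in> S2" by simp
    have "kern s x y * u y \<le> \<bar>kern s x y\<bar> * \<bar>u y\<bar>" by (metis abs_ge_self abs_mult)
    also have "\<dots> \<le> real s * \<bar>u y\<bar>" by (intro mult_right_mono kern_bound s x y) auto
    also have "\<dots> \<le> real s * ((1 + u y * u y) / 2)"
    proof (intro mult_left_mono)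
      have "0 \<le> (1 - \<bar>u y\<bar>)\<^sup>2" by simp
      also have "(1 - \<bar>u y\<bar>)\<^sup>2 = 1 + u y * u y - 2 * \<bar>u y\<bar>" by (simp add: power2_diff flip: power2_eq_square)
      finally show "\<bar>u y\<bar> \<le> (1 + u y * u y) / 2" by simp
    qed auto
    finally show "kern s x y * u y \<le> real s * ((1 + u y * u y) / 2)" .
  qed
  also have "\<dots> = real s * ((4 * pi + ip u u) / 2)"
    using bfun_integrable[OF bfun_mult[OF bu bu]] by (simp add: ip_def measure_sphere_measure_space)
  also have "\<dots> \<le> real s * 8"
  proof (intro mult_left_mono)
    have "pi \<le> 3.5" using pi_approx by simp
    then show "(4 * pi + ip u u) / 2 \<le> 8" using u(2) by simp
  qed auto
  finally show ?thesis by simp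
qed

lemma lev_eq_measure:
  assumes "continuous_on S2 u"
  shows "lev u \<alpha> = measure \<sigma> {x \<in> space \<sigma>. u x > \<alpha>}"
proof -
  define A where "A = {x \<in> space \<sigma>. u x > \<alpha>}"
  have e: "A \<inter> S2 = A" by (auto simp: A_def)
  have "lev u \<alpha> = (\<integral>x. indicator A x \<partial>\<sigma>)"
    unfolding lev_def by (intro Bochner_Integration.integral_cong) (auto simp: indicator_def A_def)
  also have "\<dots> = measure \<sigma> A" by (simp add: e)
  finally show ?thesis unfolding A_def .
qed

lemma lev_le_16: "continuous_on S2 u \<Longrightarrow> lev u \<alpha> \<le> 16"
proof -
  assume u: "continuous_on S2 u"
  have "lev u \<alpha> \<le> measure \<sigma> (space \<sigma>)" unfolding lev_eq_measure[OF u] by (rule sph.bounded_measure)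
  also have "\<dots> = 4 * pi" using measure_sphere_measure_space by simp
  also have "\<dots> \<le> 16" using pi_less_4 by simp
  finally show ?thesis .
qed

lemma lev_nonneg: "lev u \<alpha> \<ge> 0"
  unfolding lev_def by (intro Bochner_Integration.integral_nonneg) auto

lemma lev_eq_0:
  assumes u: "sph_eigen s u" "ip u u \<le> 1" and s: "s \<ge> 1" and a: "\<alpha> \<ge> 8 * real s"
  shows "lev u \<alpha> = 0"
proof -
  have "\<not> u x > \<alpha>" if "x \<in> S2" for x using sph_eigen_sup_bound[OF u s that] a by linarith
  then have "(\<integral>x. of_bool (u x > \<alpha>) \<partial>\<sigma>) = (\<integral>x. (0::real) \<partial>\<sigma>)"
    by (intro Bochner_Integration.integral_cong) auto
  then show ?thesis by (simp add: lev_def)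
qed

end

text \<open>With A = K sqrt(s / ln s): nothing above A, and below it s / ((ln s)^3 \<alpha>^6) up to
  a factor (A/\<alpha>)^\<delta>, which is large only far below A.\<close>

definition level_bound :: "real \<Rightarrow> real \<Rightarrow> nat \<Rightarrow> real \<Rightarrow> real" where
  "level_bound K \<delta> s \<alpha> = (if \<alpha> \<ge> K * sqrt (real s / ln (real s)) then 0
     else K * (real s / ln (real s) ^ 3) / \<alpha> ^ 6 * (K * sqrt (real s / ln (real s)) / \<alpha>) powr \<delta>)"

lemma level_bound_nonneg: "K \<ge> 0 \<Longrightarrow> s \<ge> 2 \<Longrightarrow> \<alpha> > 0 \<Longrightarrow> level_bound K \<delta> s \<alpha> \<ge> 0"
  by (auto simp: level_bound_def)

lemma level_bound_mono:
  assumes K: "0 \<le> K" "K \<le> K'" and s: "s \<ge> 2" and a: "\<alpha> > 0" and \<delta>: "\<delta> > 0"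
  shows "level_bound K \<delta> s \<alpha> \<le> level_bound K' \<delta> s \<alpha>"
proof -
  have l0: "ln (real s) > 0" using s by (intro ln_gt_zero) auto
  define A where "A = K * sqrt (real s / ln (real s))"
  define A' where "A' = K' * sqrt (real s / ln (real s))"
  have AA: "A \<le> A'" "A \<ge> 0" using K l0 by (auto simp: A_def A'_def intro!: mult_right_mono)
  show ?thesis
  proof (cases "\<alpha> \<ge> A")
    case True
    then have "level_bound K \<delta> s \<alpha> = 0" by (simp add: level_bound_def A_def)
    then show ?thesis using level_bound_nonneg[of K' s \<alpha> \<delta>] K s a by simp
  next
    case False
    then have f: "\<not> \<alpha> \<ge> A" "\<not> \<alpha> \<ge> A'" using AA by auto
    have "K * (real s / ln (real s) ^ 3) / \<alpha> ^ 6 * (A / \<alpha>) powr \<delta> \<le> K' * (real s / ln (real s) ^ 3) / \<alpha> ^ 6 * (A' / \<alpha>) powr \<delta>"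
      using AA K a l0 \<delta> by (intro mult_mono divide_right_mono powr_mono2 mult_right_mono) auto
    then show ?thesis using f unfolding level_bound_def A_def[symmetric] A'_def[symmetric] by simp
  qed
qed

section \<open>The improved distribution bound\<close>

context algebraic_rotation_words
begin

text \<open>For each length the words fall into two kinds: those moving y to within r of x or -x, at
  most 8n + 4 in number, and the rest, for which the kernel is at most 2 sqrt(s/r) and the crude
  count of words is accepted.\<close>

lemma amplified_inequality:
  assumes C: "\<And>n r x y. x \<in> S2 \<Longrightarrow> y \<in> S2 \<Longrightarrow> r * (C * b ^ n) < 1 \<Longrightarrow> card {w \<in> W n. norm (val w *v y - x) < r} \<le> 4 * n + 2"
    and C1: "C \<ge> 1" "b \<ge> 1"
    and u: "sph_eigen s u" "ip u u \<le> 1" "AE x in \<sigma>. T u x = \<mu> * u x" and s: "s \<ge> 1" and a: "\<alpha> > 0"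
    and N: "N \<ge> 1" and r: "r > 0" "r * (C * b ^ (2 * N)) < 1" and R: "R > 0"
  shows "real N * (\<alpha> * lev u \<alpha>)\<^sup>2 \<le> 500 * ((if R < 1 then 0 else K1 * (R\<^sup>2 / real s)) * lev u \<alpha>
      + (K2 * (real s / R) + 8 * real N * q ^ N * sqrt (real s / r)) * (lev u \<alpha>)\<^sup>2)"
proof -
  define f :: "real^3 \<Rightarrow> real" where "f = (\<lambda>x. of_bool (u x > \<alpha>))"
  note L = level_set_inner[OF u(1) a f_def]
  define m where "m = lev u \<alpha>"
  have m: "m = (\<integral>x. f x \<partial>\<sigma>)" by (simp add: m_def lev_def f_def)
  have m0: "m \<ge> 0" using L(4) m by simp
  define F where "F = Pi_proj s f"
  have Fc: "continuous_on UNIV F" unfolding F_def by (rule Pi_proj_continuous[OF L(1)])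
  have bu: "bfun u" by (rule bfun_continuous[OF sph_eigen_continuous[OF u(1)]])
  have amp: "real N * (ip u F)\<^sup>2 \<le> 500 * (\<Sum>n<2 * N. \<bar>corr n F\<bar>)"
    by (rule hecke_amplification[OF Fc bu u(2,3) N])
  define E where "E = (if R < 1 then 0 else 4 * near_const * (R\<^sup>2 / real s))"
  have per_length: "\<bar>corr n F\<bar> \<le> E * m * p0 ^ n + ((16 * real n + 8) * p0 ^ n * (real s / R) + 4 * q ^ N * sqrt (real s / r)) * m\<^sup>2"
    if n: "n < 2 * N" for n
  proof -
    \<comment> \<open>\<open>t\<close> is s times the near radius for words of length n. Once it
      drops below 1, the near region is discarded, as the ball estimate no longer applies.\<close>
    define t where "t = R\<^sup>2 * p0 ^ (6 * n)"
    have t0: "t > 0" using R p0 by (simp add: t_def)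
    define \<rho> where "\<rho> = (if t \<ge> 1 then t / real s else 0)"
    have \<rho>: "\<rho> = 0 \<or> real s * \<rho> \<ge> 1 \<and> \<rho> > 0" using s t0 by (auto simp: \<rho>_def)
    have mx: "max 1 (real s * \<rho>) \<ge> t" using s by (auto simp: \<rho>_def)
    have st: "sqrt t = R * p0 ^ (3 * n)"
    proof (rule real_sqrt_unique)
      show "(R * p0 ^ (3 * n))\<^sup>2 = t" by (simp add: t_def power_mult_distrib flip: power_mult)
    qed (use R p0 in auto)
    define D where "D = 2 * real s / (R * p0 ^ (3 * n))"
    have "sqrt t \<le> sqrt (max 1 (real s * \<rho>))" using mx by simp
    then have Dge: "2 * real s / sqrt (max 1 (real s * \<rho>)) \<le> D"
      unfolding D_def st using R p0 s by (intro divide_left_mono mult_pos_pos) auto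
    define B where "B = (8 * real n + 4) * D + 2 * q ^ n * (2 * sqrt (real s / r))"
    have cond: "r * (C * b ^ n) < 1"
    proof -
      have "b ^ n \<le> b ^ (2 * N)" using C1 n by (intro power_increasing) auto
      then have "r * (C * b ^ n) \<le> r * (C * b ^ (2 * N))" using C1 r by (intro mult_left_mono) auto
      then show ?thesis using r(2) by linarith
    qed
    have D0: "D \<ge> 0" using R p0 s by (simp add: D_def)
    have "\<bar>corr n F\<bar> \<le> (1 / sqrt q) ^ n * (real (card (W n)) * (near_const * \<rho> * (2 * m)) + B * m\<^sup>2)"
      unfolding m F_def
    proof (rule corr_bound[OF L(1,2) s \<rho>])
      fix x y assume xy: "x \<in> S2" "y \<in> S2"
      define S1 S2' where "S1 = {w \<in> W n. norm (val w *v y - x) < r}" and "S2' = {w \<in> W n. norm (val w *v y - (- x)) < r}"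
      have cS: "card S1 \<le> 4 * n + 2" "card S2' \<le> 4 * n + 2"
        unfolding S1_def S2'_def using C[OF xy cond] C[of "- x" y r n] xy cond by auto
      have fin: "finite S1" "finite S2'" "finite (W n)" using finite_W by (auto simp: S1_def S2'_def)
      define k where "k = (\<lambda>w. of_bool (far \<rho> x (val w *v y)) * \<bar>kern s x (val w *v y)\<bar>)"
      have wS: "val w *v y \<in> S2" if "w \<in> W n" for w using that xy rotation_norm[OF W_rot[OF that]] by simp
      have kD: "k w \<le> D" if "w \<in> W n" for w
        unfolding k_def using far_kern_bound'[OF s xy(1) wS[OF that] \<rho>] Dge by linarith
      have kr: "k w \<le> 2 * sqrt (real s / r)" if w: "w \<in> W n" "w \<notin> S1" "w \<notin> S2'" for w
      proof -
        have "far r x (val w *v y)" using w unfolding far_def S1_def S2'_def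
          by (auto simp: norm_minus_commute add.commute)
        from far_kern_bound[OF s xy(1) wS[OF w(1)] r(1) this]
        show ?thesis unfolding k_def using r by (auto intro: order_trans[of _ "\<bar>kern s x (val w *v y)\<bar>"])
      qed
      have k0: "k w \<ge> 0" for w by (auto simp: k_def)
      have s0: "0 \<le> 2 * sqrt (real s / r)" using r by simp
      have "(\<Sum>w\<in>W n. k w) \<le> (\<Sum>w\<in>W n. (if w \<in> S1 then D else 0) + (if w \<in> S2' then D else 0) + 2 * sqrt (real s / r))"
      proof (rule sum_mono)
        fix w assume w: "w \<in> W n"
        show "k w \<le> (if w \<in> S1 then D else 0) + (if w \<in> S2' then D else 0) + 2 * sqrt (real s / r)"
          using kD[OF w] kr[OF w] D0 s0 by (cases "w \<in> S1"; cases "w \<in> S2'"; simp only: if_True if_False; linarith)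
      qed
      also have "\<dots> = real (card S1) * D + real (card S2') * D + real (card (W n)) * (2 * sqrt (real s / r))"
      proof -
        have "W n \<inter> S1 = S1" "W n \<inter> S2' = S2'" by (auto simp: S1_def S2'_def)
        then show ?thesis using fin by (simp add: sum.distrib sum.If_cases)
      qed
      also have "\<dots> \<le> (4 * real n + 2) * D + (4 * real n + 2) * D + (2 * q ^ n) * (2 * sqrt (real s / r))"
      proof (intro add_mono mult_right_mono D0 s0 card_W_le)
        show "real (card S1) \<le> 4 * real n + 2" "real (card S2') \<le> 4 * real n + 2" using cS by linarith+
      qed
      also have "\<dots> = B" by (simp add: B_def algebra_simps)
      finally show "(\<Sum>w\<in>W n. of_bool (far \<rho> x (val w *v y)) * \<bar>kern s x (val w *v y)\<bar>) \<le> B" unfolding k_def .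
    qed
    also have "(1 / sqrt q) ^ n * (real (card (W n)) * (near_const * \<rho> * (2 * m)) + B * m\<^sup>2)
        = (p0 ^ 4) ^ n * real (card (W n)) * (near_const * \<rho> * (2 * m)) + (p0 ^ 4) ^ n * B * m\<^sup>2"
      unfolding p0(3) by (simp add: algebra_simps)
    finally have main: "\<bar>corr n F\<bar> \<le> (p0 ^ 4) ^ n * real (card (W n)) * (near_const * \<rho> * (2 * m)) + (p0 ^ 4) ^ n * B * m\<^sup>2" .
    have pn: "(p0 ^ 4) ^ n \<ge> 0" unfolding p0(3) using q3 by simp
    have A1: "(p0 ^ 4) ^ n * real (card (W n)) * (near_const * \<rho> * (2 * m)) \<le> E * m * p0 ^ n"
    proof (cases "t \<ge> 1")
      case False
      then have "\<rho> = 0" by (simp add: \<rho>_def)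
      moreover have "E * m * p0 ^ n \<ge> 0" using m0 near_const_pos p0 by (simp add: E_def)
      ultimately show ?thesis by simp
    next
      case True
      \<comment> \<open>A nonempty near region at any length forces R >= 1; this is why the whole
        near term disappears for R < 1.\<close>
      have R1: "\<not> R < 1"
      proof
        assume "R < 1"
        then have "R\<^sup>2 * p0 ^ (6 * n) < 1 * 1"
          using R p0 by (intro mult_less_le_imp_less) (auto simp: abs_square_less_1 power_le_one)
        then show False using True by (simp add: t_def)
      qed
      have "(p0 ^ 4) ^ n * real (card (W n)) \<le> (p0 ^ 4) ^ n * (2 * q ^ n)" by (intro mult_left_mono card_W_le pn)
      then have "(p0 ^ 4) ^ n * real (card (W n)) * (near_const * \<rho> * (2 * m)) \<le> (p0 ^ 4) ^ n * (2 * q ^ n) * (near_const * \<rho> * (2 * m))"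
        using m0 near_const_pos t0 s by (intro mult_right_mono) (auto simp: \<rho>_def)
      also have "\<dots> = 4 * near_const * (R\<^sup>2 / real s) * m * ((p0 ^ 4) ^ n * q ^ n * p0 ^ (6 * n))"
        using True by (simp add: \<rho>_def t_def)
      also have "(p0 ^ 4) ^ n * q ^ n * p0 ^ (6 * n) = (p0 ^ 8 * q) ^ n * p0 ^ (2 * n)"
        by (simp add: power_mult_distrib flip: power_mult power_add)
      also have "\<dots> = p0 ^ (2 * n)" unfolding p0(4) by simp
      also have "4 * near_const * (R\<^sup>2 / real s) * m * p0 ^ (2 * n) \<le> 4 * near_const * (R\<^sup>2 / real s) * m * p0 ^ n"
        using m0 near_const_pos p0 by (intro mult_left_mono power_decreasing) auto
      finally show ?thesis using R1 by (simp add: E_def)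
    qed
    have A2: "(p0 ^ 4) ^ n * B \<le> (16 * real n + 8) * p0 ^ n * (real s / R) + 4 * q ^ N * sqrt (real s / r)"
    proof -
      have "(p0 ^ 4) ^ n * B = (16 * real n + 8) * (real s / R) * ((p0 ^ 4) ^ n / p0 ^ (3 * n)) + 4 * sqrt (real s / r) * ((p0 ^ 4) ^ n * q ^ n)"
        by (simp add: B_def D_def algebra_simps add_divide_distrib)
      also have "(p0 ^ 4) ^ n / p0 ^ (3 * n) = p0 ^ n"
      proof -
        have "(p0 ^ 4) ^ n = p0 ^ n * p0 ^ (3 * n)" by (simp flip: power_mult power_add)
        then show ?thesis using p0 by simp
      qed
      finally have eqB: "(p0 ^ 4) ^ n * B = (16 * real n + 8) * (real s / R) * p0 ^ n + 4 * sqrt (real s / r) * ((p0 ^ 4) ^ n * q ^ n)" .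
      \<comment> \<open>The remaining words cost q^(-n/2) q^n = q^(n/2), at most q^N because n <
        2N.\<close>
      have le: "(p0 ^ 4) ^ n * q ^ n \<le> q ^ N"
      proof -
        have sq: "p0 ^ 4 * q = sqrt q" using p0(3) q3 by (simp add: real_div_sqrt)
        have "(p0 ^ 4) ^ n * q ^ n = (sqrt q) ^ n" by (simp only: power_mult_distrib[symmetric] sq)
        also have "\<dots> \<le> (sqrt q) ^ (2 * N)" using n q3 by (intro power_increasing) auto
        also have "\<dots> = q ^ N" using q3 by (simp add: power_mult)
        finally show ?thesis .
      qed
      have "4 * sqrt (real s / r) * ((p0 ^ 4) ^ n * q ^ n) \<le> 4 * sqrt (real s / r) * q ^ N"
        using r by (intro mult_left_mono le) auto
      then show ?thesis unfolding eqB by (simp add: mult_ac)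
    qed
    have "(p0 ^ 4) ^ n * B * m\<^sup>2 \<le> ((16 * real n + 8) * p0 ^ n * (real s / R) + 4 * q ^ N * sqrt (real s / r)) * m\<^sup>2"
      by (intro mult_right_mono A2) auto
    then show ?thesis using main A1 by linarith
  qed
  have split_sum: "(\<Sum>n<k. z * c n + (d n * x + y) * v) = z * (\<Sum>n<k. c n) + ((\<Sum>n<k. d n) * x + real k * y) * v"
    for c d :: "nat \<Rightarrow> real" and x y z v k
    by (simp add: sum.distrib sum_distrib_left sum_distrib_right distrib_right)
  have "(\<Sum>n<2 * N. \<bar>corr n F\<bar>) \<le> (\<Sum>n<2 * N. E * m * p0 ^ n + ((16 * real n + 8) * p0 ^ n * (real s / R) + 4 * q ^ N * sqrt (real s / r)) * m\<^sup>2)"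
    by (intro sum_mono per_length) auto
  also have "\<dots> = E * m * (\<Sum>n<2 * N. p0 ^ n) + ((\<Sum>n<2 * N. (16 * real n + 8) * p0 ^ n) * (real s / R) + real (2 * N) * (4 * q ^ N * sqrt (real s / r))) * m\<^sup>2"
    by (rule split_sum)
  also have "\<dots> \<le> E * m * (\<Sum>n. p0 ^ n) + (K2 * (real s / R) + real (2 * N) * (4 * q ^ N * sqrt (real s / r))) * m\<^sup>2"
  proof -
    have s1: "(\<Sum>n<2 * N. p0 ^ n) \<le> (\<Sum>n. p0 ^ n)"
      by (rule sum_le_suminf[OF summable_K1]) (use p0 in auto)
    have s2: "(\<Sum>n<2 * N. (16 * real n + 8) * p0 ^ n) \<le> K2"
      unfolding K2_def by (rule sum_le_suminf[OF summable_K2]) (use p0 in auto)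
    have "E \<ge> 0" using near_const_pos by (simp add: E_def)
    then have "E * m * (\<Sum>n<2 * N. p0 ^ n) \<le> E * m * (\<Sum>n. p0 ^ n)"
      using m0 by (intro mult_left_mono[OF s1] mult_nonneg_nonneg)
    moreover have "(\<Sum>n<2 * N. (16 * real n + 8) * p0 ^ n) * (real s / R) \<le> K2 * (real s / R)"
      using R by (intro mult_right_mono[OF s2]) simp
    then have "((\<Sum>n<2 * N. (16 * real n + 8) * p0 ^ n) * (real s / R) + real (2 * N) * (4 * q ^ N * sqrt (real s / r))) * m\<^sup>2
        \<le> (K2 * (real s / R) + real (2 * N) * (4 * q ^ N * sqrt (real s / r))) * m\<^sup>2"
      by (rule mult_right_mono[OF add_right_mono]) simp
    ultimately show ?thesis by linarith
  qed
  also have "E * m * (\<Sum>n. p0 ^ n) = (if R < 1 then 0 else K1 * (R\<^sup>2 / real s)) * m"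
    by (simp add: E_def K1_def)
  finally have sumb: "(\<Sum>n<2 * N. \<bar>corr n F\<bar>) \<le> (if R < 1 then 0 else K1 * (R\<^sup>2 / real s)) * m
      + (K2 * (real s / R) + 8 * real N * q ^ N * sqrt (real s / r)) * m\<^sup>2" by (simp add: mult.assoc)
  have "(\<alpha> * m)\<^sup>2 \<le> (ip u F)\<^sup>2" unfolding F_def using L(3) m m0 a by (intro power_mono) auto
  then have "real N * (\<alpha> * m)\<^sup>2 \<le> real N * (ip u F)\<^sup>2" by (intro mult_left_mono) auto
  also have "\<dots> \<le> 500 * (\<Sum>n<2 * N. \<bar>corr n F\<bar>)" by (rule amp)
  also have "\<dots> \<le> 500 * ((if R < 1 then 0 else K1 * (R\<^sup>2 / real s)) * m
      + (K2 * (real s / R) + 8 * real N * q ^ N * sqrt (real s / r)) * m\<^sup>2)"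
    using sumb by (rule mult_left_mono) simp
  finally show ?thesis unfolding m_def .
qed

text \<open>N is a small multiple of log s, so that q^N and b^(2N) are small powers of s. With r =
  s^(-1/2) the generic words cost N s^(1/16 + 3/4), which is absorbed by N \<alpha>^2 as soon as
  \<alpha> is of size s^(13/32).\<close>

lemma large_level:
  assumes C: "\<And>n r x y. x \<in> S2 \<Longrightarrow> y \<in> S2 \<Longrightarrow> r * (C * b ^ n) < 1 \<Longrightarrow> card {w \<in> W n. norm (val w *v y - x) < r} \<le> 4 * n + 2"
    and C1: "C \<ge> 1" "b \<ge> 1"
    and u: "sph_eigen s u" "ip u u \<le> 1" "AE x in \<sigma>. T u x = \<mu> * u x"
    and s: "s \<ge> 3" "2 / c \<le> ln (real s)" "C < real s powr (3/8)"
    and c: "c = 1 / (16 * ln (b + q))" and a: "\<alpha> \<ge> 127 * real s powr (13/32)"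
  shows "\<exists>N::real. N \<ge> c / 2 * ln (real s) \<and> N > 0 \<and> (\<alpha>\<^sup>2 > 2000 * K2 * real s / N \<longrightarrow> lev u \<alpha> \<le> 0)
     \<and> lev u \<alpha> \<le> 1000 * K1 * (2000 * K2)\<^sup>2 * real s / (N ^ 3 * \<alpha> ^ 6)"
proof -
  define S where "S = real s"
  have S: "S \<ge> 3" using s(1) by (simp add: S_def)
  have l: "2 / c \<le> ln S" "C < S powr (3/8)" using s by (simp_all add: S_def)
  have a0: "\<alpha> > 0" using a S less_le_trans[of 0 "127 * real s powr (13/32)" \<alpha>] by (simp add: S_def)
  \<comment> \<open>A single base dominating both \<open>b\<close> and \<open>q\<close>; the factor
    16 in \<open>c\<close> turns its N-th power into at most S^(1/16).\<close>
  define b' where "b' = b + q"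
  have b': "b' \<ge> 4" "b \<le> b'" "q \<le> b'" using C1 q3 by (auto simp: b'_def)
  have lb: "ln b' > 0" using b' by (intro ln_gt_zero) auto
  have c0: "c > 0" using lb by (simp add: c b'_def)
  have cl: "c * ln S \<ge> 2" using l(1) c0 by (simp add: field_simps)
  define N where "N = nat \<lfloor>c * ln S\<rfloor>"
  have Nle: "real N \<le> c * ln S" unfolding N_def using cl by (intro of_nat_floor) simp
  have "real N > c * ln S - 1" unfolding N_def using cl by linarith
  then have Nge: "real N \<ge> c / 2 * ln S" "N \<ge> 1" using cl by simp_all
  have bN: "b' ^ N \<le> S powr (1/16)"
  proof -
    have "b' ^ N = exp (real N * ln b')" using b' by (simp add: exp_of_nat_mult)
    also have "\<dots> \<le> exp (c * ln S * ln b')" using Nle lb by (intro exp_mono mult_right_mono) auto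
    also have "c * ln S * ln b' = 1/16 * ln S" using lb by (simp add: c b'_def)
    also have "exp (1/16 * ln S) = S powr (1/16)" using S by (simp add: powr_def)
    finally show ?thesis .
  qed
  have qN: "q ^ N \<le> S powr (1/16)" using power_mono[OF b'(3), of N] q3 bN by linarith
  have b2N: "b ^ (2 * N) \<le> S powr (1/8)"
  proof -
    have "b ^ (2 * N) = (b ^ N)\<^sup>2" by (simp add: power_mult mult.commute[of 2])
    also have "\<dots> \<le> (S powr (1/16))\<^sup>2" using power_mono[OF b'(2), of N] C1 bN by (intro power_mono) auto
    also have "\<dots> = S powr (1/8)" using S by (simp add: powr_power)
    finally show ?thesis .
  qed
  \<comment> \<open>As b^(2N) is at most S^(1/8), the counting condition becomes C < S^(3/8), one of
    the assumptions on s.\<close>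
  define r where "r = S powr (-1/2)"
  have r0: "r > 0" using S by (simp add: r_def)
  have rC: "r * (C * b ^ (2 * N)) < 1"
  proof -
    have "r * (C * b ^ (2 * N)) \<le> r * (C * S powr (1/8))" using r0 C1 b2N by (intro mult_left_mono) auto
    also have "\<dots> = C * (S powr (-1/2) * S powr (1/8))" by (simp add: r_def)
    also have "\<dots> = C * S powr (-3/8)" by (simp flip: powr_add)
    also have "\<dots> < S powr (3/8) * S powr (-3/8)" using l(2) S by (intro mult_strict_right_mono) auto
    also have "\<dots> = 1" using S by (simp flip: powr_add)
    finally show ?thesis .
  qed
  have sq: "sqrt (S / r) = S powr (3/4)"
  proof (rule real_sqrt_unique)
    have "S powr (3/4 * 2) * r = S powr (3/4 * 2 + (-1/2))" unfolding r_def by (simp only: powr_add)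
    then have "S powr (3/4 * 2) * r = S" using S by simp
    then show "(S powr (3/4))\<^sup>2 = S / r" using r0 S by (simp add: powr_power field_simps)
  qed simp
  \<comment> \<open>The constant 127 is taken because 127^2 >= 16000, and 16000 = 8 * 2000 gives the
    generic words the same share as the exceptional ones.\<close>
  have a2: "\<alpha>\<^sup>2 \<ge> 16000 * S powr (13/16)"
  proof -
    have "16000 * S powr (13/16) \<le> (127 * S powr (13/32))\<^sup>2" using S by (simp add: power_mult_distrib powr_power)
    also have "\<dots> \<le> \<alpha>\<^sup>2" using a by (intro power_mono) (auto simp: S_def)
    finally show ?thesis .
  qed
  have qS: "16000 * (q ^ N * S powr (3/4)) \<le> \<alpha>\<^sup>2"
  proof -
    have "q ^ N * S powr (3/4) \<le> S powr (1/16) * S powr (3/4)" using qN by (intro mult_right_mono) auto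
    also have "\<dots> = S powr (13/16)" by (simp flip: powr_add)
    finally show ?thesis using a2 by linarith
  qed
  have K2: "K2 > 0" using K2_ge by simp
  \<comment> \<open>Solves K2 S / R = N \<alpha>^2 / 2000. Together with the equal share of the
    generic words and the factor 500, the quadratic terms amount to half of the left-hand
    side.\<close>
  define R where "R = 2000 * K2 * S / (real N * \<alpha>\<^sup>2)"
  have R0: "R > 0" using K2 S Nge a0 by (simp add: R_def)
  define E where "E = (if R < 1 then 0 else K1 * (R\<^sup>2 / S))"
  define m where "m = lev u \<alpha>"
  have m0: "m \<ge> 0" unfolding m_def by (rule lev_nonneg)
  have E0: "E \<ge> 0" using K1_pos S by (simp add: E_def)
  have s1: "s \<ge> 1" using s by simp
  have amp: "real N * (\<alpha> * m)\<^sup>2 \<le> 500 * (E * m + (K2 * (S / R) + 8 * real N * q ^ N * S powr (3/4)) * m\<^sup>2)"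
    unfolding E_def m_def sq[symmetric] unfolding S_def
    by (rule amplified_inequality[where C = C and b = b and \<mu> = \<mu>])
      (rule C C1 u s1 a0 Nge(2) r0 rC R0 | assumption)+
  have t1: "K2 * (S / R) = real N * \<alpha>\<^sup>2 / 2000" using K2 S by (simp add: R_def)
  have t2: "8 * real N * q ^ N * S powr (3/4) \<le> real N * \<alpha>\<^sup>2 / 2000"
  proof -
    have "real N * (16000 * (q ^ N * S powr (3/4))) \<le> real N * \<alpha>\<^sup>2" by (intro mult_left_mono qS) auto
    then show ?thesis by simp
  qed
  have "K2 * (S / R) + 8 * real N * q ^ N * S powr (3/4) \<le> real N * \<alpha>\<^sup>2 / 1000"
  proof -
    have "x + y \<le> z / 1000" if "x = z / 2000" "y \<le> z / 2000" for x y z :: real using that by simp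
    from this[OF t1 t2] show ?thesis .
  qed
  then have "(K2 * (S / R) + 8 * real N * q ^ N * S powr (3/4)) * m\<^sup>2 \<le> (real N * \<alpha>\<^sup>2 / 1000) * m\<^sup>2"
    by (rule mult_right_mono) simp
  then have "500 * (E * m + (K2 * (S / R) + 8 * real N * q ^ N * S powr (3/4)) * m\<^sup>2) \<le> 500 * (E * m + (real N * \<alpha>\<^sup>2 / 1000) * m\<^sup>2)"
    by (intro mult_left_mono add_left_mono) simp_all
  then have le: "real N * (\<alpha> * m)\<^sup>2 \<le> 500 * (E * m + (real N * \<alpha>\<^sup>2 / 1000) * m\<^sup>2)" by (rule order_trans[OF amp])
  define X Y where "X = real N * \<alpha>\<^sup>2 * m * m" and "Y = E * m"
  have "real N * (\<alpha> * m)\<^sup>2 = X" "(real N * \<alpha>\<^sup>2 / 1000) * m\<^sup>2 = X / 1000"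
    by (simp_all add: X_def power_mult_distrib power2_eq_square)
  then have "X \<le> 500 * (Y + X / 1000)" using le by (simp only: Y_def)
  then have "X \<le> 1000 * Y" by simp
  then have "real N * \<alpha>\<^sup>2 * m * m \<le> 1000 * E * m" by (simp add: X_def Y_def)
  then have main: "real N * \<alpha>\<^sup>2 * m \<le> 1000 * E"
    using m0 E0 mult_right_le_imp_le[of "real N * \<alpha>\<^sup>2 * m" m "1000 * E"] by (cases "m = 0") auto
  have NA: "real N * \<alpha>\<^sup>2 > 0" using Nge a0 by simp
  have m_le: "m \<le> 1000 * E / (real N * \<alpha>\<^sup>2)" using main NA by (simp add: pos_le_divide_eq mult.commute)
  show ?thesis
  proof (intro exI[of _ "real N"] conjI impI)
    show "real N \<ge> c / 2 * ln (real s)" using Nge by (simp add: S_def)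
    show "real N > 0" using Nge by simp
    \<comment> \<open>This is the condition R < 1: the near term is then absent and nothing remains
      to bound the measure from above but 0.\<close>
    assume big: "2000 * K2 * real s / real N < \<alpha>\<^sup>2"
    then have "2000 * K2 * S < \<alpha>\<^sup>2 * real N" using Nge by (simp add: pos_divide_less_eq S_def)
    then have "R < 1" unfolding R_def using NA by (simp add: pos_divide_less_eq mult.commute)
    then show "lev u \<alpha> \<le> 0" using m_le by (simp add: E_def m_def)
  next
    have "E \<le> K1 * (R\<^sup>2 / S)" using K1_pos S by (simp add: E_def)
    then have "1000 * E / (real N * \<alpha>\<^sup>2) \<le> 1000 * (K1 * (R\<^sup>2 / S)) / (real N * \<alpha>\<^sup>2)"
      using NA by (intro divide_right_mono) auto
    also have "\<dots> = 1000 * K1 * (2000 * K2)\<^sup>2 * S / (real N ^ 3 * \<alpha> ^ 6)"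
      using S Nge a0 by (simp add: R_def power_divide power_mult_distrib field_simps eval_nat_numeral)
    finally show "lev u \<alpha> \<le> 1000 * K1 * (2000 * K2)\<^sup>2 * real s / (real N ^ 3 * \<alpha> ^ 6)"
      using m_le by (simp add: m_def S_def)
  qed
qed

text \<open>Three ranges of \<alpha>: from A upwards the level set is null, between 127 s^(13/32)
  and A the amplified bound holds, and further down the plain bound is enough since
  (A/\<alpha>)^\<delta> then exceeds (ln s)^3.\<close>

lemma distribution_bound_large:
  assumes \<delta>: "\<delta> > 0"
  obtains K :: real and s0 :: nat where "K > 0" "s0 \<ge> 3"
    "\<And>s u \<mu> \<alpha>. s \<ge> s0 \<Longrightarrow> sph_eigen s u \<Longrightarrow> ip u u \<le> 1 \<Longrightarrow> AE x in \<sigma>. T u x = \<mu> * u x \<Longrightarrow> \<alpha> > 0 \<Longrightarrow>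
       lev u \<alpha> \<le> level_bound K \<delta> s \<alpha>"
proof -
  obtain C b :: real where C1: "C \<ge> 1" "b \<ge> 1"
    and C: "\<And>n r x y. x \<in> S2 \<Longrightarrow> y \<in> S2 \<Longrightarrow> r * (C * b ^ n) < 1 \<Longrightarrow> card {w \<in> W n. norm (val w *v y - x) < r} \<le> 4 * n + 2"
    by (rule few_words_near) blast
  define c where "c = 1 / (16 * ln (b + q))"
  have c0: "c > 0" unfolding c_def using C1 q3 by (intro divide_pos_pos mult_pos_pos ln_gt_zero) auto
  obtain s0 :: nat where s0: "s0 \<ge> 3" "\<And>s. s \<ge> s0 \<Longrightarrow> 2 / c \<le> ln (real s)" "\<And>s. s \<ge> s0 \<Longrightarrow> C < real s powr (3/8)"
    "\<And>s. s \<ge> s0 \<Longrightarrow> c * ln (real s) \<le> real s powr (3/16)" "\<And>s. s \<ge> s0 \<Longrightarrow> ln (real s) \<le> real s powr (3/16)"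
    "\<And>s. s \<ge> s0 \<Longrightarrow> ln (real s) ^ 3 \<le> (real s powr (3/32) / sqrt (ln (real s))) powr \<delta>"
    using eventually_large[OF c0 \<delta>, of C] by blast
  define Z where "Z = 1000 * K1 * (2000 * K2)\<^sup>2"
  have Z0: "Z > 0" using K1_pos K2_ge by (simp add: Z_def)
  have K2: "K2 > 0" using K2_ge by simp
  \<comment> \<open>The summands serve in turn the comparison of A with 127 s^(13/32), the plain
    bound, the amplified bound, and the vanishing from A upwards.\<close>
  define K where "K = 127 + 64 * near_const + Z * (2 / c) ^ 3 + 4000 * K2 / c"
  have "Z * (2 / c) ^ 3 \<ge> 0" "4000 * K2 / c \<ge> 0" using Z0 c0 K2 by auto
  then have K: "K \<ge> 127" "K \<ge> 64 * near_const" "K \<ge> Z * (2 / c) ^ 3" "K > 4000 * K2 / c"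
    using near_const_pos unfolding K_def by linarith+
  show ?thesis
  proof (rule that[of K s0])
    show "K > 0" using K by simp
    show "s0 \<ge> 3" by (rule s0)
    fix s u \<mu> \<alpha>
    assume s: "s \<ge> s0" and u: "sph_eigen s u" "ip u u \<le> 1" "AE x in \<sigma>. T u x = \<mu> * u x" and a: "\<alpha> > (0::real)"
    define S where "S = real s"
    define l where "l = ln S"
    note cond = s0(2-6)[OF s, folded S_def, folded l_def]
    have s3: "s \<ge> 3" using s s0 by simp
    have S: "S \<ge> 3" using s3 by (simp add: S_def)
    have l0: "l > 0" unfolding l_def using S by (intro ln_gt_zero) auto
    define A where "A = K * sqrt (S / l)"
    have A0: "A > 0" using K S l0 by (simp add: A_def)
    have Aeq: "A = K * S powr (1/2) / sqrt l" by (simp add: A_def real_sqrt_divide powr_half_sqrt S_def)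
    have A13: "127 * S powr (13/32) \<le> A"
    proof -
      have "S powr (13/32) = sqrt (S / S powr (3/16))"
        using S by (simp add: powr_half_sqrt[symmetric] powr_divide powr_powr flip: powr_diff)
      also have "\<dots> \<le> sqrt (S / l)" using cond(4) l0 S by (intro real_sqrt_le_mono divide_left_mono) auto
      finally show ?thesis unfolding A_def using K(1) by (intro mult_mono) auto
    qed
    have LL: "\<exists>N::real. N \<ge> c / 2 * l \<and> N > 0 \<and> (\<alpha>\<^sup>2 > 2000 * K2 * S / N \<longrightarrow> lev u \<alpha> \<le> 0)
        \<and> lev u \<alpha> \<le> Z * S / (N ^ 3 * \<alpha> ^ 6)" if "127 * S powr (13/32) \<le> \<alpha>"
      unfolding Z_def l_def S_def
      by (rule large_level[where C = C and b = b and \<mu> = \<mu>])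
        (rule C C1 u s3 s0(2)[OF s] s0(3)[OF s] c_def that[unfolded S_def] | assumption)+
    have "lev u \<alpha> \<le> (if \<alpha> \<ge> A then 0 else K * (S / l ^ 3) / \<alpha> ^ 6 * (A / \<alpha>) powr \<delta>)"
    proof (cases "\<alpha> \<ge> A")
      case True
      then obtain N where N: "N \<ge> c / 2 * l" "N > 0" "\<alpha>\<^sup>2 > 2000 * K2 * S / N \<Longrightarrow> lev u \<alpha> \<le> 0"
        using LL A13 by force
      have "2000 * K2 * S / N \<le> 2000 * K2 * S / (c / 2 * l)"
        using N K2 S c0 l0 by (intro divide_left_mono) auto
      also have "\<dots> = 4000 * K2 / c * (S / l)" using c0 l0 by (simp add: field_simps)
      also have "\<dots> < K * (S / l)" using K(4) S l0 by (intro mult_strict_right_mono) auto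
      also have "\<dots> \<le> K\<^sup>2 * (S / l)" using K(1) S l0 by (intro mult_right_mono) (auto simp: power2_eq_square)
      also have "\<dots> = A\<^sup>2" using S l0 by (simp add: A_def power_mult_distrib)
      also have "\<dots> \<le> \<alpha>\<^sup>2" using True A0 by (intro power_mono) auto
      finally show ?thesis using N(3) True by simp
    next
      case False
      then have aA: "\<alpha> < A" by simp
      have Apow: "(A / \<alpha>) powr \<delta> \<ge> 1" using aA a \<delta> by (intro ge_one_powr_ge_zero) auto
      show ?thesis
      proof (cases "127 * S powr (13/32) \<le> \<alpha>")
        case True
        then obtain N where N: "N \<ge> c / 2 * l" "N > 0" "lev u \<alpha> \<le> Z * S / (N ^ 3 * \<alpha> ^ 6)" using LL by blast
        note N(3)
        also have "Z * S / (N ^ 3 * \<alpha> ^ 6) \<le> Z * S / ((c / 2 * l) ^ 3 * \<alpha> ^ 6)"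
          using N c0 l0 a Z0 S by (intro divide_left_mono mult_right_mono power_mono) auto
        also have "\<dots> = Z * (2 / c) ^ 3 * (S / l ^ 3) / \<alpha> ^ 6"
          using c0 l0 a by (simp add: field_simps power_mult_distrib power_divide)
        also have "\<dots> \<le> K * (S / l ^ 3) / \<alpha> ^ 6"
          using K(3) S l0 a by (intro divide_right_mono mult_right_mono) auto
        also have "\<dots> \<le> K * (S / l ^ 3) / \<alpha> ^ 6 * (A / \<alpha>) powr \<delta>"
          using Apow K S l0 a mult_left_mono[OF Apow, of "K * (S / l ^ 3) / \<alpha> ^ 6"] by simp
        finally show ?thesis using False by simp
      next
        case small: False
        \<comment> \<open>In the lowest range \<alpha> falls short of A by the factor s^(1/2 -
          13/32) = s^(3/32), up to the root of the logarithm.\<close>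
        have "S powr (3/32) / sqrt l \<le> A / \<alpha>"
        proof -
          have "S powr (3/32) * \<alpha> \<le> S powr (3/32) * (127 * S powr (13/32))"
            using small by (intro mult_left_mono) auto
          also have "\<dots> = 127 * S powr (1/2)" by (simp flip: powr_add)
          also have "\<dots> \<le> K * S powr (1/2)" using K(1) by (intro mult_right_mono) auto
          finally have "S powr (3/32) * \<alpha> / sqrt l \<le> A" unfolding Aeq using l0 by (intro divide_right_mono) auto
          then show ?thesis using a by (simp add: pos_le_divide_eq)
        qed
        then have "(S powr (3/32) / sqrt l) powr \<delta> \<le> (A / \<alpha>) powr \<delta>" using \<delta> l0 by (intro powr_mono2) auto
        then have l3: "l ^ 3 \<le> (A / \<alpha>) powr \<delta>" using cond(5) by linarith
        have "s \<ge> 1" using s3 by simp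
        then have "lev u \<alpha> \<le> 64 * near_const * S / \<alpha> ^ 6" unfolding S_def by (intro weak_type_plain u a)
        also have "\<dots> \<le> K * S / \<alpha> ^ 6" using K(2) S a by (intro divide_right_mono mult_right_mono) auto
        also have "\<dots> = K * (S / l ^ 3) / \<alpha> ^ 6 * l ^ 3" using l0 by simp
        also have "\<dots> \<le> K * (S / l ^ 3) / \<alpha> ^ 6 * (A / \<alpha>) powr \<delta>"
          using l3 K S l0 a by (intro mult_left_mono) auto
        finally show ?thesis using False by simp
      qed
    qed
    then show "lev u \<alpha> \<le> level_bound K \<delta> s \<alpha>" unfolding level_bound_def A_def l_def S_def .
  qed
qed

text \<open>For s below the threshold \<open>s0\<close> a large constant is enough: level sets are
  null from 8 s0 upwards and have measure at most 4 pi, less than 16, below.\<close>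

lemma distribution_bound:
  assumes \<delta>: "\<delta> > 0"
  obtains K :: real where "K > 0"
    "\<forall>s u \<mu> \<alpha>. s \<ge> 2 \<and> sph_eigen s u \<and> ip u u \<le> 1 \<and> (AE x in \<sigma>. T u x = \<mu> * u x) \<and> \<alpha> > 0 \<longrightarrow>
       lev u \<alpha> \<le> level_bound K \<delta> s \<alpha>"
proof -
  obtain K0 :: real and s0 :: nat where K0: "K0 > 0" "s0 \<ge> 3"
    and large: "\<And>s u \<mu> \<alpha>. s \<ge> s0 \<Longrightarrow> sph_eigen s u \<Longrightarrow> ip u u \<le> 1 \<Longrightarrow> AE x in \<sigma>. T u x = \<mu> * u x \<Longrightarrow> \<alpha> > 0 \<Longrightarrow>
       lev u \<alpha> \<le> level_bound K0 \<delta> s \<alpha>"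
    using distribution_bound_large[OF \<delta>] by blast
  define B where "B = 8 * real s0"
  have B0: "B > 0" using K0 by (simp add: B_def)
  define K where "K = K0 + B + 16 * B ^ 6 * real s0 ^ 3"
  have "16 * B ^ 6 * real s0 ^ 3 \<ge> 0" using B0 by simp
  then have K: "K0 \<le> K" "B \<le> K" "16 * B ^ 6 * real s0 ^ 3 \<le> K" using K0 B0 unfolding K_def by linarith+
  show ?thesis
  proof (rule that[of K], goal_cases)
    case 1
    show "K > 0" using K K0 by linarith
  next
    case 2
    show ?case
    proof (intro allI impI, elim conjE)
    fix s u \<mu> \<alpha>
    assume s: "s \<ge> 2" and u: "sph_eigen s u" "ip u u \<le> 1" "AE x in \<sigma>. T u x = \<mu> * u x" and a: "\<alpha> > (0::real)"
    show "lev u \<alpha> \<le> level_bound K \<delta> s \<alpha>"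
    proof (cases "s \<ge> s0")
      case True
      have "lev u \<alpha> \<le> level_bound K0 \<delta> s \<alpha>" by (rule large[OF True u a])
      also have "\<dots> \<le> level_bound K \<delta> s \<alpha>" using K0 K s a \<delta> by (intro level_bound_mono) auto
      finally show ?thesis .
    next
      case False
      define l where "l = ln (real s)"
      have l0: "l > 0" unfolding l_def using s by (intro ln_gt_zero) auto
      have ls: "l \<le> real s" unfolding l_def using s ln_le_minus_one[of "real s"] by simp
      define A where "A = K * sqrt (real s / l)"
      have AK: "A \<ge> K"
      proof -
        have "1 \<le> sqrt (real s / l)" using ls l0 by (simp add: real_le_rsqrt)
        then show ?thesis unfolding A_def using K K0 by simp
      qed
      have lb0: "level_bound K \<delta> s \<alpha> \<ge> 0" using K K0 s a by (intro level_bound_nonneg) auto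
      show ?thesis
      proof (cases "\<alpha> \<ge> B")
        case True
        have "lev u \<alpha> = 0" by (rule lev_eq_0[OF u(1,2)]) (use s True False in \<open>auto simp: B_def\<close>)
        then show ?thesis using lb0 by simp
      next
        case small: False
        have nA: "\<not> \<alpha> \<ge> A" using small AK K by linarith
        have p1: "(A / \<alpha>) powr \<delta> \<ge> 1" using nA a \<delta> by (intro ge_one_powr_ge_zero) auto
        have "lev u \<alpha> \<le> 16" by (rule lev_le_16[OF sph_eigen_continuous[OF u(1)]])
        also have "16 = 16 * B ^ 6 * real s0 ^ 3 * (1 / real s0 ^ 3) / B ^ 6" using B0 K0 by simp
        also have "\<dots> \<le> K * (real s / l ^ 3) / \<alpha> ^ 6"
        proof (rule frac_le)
          have "l \<le> real s0" using ls False by simp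
          then have "1 / real s0 ^ 3 \<le> real s / l ^ 3" using l0 s by (intro frac_le power_mono) auto
          then show "16 * B ^ 6 * real s0 ^ 3 * (1 / real s0 ^ 3) \<le> K * (real s / l ^ 3)"
            using K K0 by (intro mult_mono) auto
          show "0 \<le> K * (real s / l ^ 3)" using K K0 l0 by auto
          show "0 < \<alpha> ^ 6" using a by simp
          show "\<alpha> ^ 6 \<le> B ^ 6" using a small by (intro power_mono) auto
        qed
        also have "\<dots> \<le> K * (real s / l ^ 3) / \<alpha> ^ 6 * (A / \<alpha>) powr \<delta>"
          using mult_left_mono[OF p1, of "K * (real s / l ^ 3) / \<alpha> ^ 6"] K K0 l0 a by simp
        finally show ?thesis using nA unfolding level_bound_def A_def l_def by simp
      qed
    qed
    qed
  qed
qed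

end

section \<open>Complex eigenfunctions\<close>

lemma matrix_inv_rotation:
  fixes A :: "real^3^3"
  assumes "rotation_matrix A"
  shows "matrix_inv A = transpose A"
proof -
  note t = rotation_matrix_transpose[OF assms]
  show ?thesis unfolding matrix_inv_def
  proof (rule some_equality)
    show "A ** transpose A = mat 1 \<and> transpose A ** A = mat 1" using t by simp
    fix B assume B: "A ** B = mat 1 \<and> B ** A = mat 1"
    have "B = (transpose A ** A) ** B" using t by simp
    also have "\<dots> = transpose A ** (A ** B)" by (simp only: matrix_mul_assoc)
    finally show "B = transpose A" using B by simp
  qed
qed

lemma Lp_norm_2_eq_1:
  assumes c: "continuous_on S2 u1" "continuous_on S2 u2"
    and \<psi>: "\<And>x. x \<in> S2 \<Longrightarrow> \<psi> x = Complex (u1 x) (u2 x)" and n: "Lp_norm \<sigma> 2 \<psi> = 1"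
  shows "(\<integral>x. u1 x * u1 x \<partial>\<sigma>) + (\<integral>x. u2 x * u2 x \<partial>\<sigma>) = 1"
proof -
  have b: "bfun u1" "bfun u2" using c by (auto intro: bfun_continuous)
  have i: "integrable \<sigma> (\<lambda>x. u1 x * u1 x)" "integrable \<sigma> (\<lambda>x. u2 x * u2 x)"
    by (intro bfun_integrable bfun_mult b)+
  define J where "J = (\<integral>x. u1 x * u1 x \<partial>\<sigma>) + (\<integral>x. u2 x * u2 x \<partial>\<sigma>)"
  have J0: "J \<ge> 0" unfolding J_def by (intro add_nonneg_nonneg Bochner_Integration.integral_nonneg) auto
  have "(\<integral>\<^sup>+x. ennreal (norm (\<psi> x) powr 2) \<partial>\<sigma>) = (\<integral>\<^sup>+x. ennreal (u1 x * u1 x + u2 x * u2 x) \<partial>\<sigma>)"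
  proof (rule nn_integral_cong)
    fix x assume "x \<in> space \<sigma>"
    then have x: "x \<in> S2" by simp
    have "norm (\<psi> x) powr 2 = (norm (\<psi> x))\<^sup>2" by (simp add: powr_numeral)
    also have "\<dots> = u1 x * u1 x + u2 x * u2 x" unfolding cmod_power2 by (simp add: \<psi>[OF x] power2_eq_square)
    finally show "ennreal (norm (\<psi> x) powr 2) = ennreal (u1 x * u1 x + u2 x * u2 x)" by simp
  qed
  also have "\<dots> = ennreal (\<integral>x. u1 x * u1 x + u2 x * u2 x \<partial>\<sigma>)"
    by (rule nn_integral_eq_integral) (use i in auto)
  also have "(\<integral>x. u1 x * u1 x + u2 x * u2 x \<partial>\<sigma>) = J" unfolding J_def by (rule Bochner_Integration.integral_add[OF i])
  finally have I: "(\<integral>\<^sup>+x. ennreal (norm (\<psi> x) powr 2) \<partial>\<sigma>) = ennreal J" .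
  have "Lp_norm \<sigma> 2 \<psi> = ennreal (J powr (1/2))"
  proof -
    have two: "enn2real 2 = 2" by simp
    show ?thesis unfolding Lp_norm_def Let_def two I using J0 by simp
  qed
  then have "J powr (1/2) = 1" using n by (simp add: ennreal_eq_1)
  then have "sqrt J = 1" using J0 by (simp add: powr_half_sqrt)
  then show ?thesis by (simp add: J_def)
qed

text \<open>The factor 4 counts the real and imaginary parts with both signs, one of which must
  exceed \<alpha>/2; rescaling the sixth power gives 4 * 2^6 = 256.\<close>

lemma four_level_bound:
  assumes "\<alpha> > 0"
  shows "4 * level_bound K \<delta> s (\<alpha> / 2) = (if \<alpha> \<ge> 2 * K * sqrt (real s / ln (real s)) then 0
     else 256 * K * (real s / ln (real s) ^ 3) / \<alpha> ^ 6 * (2 * K * sqrt (real s / ln (real s)) / \<alpha>) powr \<delta>)"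
proof -
  define A where "A = K * sqrt (real s / ln (real s))"
  have 1: "(\<alpha> / 2 \<ge> A) = (\<alpha> \<ge> 2 * K * sqrt (real s / ln (real s)))" by (auto simp: A_def)
  have 2: "A / (\<alpha> / 2) = 2 * K * sqrt (real s / ln (real s)) / \<alpha>" by (simp add: A_def)
  show ?thesis unfolding level_bound_def A_def[symmetric] 1 2 by (simp add: power_divide)
qed

text \<open>The exponents combine as 1 + (p - 6)/2 = p/2 - 2 for s and -3 - (p - 6)/2 = -p/2 for the
  logarithm, the p-th powers of the rates in the claim.\<close>

lemma level_powers:
  fixes K S l p D :: real
  assumes "K > 0" "S > 0" "l > 0"
  shows "256 * K * (S / l ^ 3) * (2 * K * sqrt (S / l)) powr (p - 6) * D
    = (256 * K * (2 * K) powr (p - 6) * D) * (S powr (p / 2 - 2) * l powr (- (p / 2)))"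
proof -
  define e where "e = p - 6"
  have h1: "sqrt (S / l) = S powr (1/2) * l powr (- (1/2))"
    unfolding powr_minus_divide using assms by (simp add: powr_half_sqrt real_sqrt_divide)
  have h2: "(2 * K * sqrt (S / l)) powr e = (2 * K) powr e * (S powr (1/2 * e) * l powr (- (1/2) * e))"
    unfolding h1 using assms by (simp add: powr_mult powr_powr)
  have h3: "S / l ^ 3 = S powr 1 * l powr (-3)" unfolding powr_minus_divide using assms by (simp add: powr_numeral)
  have h4: "S powr 1 * S powr (1/2 * e) = S powr (p / 2 - 2)"
    unfolding powr_add[symmetric] by (rule arg_cong[where f = "\<lambda>z. S powr z"]) (simp add: e_def field_simps)
  have h5: "l powr (-3) * l powr (- (1/2) * e) = l powr (- (p / 2))"
    unfolding powr_add[symmetric] by (rule arg_cong[where f = "\<lambda>z. l powr z"]) (simp add: e_def field_simps)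
  have "256 * K * (S / l ^ 3) * (2 * K * sqrt (S / l)) powr e * D
      = (256 * K * (2 * K) powr e * D) * ((S powr 1 * S powr (1/2 * e)) * (l powr (-3) * l powr (- (1/2) * e)))"
    unfolding h2 h3 by (simp only: mult_ac)
  then show ?thesis unfolding h4 h5 unfolding e_def .
qed

context algebraic_rotation_words
begin

lemma T_sum: "T F x = (1 / sqrt q) * (\<Sum>j\<in>{1..M}. F (g j *v x) + F (transpose (g j) *v x))"
proof -
  have "(\<Sum>l\<in>Sigma {1..M} (\<lambda>_. UNIV). h l) = (\<Sum>j\<in>{1..M}. \<Sum>b\<in>UNIV. h (j, b))" for h :: "nat * bool \<Rightarrow> real"
    by (simp add: sum.Sigma)
  then show ?thesis by (simp add: T_def letters_def UNIV_bool lv_def add.commute)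
qed

lemma T_op_Complex:
  assumes \<psi>: "\<And>y. y \<in> S2 \<Longrightarrow> \<psi> y = Complex (u1 y) (u2 y)" and x: "x \<in> S2"
  shows "T_op M g \<psi> x = Complex (T u1 x) (T u2 x)"
proof -
  have e: "\<psi> (g j *v x) + \<psi> (matrix_inv (g j) *v x)
      = Complex (u1 (g j *v x) + u1 (transpose (g j) *v x)) (u2 (g j *v x) + u2 (transpose (g j) *v x))"
    if j: "j \<in> {1..M}" for j
  proof -
    have "g j *v x \<in> S2" "transpose (g j) *v x \<in> S2"
      using x rotation_norm[OF g_rot[OF j]] rotation_norm[OF rotation_matrix_transpose(1)[OF g_rot[OF j]]]
      by (auto simp del: transpose_matrix_vector)
    then show ?thesis by (simp add: matrix_inv_rotation[OF g_rot[OF j]] \<psi> complex_eq_iff del: transpose_matrix_vector)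
  qed
  have "(\<Sum>j\<in>{1..M}. \<psi> (g j *v x) + \<psi> (matrix_inv (g j) *v x))
      = (\<Sum>j\<in>{1..M}. Complex (u1 (g j *v x) + u1 (transpose (g j) *v x)) (u2 (g j *v x) + u2 (transpose (g j) *v x)))"
    by (rule sum.cong[OF refl e])
  then show ?thesis unfolding T_op_def Let_def T_sum q_def
    by (intro complex_eqI) (simp_all del: transpose_matrix_vector)
qed

text \<open>Moving T across the product of the two parts gives c times the total mass equal to zero.
  The eigenvalue is thus real, and the real and imaginary parts satisfy the eigenvalue equation
  separately.\<close>

lemma T_eigenvalue_real:
  assumes b: "bfun u1" "bfun u2" and n: "ip u1 u1 + ip u2 u2 = 1"
    and T1: "AE x in \<sigma>. T u1 x = a * u1 x - c * u2 x" and T2: "AE x in \<sigma>. T u2 x = c * u1 x + a * u2 x"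
  shows "c = 0"
proof -
  note m = bfun_measurable[OF bfun_mult[OF bfun_T[OF b(1)] b(2)]] bfun_measurable[OF bfun_mult[OF b(1) bfun_T[OF b(2)]]]
  have i: "integrable \<sigma> (\<lambda>x. u1 x * u1 x)" "integrable \<sigma> (\<lambda>x. u1 x * u2 x)" "integrable \<sigma> (\<lambda>x. u2 x * u2 x)"
    by (intro bfun_integrable bfun_mult b)+
  have "(\<integral>x. T u1 x * u2 x \<partial>\<sigma>) = (\<integral>x. a * (u1 x * u2 x) - c * (u2 x * u2 x) \<partial>\<sigma>)"
  proof (rule integral_cong_AE[OF m(1)])
    show "AE x in \<sigma>. T u1 x * u2 x = a * (u1 x * u2 x) - c * (u2 x * u2 x)"
      using T1 by eventually_elim (simp only: left_diff_distrib right_diff_distrib mult_ac)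
  qed (use i in measurable)
  also have "\<dots> = a * ip u1 u2 - c * ip u2 u2" using i by (simp add: ip_def)
  finally have 1: "(\<integral>x. T u1 x * u2 x \<partial>\<sigma>) = a * ip u1 u2 - c * ip u2 u2" .
  have "(\<integral>x. u1 x * T u2 x \<partial>\<sigma>) = (\<integral>x. c * (u1 x * u1 x) + a * (u1 x * u2 x) \<partial>\<sigma>)"
  proof (rule integral_cong_AE[OF m(2)])
    show "AE x in \<sigma>. u1 x * T u2 x = c * (u1 x * u1 x) + a * (u1 x * u2 x)"
      using T2 by eventually_elim (simp only: distrib_left mult_ac)
  qed (use i in measurable)
  also have "\<dots> = c * ip u1 u1 + a * ip u1 u2" using i by (simp add: ip_def)
  finally have "a * ip u1 u2 - c * ip u2 u2 = c * ip u1 u1 + a * ip u1 u2"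
    using 1 T_self_adjoint[OF b] by simp
  then have "c * (ip u1 u1 + ip u2 u2) = 0" by (simp add: algebra_simps)
  then show ?thesis using n by simp
qed

lemma T_uminus: "T (\<lambda>x. - u x) x = - T u x"
  by (simp add: T_def sum_negf)

text \<open>The real and imaginary parts and their negatives are real joint eigenfunctions of norm
  at most 1 for one common eigenvalue, and |\<psi>| > \<alpha> forces one of these four to exceed
  \<alpha>/2.\<close>

lemma joint_eigenfunction_distribution:
  assumes bound: "\<forall>s u \<mu> \<alpha>. s \<ge> 2 \<and> sph_eigen s u \<and> ip u u \<le> 1 \<and> (AE x in \<sigma>. T u x = \<mu> * u x) \<and> \<alpha> > 0 \<longrightarrow>
       lev u \<alpha> \<le> level_bound K \<delta> s \<alpha>"
    and K: "K > 0" and s: "s \<ge> 2" and C2: "C2_sphere \<psi>" and n: "Lp_norm \<sigma> 2 \<psi> = 1"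
    and eig: "\<forall>x\<in>S2. sphere_laplacian \<psi> x = of_nat (s * (s + 1)) * \<psi> x"
    and Te: "T_eigenfunction M g \<psi>"
  shows "(\<lambda>x. norm (\<psi> x)) \<in> borel_measurable \<sigma>"
    "\<alpha> > 0 \<Longrightarrow> emeasure \<sigma> {x \<in> space \<sigma>. norm (\<psi> x) > \<alpha>} \<le> ennreal (4 * level_bound K \<delta> s (\<alpha> / 2))"
proof -
  define u1 where "u1 = (\<lambda>x. Re (radial_extension \<psi> x))"
  define u2 where "u2 = (\<lambda>x. Im (radial_extension \<psi> x))"
  have e: "sph_eigen s u1" "sph_eigen s u2"
    unfolding u1_def u2_def by (intro sph_eigen_radial_extension bounded_linear_Re bounded_linear_Im C2 eig[rule_format]; assumption)+
  have \<psi>: "\<psi> x = Complex (u1 x) (u2 x)" if "x \<in> S2" for x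
    using radial_extension_S2[OF that, of \<psi>] by (simp add: u1_def u2_def)
  note c = e[THEN sph_eigen_continuous]
  note b = c[THEN bfun_continuous]
  have [measurable]: "u1 \<in> borel_measurable \<sigma>" "u2 \<in> borel_measurable \<sigma>" using b by (auto intro: bfun_measurable)
  have nn: "ip u1 u1 + ip u2 u2 = 1" unfolding ip_def by (rule Lp_norm_2_eq_1[OF c \<psi> n])
  have "ip u1 u1 \<ge> 0" "ip u2 u2 \<ge> 0" unfolding ip_def by (auto intro: Bochner_Integration.integral_nonneg)
  then have n1: "ip u1 u1 \<le> 1" "ip u2 u2 \<le> 1" using nn by linarith+
  obtain \<mu> where \<mu>: "AE x in \<sigma>. T_op M g \<psi> x = \<mu> * \<psi> x" using Te unfolding T_eigenfunction_def by blast
  have T12: "AE x in \<sigma>. T u1 x = Re \<mu> * u1 x - Im \<mu> * u2 x \<and> T u2 x = Im \<mu> * u1 x + Re \<mu> * u2 x"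
    using \<mu> AE_space
  proof eventually_elim
    case (elim x)
    then have x: "x \<in> S2" by simp
    have "Complex (T u1 x) (T u2 x) = \<mu> * Complex (u1 x) (u2 x)" using elim(1) T_op_Complex[OF \<psi> x] \<psi>[OF x] by simp
    then show ?case by (simp add: complex_eq_iff)
  qed
  have c0: "Im \<mu> = 0"
    by (rule T_eigenvalue_real[OF b nn, of "Re \<mu>"]) (use T12 in \<open>eventually_elim, simp\<close>)+
  have T1: "AE x in \<sigma>. T u1 x = Re \<mu> * u1 x" "AE x in \<sigma>. T u2 x = Re \<mu> * u2 x"
    using T12 c0 by (auto elim!: eventually_mono)
  have one: "emeasure \<sigma> {x \<in> space \<sigma>. v x > \<beta>} \<le> ennreal (level_bound K \<delta> s \<beta>)"
    if v: "sph_eigen s v" "ip v v \<le> 1" "AE x in \<sigma>. T v x = Re \<mu> * v x" and \<beta>: "\<beta> > 0" for v \<beta>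
  proof -
    have "emeasure \<sigma> {x \<in> space \<sigma>. v x > \<beta>} = ennreal (lev v \<beta>)"
      unfolding lev_eq_measure[OF sph_eigen_continuous[OF v(1)]] by (rule sph.emeasure_eq_measure)
    also have "\<dots> \<le> ennreal (level_bound K \<delta> s \<beta>)" using bound s v \<beta> by (intro ennreal_leI) blast
    finally show ?thesis .
  qed
  have neg: "ip (\<lambda>x. - v x) (\<lambda>x. - v x) = ip v v" for v by (simp add: ip_def)
  have Tneg: "AE x in \<sigma>. T (\<lambda>x. - v x) x = Re \<mu> * - v x" if "AE x in \<sigma>. T v x = Re \<mu> * v x" for v
    using that by eventually_elim (simp add: T_uminus)
  have "(\<lambda>x. norm (Complex (u1 x) (u2 x))) \<in> borel_measurable \<sigma>" by (simp add: complex_norm)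
  then show wm: "(\<lambda>x. norm (\<psi> x)) \<in> borel_measurable \<sigma>"
    by (rule measurable_cong[THEN iffD1, rotated]) (simp add: \<psi>)
  assume a: "\<alpha> > 0"
  define \<beta> where "\<beta> = \<alpha> / 2"
  have \<beta>: "\<beta> > 0" using a by (simp add: \<beta>_def)
  define U where "U v = {x \<in> space \<sigma>. v x > \<beta>}" for v :: "real^3 \<Rightarrow> real"
  define L where "L = level_bound K \<delta> s \<beta>"
  have L0: "L \<ge> 0" unfolding L_def using K s \<beta> by (intro level_bound_nonneg) auto
  have Us: "U u1 \<in> sets \<sigma>" "U (\<lambda>x. - u1 x) \<in> sets \<sigma>" "U u2 \<in> sets \<sigma>" "U (\<lambda>x. - u2 x) \<in> sets \<sigma>"
    unfolding U_def by measurable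
  have Ub: "emeasure \<sigma> (U u1) \<le> ennreal L" "emeasure \<sigma> (U (\<lambda>x. - u1 x)) \<le> ennreal L"
    "emeasure \<sigma> (U u2) \<le> ennreal L" "emeasure \<sigma> (U (\<lambda>x. - u2 x)) \<le> ennreal L"
    unfolding U_def L_def
    by (rule one[OF e(1) n1(1) T1(1) \<beta>], rule one[OF sph_eigen_uminus[OF e(1)] _ Tneg[OF T1(1)] \<beta>], simp add: neg n1,
        rule one[OF e(2) n1(2) T1(2) \<beta>], rule one[OF sph_eigen_uminus[OF e(2)] _ Tneg[OF T1(2)] \<beta>], simp add: neg n1)
  have "{x \<in> space \<sigma>. norm (\<psi> x) > \<alpha>} \<subseteq> (U u1 \<union> U (\<lambda>x. - u1 x)) \<union> (U u2 \<union> U (\<lambda>x. - u2 x))"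
  proof
    fix x assume "x \<in> {x \<in> space \<sigma>. norm (\<psi> x) > \<alpha>}"
    then have x: "x \<in> S2" "norm (\<psi> x) > \<alpha>" by auto
    have "norm (\<psi> x) \<le> \<bar>u1 x\<bar> + \<bar>u2 x\<bar>" using cmod_le[of "\<psi> x"] \<psi>[OF x(1)] by simp
    then have "\<bar>u1 x\<bar> > \<beta> \<or> \<bar>u2 x\<bar> > \<beta>" using x(2) unfolding \<beta>_def by linarith
    then have "u1 x > \<beta> \<or> - u1 x > \<beta> \<or> u2 x > \<beta> \<or> - u2 x > \<beta>" by linarith
    then show "x \<in> (U u1 \<union> U (\<lambda>x. - u1 x)) \<union> (U u2 \<union> U (\<lambda>x. - u2 x))" using x(1) unfolding U_def by auto
  qed
  then have "emeasure \<sigma> {x \<in> space \<sigma>. norm (\<psi> x) > \<alpha>} \<le> emeasure \<sigma> ((U u1 \<union> U (\<lambda>x. - u1 x)) \<union> (U u2 \<union> U (\<lambda>x. - u2 x)))"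
    by (rule emeasure_mono) (intro sets.Un Us)
  also have "\<dots> \<le> emeasure \<sigma> (U u1 \<union> U (\<lambda>x. - u1 x)) + emeasure \<sigma> (U u2 \<union> U (\<lambda>x. - u2 x))"
    by (intro emeasure_subadditive sets.Un Us)
  also have "\<dots> \<le> (emeasure \<sigma> (U u1) + emeasure \<sigma> (U (\<lambda>x. - u1 x))) + (emeasure \<sigma> (U u2) + emeasure \<sigma> (U (\<lambda>x. - u2 x)))"
    by (intro add_mono emeasure_subadditive Us)
  also have "\<dots> \<le> (ennreal L + ennreal L) + (ennreal L + ennreal L)" by (intro add_mono Ub)
  also have "\<dots> = ennreal (4 * L)" using L0 by (simp flip: ennreal_plus)
  finally show "emeasure \<sigma> {x \<in> space \<sigma>. norm (\<psi> x) > \<alpha>} \<le> ennreal (4 * level_bound K \<delta> s (\<alpha> / 2))"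
    unfolding L_def \<beta>_def .
qed

lemma Lp_bound:
  assumes p: "6 < p"
  shows "\<exists>C>0. \<forall>s\<ge>2. \<forall>\<psi>. C2_sphere \<psi> \<and> Lp_norm \<sigma> 2 \<psi> = 1 \<and>
      (\<forall>x\<in>S2. sphere_laplacian \<psi> x = of_nat (s * (s + 1)) * \<psi> x) \<and> T_eigenfunction M g \<psi> \<longrightarrow>
      Lp_norm \<sigma> p \<psi> \<le> ennreal (C * (real s powr (1/2 - enn2real (2 / p)) / sqrt (ln (real s))))"
proof (cases p)
  case top
  obtain K :: real where K: "K > 0" and bd: "\<forall>s u \<mu> \<alpha>. s \<ge> 2 \<and> sph_eigen s u \<and> ip u u \<le> 1 \<and> (AE x in \<sigma>. T u x = \<mu> * u x) \<and> \<alpha> > 0 \<longrightarrow>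
       lev u \<alpha> \<le> level_bound K 1 s \<alpha>" by (rule distribution_bound[OF zero_less_one]) (erule (1) that)
  show ?thesis
  proof (intro exI[of _ "2 * K"] conjI allI impI)
    show "2 * K > 0" using K by simp
    fix s \<psi> assume s: "2 \<le> s" and h: "C2_sphere \<psi> \<and> Lp_norm \<sigma> 2 \<psi> = 1 \<and>
      (\<forall>x\<in>S2. sphere_laplacian \<psi> x = of_nat (s * (s + 1)) * \<psi> x) \<and> T_eigenfunction M g \<psi>"
    have l0: "ln (real s) > 0" using s by (intro ln_gt_zero) auto
    define A where "A = 2 * K * sqrt (real s / ln (real s))"
    have A0: "A > 0" using K s l0 by (simp add: A_def)
    have eig: "\<forall>x\<in>S2. sphere_laplacian \<psi> x = of_nat (s * (s + 1)) * \<psi> x" using h by blast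
    note D = joint_eigenfunction_distribution[OF bd K s conjunct1[OF h] conjunct1[OF conjunct2[OF h]] eig conjunct2[OF conjunct2[OF conjunct2[OF h]]]]
    note [measurable] = D(1)
    have ms: "{x \<in> space \<sigma>. norm (\<psi> x) > A} \<in> sets \<sigma>" by measurable
    \<comment> \<open>At \<alpha> = A the distribution bound is 0, so the level set is null and the
      essential supremum is at most A.\<close>
    have z: "emeasure \<sigma> {x \<in> space \<sigma>. norm (\<psi> x) > A} = 0"
      using D(2)[OF A0] four_level_bound[OF A0, of K 1 s] unfolding A_def[symmetric] by simp
    have "AE x in \<sigma>. norm (\<psi> x) \<le> A" by (rule AE_I[OF _ z ms]) auto
    then have "AE x in \<sigma>. ennreal (norm (\<psi> x)) \<le> ennreal A" by eventually_elim (rule ennreal_leI)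
    then have "esssup \<sigma> (\<lambda>x. ennreal (norm (\<psi> x))) \<le> ennreal A" by (intro esssup_I) measurable
    moreover have "A = 2 * K * (real s powr (1/2) / sqrt (ln (real s)))"
      by (simp add: A_def real_sqrt_divide powr_half_sqrt)
    ultimately show "Lp_norm \<sigma> p \<psi> \<le> ennreal (2 * K * (real s powr (1/2 - enn2real (2 / p)) / sqrt (ln (real s))))"
      using top by (simp add: Lp_norm_def)
  qed
next
  case (real p')
  have "ennreal 6 < ennreal p'" using p real by simp
  then have p': "p' > 6" by (rule ennreal_less_iff[THEN iffD1, rotated]) simp
  \<comment> \<open>Half the distance to the critical exponent leaves the other half for the
    convergence of the dyadic series.\<close>
  define \<delta> where "\<delta> = (p' - 6) / 2"
  have \<delta>: "\<delta> > 0" "p' > 6 + \<delta>" using p' by (simp_all add: \<delta>_def field_simps)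
  obtain K :: real where K: "K > 0" and bd: "\<forall>s u \<mu> \<alpha>. s \<ge> 2 \<and> sph_eigen s u \<and> ip u u \<le> 1 \<and> (AE x in \<sigma>. T u x = \<mu> * u x) \<and> \<alpha> > 0 \<longrightarrow>
       lev u \<alpha> \<le> level_bound K \<delta> s \<alpha>" by (rule distribution_bound[OF \<delta>(1)]) (erule (1) that)
  define D where "D = 2 powr (6 + \<delta>) / (1 - 2 powr (6 + \<delta> - p'))"
  have "2 powr (6 + \<delta> - p') < (1::real)" using \<delta> powr_less_mono[of "6 + \<delta> - p'" 0 2] by simp
  then have D0: "D > 0" by (simp add: D_def)
  define Z where "Z = 256 * K * (2 * K) powr (p' - 6) * D"
  have Z0: "Z > 0" using K D0 by (simp add: Z_def)
  have exponent: "enn2real (2 / p) = 2 / p'"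
  proof -
    have "ennreal 2 / ennreal p' = ennreal (2 / p')" by (rule divide_ennreal) (use p' in auto)
    then have "2 / p = ennreal (2 / p')" using real by simp
    then show ?thesis using p' by simp
  qed
  show ?thesis
  proof (intro exI[of _ "Z powr (1 / p')"] conjI allI impI)
    show "Z powr (1 / p') > 0" using Z0 by simp
    fix s \<psi> assume s: "2 \<le> s" and h: "C2_sphere \<psi> \<and> Lp_norm \<sigma> 2 \<psi> = 1 \<and>
      (\<forall>x\<in>S2. sphere_laplacian \<psi> x = of_nat (s * (s + 1)) * \<psi> x) \<and> T_eigenfunction M g \<psi>"
    define S where "S = real s"
    define l where "l = ln S"
    have S0: "S > 0" using s by (simp add: S_def)
    have l0: "l > 0" unfolding l_def S_def using s by (intro ln_gt_zero) auto
    define A where "A = 2 * K * sqrt (S / l)"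
    have A0: "A > 0" using K S0 l0 by (simp add: A_def)
    define B where "B = 256 * K * (S / l ^ 3)"
    have B0: "B \<ge> 0" using K S0 l0 by (simp add: B_def)
    have eig: "\<forall>x\<in>S2. sphere_laplacian \<psi> x = of_nat (s * (s + 1)) * \<psi> x" using h by blast
    note distr = joint_eigenfunction_distribution[OF bd K s conjunct1[OF h] conjunct1[OF conjunct2[OF h]] eig conjunct2[OF conjunct2[OF conjunct2[OF h]]]]
    define I where "I = (\<integral>\<^sup>+x. ennreal (norm (\<psi> x) powr p') \<partial>\<sigma>)"
    have "I \<le> ennreal (B * A powr (p' - 6) * D)"
      unfolding I_def D_def
    proof (rule Lp_from_distribution[OF distr(1) _ A0 B0 \<delta>(2,1)])
      fix \<alpha> :: real assume a: "\<alpha> > 0"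
      show "emeasure \<sigma> {x \<in> space \<sigma>. norm (\<psi> x) > \<alpha>} \<le> ennreal (if \<alpha> \<ge> A then 0 else B / \<alpha> ^ 6 * (A / \<alpha>) powr \<delta>)"
        using distr(2)[OF a] unfolding four_level_bound[OF a] A_def B_def l_def S_def .
    qed simp
    also have "B * A powr (p' - 6) * D = Z * (S powr (p' / 2 - 2) * l powr (- (p' / 2)))"
      unfolding B_def A_def Z_def by (rule level_powers[OF K S0 l0])
    finally have Ile: "I \<le> ennreal (Z * (S powr (p' / 2 - 2) * l powr (- (p' / 2))))" .
    then have fin: "I \<noteq> \<infinity>" by (auto simp: top_unique)
    have nn: "Z * (S powr (p' / 2 - 2) * l powr (- (p' / 2))) \<ge> 0" using Z0 by simp
    have "enn2real I \<le> Z * (S powr (p' / 2 - 2) * l powr (- (p' / 2)))" using enn2real_mono[OF Ile] nn by simp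
    then have "enn2real I powr (1 / p') \<le> (Z * (S powr (p' / 2 - 2) * l powr (- (p' / 2)))) powr (1 / p')"
      using p' by (intro powr_mono2) auto
    also have "\<dots> = Z powr (1 / p') * (S powr ((p' / 2 - 2) * (1 / p')) * l powr (- (p' / 2) * (1 / p')))"
      using Z0 by (simp add: powr_mult powr_powr)
    also have "(p' / 2 - 2) * (1 / p') = 1/2 - 2 / p'" using p' by (simp add: field_simps)
    also have "- (p' / 2) * (1 / p') = - (1/2)" using p' by simp
    also have "l powr (- (1/2)) = 1 / sqrt l" unfolding powr_minus_divide using l0 by (simp add: powr_half_sqrt)
    finally have le: "enn2real I powr (1 / p') \<le> Z powr (1 / p') * (S powr (1/2 - 2 / p') / sqrt l)" by simp
    have pr: "enn2real p = p'" "p \<noteq> \<infinity>" using real by auto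
    have Lp: "Lp_norm \<sigma> p \<psi> = ennreal (enn2real I powr (1 / p'))"
      unfolding Lp_norm_def Let_def pr(1) I_def[symmetric] using pr(2) fin by simp
    show "Lp_norm \<sigma> p \<psi> \<le> ennreal (Z powr (1 / p') * (real s powr (1/2 - enn2real (2 / p)) / sqrt (ln (real s))))"
      unfolding Lp exponent S_def[symmetric] l_def[symmetric] by (rule ennreal_leI[OF le])
  qed
qed

end

theorem theorem1p4:
  fixes M :: nat and g :: "nat \<Rightarrow> real^3^3" and \<Gamma> :: "(real^3^3) monoid" and p :: ennreal
  assumes "M \<ge> 2"
    and "\<And>j. j \<in> {1..M} \<Longrightarrow> g j \<in> carrier SO3"
    and "\<And>j a b. j \<in> {1..M} \<Longrightarrow> algebraic (g j $ a $ b)"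
    and "freely_generates_on SO3 g {1..M}"
    and "\<Gamma> = subgroup_generated SO3 (g ` {1..M})"
    and "\<And>x. x \<in> sphere 0 1 \<Longrightarrow>
           trivial_group (stabilizer_group \<Gamma> x) \<or> cyclic_group (stabilizer_group \<Gamma> x)"
    and "6 < p"
  shows "\<exists>C>0. \<forall>s\<ge>2. \<forall>\<psi>.
           C2_sphere \<psi> \<and> Lp_norm sphere_measure 2 \<psi> = 1 \<and>
           (\<forall>x\<in>sphere 0 1. sphere_laplacian \<psi> x = of_nat (s * (s + 1)) * \<psi> x) \<and>
           T_eigenfunction M g \<psi> \<longrightarrow>
           Lp_norm sphere_measure p \<psi> \<le>
             ennreal (C * (real s powr (1/2 - enn2real (2 / p)) / sqrt (ln (real s))))"
proof -
  interpret algebraic_rotation_words M g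
    by unfold_locales (use assms in auto)
  show ?thesis by (rule Lp_bound[OF assms(7)])
qed

end
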